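(* Let $N\ge2$, $m=N-1$, $0<g_1<\cdots<g_N$, $d\ge2$, $p>d+2$, let $\Omega\subset\mathbb R^d$ be a bounded domain of class $C^2$, and let $R=\prod_{j=1}^m[a_j,b_j]$ with $g_j<a_j\le b_j<g_{j+1}$. There are a radius $\rho_\Omega>0$ and constants $c_R,C_R,\varepsilon_R>0$, uniform for interior and boundary cylinders of radius at most $\rho_\Omega$, with the following property. Let $x_0\in\overline\Omega$, $t_0\in\mathbb R$, $0<\rho\le\rho_\Omega$, and let $z$ be a strong root solution on a neighbourhood of $Q_\rho^\Omega=Q_\rho^\Omega(t_0,x_0)$ with values in $R$. Fix $i\in\{1,\dots,m\}$ and $k\in[a_i,b_i]$, and put $r=(z_i-k)_+$ (upper truncation) or $r=(k-z_i)_+$ (lower truncation). Then for every $C^1$ cutoff $0\le\eta\le1$ which vanishes near the lower time face and the artificial lateral boundary of $Q_\rho^\Omega$ but may be nonzero on the physical boundary $\partial\Omega$, $$\operatorname*{ess\,sup}_s\int_{D_\rho}\eta^2r^2(s)+c_R\iint_{Q_\rho^\Omega}\eta^2|\nabla r|^2+c_R\varepsilon_R\iint_{Q_\rho^\Omega}\eta^2r^2\sum_{j\ne i}|\nabla z_j|^2\le C_R\iint_{Q_\rho^\Omega}r^2\bigl(|\nabla\eta|^2+\eta|\partial_t\eta|\bigr).$$ Consequently, for $0<\varrho<\rho$, $$\operatorname*{ess\,sup}_{t\in(t_0-\varrho^2,t_0)}\int_{D_\varrho}r^2(t)+\iint_{Q_\varrho^\Omega}|\nabla r|^2+c_R\varepsilon_R\iint_{Q_\varrho^\Omega}r^2\sum_{j\ne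 i}|\nabla z_j|^2\le\frac{C_R}{(\rho-\varrho)^2}\iint_{Q_\rho^\Omega}r^2.$$
   Context: $D_\rho=D_\rho(x_0)=B_\rho(x_0)\cap\Omega$, $Q_\rho^\Omega(t_0,x_0)=(t_0-\rho^2,t_0)\times D_\rho(x_0)$. The artificial lateral boundary is $(t_0-\rho^2,t_0)\times(\partial B_\rho(x_0)\cap\Omega)$ and the lower time face is $\{t_0-\rho^2\}\times D_\rho$. $\rho_\Omega$ depends only on $d$ and the $C^2$ geometry of $\Omega$; the constants depend only on $R$, $g$, $N$, $d$ and the local geometry of $\Omega$, not on the solution, $k$, $t_0$, $x_0$, $\rho$. For $z\in R$: $\lambda_j(z)=\sum_{l=1}^Ng_l-\sum_{\ell\ne j}z_\ell>0$, $\mathfrak a_j=1/\lambda_j$, $C_{jk}=(\mathfrak a_j+\mathfrak a_k)/(z_j-z_k)$ for $j\ne k$. Strong root solution on a neighbourhood of $Q_\rho^\Omega$: for an open interval $I\supset[t_0-\rho^2,t_0]$ and an open set $O\supset\overline{B_\rho(x_0)}$, with $\Omega'=\Omega\cap O$, $z\in W^{1,p}(I;L^p(\Omega';\mathbb R^m))\cap L^p(I;W^{2,p}(\Omega';\mathbb R^m))\cap C(\overline I;C^1(\overline{\Omega'};\mathbb R^m))$, the system $\partial_tz_j-\operatorname{div}(\mathfrak a_j(z)\nabla z_j)+\sum_{k\ne j}C_{jk}(z)\nabla z_j\cdot\nabla z_k=0$, $j=1,\dots,m$, holds distributionally on $I\times\Omega'$, and $\partial_\nu z_j=0$ on $\partial\Omega\cap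 O$ in the trace sense. *)

theory Defs
  imports "HOL-Analysis.Analysis" "HOL-Probability.Essential_Supremum"
begin

section \<open>Derivatives, test functions and weak derivatives\<close>

definition grad :: "('a::euclidean_space \<Rightarrow> real) \<Rightarrow> 'a \<Rightarrow> 'a" where
  "grad f x = (\<Sum>b\<in>Basis. frechet_derivative f (at x) b *\<^sub>R b)"

text \<open>Intended for open \<open>S\<close> only.\<close>

primrec Ck_on :: "nat \<Rightarrow> 'a::euclidean_space set \<Rightarrow> ('a \<Rightarrow> real) \<Rightarrow> bool" where
  "Ck_on 0 S f \<longleftrightarrow> continuous_on S f"
| "Ck_on (Suc k) S f \<longleftrightarrow>
     (\<forall>x\<in>S. f differentiable (at x)) \<and> (\<forall>v. Ck_on k S (\<lambda>x. frechet_derivative f (at x) v))"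

definition test_function :: "'a::euclidean_space set \<Rightarrow> ('a \<Rightarrow> real) \<Rightarrow> bool" where
  "test_function S \<phi> \<longleftrightarrow>
     (\<forall>k. Ck_on k UNIV \<phi>) \<and> compact (closure {x. \<phi> x \<noteq> 0}) \<and> closure {x. \<phi> x \<noteq> 0} \<subseteq> S"

definition has_weak_gradient ::
  "'a::euclidean_space set \<Rightarrow> ('a \<Rightarrow> real) \<Rightarrow> ('a \<Rightarrow> 'a) \<Rightarrow> bool" where
  "has_weak_gradient S f G \<longleftrightarrow>
     (\<forall>K. compact K \<and> K \<subseteq> S \<longrightarrow> set_integrable lborel K f \<and> set_integrable lborel K G) \<and>
     (\<forall>\<phi>. test_function S \<phi> \<longrightarrow>
        (LINT x:S|lborel. f x *\<^sub>R grad \<phi> x) = - (LINT x:S|lborel. \<phi> x *\<^sub>R G x))"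


section \<open>Function spaces on \<open>J \<times> S\<close>\<close>

definition Lp_on ::
  "real \<Rightarrow> 'a::euclidean_space set \<Rightarrow> ('a \<Rightarrow> 'b::euclidean_space) \<Rightarrow> bool" where
  "Lp_on p S f \<longleftrightarrow>
     set_borel_measurable lborel S f \<and> set_integrable lborel S (\<lambda>x. norm (f x) powr p)"

text \<open>
  Elements of \<open>L\<^sup>p(J; L\<^sup>p(S))\<close> are represented by jointly measurable functions on \<open>J \<times> S\<close>.

  \<open>W\<^sup>1\<^sup>,\<^sup>p(J; L\<^sup>p(S))\<close>: the time derivative \<open>h\<close> is the vector-valued distributional one; an
  identity between \<open>L\<^sup>p(S)\<close>-valued integrals holds almost everywhere in \<open>S\<close>.
\<close>

definition W1p_Lp ::
  "real \<Rightarrow> real set \<Rightarrow> 'a::euclidean_space set \<Rightarrow> (real \<Rightarrow> 'a \<Rightarrow> real) \<Rightarrow> bool" where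
  "W1p_Lp p J S u \<longleftrightarrow>
     Lp_on p (J \<times> S) (\<lambda>(t, x). u t x) \<and>
     (\<exists>h. Lp_on p (J \<times> S) (\<lambda>(t, x). h t x) \<and>
        (\<forall>\<phi>. test_function J \<phi> \<longrightarrow>
           (AE x in lborel. x \<in> S \<longrightarrow>
              (LINT t:J|lborel. deriv \<phi> t * u t x) = - (LINT t:J|lborel. \<phi> t * h t x))))"

text \<open>
  \<open>L\<^sup>p(J; W\<^sup>2\<^sup>,\<^sup>p(S))\<close>: \<open>G t\<close> is the weak gradient of \<open>u t\<close>, and \<open>H b t\<close> that of its
  \<open>b\<close>-component, for almost every \<open>t\<close>.
\<close>

definition Lp_W2p ::
  "real \<Rightarrow> real set \<Rightarrow> 'a::euclidean_space set \<Rightarrow> (real \<Rightarrow> 'a \<Rightarrow> real) \<Rightarrow> bool" where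
  "Lp_W2p p J S u \<longleftrightarrow>
     Lp_on p (J \<times> S) (\<lambda>(t, x). u t x) \<and>
     (\<exists>(G :: real \<Rightarrow> 'a \<Rightarrow> 'a) (H :: 'a \<Rightarrow> real \<Rightarrow> 'a \<Rightarrow> 'a).
        Lp_on p (J \<times> S) (\<lambda>(t, x). G t x) \<and>
        (AE t in lborel. t \<in> J \<longrightarrow> has_weak_gradient S (u t) (G t)) \<and>
        (\<forall>b\<in>Basis.
           Lp_on p (J \<times> S) (\<lambda>(t, x). H b t x) \<and>
           (AE t in lborel. t \<in> J \<longrightarrow> has_weak_gradient S (\<lambda>x. G t x \<bullet> b) (H b t))))"

definition C1_closure :: "'a::euclidean_space set \<Rightarrow> ('a \<Rightarrow> real) \<Rightarrow> bool" where
  "C1_closure S f \<longleftrightarrow>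
     (\<forall>x\<in>S. f differentiable (at x)) \<and> continuous_on (closure S) f \<and>
     (\<exists>G. continuous_on (closure S) G \<and> (\<forall>x\<in>S. G x = grad f x))"

text \<open>
  \<open>C(closure J; C\<^sup>1(closure S))\<close>. The supremum over \<open>closure S\<close> of a continuously extended
  gradient is already attained as supremum over \<open>S\<close>.
\<close>

definition C_C1 ::
  "real set \<Rightarrow> 'a::euclidean_space set \<Rightarrow> (real \<Rightarrow> 'a \<Rightarrow> real) \<Rightarrow> bool" where
  "C_C1 J S u \<longleftrightarrow>
     (\<forall>t\<in>closure J. C1_closure S (u t) \<and>
        uniform_limit (closure S) u (u t) (at t within closure J) \<and>
        uniform_limit S (\<lambda>s. grad (u s)) (grad (u t)) (at t within closure J))"


section \<open>Domains of class \<open>C\<^sup>2\<close>\<close>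

text \<open>
  Near \<open>x\<close> the domain is the part above the graph, in direction \<open>e\<close>, of a \<open>C\<^sup>2\<close> function on the
  hyperplane orthogonal to \<open>e\<close>; only the values of \<open>\<gamma>\<close> on that hyperplane matter.
\<close>

definition C2_graph_near ::
  "'a::euclidean_space set \<Rightarrow> 'a \<Rightarrow> real \<Rightarrow> 'a \<Rightarrow> ('a \<Rightarrow> real) \<Rightarrow> bool" where
  "C2_graph_near \<Omega> x \<delta> e \<gamma> \<longleftrightarrow>
     \<delta> > 0 \<and> norm e = 1 \<and> Ck_on 2 UNIV \<gamma> \<and>
     \<Omega> \<inter> ball x \<delta> = {y \<in> ball x \<delta>. \<gamma> (y - (y \<bullet> e) *\<^sub>R e) < y \<bullet> e}"

definition bounded_C2_domain :: "'a::euclidean_space set \<Rightarrow> bool" where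
  "bounded_C2_domain \<Omega> \<longleftrightarrow>
     open \<Omega> \<and> connected \<Omega> \<and> \<Omega> \<noteq> {} \<and> bounded \<Omega> \<and>
     (\<forall>x\<in>frontier \<Omega>. \<exists>\<delta> e \<gamma>. C2_graph_near \<Omega> x \<delta> e \<gamma>)"

definition outward_unit_normal :: "'a::euclidean_space set \<Rightarrow> 'a \<Rightarrow> 'a \<Rightarrow> bool" where
  "outward_unit_normal \<Omega> x \<nu> \<longleftrightarrow>
     (\<exists>\<delta> e \<gamma>. C2_graph_near \<Omega> x \<delta> e \<gamma> \<and>
        (let n = grad (\<lambda>y. \<gamma> (y - (y \<bullet> e) *\<^sub>R e) - y \<bullet> e) x in \<nu> = n /\<^sub>R norm n))"


section \<open>The root system\<close>

text \<open>
  Points of \<open>\<real>\<^sup>m\<close>, \<open>m = N - 1\<close>, are functions on \<open>nat\<close> of which only the values on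
  \<open>{1..N - 1}\<close> matter; likewise \<open>z j t x\<close> is the \<open>j\<close>-th component of \<open>z\<close> at \<open>(t, x)\<close>.
\<close>

definition root_lambda :: "nat \<Rightarrow> (nat \<Rightarrow> real) \<Rightarrow> nat \<Rightarrow> (nat \<Rightarrow> real) \<Rightarrow> real" where
  "root_lambda N g j \<zeta> = (\<Sum>l=1..N. g l) - (\<Sum>l\<in>{1..N-1} - {j}. \<zeta> l)"

definition root_a :: "nat \<Rightarrow> (nat \<Rightarrow> real) \<Rightarrow> nat \<Rightarrow> (nat \<Rightarrow> real) \<Rightarrow> real" where
  "root_a N g j \<zeta> = 1 / root_lambda N g j \<zeta>"

definition root_C :: "nat \<Rightarrow> (nat \<Rightarrow> real) \<Rightarrow> nat \<Rightarrow> nat \<Rightarrow> (nat \<Rightarrow> real) \<Rightarrow> real" where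
  "root_C N g j k \<zeta> = (root_a N g j \<zeta> + root_a N g k \<zeta>) / (\<zeta> j - \<zeta> k)"

definition root_system_distributional ::
  "nat \<Rightarrow> (nat \<Rightarrow> real) \<Rightarrow> real set \<Rightarrow> 'a::euclidean_space set \<Rightarrow>
   (nat \<Rightarrow> real \<Rightarrow> 'a \<Rightarrow> real) \<Rightarrow> bool" where
  "root_system_distributional N g J S z \<longleftrightarrow>
     (\<forall>j\<in>{1..N-1}. \<forall>\<phi> :: real \<times> 'a \<Rightarrow> real. test_function (J \<times> S) \<phi> \<longrightarrow>
        (LINT q:J \<times> S|lborel. (case q of (t, x) \<Rightarrow>
             - z j t x * deriv (\<lambda>s. \<phi> (s, x)) t
             + root_a N g j (\<lambda>l. z l t x) * (grad (z j t) x \<bullet> grad (\<lambda>y. \<phi> (t, y)) x)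
             + (\<Sum>k\<in>{1..N-1} - {j}.
                  root_C N g j k (\<lambda>l. z l t x) * (grad (z j t) x \<bullet> grad (z k t) x)) * \<phi> (t, x)))
        = 0)"

text \<open>
  Since \<open>grad (z j t)\<close> extends continuously to the closure of \<open>\<Omega> \<inter> U\<close>, its trace on
  \<open>frontier \<Omega> \<inter> U\<close> is given by boundary limits.
\<close>

definition neumann_trace_zero ::
  "nat \<Rightarrow> real set \<Rightarrow> 'a::euclidean_space set \<Rightarrow> 'a set \<Rightarrow>
   (nat \<Rightarrow> real \<Rightarrow> 'a \<Rightarrow> real) \<Rightarrow> bool" where
  "neumann_trace_zero N J \<Omega> U z \<longleftrightarrow>
     (\<forall>j\<in>{1..N-1}. \<forall>t\<in>J. \<forall>x\<in>frontier \<Omega> \<inter> U. \<forall>\<nu>. outward_unit_normal \<Omega> x \<nu> \<longrightarrow>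
        ((\<lambda>y. grad (z j t) y \<bullet> \<nu>) \<longlongrightarrow> 0) (at x within \<Omega> \<inter> U))"

definition strong_root_solution ::
  "nat \<Rightarrow> (nat \<Rightarrow> real) \<Rightarrow> real \<Rightarrow> 'a::euclidean_space set \<Rightarrow> real set \<Rightarrow> 'a set \<Rightarrow>
   (nat \<Rightarrow> real \<Rightarrow> 'a \<Rightarrow> real) \<Rightarrow> bool" where
  "strong_root_solution N g p \<Omega> J U z \<longleftrightarrow>
     (\<forall>j\<in>{1..N-1}. W1p_Lp p J (\<Omega> \<inter> U) (z j) \<and> Lp_W2p p J (\<Omega> \<inter> U) (z j) \<and>
        C_C1 J (\<Omega> \<inter> U) (z j)) \<and>
     root_system_distributional N g J (\<Omega> \<inter> U) z \<and>
     neumann_trace_zero N J \<Omega> U z"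


section \<open>Cylinders and cutoffs\<close>

definition Dcap :: "'a::euclidean_space set \<Rightarrow> 'a \<Rightarrow> real \<Rightarrow> 'a set" where
  "Dcap \<Omega> x0 \<rho> = ball x0 \<rho> \<inter> \<Omega>"

definition Qcyl :: "'a::euclidean_space set \<Rightarrow> real \<Rightarrow> 'a \<Rightarrow> real \<Rightarrow> (real \<times> 'a) set" where
  "Qcyl \<Omega> t0 x0 \<rho> = {t0 - \<rho>\<^sup>2 <..< t0} \<times> Dcap \<Omega> x0 \<rho>"

definition solution_neighbourhood ::
  "real \<Rightarrow> 'a::euclidean_space \<Rightarrow> real \<Rightarrow> real set \<Rightarrow> 'a set \<Rightarrow> bool" where
  "solution_neighbourhood t0 x0 \<rho> J U \<longleftrightarrow>
     open J \<and> is_interval J \<and> {t0 - \<rho>\<^sup>2 .. t0} \<subseteq> J \<and> open U \<and> closure (ball x0 \<rho>) \<subseteq> U"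

definition cutoff ::
  "'a::euclidean_space set \<Rightarrow> real \<Rightarrow> 'a \<Rightarrow> real \<Rightarrow> (real \<times> 'a \<Rightarrow> real) \<Rightarrow> bool" where
  "cutoff \<Omega> t0 x0 \<rho> \<eta> \<longleftrightarrow>
     C1_closure (Qcyl \<Omega> t0 x0 \<rho>) \<eta> \<and>
     (\<forall>q\<in>Qcyl \<Omega> t0 x0 \<rho>. 0 \<le> \<eta> q \<and> \<eta> q \<le> 1) \<and>
     (\<exists>V. open V \<and> {t0 - \<rho>\<^sup>2} \<times> Dcap \<Omega> x0 \<rho> \<subseteq> V \<and>
        {t0 - \<rho>\<^sup>2 <..< t0} \<times> (frontier (ball x0 \<rho>) \<inter> \<Omega>) \<subseteq> V \<and>
        (\<forall>q\<in>V \<inter> Qcyl \<Omega> t0 x0 \<rho>. \<eta> q = 0))"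

end

theory Submission
  imports Defs "HOL-Computational_Algebra.Polynomial"
begin

text \<open>
  Test the system with the derivatives of an energy \<open>E(z)\<close>. The reaction term and the gradient
  of \<open>E\<^sub>j\<close> combine to the quadratic form
  \<open>\<Sum>\<^sub>j \<aa>\<^sub>j E\<^sub>j\<^sub>j \<bar>\<nabla>z\<^sub>j\<bar>\<^sup>2 + \<Sum>\<^bsub>j<k\<^esub> (\<aa>\<^sub>j + \<aa>\<^sub>k) M\<^sub>j\<^sub>k \<nabla>z\<^sub>j \<bullet> \<nabla>z\<^sub>k\<close> with
  \<open>M\<^sub>j\<^sub>k = E\<^sub>j\<^sub>k + (E\<^sub>j - E\<^sub>k) / (z\<^sub>j - z\<^sub>k)\<close>, so energies solving the Euler--Poisson--Darboux
  system \<open>M = 0\<close> have no cross terms. The moment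
  \<open>J\<^sub>i = \<plusminus> \<integral>\<^bsub>s > \<kappa>\<^esub> (z\<^sub>i - s) (\<Prod>\<^bsub>k \<noteq> i\<^esub> (s - z\<^sub>k)) ds\<close> is such an energy; it is comparable to
  \<open>r\<^sup>2\<close> and controls \<open>\<bar>\<nabla>r\<bar>\<^sup>2\<close>. Adding \<open>\<epsilon> r\<^sup>2 T\<close>, with \<open>T\<close> the sum of the moments in the other
  variables, produces \<open>\<epsilon> r\<^sup>2 \<bar>\<nabla>z\<^sub>k\<bar>\<^sup>2\<close> for \<open>k \<noteq> i\<close>, and its cross terms carry a factor \<open>\<epsilon> r\<close>
  and are absorbed. The test is justified by mollification in space-time and by a cutoff
  vanishing near the physical boundary: the boundary layer of width \<open>d\<close> has measure \<open>O(d)\<close> and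
  the flux through it tends to zero by the Neumann condition. Lower truncations are upper
  truncations of \<open>- z\<close>.
\<close>

section \<open>Smooth kernels and mollification\<close>

text \<open>Two losses of regularity shape the argument. The functions \<open>E\<^sub>j(z)\<close>
  are not smooth test functions, so mollification first makes the equation pointwise. The time
  derivative and the divergence of the mollified flux have no known limits, but they cancel before
  the limit is taken. The square of a truncation is not twice differentiable, and smoothing it
  directly would destroy the Euler--Poisson--Darboux identity. That identity holds for the
  polynomial \<open>\<Prod>\<^sub>k (s - w\<^sub>k)\<close> at every single \<open>s\<close>, so a
  weight in front of it is free: the truncation is put into the weight and smoothed there by ramps.
  Second derivatives contain the weight but never its derivative, so the ramps may tend to a jump.
  Positivity of the moments uses the gaps between the intervals: integration starts at most half a
  gap below the interval of \<open>w\<^sub>i\<close>, where each factor still has a fixed sign and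
  is bounded away from zero. The main moment is affine in each \<open>w\<^sub>k\<close> with
  \<open>k \<noteq> i\<close> and yields nothing for those gradients; this forces the correction by
  \<open>r\<^sup>2 T\<close>.\<close>

lemma Ck_on_Suc_lower: "Ck_on (Suc k) UNIV f \<Longrightarrow> Ck_on k UNIV f"
proof (induction k arbitrary: f)
  case 0
  then show ?case by (auto intro!: continuous_at_imp_continuous_on differentiable_imp_continuous_within)
next
  case (Suc k)
  then show ?case by (metis Ck_on.simps(2))
qed

lemma frechet_derivative_eqI: "(f has_derivative D) (at x) \<Longrightarrow> frechet_derivative f (at x) = D"
  by (metis frechet_derivative_at)

lemma Ck_on_const: "Ck_on k UNIV (\<lambda>x. c)"
  by (induction k arbitrary: c) (auto simp: frechet_derivative_eqI[OF has_derivative_const])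

lemma Ck_on_add:
  "Ck_on k UNIV f \<Longrightarrow> Ck_on k UNIV g \<Longrightarrow> Ck_on k UNIV (\<lambda>x. f x + g x)"
proof (induction k arbitrary: f g)
  case 0
  then show ?case by (auto intro: continuous_intros)
next
  case (Suc k)
  have "frechet_derivative (\<lambda>x. f x + g x) (at x) v
      = frechet_derivative f (at x) v + frechet_derivative g (at x) v" for x v
    using Suc.prems
    by (subst frechet_derivative_eqI[OF has_derivative_add])
       (auto simp: frechet_derivative_works[symmetric])
  then show ?case using Suc by auto
qed

lemma Ck_on_mult:
  "Ck_on k UNIV f \<Longrightarrow> Ck_on k UNIV g \<Longrightarrow> Ck_on k UNIV (\<lambda>x. f x * g x)"
proof (induction k arbitrary: f g)
  case 0
  then show ?case by (auto intro: continuous_intros)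
next
  case (Suc k)
  have *: "frechet_derivative (\<lambda>x. f x * g x) (at x) v
      = f x * frechet_derivative g (at x) v + frechet_derivative f (at x) v * g x" for x v
    using Suc.prems
    by (subst frechet_derivative_eqI[OF has_derivative_mult])
       (auto simp: frechet_derivative_works[symmetric])
  show ?case
    unfolding Ck_on.simps * using Suc.prems
    using Ck_on_Suc_lower[OF Suc.prems(1)] Ck_on_Suc_lower[OF Suc.prems(2)]
    by (auto intro!: Ck_on_add Suc.IH)
qed

lemma Ck_on_prod:
  "(\<And>i. i \<in> A \<Longrightarrow> Ck_on k UNIV (f i)) \<Longrightarrow> Ck_on k UNIV (\<lambda>x. \<Prod>i\<in>A. f i x)"
  by (induction A rule: infinite_finite_induct) (auto intro: Ck_on_const Ck_on_mult)

text \<open>The sequence \<open>F\<close> of successive derivatives stands for a smooth function of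
  one variable. A directional derivative of the composite is the next member of the sequence times
  the constant \<open>v \<bullet> b\<close>, so the induction on \<open>k\<close> never leaves the
  family.\<close>

lemma Ck_on_comp_affine:
  assumes "\<And>n x. (F n has_real_derivative F (Suc n) x) (at x)"
  shows "Ck_on k UNIV (\<lambda>x. F n (x \<bullet> b + c))"
proof (induction k arbitrary: n)
  case 0
  have "continuous_on UNIV (F n)"
    using assms[of n] by (meson DERIV_isCont continuous_at_imp_continuous_on)
  then show ?case
    by (auto intro!: continuous_on_compose2[where f = "\<lambda>x. x \<bullet> b + c"] continuous_intros)
next
  case (Suc k)
  have d: "((\<lambda>x. F n (x \<bullet> b + c)) has_derivative (\<lambda>v. F (Suc n) (x \<bullet> b + c) * (v \<bullet> b))) (at x)" for x
  proof -
    have "((\<lambda>x. x \<bullet> b + c) has_derivative (\<lambda>v. v \<bullet> b)) (at x)"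
      by (auto intro!: derivative_eq_intros)
    from has_derivative_compose[OF this, of "F n" "(*) (F (Suc n) (x \<bullet> b + c))"]
    show ?thesis using assms[of n "x \<bullet> b + c"] by (simp add: has_field_derivative_def)
  qed
  show ?case
    unfolding Ck_on.simps frechet_derivative_eqI[OF d]
    using d Suc.IH by (auto intro!: Ck_on_mult Ck_on_const simp: differentiable_def)
qed

lemma Ck_on_translate:
  fixes f :: "'b::euclidean_space \<Rightarrow> real"
  shows "Ck_on k UNIV f \<Longrightarrow> Ck_on k UNIV (\<lambda>q. f (q - p))"
proof (induction k arbitrary: f)
  case 0
  then show ?case
    by (auto intro!: continuous_on_compose2[where f = "\<lambda>x. x - p" and g = f] continuous_intros)
next
  case (Suc k)
  have d: "((\<lambda>q. f (q - p)) has_derivative frechet_derivative f (at (q - p))) (at q)" for q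
  proof -
    have f: "(f has_derivative frechet_derivative f (at (q - p))) (at (q - p))"
      using Suc.prems by (auto simp: frechet_derivative_works[symmetric])
    have "((\<lambda>q. q - p) has_derivative (\<lambda>v. v)) (at q)"
      by (auto intro!: derivative_eq_intros)
    from has_derivative_compose[OF this f] show ?thesis .
  qed
  have "Ck_on k UNIV (\<lambda>q. frechet_derivative f (at (q - p)) v)" for v
    using Suc by auto
  then show ?case
    unfolding Ck_on.simps frechet_derivative_eqI[OF d]
    using d by (auto simp: differentiable_def)
qed

text \<open>With \<open>y = 1 / x\<close> these are the functions \<open>P(y) exp(- y)\<close>,
  extended by zero. All derivatives of the standard flat function have this form, so the family is
  closed under differentiation.\<close>

definition flat_exp :: "real poly \<Rightarrow> real \<Rightarrow> real" where
  "flat_exp P x = (if x > 0 then poly P (1 / x) * exp (- (1 / x)) else 0)"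

lemma poly_exp_tendsto_0: "((\<lambda>y::real. poly P y * exp (- y)) \<longlongrightarrow> 0) at_top"
proof -
  have "((\<lambda>y::real. \<Sum>i\<le>degree P. coeff P i * (y ^ i / exp y)) \<longlongrightarrow> (\<Sum>i\<le>degree P. coeff P i * 0)) at_top"
    by (intro tendsto_intros tendsto_power_div_exp_0)
  then show ?thesis
    by (simp add: poly_altdef exp_minus field_simps sum_divide_distrib)
qed

text \<open>As \<open>y = 1 / x\<close> has derivative \<open>- y\<^sup>2\<close>, the function
  \<open>P(y) exp(- y)\<close> has derivative \<open>y\<^sup>2 (P(y) - P'(y)) exp(- y)\<close>. At
  the origin exponential decay beats every polynomial.\<close>

lemma flat_exp_DERIV:
  "(flat_exp P has_real_derivative flat_exp ([:0, 0, 1:] * (P - pderiv P)) x) (at x)"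
proof -
  consider "x > 0" | "x < 0" | "x = 0" by linarith
  then show ?thesis
  proof cases
    case 1
    have "((\<lambda>x. poly P (1 / x) * exp (- (1 / x))) has_real_derivative
        flat_exp ([:0, 0, 1:] * (P - pderiv P)) x) (at x)"
      using 1
      by (auto intro!: derivative_eq_intros DERIV_chain'[where g = "poly P", OF _ poly_DERIV]
          simp: flat_exp_def algebra_simps power2_eq_square divide_simps)
    then show ?thesis
      by (rule has_field_derivative_transform_within_open[where S = "{0<..}"])
         (use 1 in \<open>auto simp: flat_exp_def\<close>)
  next
    case 2
    have "((\<lambda>x. 0) has_real_derivative 0) (at x)" by simp
    then have "(flat_exp P has_real_derivative 0) (at x)"
      by (rule has_field_derivative_transform_within_open[where S = "{..<0}"])
         (use 2 in \<open>auto simp: flat_exp_def\<close>)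
    then show ?thesis using 2 by (simp add: flat_exp_def)
  next
    case 3
    have inv: "filterlim (\<lambda>h::real. 1 / h) at_top (at_right 0)"
      using filterlim_inverse_at_top_right by (simp add: inverse_eq_divide)
    \<comment> \<open>The extra factor \<open>y\<close> is the denominator \<open>h = 1 / y\<close>
      of the difference quotient at zero.\<close>
    have "((\<lambda>y::real. poly ([:0, 1:] * P) y * exp (- y)) \<longlongrightarrow> 0) at_top"
      by (rule poly_exp_tendsto_0)
    then have "((\<lambda>h::real. poly ([:0, 1:] * P) (1 / h) * exp (- (1 / h))) \<longlongrightarrow> 0) (at_right 0)"
      using inv by (rule filterlim_compose)
    then have r: "((\<lambda>h. (flat_exp P h - flat_exp P 0) / (h - 0)) \<longlongrightarrow> 0) (at_right 0)"
      by (rule Lim_transform_eventually)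
         (auto simp: eventually_at_filter flat_exp_def intro!: always_eventually)
    have l: "((\<lambda>h. (flat_exp P h - flat_exp P 0) / (h - 0)) \<longlongrightarrow> 0) (at_left 0)"
      by (rule Lim_transform_eventually[OF tendsto_const])
         (auto simp: eventually_at_filter flat_exp_def)
    show ?thesis
      using filterlim_split_at[OF l r] 3 by (simp add: has_field_derivative_iff flat_exp_def)
  qed
qed

text \<open>A product over the coordinates of one-variable bumps has only affine inner functions.
  Its support is a cube; the half-width \<open>e / DIM('b)\<close> puts it into the ball of radius
  \<open>e\<close>, because the norm is at most the sum of the moduli of the coordinates.\<close>

lemma exists_smooth_kernel:
  assumes "e > 0"
  obtains \<kappa> :: "'b::euclidean_space \<Rightarrow> real"
  where "\<And>k. Ck_on k UNIV \<kappa>" "\<And>q. \<kappa> q \<ge> 0" "\<And>q. norm q \<ge> e \<Longrightarrow> \<kappa> q = 0"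
    "integrable lborel \<kappa>" "integral\<^sup>L lborel \<kappa> = 1"
proof -
  define P :: "nat \<Rightarrow> real poly" where "P n = ((\<lambda>P. [:0, 0, 1:] * (P - pderiv P)) ^^ n) 1" for n
  define F where "F n = flat_exp (P n)" for n
  have F: "(F n has_real_derivative F (Suc n) x) (at x)" for n x
    using flat_exp_DERIV[of "P n" x] by (simp add: F_def P_def)
  have F0: "F 0 x = (if x > 0 then exp (- (1 / x)) else 0)" for x
    by (simp add: F_def P_def flat_exp_def)
  define \<delta> where "\<delta> = e / real (DIM('b))"
  have \<delta>: "\<delta> > 0" using assms by (simp add: \<delta>_def)
  define \<rho> :: "'b \<Rightarrow> real" where "\<rho> q = (\<Prod>b\<in>Basis. F 0 (q \<bullet> b + \<delta>) * F 0 (q \<bullet> (-b) + \<delta>))" for q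
  have smooth: "Ck_on k UNIV \<rho>" for k
    unfolding \<rho>_def by (intro Ck_on_prod Ck_on_mult Ck_on_comp_affine F)
  have nonneg: "\<rho> q \<ge> 0" for q
    unfolding \<rho>_def by (intro prod_nonneg) (auto simp: F0)
  have supp: "\<rho> q = 0" if "norm q \<ge> e" for q
  proof (rule ccontr)
    assume "\<rho> q \<noteq> 0"
    then have "\<bar>q \<bullet> b\<bar> < \<delta>" if "b \<in> Basis" for b
      using that by (auto simp: \<rho>_def F0 split: if_splits)
    then have "(\<Sum>b\<in>Basis. \<bar>q \<bullet> b\<bar>) < (\<Sum>b\<in>(Basis::'b set). \<delta>)"
      by (intro sum_strict_mono) auto
    then show False
      using norm_le_l1[of q] that by (simp add: \<delta>_def)
  qed
  have cont: "continuous_on UNIV \<rho>" using smooth[of 0] by simp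
  have int: "integrable lborel \<rho>"
  proof -
    have "set_integrable lborel (cball 0 e) \<rho>"
      unfolding set_integrable_def
      using continuous_on_subset[OF cont] by (intro borel_integrable_compact) auto
    moreover have "(\<lambda>q. indicator (cball 0 e) q *\<^sub>R \<rho> q) = \<rho>"
      using supp by (auto simp: fun_eq_iff indicator_def)
    ultimately show ?thesis by (simp add: set_integrable_def)
  qed
  \<comment> \<open>A nonnegative function with vanishing integral is zero almost everywhere, but
    the set where this one is nonzero is open and contains the origin.\<close>
  have pos: "integral\<^sup>L lborel \<rho> > 0"
  proof (rule ccontr)
    assume "\<not> integral\<^sup>L lborel \<rho> > 0"
    then have "integral\<^sup>L lborel \<rho> = 0"
      using nonneg by (meson Bochner_Integration.integral_nonneg order.antisym not_less)
    then have ae: "AE q in lborel. \<rho> q = 0"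
      using integral_nonneg_eq_0_iff_AE[OF int] nonneg by auto
    have op: "open {q. \<rho> q \<noteq> 0}"
      using cont by (simp add: open_Collect_neq)
    have "\<rho> 0 \<noteq> 0" using \<delta> by (auto simp: \<rho>_def F0)
    then have "\<not> negligible {q. \<rho> q \<noteq> 0}"
      using op open_not_negligible by auto
    moreover have "{q. \<rho> q \<noteq> 0} \<in> null_sets lborel"
      using ae op by (subst (asm) AE_iff_null) (auto simp: borel_open)
    ultimately show False
      by (metis negligible_iff_null_sets null_sets_completionI)
  qed
  show ?thesis
  proof (rule that[of "\<lambda>q. (1 / integral\<^sup>L lborel \<rho>) * \<rho> q"])
    show "Ck_on k UNIV (\<lambda>q. (1 / integral\<^sup>L lborel \<rho>) * \<rho> q)" for k
      by (intro Ck_on_mult Ck_on_const smooth)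
  qed (use nonneg supp int pos in auto)
qed

section \<open>Translation invariance and differentiation of integrals\<close>

lemma integral_lborel_translate:
  fixes f :: "'b::euclidean_space \<Rightarrow> real"
  shows "integral\<^sup>L lborel (\<lambda>x. f (x + c)) = integral\<^sup>L lborel f"
    and "integrable lborel (\<lambda>x. f (x + c)) \<longleftrightarrow> integrable lborel f"
proof -
  have i: "integrable lborel (\<lambda>x. f (x + c))" if "integrable lborel f" for f :: "'b \<Rightarrow> real" and c
  proof -
    have "integrable (distr lborel borel ((+) c)) f"
      using that by (simp add: lborel_distr_plus)
    then have "integrable lborel (\<lambda>x. f (c + x))"
      by (subst (asm) integrable_distr_eq) (use borel_measurable_integrable[OF that] in auto)
    then show ?thesis by (simp add: add.commute)
  qed
  show eq: "integrable lborel (\<lambda>x. f (x + c)) \<longleftrightarrow> integrable lborel f"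
    using i[of f c] i[of "\<lambda>x. f (x + c)" "- c"] by auto
  show "integral\<^sup>L lborel (\<lambda>x. f (x + c)) = integral\<^sup>L lborel f"
  proof (cases "integrable lborel f")
    case True
    have "integral\<^sup>L (distr lborel borel ((+) c)) f = integral\<^sup>L lborel (\<lambda>x. f (c + x))"
      by (intro integral_distr) (use borel_measurable_integrable[OF True] in auto)
    then show ?thesis by (simp add: lborel_distr_plus add.commute)
  next
    case False
    then show ?thesis using eq by (simp add: not_integrable_integral_eq)
  qed
qed

text \<open>Derivatives of mollified functions and of cutoffs are taken along lines, at parameter
  zero and for every base point. Moving the base point yields the derivative at an arbitrary
  parameter.\<close>

lemma DERIV_along_line:
  fixes x v :: "'b::real_vector"
  assumes "\<And>x. ((\<lambda>h. f (x + h *\<^sub>R v)) has_real_derivative f' x) (at 0)"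
  shows "((\<lambda>h. f (x + h *\<^sub>R v)) has_real_derivative f' (x + t *\<^sub>R v)) (at t)"
proof -
  have "((\<lambda>h. f (x + t *\<^sub>R v + (h - t) *\<^sub>R v)) has_real_derivative f' (x + t *\<^sub>R v) * 1) (at t)"
    by (rule DERIV_chain2[where f = "\<lambda>h. f (x + t *\<^sub>R v + h *\<^sub>R v)" and g = "\<lambda>h. h - t"])
       (use assms[of "x + t *\<^sub>R v"] in \<open>auto intro!: derivative_eq_intros\<close>)
  then show ?thesis by (simp add: algebra_simps)
qed

lemma line_Lipschitz:
  fixes x v :: "'b::real_vector"
  assumes "\<And>x. ((\<lambda>h. f (x + h *\<^sub>R v)) has_real_derivative f' x) (at 0)"
    and "\<And>x. \<bar>f' x\<bar> \<le> L"
  shows "\<bar>f (x + h *\<^sub>R v) - f x\<bar> \<le> L * \<bar>h\<bar>"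
proof -
  have "norm (f (x + h *\<^sub>R v) - f (x + 0 *\<^sub>R v)) \<le> L * norm (h - 0)"
    by (rule field_differentiable_bound[where S = UNIV and f = "\<lambda>h. f (x + h *\<^sub>R v)" and f' = "\<lambda>t. f' (x + t *\<^sub>R v)"])
       (use DERIV_along_line[OF assms(1)] assms(2) in \<open>auto intro: has_field_derivative_at_within\<close>)
  then show ?thesis by simp
qed

text \<open>Translation invariance makes every difference quotient integrate to zero, and the bound
  on \<open>f'\<close> together with the bounded support dominates the quotients. This gives
  integration by parts without iterated integrals.\<close>

lemma integral_DERIV_along_zero:
  fixes f f' :: "'b::euclidean_space \<Rightarrow> real"
  assumes int: "integrable lborel f"
    and der: "\<And>x. ((\<lambda>h. f (x + h *\<^sub>R v)) has_real_derivative f' x) (at 0)"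
    and bd: "\<And>x. \<bar>f' x\<bar> \<le> L"
    and supp: "bounded K" "\<And>x. x \<notin> K \<Longrightarrow> f x = 0"
  shows "integrable lborel f'" "integral\<^sup>L lborel f' = 0"
proof -
  have meas[measurable]: "f \<in> borel_measurable borel" using borel_measurable_integrable[OF int] by simp
  obtain R0 where R0: "\<And>x. x \<in> K \<Longrightarrow> norm x \<le> R0"
    using supp(1) by (auto simp: bounded_iff)
  \<comment> \<open>The increments \<open>1 / Suc n\<close> are at most one, so every difference
    quotient is supported within distance \<open>norm v\<close> of \<open>K\<close>.\<close>
  define R where "R = R0 + norm v"
  define Q where "Q n x = (f (x + (1 / (Suc n)) *\<^sub>R v) - f x) / (1 / (Suc n))" for n x
  have L0: "L \<ge> 0" using bd[of 0] by linarith
  have Q_bd: "norm (Q n x) \<le> L * indicator (cball 0 R) x" for n x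
  proof (cases "x \<in> cball 0 R")
    case True
    then show ?thesis
      using line_Lipschitz[OF der bd, of x "1 / (Suc n)"]
      by (simp add: Q_def abs_mult pos_le_divide_eq[symmetric] del: of_nat_Suc)
  next
    case False
    have "norm x \<le> norm (x + (1 / (Suc n)) *\<^sub>R v) + norm ((1 / (Suc n)) *\<^sub>R v)"
      by (metis add_diff_cancel_right' norm_triangle_ineq4)
    also have "norm ((1 / (Suc n)) *\<^sub>R v) \<le> norm v"
      by (simp add: divide_le_eq algebra_simps)
    finally have "x + (1 / (Suc n)) *\<^sub>R v \<notin> K" "x \<notin> K"
      using False R0[of x] R0[of "x + (1 / (Suc n)) *\<^sub>R v"] norm_ge_zero[of v] by (auto simp: R_def)
    then show ?thesis using L0 supp(2) by (simp add: Q_def indicator_def)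
  qed
  have lim: "(\<lambda>n. Q n x) \<longlonglongrightarrow> f' x" for x
  proof -
    have "((\<lambda>h. (f (x + h *\<^sub>R v) - f x) / h) \<longlongrightarrow> f' x) (at 0)"
      using der[of x] by (simp add: has_field_derivative_iff)
    moreover have "filterlim (\<lambda>n. 1 / real (Suc n)) (at 0) sequentially"
      using LIMSEQ_inverse_real_of_nat
      by (auto simp: filterlim_at inverse_eq_divide intro!: always_eventually)
    ultimately show ?thesis
      unfolding Q_def by (rule filterlim_compose)
  qed
  have [measurable]: "Q n \<in> borel_measurable borel" for n
    unfolding Q_def by measurable
  have m': "f' \<in> borel_measurable borel"
    using lim by (rule borel_measurable_LIMSEQ_real) simp
  have w: "integrable lborel (\<lambda>x. L * indicator (cball 0 R) x :: real)"
    by (intro integrable_mult_right integrable_real_indicator) (use emeasure_bounded_finite[OF bounded_cball] in \<open>auto simp: top.not_eq_extremum\<close>)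
  show "integrable lborel f'"
    by (rule integrable_dominated_convergence[of f' lborel Q "\<lambda>x. L * indicator (cball 0 R) x"])
       (use lim Q_bd m' w in auto)
  have "(\<lambda>n. integral\<^sup>L lborel (Q n)) \<longlonglongrightarrow> integral\<^sup>L lborel f'"
    by (rule integral_dominated_convergence[of f' lborel Q "\<lambda>x. L * indicator (cball 0 R) x"])
       (use lim Q_bd m' w in auto)
  moreover have "integral\<^sup>L lborel (Q n) = 0" for n
    unfolding Q_def using int integral_lborel_translate[of f]
    by simp
  ultimately show "integral\<^sup>L lborel f' = 0"
    by (simp add: LIMSEQ_const_iff)
qed

lemma DERIV_under_integral:
  fixes f :: "real \<Rightarrow> 'b \<Rightarrow> real"
  assumes int: "\<And>h. integrable M (f h)"
    and der: "\<And>q. q \<in> space M \<Longrightarrow> ((\<lambda>h. f h q) has_real_derivative f' q) (at 0)"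
    and bd: "\<And>h q. q \<in> space M \<Longrightarrow> \<bar>f h q - f 0 q\<bar> \<le> \<bar>h\<bar> * w q" and w: "integrable M w"
  shows "((\<lambda>h. integral\<^sup>L M (f h)) has_real_derivative integral\<^sup>L M f') (at 0)"
    "f' \<in> borel_measurable M"
proof -
  have meas[measurable]: "f h \<in> borel_measurable M" for h using int by auto
  have conv: "(\<lambda>n. (f (X n) q - f 0 q) / X n) \<longlonglongrightarrow> f' q"
    if "\<And>n. X n \<in> UNIV - {0}" "X \<longlonglongrightarrow> 0" "q \<in> space M" for X q
    using der[OF that(3)] that(1,2)
    unfolding has_field_derivative_iff tendsto_at_iff_sequentially by (auto simp: o_def)
  show m': "f' \<in> borel_measurable M"
  proof (rule borel_measurable_LIMSEQ_real)
    show "(\<lambda>n. (f (1 / real (Suc n)) q - f 0 q) / (1 / real (Suc n))) \<longlonglongrightarrow> f' q" if "q \<in> space M" for q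
      using LIMSEQ_inverse_real_of_nat by (intro conv that) (auto simp: inverse_eq_divide)
  qed measurable
  show "((\<lambda>h. integral\<^sup>L M (f h)) has_real_derivative integral\<^sup>L M f') (at 0)"
    unfolding has_field_derivative_iff tendsto_at_iff_sequentially
  proof (intro allI impI)
    fix X :: "nat \<Rightarrow> real" assume X: "\<forall>i. X i \<in> UNIV - {0}" "X \<longlonglongrightarrow> 0"
    have "(\<lambda>n. integral\<^sup>L M (\<lambda>q. (f (X n) q - f 0 q) / X n)) \<longlonglongrightarrow> integral\<^sup>L M f'"
    proof (rule integral_dominated_convergence[where w = w])
      show "AE q in M. (\<lambda>n. (f (X n) q - f 0 q) / X n) \<longlonglongrightarrow> f' q"
        using conv X by auto
      show "AE q in M. norm ((f (X n) q - f 0 q) / X n) \<le> w q" for n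
        using bd[of _ "X n"] X by (auto simp: divide_le_eq mult.commute)
    qed (use m' w in auto)
    then show "((\<lambda>h. (integral\<^sup>L M (f h) - integral\<^sup>L M (f 0)) / (h - 0)) \<circ> X) \<longlonglongrightarrow> integral\<^sup>L M f'"
      using int by (simp add: o_def)
  qed
qed

text \<open>On a set of finite measure this is what dominated convergence asks for, and unlike
  uniform convergence it admits the discontinuous limit of the ramps. Being closed under sums and
  products, it reduces the convergence of a long integrand to that of its factors.\<close>

definition bounded_conv :: "'b::euclidean_space set \<Rightarrow> (nat \<Rightarrow> 'b \<Rightarrow> real) \<Rightarrow> ('b \<Rightarrow> real) \<Rightarrow> bool" where
  "bounded_conv K f l \<longleftrightarrow> (\<forall>n. f n \<in> borel_measurable (restrict_space borel K)) \<and>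
     (\<exists>C. \<forall>n. \<forall>q\<in>K. \<bar>f n q\<bar> \<le> C) \<and> (\<forall>q\<in>K. (\<lambda>n. f n q) \<longlonglongrightarrow> l q)"

lemma bounded_convI:
  assumes "\<And>n. f n \<in> borel_measurable (restrict_space borel K)"
    "\<And>n q. q \<in> K \<Longrightarrow> \<bar>f n q\<bar> \<le> C" "\<And>q. q \<in> K \<Longrightarrow> (\<lambda>n. f n q) \<longlonglongrightarrow> l q"
  shows "bounded_conv K f l"
  using assms unfolding bounded_conv_def by blast

lemma bounded_conv_const:
  "f \<in> borel_measurable (restrict_space borel K) \<Longrightarrow> (\<And>q. q \<in> K \<Longrightarrow> \<bar>f q\<bar> \<le> C) \<Longrightarrow> bounded_conv K (\<lambda>n. f) f"
  by (rule bounded_convI) auto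

lemma bounded_conv_add:
  assumes "bounded_conv K f l" "bounded_conv K g m"
  shows "bounded_conv K (\<lambda>n q. f n q + g n q) (\<lambda>q. l q + m q)"
proof -
  obtain C D where "\<And>n q. q \<in> K \<Longrightarrow> \<bar>f n q\<bar> \<le> C" "\<And>n q. q \<in> K \<Longrightarrow> \<bar>g n q\<bar> \<le> D"
    using assms unfolding bounded_conv_def by metis
  then have "\<bar>f n q + g n q\<bar> \<le> C + D" if "q \<in> K" for n q
    using that by (meson abs_triangle_ineq add_mono order_trans)
  then show ?thesis
    using assms by (intro bounded_convI) (auto simp: bounded_conv_def intro: tendsto_add borel_measurable_add)
qed

lemma bounded_conv_mult:
  assumes "bounded_conv K f l" "bounded_conv K g m"
  shows "bounded_conv K (\<lambda>n q. f n q * g n q) (\<lambda>q. l q * m q)"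
proof -
  obtain C D where "\<And>n q. q \<in> K \<Longrightarrow> \<bar>f n q\<bar> \<le> C" "\<And>n q. q \<in> K \<Longrightarrow> \<bar>g n q\<bar> \<le> D"
    using assms unfolding bounded_conv_def by metis
  then have "\<bar>f n q * g n q\<bar> \<le> C * D" if "q \<in> K" for n q
    using that unfolding abs_mult by (meson abs_ge_zero mult_mono order_trans)
  then show ?thesis
    using assms by (intro bounded_convI) (auto simp: bounded_conv_def intro: tendsto_mult borel_measurable_times)
qed

lemma bounded_conv_uminus: "bounded_conv K f l \<Longrightarrow> bounded_conv K (\<lambda>n q. - f n q) (\<lambda>q. - l q)"
  unfolding bounded_conv_def by (auto intro: tendsto_minus)

lemma bounded_conv_diff:
  "bounded_conv K f l \<Longrightarrow> bounded_conv K g m \<Longrightarrow> bounded_conv K (\<lambda>n q. f n q - g n q) (\<lambda>q. l q - m q)"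
  using bounded_conv_add[OF _ bounded_conv_uminus, of K f l g m] by simp

lemma bounded_conv_sum:
  "(\<And>i. i \<in> A \<Longrightarrow> bounded_conv K (f i) (l i)) \<Longrightarrow> bounded_conv K (\<lambda>n q. \<Sum>i\<in>A. f i n q) (\<lambda>q. \<Sum>i\<in>A. l i q)"
  by (induction A rule: infinite_finite_induct)
     (auto intro: bounded_conv_add bounded_conv_const[where C = 0])

lemmas bounded_conv_intros =
  bounded_conv_add bounded_conv_mult bounded_conv_uminus bounded_conv_diff bounded_conv_sum

lemma bounded_conv_integral:
  assumes bc: "bounded_conv K f l" and K: "K \<in> sets borel" "emeasure lborel K < \<infinity>"
  shows "set_integrable lborel K (f n)" "set_integrable lborel K l"
    "(\<lambda>n. LINT q:K|lborel. f n q) \<longlonglongrightarrow> (LINT q:K|lborel. l q)"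
proof -
  obtain C where C: "\<And>n q. q \<in> K \<Longrightarrow> \<bar>f n q\<bar> \<le> C" using bc unfolding bounded_conv_def by metis
  define C' where "C' = max C 0"
  have m: "(\<lambda>q. indicator K q *\<^sub>R f n q) \<in> borel_measurable borel" for n
    using bc K borel_measurable_restrict_space_iff[of K borel "f n"] by (auto simp: bounded_conv_def)
  have lim: "(\<lambda>n. indicator K q *\<^sub>R f n q) \<longlonglongrightarrow> indicator K q *\<^sub>R l q" for q
    using bc by (auto simp: bounded_conv_def indicator_def)
  have ml: "(\<lambda>q. indicator K q *\<^sub>R l q) \<in> borel_measurable borel"
    using lim m by (rule borel_measurable_LIMSEQ_real)
  have w: "integrable lborel (\<lambda>q. C' * indicator K q)"
    using K by (intro integrable_mult_right integrable_real_indicator) auto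
  have bd: "norm (indicator K q *\<^sub>R f n q) \<le> C' * indicator K q" for n q
    using C[of q n] by (auto simp: indicator_def C'_def)
  show "set_integrable lborel K (f n)"
    unfolding set_integrable_def by (rule Bochner_Integration.integrable_bound[OF w])
      (use order_trans[OF bd abs_ge_self] m in auto)
  show "set_integrable lborel K l" unfolding set_integrable_def
    by (rule integrable_dominated_convergence[where w = "\<lambda>q. C' * indicator K q" and s = "\<lambda>n q. indicator K q *\<^sub>R f n q"])
       (use lim bd m ml w in auto)
  show "(\<lambda>n. LINT q:K|lborel. f n q) \<longlonglongrightarrow> (LINT q:K|lborel. l q)"
    unfolding set_lebesgue_integral_def
    by (rule integral_dominated_convergence[where w = "\<lambda>q. C' * indicator K q"])
       (use lim bd m ml w in auto)
qed

section \<open>Mollification\<close>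

definition smooth_kernel :: "real \<Rightarrow> ('b::euclidean_space \<Rightarrow> real) \<Rightarrow> bool" where
  "smooth_kernel e \<kappa> \<longleftrightarrow> e > 0 \<and> (\<forall>k. Ck_on k UNIV \<kappa>) \<and> (\<forall>q. \<kappa> q \<ge> 0) \<and>
     (\<forall>q. norm q \<ge> e \<longrightarrow> \<kappa> q = 0) \<and> integrable lborel \<kappa> \<and> integral\<^sup>L lborel \<kappa> = 1"

text \<open>The kernel is evaluated at \<open>q - p\<close>, so that as a function of
  \<open>q\<close> it is itself an admissible test function. Derivatives in \<open>p\<close>
  therefore carry a minus sign.\<close>

definition mollify :: "('b::euclidean_space \<Rightarrow> real) \<Rightarrow> ('b \<Rightarrow> real) \<Rightarrow> 'b \<Rightarrow> real" where
  "mollify \<kappa> g p = (LINT q|lborel. \<kappa> (q - p) * g q)"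

context
  fixes e :: real and \<kappa> :: "'b::euclidean_space \<Rightarrow> real"
  assumes ker: "smooth_kernel e \<kappa>"
begin

abbreviation (input) "D\<kappa> q v \<equiv> frechet_derivative \<kappa> (at q) v"

lemma kernel_Ck: "Ck_on k UNIV \<kappa>"
  and kernel_nonneg: "\<kappa> q \<ge> 0" and kernel_eq_0: "norm q \<ge> e \<Longrightarrow> \<kappa> q = 0"
  using ker by (auto simp: smooth_kernel_def)

lemma kernel_has_derivative: "(\<kappa> has_derivative D\<kappa> q) (at q)"
  using kernel_Ck[of "Suc 0"] by (simp add: frechet_derivative_works[symmetric])

lemma kernel_cont: "continuous_on S \<kappa>"
  using kernel_Ck[of 0] continuous_on_subset by auto

lemma kernel_D_cont: "continuous_on S (\<lambda>q. D\<kappa> q v)"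
  using kernel_Ck[of "Suc 0"] by (auto intro: continuous_on_subset)

lemma kernel_measurable[measurable]: "\<kappa> \<in> borel_measurable borel"
  by (rule borel_measurable_continuous_onI) (rule kernel_cont)

lemma kernel_D_measurable[measurable]: "(\<lambda>q. D\<kappa> q v) \<in> borel_measurable borel"
  by (rule borel_measurable_continuous_onI) (rule kernel_D_cont)

lemma kernel_D_eq_0:
  assumes "norm q > e" shows "D\<kappa> q v = 0"
proof -
  have "((\<lambda>_. 0) has_derivative (\<lambda>_. 0)) (at q)" by simp
  then have "(\<kappa> has_derivative (\<lambda>_. 0)) (at q)"
    by (rule has_derivative_transform_within_open[OF _ open_Compl[OF closed_cball[of 0 e]]])
       (use assms kernel_eq_0 in auto)
  then show ?thesis by (simp add: frechet_derivative_eqI)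
qed

lemma kernel_bounded: "\<exists>L. \<forall>q. \<bar>\<kappa> q\<bar> \<le> L" and kernel_D_bounded: "\<exists>L. \<forall>q. \<bar>D\<kappa> q v\<bar> \<le> L"
proof -
  have *: "\<exists>L. \<forall>q. \<bar>f q\<bar> \<le> L" if f: "continuous_on UNIV f" "\<And>q. norm q > e \<Longrightarrow> f q = 0" for f :: "'b \<Rightarrow> real"
  proof -
    have "bounded (f ` cball 0 e)"
      by (intro compact_imp_bounded compact_continuous_image) (auto intro: continuous_on_subset[OF f(1)])
    then obtain L where "\<forall>y\<in>f ` cball 0 e. norm y \<le> L" unfolding bounded_iff ..
    then have L: "\<bar>f q\<bar> \<le> L" if "q \<in> cball 0 e" for q using that by auto
    have "\<bar>f q\<bar> \<le> max L 0" for q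
      using L[of q] f(2)[of q] by (cases "norm q \<le> e") auto
    then show ?thesis by blast
  qed
  show "\<exists>L. \<forall>q. \<bar>\<kappa> q\<bar> \<le> L" by (rule *) (use kernel_cont kernel_eq_0 in auto)
  show "\<exists>L. \<forall>q. \<bar>D\<kappa> q v\<bar> \<le> L" by (rule *) (use kernel_D_cont kernel_D_eq_0 in auto)
qed

lemma integrable_bounded_mult:
  fixes f g :: "'b \<Rightarrow> real"
  assumes "integrable lborel g" "f \<in> borel_measurable borel" "\<And>q. \<bar>f q\<bar> \<le> L"
  shows "integrable lborel (\<lambda>q. f q * g q)"
proof (rule Bochner_Integration.integrable_bound)
  show "integrable lborel (\<lambda>q. L * g q)" using assms by simp
  have "\<bar>f q\<bar> * \<bar>g q\<bar> \<le> \<bar>L\<bar> * \<bar>g q\<bar>" for q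
    using assms(3)[of q] by (intro mult_right_mono) auto
  then show "AE q in lborel. norm (f q * g q) \<le> norm (L * g q)"
    by (auto simp: abs_mult)
qed (use assms in auto)

lemma kernel_mult_integrable:
  assumes "integrable lborel g"
  shows "integrable lborel (\<lambda>q. \<kappa> (q - p) * g q)"
    "integrable lborel (\<lambda>q. D\<kappa> (q - p) v * g q)"
proof -
  obtain L where "\<forall>q. \<bar>\<kappa> q\<bar> \<le> L" using kernel_bounded by auto
  then show "integrable lborel (\<lambda>q. \<kappa> (q - p) * g q)"
    by (intro integrable_bounded_mult[OF assms]) auto
  obtain L where "\<forall>q. \<bar>D\<kappa> q v\<bar> \<le> L" using kernel_D_bounded by auto
  then show "integrable lborel (\<lambda>q. D\<kappa> (q - p) v * g q)"
    by (intro integrable_bounded_mult[OF assms]) (auto intro!: measurable_compose[OF _ kernel_D_measurable])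
qed

lemma kernel_translate_DERIV:
  "((\<lambda>h. \<kappa> (q + h *\<^sub>R v - p)) has_real_derivative D\<kappa> (q - p) v) (at 0)"
proof -
  have 1: "((\<lambda>h. q + h *\<^sub>R v - p) has_derivative (\<lambda>h. h *\<^sub>R v)) (at 0)"
    by (auto intro!: derivative_eq_intros)
  have 2: "(\<kappa> has_derivative D\<kappa> (q - p)) (at (q + 0 *\<^sub>R v - p))"
    using kernel_has_derivative by simp
  have "((\<lambda>h. \<kappa> (q + h *\<^sub>R v - p)) has_derivative (\<lambda>h. D\<kappa> (q - p) (h *\<^sub>R v))) (at 0)"
    by (rule has_derivative_compose[OF 1 2])
  moreover have "D\<kappa> (q - p) (h *\<^sub>R v) = D\<kappa> (q - p) v * h" for h
    using linear_cmul[OF has_derivative_linear[OF kernel_has_derivative]] by simp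
  ultimately show ?thesis by (simp add: has_field_derivative_def)
qed

text \<open>Shifting \<open>p\<close> by \<open>h v\<close> shifts the kernel by
  \<open>- h v\<close>, so the derivative falls on the kernel alone and exists for every integrable
  \<open>g\<close>.\<close>

lemma mollify_DERIV:
  assumes g: "integrable lborel g"
  shows "((\<lambda>h. mollify \<kappa> g (p + h *\<^sub>R v)) has_real_derivative - mollify (\<lambda>q. D\<kappa> q v) g p) (at 0)"
    and "\<exists>L. \<forall>p. \<bar>mollify (\<lambda>q. D\<kappa> q v) g p\<bar> \<le> L"
proof -
  obtain L where L: "\<And>q. \<bar>D\<kappa> q v\<bar> \<le> L" using kernel_D_bounded by auto
  have der: "((\<lambda>h. \<kappa> (q + h *\<^sub>R (-v) - p)) has_real_derivative - D\<kappa> (q - p) v) (at 0)" for q p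
    using kernel_translate_DERIV[of q "-v" p]
      linear_neg[OF has_derivative_linear[OF kernel_has_derivative]] by simp
  have bd: "\<bar>\<kappa> (q + h *\<^sub>R (-v) - p) - \<kappa> (q - p)\<bar> \<le> L * \<bar>h\<bar>" for q h
    by (rule line_Lipschitz[where f = "\<lambda>q. \<kappa> (q - p)", OF der]) (use L in simp)
  have "((\<lambda>h. LINT q|lborel. \<kappa> (q + h *\<^sub>R (-v) - p) * g q) has_real_derivative
      (LINT q|lborel. - D\<kappa> (q - p) v * g q)) (at 0)"
  proof (rule DERIV_under_integral(1)[where w = "\<lambda>q. L * \<bar>g q\<bar>"])
    show "integrable lborel (\<lambda>q. \<kappa> (q + h *\<^sub>R (-v) - p) * g q)" for h
      using kernel_mult_integrable(1)[OF g, of "p + h *\<^sub>R v"] by (simp add: algebra_simps)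
    show "((\<lambda>h. \<kappa> (q + h *\<^sub>R (-v) - p) * g q) has_real_derivative - D\<kappa> (q - p) v * g q) (at 0)" for q
      using der[of q p] by (auto intro!: derivative_eq_intros)
    show "\<bar>\<kappa> (q + h *\<^sub>R (-v) - p) * g q - \<kappa> (q + 0 *\<^sub>R (-v) - p) * g q\<bar> \<le> \<bar>h\<bar> * (L * \<bar>g q\<bar>)" for h q
    proof -
      have "\<bar>\<kappa> (q + h *\<^sub>R (-v) - p) * g q - \<kappa> (q - p) * g q\<bar> = \<bar>\<kappa> (q + h *\<^sub>R (-v) - p) - \<kappa> (q - p)\<bar> * \<bar>g q\<bar>"
        by (metis abs_mult left_diff_distrib)
      also have "\<dots> \<le> L * \<bar>h\<bar> * \<bar>g q\<bar>"
        by (intro mult_right_mono bd) simp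
      finally show ?thesis by (simp add: mult_ac)
    qed
  qed (use g in auto)
  then show "((\<lambda>h. mollify \<kappa> g (p + h *\<^sub>R v)) has_real_derivative - mollify (\<lambda>q. D\<kappa> q v) g p) (at 0)"
    by (simp add: mollify_def algebra_simps)
  have "\<bar>mollify (\<lambda>q. D\<kappa> q v) g p\<bar> \<le> (LINT q|lborel. L * \<bar>g q\<bar>)" for p
  proof -
    have "\<bar>mollify (\<lambda>q. D\<kappa> q v) g p\<bar> \<le> (LINT q|lborel. \<bar>D\<kappa> (q - p) v * g q\<bar>)"
      unfolding mollify_def by (rule integral_abs_bound)
    also have "\<dots> \<le> (LINT q|lborel. L * \<bar>g q\<bar>)"
      using integrable_abs[OF kernel_mult_integrable(2)[OF g]] g L
      by (intro integral_mono) (auto simp: abs_mult intro: mult_right_mono)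
    finally show ?thesis .
  qed
  then show "\<exists>L. \<forall>p. \<bar>mollify (\<lambda>q. D\<kappa> q v) g p\<bar> \<le> L" by blast
qed

lemma mollify_continuous:
  assumes g: "integrable lborel g" shows "continuous_on S (mollify \<kappa> g)"
proof (intro continuous_at_imp_continuous_on ballI)
  fix p
  obtain L where L: "\<And>q. \<bar>\<kappa> q\<bar> \<le> L" using kernel_bounded by auto
  show "isCont (mollify \<kappa> g) p"
    unfolding continuous_at_sequentially
  proof (intro allI impI)
    fix X assume X: "X \<longlonglongrightarrow> p"
    have "(\<lambda>n. LINT q|lborel. \<kappa> (q - X n) * g q) \<longlonglongrightarrow> (LINT q|lborel. \<kappa> (q - p) * g q)"
    proof (rule integral_dominated_convergence[where w = "\<lambda>q. L * \<bar>g q\<bar>"])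
      show "AE q in lborel. (\<lambda>n. \<kappa> (q - X n) * g q) \<longlonglongrightarrow> \<kappa> (q - p) * g q"
      proof (rule AE_I2)
        fix q
        have "(\<lambda>n. \<kappa> (q - X n)) \<longlonglongrightarrow> \<kappa> (q - p)"
          by (rule continuous_on_tendsto_compose[OF kernel_cont[of UNIV]]) (use X in \<open>auto intro: tendsto_intros\<close>)
        then show "(\<lambda>n. \<kappa> (q - X n) * g q) \<longlonglongrightarrow> \<kappa> (q - p) * g q" by (intro tendsto_intros)
      qed
      show "AE q in lborel. norm (\<kappa> (q - X n) * g q) \<le> L * \<bar>g q\<bar>" for n
        using L by (auto simp: abs_mult intro!: AE_I2 mult_right_mono)
    qed (use g in auto)
    then show "(mollify \<kappa> g \<circ> X) \<longlonglongrightarrow> mollify \<kappa> g p" by (simp add: mollify_def o_def)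
  qed
qed

text \<open>A mollification is an average of mass one over a ball. This keeps the mollified roots
  inside the box, where the energies are regular and bounded.\<close>

lemma mollify_between:
  assumes g: "integrable lborel g" and ab: "\<And>q. norm (q - p) < e \<Longrightarrow> a \<le> g q \<and> g q \<le> b"
  shows "a \<le> mollify \<kappa> g p" "mollify \<kappa> g p \<le> b"
proof -
  have i: "integrable lborel (\<lambda>q. \<kappa> (q - p))" and 1: "(LINT q|lborel. \<kappa> (q - p)) = 1"
    using integral_lborel_translate[of \<kappa> "- p"] ker by (auto simp: smooth_kernel_def)
  have *: "\<kappa> (q - p) * a \<le> \<kappa> (q - p) * g q" "\<kappa> (q - p) * g q \<le> \<kappa> (q - p) * b" for q
    using ab[of q] kernel_nonneg kernel_eq_0[of "q - p"]
    by (cases "norm (q - p) < e"; simp add: mult_left_mono)+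
  have "a = (LINT q|lborel. \<kappa> (q - p) * a)" using 1 by simp
  also have "\<dots> \<le> mollify \<kappa> g p"
    unfolding mollify_def using * i kernel_mult_integrable(1)[OF g] by (intro integral_mono) auto
  finally show "a \<le> mollify \<kappa> g p" .
  have "mollify \<kappa> g p \<le> (LINT q|lborel. \<kappa> (q - p) * b)"
    unfolding mollify_def using * i kernel_mult_integrable(1)[OF g] by (intro integral_mono) auto
  also have "\<dots> = b" using 1 by simp
  finally show "mollify \<kappa> g p \<le> b" .
qed

text \<open>The product of the translated kernel with \<open>g\<close> has a line derivative of
  integral zero; the product rule then moves the derivative from the kernel to \<open>g\<close>.
  Outside the ball that carries the kernel the product vanishes, whatever \<open>g\<close> does
  there.\<close>

lemma mollify_by_parts:
  assumes g: "integrable lborel g"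
    and der: "\<And>q. norm (q - p) \<le> e \<Longrightarrow> ((\<lambda>h. g (q + h *\<^sub>R v)) has_real_derivative g' q) (at 0)"
    and bd: "\<And>q. norm (q - p) \<le> e \<Longrightarrow> \<bar>g q\<bar> \<le> M \<and> \<bar>g' q\<bar> \<le> M"
  shows "- mollify (\<lambda>q. D\<kappa> q v) g p = mollify \<kappa> g' p"
proof -
  obtain L where L: "\<And>q. \<bar>\<kappa> q\<bar> \<le> L" using kernel_bounded by auto
  obtain L' where L': "\<And>q. \<bar>D\<kappa> q v\<bar> \<le> L'" using kernel_D_bounded by auto
  let ?f = "\<lambda>q. \<kappa> (q - p) * g q" and ?f' = "\<lambda>q. D\<kappa> (q - p) v * g q + \<kappa> (q - p) * g' q"
  have d: "((\<lambda>h. ?f (q + h *\<^sub>R v)) has_real_derivative ?f' q) (at 0)" for q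
  proof (cases "norm (q - p) \<le> e")
    case True
    show ?thesis
      using DERIV_mult[OF kernel_translate_DERIV[of q v p] der[OF True]] by (simp add: algebra_simps)
  next
    case False
    let ?S = "{h::real. q + h *\<^sub>R v - p \<in> - cball 0 e}"
    have "((\<lambda>h. 0) has_real_derivative 0) (at 0)" by simp
    then have "((\<lambda>h. ?f (q + h *\<^sub>R v)) has_real_derivative 0) (at 0)"
      by (rule has_field_derivative_transform_within_open[where S = ?S])
         (use False kernel_eq_0 in \<open>auto intro!: open_Collect_less continuous_intros simp: not_le\<close>)
    moreover have "?f' q = 0"
      using False kernel_D_eq_0[of "q - p"] kernel_eq_0[of "q - p"] by simp
    ultimately show ?thesis by simp
  qed
  have b: "\<bar>?f' q\<bar> \<le> L' * \<bar>M\<bar> + L * \<bar>M\<bar>" for q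
  proof (cases "norm (q - p) \<le> e")
    case True
    have "\<bar>?f' q\<bar> \<le> \<bar>D\<kappa> (q - p) v\<bar> * \<bar>g q\<bar> + \<bar>\<kappa> (q - p)\<bar> * \<bar>g' q\<bar>"
      by (metis abs_mult abs_triangle_ineq)
    also have "\<dots> \<le> L' * \<bar>M\<bar> + L * \<bar>M\<bar>"
      using bd[OF True] L[of "q - p"] L'[of "q - p"] by (intro add_mono mult_mono) auto
    finally show ?thesis .
  next
    case False
    then show ?thesis
      using kernel_D_eq_0[of "q - p"] kernel_eq_0[of "q - p"] L[of 0] L'[of 0] by simp
  qed
  have s: "bounded (cball p e)" "\<And>q. q \<notin> cball p e \<Longrightarrow> ?f q = 0"
    using kernel_eq_0 by (auto simp: dist_norm norm_minus_commute)
  note I = integral_DERIV_along_zero[OF kernel_mult_integrable(1)[OF g] d b s]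
  have "integrable lborel (\<lambda>q. ?f' q - D\<kappa> (q - p) v * g q)"
    using I(1) kernel_mult_integrable(2)[OF g] by (rule Bochner_Integration.integrable_diff)
  then have "integrable lborel (\<lambda>q. \<kappa> (q - p) * g' q)" by simp
  then have "integral\<^sup>L lborel ?f' = mollify (\<lambda>q. D\<kappa> q v) g p + mollify \<kappa> g' p"
    unfolding mollify_def using kernel_mult_integrable(2)[OF g] by simp
  then show ?thesis using I(2) by simp
qed

end

lemma mollify_tendsto:
  assumes ker: "\<And>n. smooth_kernel (e n) (\<kappa> n)" and e: "e \<longlonglongrightarrow> 0"
    and g: "integrable lborel g" "isCont g p"
  shows "(\<lambda>n. mollify (\<kappa> n) g p) \<longlonglongrightarrow> g p"
proof (rule LIMSEQ_I)
  fix r :: real assume r: "r > 0"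
  then obtain d where d: "d > 0" "\<And>q. dist q p < d \<Longrightarrow> dist (g q) (g p) < r / 2"
    using g(2) unfolding continuous_at_eps_delta by (metis half_gt_zero)
  obtain N where N: "\<And>n. n \<ge> N \<Longrightarrow> e n < d"
    using order_tendstoD(2)[OF e d(1)] by (auto simp: eventually_sequentially)
  have "norm (mollify (\<kappa> n) g p - g p) < r" if "n \<ge> N" for n
  proof -
    have "g p - r / 2 \<le> g q \<and> g q \<le> g p + r / 2" if "norm (q - p) < e n" for q
    proof -
      have "\<bar>g q - g p\<bar> < r / 2"
        using d(2)[of q] that N[OF \<open>n \<ge> N\<close>] by (simp add: dist_norm)
      then show ?thesis by arith
    qed
    note ab = this
    have "g p - r / 2 \<le> mollify (\<kappa> n) g p" "mollify (\<kappa> n) g p \<le> g p + r / 2"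
      using mollify_between[OF ker[of n] g(1)] ab by blast+
    then show ?thesis using r by (simp add: abs_less_iff)
  qed
  then show "\<exists>N. \<forall>n\<ge>N. norm (mollify (\<kappa> n) g p - g p) < r" by blast
qed

declare kernel_measurable[measurable del] kernel_D_measurable[measurable del]

section \<open>Weak flows and the energy identity\<close>

definition coord_box :: "nat set \<Rightarrow> (nat \<Rightarrow> real) \<Rightarrow> (nat \<Rightarrow> real) \<Rightarrow> (nat \<Rightarrow> real) set" where
  "coord_box I a b = {w. \<forall>j\<in>I. a j \<le> w j \<and> w j \<le> b j}"

text \<open>Points are functions on \<open>nat\<close>, which carry no norm, so differentiability is
  expressed by the chain rule along curves with differentiable coordinates. The curve has to lie in
  \<open>X\<close> only at the time considered; the faces of the box thus cause no one-sided
  derivatives.\<close>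

definition path_deriv :: "nat set \<Rightarrow> (nat \<Rightarrow> real) set \<Rightarrow> ((nat \<Rightarrow> real) \<Rightarrow> real) \<Rightarrow> (nat \<Rightarrow> (nat \<Rightarrow> real) \<Rightarrow> real) \<Rightarrow> bool" where
  "path_deriv I X E E' \<longleftrightarrow> (\<forall>w w' \<tau>. (\<forall>j\<in>I. (w j has_real_derivative w' j) (at \<tau>)) \<and> (\<lambda>j. w j \<tau>) \<in> X \<longrightarrow>
     ((\<lambda>\<tau>. E (\<lambda>j. w j \<tau>)) has_real_derivative (\<Sum>j\<in>I. E' j (\<lambda>j. w j \<tau>) * w' j)) (at \<tau>))"

text \<open>Sequential continuity in the coordinates that matter, together with a bound: this turns
  pointwise convergence of the arguments into bounded convergence of the values.\<close>

definition coord_cont :: "nat set \<Rightarrow> (nat \<Rightarrow> real) set \<Rightarrow> ((nat \<Rightarrow> real) \<Rightarrow> real) \<Rightarrow> bool" where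
  "coord_cont I X E \<longleftrightarrow> (\<forall>f l. (\<forall>j\<in>I. (\<lambda>n. f n j) \<longlonglongrightarrow> l j) \<and> (\<forall>n. f n \<in> X) \<and> l \<in> X \<longrightarrow> (\<lambda>n::nat. E (f n)) \<longlonglongrightarrow> E l)
     \<and> (\<exists>C. \<forall>w\<in>X. \<bar>E w\<bar> \<le> C)"

definition twice_path_deriv where
  "twice_path_deriv I X E E1 E2 \<longleftrightarrow> path_deriv I X E E1 \<and> (\<forall>j\<in>I. path_deriv I X (E1 j) (E2 j)) \<and>
     coord_cont I X E \<and> (\<forall>j\<in>I. coord_cont I X (E1 j)) \<and> (\<forall>j\<in>I. \<forall>k\<in>I. coord_cont I X (E2 j k))"

lemma coord_cont_compose:
  fixes z :: "nat \<Rightarrow> 'b::euclidean_space \<Rightarrow> real"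
  assumes "coord_cont I X E" "\<And>j. j \<in> I \<Longrightarrow> continuous_on K (z j)" "\<And>q. q \<in> K \<Longrightarrow> (\<lambda>j. z j q) \<in> X"
  shows "continuous_on K (\<lambda>q. E (\<lambda>j. z j q))"
  unfolding continuous_on_sequentially
proof (intro ballI allI impI)
  fix x q assume x: "q \<in> K" "(\<forall>n. x n \<in> K) \<and> x \<longlonglongrightarrow> q"
  have "(\<lambda>n. z j (x n)) \<longlonglongrightarrow> z j q" if "j \<in> I" for j
    using assms(2)[OF that] x unfolding continuous_on_sequentially by (auto simp: o_def)
  then show "((\<lambda>q. E (\<lambda>j. z j q)) \<circ> x) \<longlonglongrightarrow> E (\<lambda>j. z j q)"
    using assms(1)[unfolded coord_cont_def, THEN conjunct1, rule_format, of "\<lambda>n j. z j (x n)" "\<lambda>j. z j q"]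
      assms(3) x by (auto simp: o_def)
qed

lemma bounded_conv_coord_cont:
  assumes E: "coord_cont I X E" and Z: "\<And>n j. j \<in> I \<Longrightarrow> continuous_on K (Z n j)" "\<And>n q. q \<in> K \<Longrightarrow> (\<lambda>j. Z n j q) \<in> X"
    and z: "\<And>q j. q \<in> K \<Longrightarrow> j \<in> I \<Longrightarrow> (\<lambda>n. Z n j q) \<longlonglongrightarrow> z j q" "\<And>q. q \<in> K \<Longrightarrow> (\<lambda>j. z j q) \<in> X"
  shows "bounded_conv K (\<lambda>n q. E (\<lambda>j. Z n j q)) (\<lambda>q. E (\<lambda>j. z j q))"
proof -
  obtain C where "\<And>w. w \<in> X \<Longrightarrow> \<bar>E w\<bar> \<le> C" using E by (auto simp: coord_cont_def)
  then show ?thesis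
    using coord_cont_compose[OF E Z] E Z z
    by (intro bounded_convI[where C = C]) (auto intro!: borel_measurable_continuous_on_restrict simp: coord_cont_def)
qed

lemma frechet_derivative_translate:
  fixes \<kappa> :: "'b::euclidean_space \<Rightarrow> real"
  assumes "\<And>q. \<kappa> differentiable (at q)"
  shows "frechet_derivative (\<lambda>q. \<kappa> (q - p)) (at q) = frechet_derivative \<kappa> (at (q - p))"
proof (rule frechet_derivative_eqI)
  have 1: "((\<lambda>q. q - p) has_derivative (\<lambda>v. v)) (at q)"
    by (auto intro!: derivative_eq_intros)
  show "((\<lambda>q. \<kappa> (q - p)) has_derivative frechet_derivative \<kappa> (at (q - p))) (at q)"
    using assms frechet_derivative_works by (blast intro: has_derivative_compose[OF 1])
qed

text \<open>The problem reduced to continuous data on an open set: all of them are bounded on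
  compact subsets, so their mollifications converge boundedly there. The roots are differentiated
  classically in the space directions only; time enters through \<open>weak\<close>.\<close>

locale weak_flow =
  fixes Q :: "(real \<times> 'a::euclidean_space) set" and I :: "nat set" and a b :: "nat \<Rightarrow> real"
    and z :: "nat \<Rightarrow> real \<times> 'a \<Rightarrow> real" and G F :: "nat \<Rightarrow> real \<times> 'a \<Rightarrow> 'a" and B :: "nat \<Rightarrow> real \<times> 'a \<Rightarrow> real"
  assumes Q_open: "open Q" and fin: "finite I"
    and z_cont: "\<And>j. j \<in> I \<Longrightarrow> continuous_on Q (z j)"
    and G_cont: "\<And>j. j \<in> I \<Longrightarrow> continuous_on Q (G j)"
    and F_cont: "\<And>j. j \<in> I \<Longrightarrow> continuous_on Q (F j)"
    and B_cont: "\<And>j. j \<in> I \<Longrightarrow> continuous_on Q (B j)"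
    and z_DERIV: "\<And>j q w. j \<in> I \<Longrightarrow> q \<in> Q \<Longrightarrow> ((\<lambda>h. z j (q + h *\<^sub>R (0, w))) has_real_derivative G j q \<bullet> w) (at 0)"
    and z_box: "\<And>q. q \<in> Q \<Longrightarrow> (\<lambda>j. z j q) \<in> coord_box I a b"
    and weak: "\<And>j \<phi>. j \<in> I \<Longrightarrow> test_function Q \<phi> \<Longrightarrow>
       (LINT q:Q|lborel. - z j q * frechet_derivative \<phi> (at q) (1, 0)
          + (\<Sum>b\<in>Basis. (F j q \<bullet> b) * frechet_derivative \<phi> (at q) (0, b)) + B j q * \<phi> q) = 0"
begin

text \<open>Testing with a translate of the kernel gives an identity at each point of
  \<open>K\<close>: there the mollified data solve the system classically. For the time derivatives
  and the divergence of the fluxes only this identity is recorded; gradients, fluxes and reactions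
  converge boundedly.\<close>

lemma mollified_system:
  assumes K: "compact K" "K \<subseteq> Q"
  obtains Z :: "nat \<Rightarrow> nat \<Rightarrow> real \<times> 'a \<Rightarrow> real" and DZ and Fn :: "nat \<Rightarrow> nat \<Rightarrow> 'a \<Rightarrow> real \<times> 'a \<Rightarrow> real" and DF and Bn
  where "\<And>n j. j \<in> I \<Longrightarrow> continuous_on UNIV (Z n j)"
    "\<And>n j p v. j \<in> I \<Longrightarrow> ((\<lambda>h. Z n j (p + h *\<^sub>R v)) has_real_derivative DZ n j v p) (at 0)"
    "\<And>n j v. j \<in> I \<Longrightarrow> \<exists>L. \<forall>p. \<bar>DZ n j v p\<bar> \<le> L"
    "\<And>n j b. j \<in> I \<Longrightarrow> continuous_on UNIV (Fn n j b)"
    "\<And>n j b p v. j \<in> I \<Longrightarrow> ((\<lambda>h. Fn n j b (p + h *\<^sub>R v)) has_real_derivative DF n j b v p) (at 0)"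
    "\<And>n j b v. j \<in> I \<Longrightarrow> \<exists>L. \<forall>p. \<bar>DF n j b v p\<bar> \<le> L"
    "\<And>n p. p \<in> K \<Longrightarrow> (\<lambda>j. Z n j p) \<in> coord_box I a b"
    "\<And>n j p. j \<in> I \<Longrightarrow> p \<in> K \<Longrightarrow> DZ n j (1, 0) p = (\<Sum>b\<in>Basis. DF n j b (0, b) p) - Bn n j p"
    "\<And>j p. j \<in> I \<Longrightarrow> p \<in> K \<Longrightarrow> (\<lambda>n. Z n j p) \<longlonglongrightarrow> z j p"
    "\<And>j b. j \<in> I \<Longrightarrow> bounded_conv K (\<lambda>n. DZ n j (0, b)) (\<lambda>q. G j q \<bullet> b)"
    "\<And>j b. j \<in> I \<Longrightarrow> bounded_conv K (\<lambda>n. Fn n j b) (\<lambda>q. F j q \<bullet> b)"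
    "\<And>j. j \<in> I \<Longrightarrow> bounded_conv K (\<lambda>n. Bn n j) (B j)"
proof -
  obtain e0 where e0: "e0 > 0" "(\<Union>x\<in>K. cball x e0) \<subseteq> Q"
    using compact_subset_open_imp_cball_epsilon_subset[OF K(1) Q_open K(2)] by auto
  \<comment> \<open>A compact neighbourhood of \<open>K\<close> inside \<open>Q\<close>.
    Multiplication by its indicator makes all data integrable on the whole space, and kernels of
    radius below \<open>e0\<close> centred in \<open>K\<close> do not notice it.\<close>
  define K1 where "K1 = {x + y | x y. x \<in> K \<and> y \<in> cball 0 e0}"
  have K1: "compact K1" unfolding K1_def by (intro compact_sums K(1) compact_cball)
  have K1Q: "K1 \<subseteq> Q"
  proof -
    have "x + y \<in> cball x e0" if "y \<in> cball 0 e0" for x y :: "real \<times> 'a" using that by (simp add: dist_norm)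
    then show ?thesis using e0(2) unfolding K1_def by blast
  qed
  have cb: "q \<in> K1" if "p \<in> K" "norm (q - p) \<le> e0" for p q
    unfolding K1_def mem_Collect_eq
    by (rule exI[of _ p], rule exI[of _ "q - p"]) (use that in simp)
  have K1b: "K1 \<in> sets borel" using K1 by (simp add: compact_imp_closed borel_closed)
  \<comment> \<open>The shift by two makes every radius strictly smaller than \<open>e0\<close>, the
    first one included.\<close>
  define e where "e n = e0 / real (n + 2)" for n
  have e: "e n > 0" "e n < e0" for n using e0 by (auto simp: e_def field_simps intro: add_pos_nonneg)
  have elim: "e \<longlonglongrightarrow> 0"
    unfolding e_def using LIMSEQ_ignore_initial_segment[OF lim_const_over_n[of e0], of 2] by simp
  have "\<exists>\<kappa> :: real \<times> 'a \<Rightarrow> real. smooth_kernel (e n) \<kappa>" for n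
    using exists_smooth_kernel[OF e(1)[of n], where 'b = "real \<times> 'a"] e(1)[of n]
    unfolding smooth_kernel_def by metis
  then obtain \<kappa> :: "nat \<Rightarrow> real \<times> 'a \<Rightarrow> real" where ker: "\<And>n. smooth_kernel (e n) (\<kappa> n)" by metis
  define cut where "cut f q = indicator K1 q * f q" for f :: "real \<times> 'a \<Rightarrow> real" and q
  have cut_int: "integrable lborel (cut f)" if "continuous_on Q f" for f
    using borel_integrable_compact[OF K1 continuous_on_subset[OF that K1Q]] by (simp add: cut_def[abs_def])
  have cut_bd: "\<exists>M. \<forall>q. \<bar>cut f q\<bar> \<le> M" if "continuous_on Q f" for f
  proof -
    have "bounded (f ` K1)"
      by (intro compact_imp_bounded compact_continuous_image K1 continuous_on_subset[OF that K1Q])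
    then obtain M where "\<forall>y\<in>f ` K1. norm y \<le> M" unfolding bounded_iff ..
    then have "\<bar>cut f q\<bar> \<le> max M 0" for q by (auto simp: cut_def indicator_def)
    then show ?thesis by blast
  qed
  have cut_eq: "cut f q = f q" if "p \<in> K" "norm (q - p) \<le> e0" for f p q
    using cb[OF that] by (simp add: cut_def)
  have cut_isCont: "isCont (cut f) p" if f: "continuous_on Q f" and p: "p \<in> K" for f p
  proof -
    have "continuous_on (ball p e0) f"
      using f by (rule continuous_on_subset) (use K1Q cb[OF p] in \<open>force simp: dist_norm norm_minus_commute\<close>)
    then have "continuous_on (ball p e0) (cut f)"
      by (rule continuous_on_eq) (use cut_eq[OF p] in \<open>auto simp: dist_norm norm_minus_commute\<close>)
    then show ?thesis using e0(1) by (simp add: continuous_on_eq_continuous_at)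
  qed
  have conv: "bounded_conv K (\<lambda>n. mollify (\<kappa> n) (cut f)) f" if f: "continuous_on Q f" for f
  proof -
    obtain M where M: "\<And>q. \<bar>cut f q\<bar> \<le> M" using cut_bd[OF f] by auto
    show ?thesis
    proof (rule bounded_convI[where C = M])
      show "mollify (\<kappa> n) (cut f) \<in> borel_measurable (restrict_space borel K)" for n
        by (intro borel_measurable_continuous_on_restrict mollify_continuous[OF ker] cut_int f)
      show "\<bar>mollify (\<kappa> n) (cut f) q\<bar> \<le> M" for n q
      proof -
        have "- M \<le> cut f x \<and> cut f x \<le> M" for x using M[of x] by (simp add: abs_le_iff)
        with mollify_between[OF ker cut_int[OF f]]
        have "- M \<le> mollify (\<kappa> n) (cut f) q" "mollify (\<kappa> n) (cut f) q \<le> M" by blast+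
        then show ?thesis by linarith
      qed
      show "(\<lambda>n. mollify (\<kappa> n) (cut f) q) \<longlonglongrightarrow> f q" if "q \<in> K" for q
        using mollify_tendsto[OF ker elim cut_int[OF f] cut_isCont[OF f that]] cut_eq[OF that, of q] e0 by simp
    qed
  qed
  define Dk where "Dk n v q = frechet_derivative (\<kappa> n) (at q) v" for n v q
  define Z where "Z n j = mollify (\<kappa> n) (cut (z j))" for n j
  define DZ where "DZ n j v p = - mollify (Dk n v) (cut (z j)) p" for n j v p
  define Fn where "Fn n j b = mollify (\<kappa> n) (cut (\<lambda>q. F j q \<bullet> b))" for n j b
  define DF where "DF n j b v p = - mollify (Dk n v) (cut (\<lambda>q. F j q \<bullet> b)) p" for n j b v p
  define Bn where "Bn n j = mollify (\<kappa> n) (cut (B j))" for n j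
  have Fc: "continuous_on Q (\<lambda>q. F j q \<bullet> b)" if "j \<in> I" for j b
    using F_cont[OF that] by (intro continuous_intros)
  have Gc: "continuous_on Q (\<lambda>q. G j q \<bullet> b)" if "j \<in> I" for j b
    using G_cont[OF that] by (intro continuous_intros)
  show ?thesis
  proof (rule that[of Z DZ Fn DF Bn])
    fix n j p b and v :: "real \<times> 'a" assume j: "j \<in> I"
    show "continuous_on UNIV (Z n j)" "continuous_on UNIV (Fn n j b)"
      unfolding Z_def Fn_def by (intro mollify_continuous[OF ker] cut_int z_cont Fc j)+
    show "((\<lambda>h. Z n j (p + h *\<^sub>R v)) has_real_derivative DZ n j v p) (at 0)"
      unfolding Z_def DZ_def Dk_def[abs_def] by (intro mollify_DERIV(1)[OF ker] cut_int z_cont j)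
    show "((\<lambda>h. Fn n j b (p + h *\<^sub>R v)) has_real_derivative DF n j b v p) (at 0)"
      unfolding Fn_def DF_def Dk_def[abs_def] by (intro mollify_DERIV(1)[OF ker] cut_int Fc j)
    show "\<exists>L. \<forall>p. \<bar>DZ n j v p\<bar> \<le> L"
      using mollify_DERIV(2)[OF ker cut_int[OF z_cont[OF j]]] by (simp add: DZ_def Dk_def[abs_def])
    show "\<exists>L. \<forall>p. \<bar>DF n j b v p\<bar> \<le> L"
      using mollify_DERIV(2)[OF ker cut_int[OF Fc[OF j]]] by (simp add: DF_def Dk_def[abs_def])
    show "bounded_conv K (\<lambda>n. Fn n j b) (\<lambda>q. F j q \<bullet> b)" "bounded_conv K (\<lambda>n. Bn n j) (B j)"
      unfolding Fn_def Bn_def by (intro conv Fc B_cont j)+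
    show "bounded_conv K (\<lambda>n. DZ n j (0, b)) (\<lambda>q. G j q \<bullet> b)"
    proof -
      \<comment> \<open>In the space directions the roots are differentiable, so the derivative
        moves from the kernel onto them; hence the mollified gradients converge.\<close>
      have "DZ n j (0, b) p = mollify (\<kappa> n) (cut (\<lambda>q. G j q \<bullet> b)) p" if p: "p \<in> K" for n p
      proof -
        obtain M1 M2 where M: "\<And>q. \<bar>cut (z j) q\<bar> \<le> M1" "\<And>q. \<bar>cut (\<lambda>q. G j q \<bullet> b) q\<bar> \<le> M2"
          using cut_bd[OF z_cont[OF j]] cut_bd[OF Gc[OF j]] by metis
        show ?thesis unfolding DZ_def Dk_def[abs_def]
        proof (rule mollify_by_parts[OF ker cut_int[OF z_cont[OF j]], where M = "max M1 M2"])
          fix q assume q: "norm (q - p) \<le> e n"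
          then have qe: "norm (q - p) < e0" using e(2)[of n] by simp
          have "((\<lambda>h. z j (q + h *\<^sub>R (0, b))) has_real_derivative G j q \<bullet> b) (at 0)"
            using cb[OF p, of q] qe K1Q by (intro z_DERIV j) auto
          moreover have "open ((\<lambda>h::real. q + h *\<^sub>R (0, b)) -` ball p e0)"
            by (intro open_vimage open_ball continuous_intros)
          moreover have "0 \<in> (\<lambda>h::real. q + h *\<^sub>R (0, b)) -` ball p e0"
            using qe by (simp add: dist_norm norm_minus_commute zero_prod_def[symmetric])
          moreover have "z j (q + h *\<^sub>R (0, b)) = cut (z j) (q + h *\<^sub>R (0, b))"
            if "h \<in> (\<lambda>h::real. q + h *\<^sub>R (0, b)) -` ball p e0" for h
            using that cut_eq[OF p, of "q + h *\<^sub>R (0, b)"] by (simp add: dist_norm norm_minus_commute)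
          ultimately have "((\<lambda>h. cut (z j) (q + h *\<^sub>R (0, b))) has_real_derivative G j q \<bullet> b) (at 0)"
            by (rule has_field_derivative_transform_within_open)
          then show "((\<lambda>h. cut (z j) (q + h *\<^sub>R (0, b))) has_real_derivative cut (\<lambda>q. G j q \<bullet> b) q) (at 0)"
            using cut_eq[OF p, of q] qe by simp
          show "\<bar>cut (z j) q\<bar> \<le> max M1 M2 \<and> \<bar>cut (\<lambda>q. G j q \<bullet> b) q\<bar> \<le> max M1 M2"
            using M[of q] by (simp add: le_max_iff_disj)
        qed
      qed
      note eq = this
      have "DZ n j (0, b) \<in> borel_measurable (restrict_space borel K) \<longleftrightarrow>
         mollify (\<kappa> n) (cut (\<lambda>q. G j q \<bullet> b)) \<in> borel_measurable (restrict_space borel K)" for n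
        by (rule measurable_cong) (use eq in \<open>simp add: space_restrict_space\<close>)
      with conv[OF Gc[OF j, of b]] show ?thesis by (simp add: bounded_conv_def eq)
    qed
  next
    fix n p assume p: "p \<in> K"
    show "(\<lambda>j. Z n j p) \<in> coord_box I a b"
    proof (unfold coord_box_def, intro CollectI ballI)
      fix j assume j: "j \<in> I"
      have "a j \<le> cut (z j) q \<and> cut (z j) q \<le> b j" if "norm (q - p) < e n" for q
        using that e(2)[of n] cut_eq[OF p, of q] cb[OF p, of q] K1Q z_box[of q] j by (auto simp: coord_box_def)
      from mollify_between[OF ker cut_int[OF z_cont[OF j]] this]
      show "a j \<le> Z n j p \<and> Z n j p \<le> b j" by (simp add: Z_def)
    qed
  next
    fix j p assume j: "j \<in> I" and p: "p \<in> K"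
    show "(\<lambda>n. Z n j p) \<longlonglongrightarrow> z j p"
      using conv[OF z_cont[OF j]] p by (simp add: bounded_conv_def Z_def)
    fix n
    have kd: "\<kappa> n differentiable (at q)" for q
      using kernel_has_derivative[OF ker] differentiable_def by blast
    let ?\<phi> = "\<lambda>q. \<kappa> n (q - p)"
    have D: "frechet_derivative ?\<phi> (at q) v = Dk n v (q - p)" for q v
      using frechet_derivative_translate[of "\<kappa> n", OF kd] by (simp add: Dk_def)
    have ph0: "?\<phi> q = 0" "Dk n v (q - p) = 0" if "norm (q - p) > e n" for q v
      using kernel_eq_0[OF ker, of n "q - p"] kernel_D_eq_0[OF ker, of n "q - p"] that by (auto simp: Dk_def)
    have cl: "closure {q. ?\<phi> q \<noteq> 0} \<subseteq> cball p (e n)"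
    proof (rule closure_minimal)
      show "{q. ?\<phi> q \<noteq> 0} \<subseteq> cball p (e n)"
        using ph0(1) by (auto simp: dist_norm norm_minus_commute not_less[symmetric])
    qed simp
    have cQ: "cball p (e n) \<subseteq> Q"
    proof
      fix q assume "q \<in> cball p (e n)"
      then have "norm (q - p) \<le> e0" using e(2)[of n] by (simp add: dist_norm norm_minus_commute)
      from cb[OF p this] K1Q show "q \<in> Q" by blast
    qed
    have "compact (closure {q. ?\<phi> q \<noteq> 0})"
      using compact_Int_closed[OF compact_cball[of p "e n"] closed_closure[of "{q. ?\<phi> q \<noteq> 0}"]] cl
      by (simp add: Int_absorb1)
    then have test: "test_function Q ?\<phi>"
      unfolding test_function_def using Ck_on_translate[OF kernel_Ck[OF ker]] cl cQ by auto
    have i: "integrable lborel (\<lambda>q. Dk n v (q - p) * cut f q)" "integrable lborel (\<lambda>q. \<kappa> n (q - p) * cut f q)"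
      if "continuous_on Q f" for f v
      using kernel_mult_integrable[OF ker cut_int[OF that]] by (auto simp: Dk_def)
    \<comment> \<open>Beyond radius \<open>e n\<close> the kernel and its derivatives vanish, and
      within it the point lies in both \<open>K1\<close> and \<open>Q\<close>. So the two indicators
      may be exchanged.\<close>
    have eq: "indicator Q q *\<^sub>R (- z j q * frechet_derivative ?\<phi> (at q) (1, 0)
          + (\<Sum>b\<in>Basis. (F j q \<bullet> b) * frechet_derivative ?\<phi> (at q) (0, b)) + B j q * ?\<phi> q)
        = - (Dk n (1, 0) (q - p) * cut (z j) q)
          + (\<Sum>b\<in>Basis. Dk n (0, b) (q - p) * cut (\<lambda>q. F j q \<bullet> b) q) + \<kappa> n (q - p) * cut (B j) q" for q
    proof (cases "norm (q - p) \<le> e n")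
      case True
      then have "q \<in> K1" "q \<in> Q" using cb[OF p, of q] e(2)[of n] K1Q by auto
      then show ?thesis by (simp add: D cut_def mult.commute)
    next
      case False
      then show ?thesis using ph0 by (simp add: D)
    qed
    have "0 = (LINT q|lborel. - (Dk n (1, 0) (q - p) * cut (z j) q)
          + (\<Sum>b\<in>Basis. Dk n (0, b) (q - p) * cut (\<lambda>q. F j q \<bullet> b) q) + \<kappa> n (q - p) * cut (B j) q)"
      using weak[OF j test] unfolding set_lebesgue_integral_def eq by simp
    also have "\<dots> = - mollify (Dk n (1, 0)) (cut (z j)) p
        + (\<Sum>b\<in>Basis. mollify (Dk n (0, b)) (cut (\<lambda>q. F j q \<bullet> b)) p) + mollify (\<kappa> n) (cut (B j)) p"
      unfolding mollify_def
      using i[OF z_cont[OF j]] i[OF Fc[OF j]] i[OF B_cont[OF j]] by simp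
    finally show "DZ n j (1, 0) p = (\<Sum>b\<in>Basis. DF n j b (0, b) p) - Bn n j p"
      by (simp add: DZ_def DF_def Bn_def sum_negf)
  qed
qed

end

section \<open>Cutoff functions and integration by parts\<close>

definition bdd_on :: "'b set \<Rightarrow> ('b \<Rightarrow> real) \<Rightarrow> bool" where
  "bdd_on K f \<longleftrightarrow> (\<exists>M. \<forall>q\<in>K. \<bar>f q\<bar> \<le> M)"

lemma bdd_onI: "(\<And>q. q \<in> K \<Longrightarrow> \<bar>f q\<bar> \<le> M) \<Longrightarrow> bdd_on K f"
  by (auto simp: bdd_on_def)

lemma bdd_on_add: "bdd_on K f \<Longrightarrow> bdd_on K g \<Longrightarrow> bdd_on K (\<lambda>q. f q + g q)"
  unfolding bdd_on_def by (meson abs_triangle_ineq add_mono order_trans)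

lemma bdd_on_mult: "bdd_on K f \<Longrightarrow> bdd_on K g \<Longrightarrow> bdd_on K (\<lambda>q. f q * g q)"
  unfolding bdd_on_def abs_mult by (meson abs_ge_zero mult_mono order_trans)

lemma bdd_on_sum: "(\<And>i. i \<in> A \<Longrightarrow> bdd_on K (f i)) \<Longrightarrow> bdd_on K (\<lambda>q. \<Sum>i\<in>A. f i q)"
  by (induction A rule: infinite_finite_induct) (auto intro: bdd_on_add bdd_onI[where M = 0])

lemma bdd_on_compact:
  fixes f :: "'b::euclidean_space \<Rightarrow> real"
  assumes "compact K" "continuous_on K f" shows "bdd_on K f"
proof -
  have "bounded (f ` K)" using assms by (intro compact_imp_bounded compact_continuous_image)
  then obtain M where "\<forall>y\<in>f ` K. norm y \<le> M" unfolding bounded_iff ..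
  then show ?thesis by (auto intro: bdd_onI)
qed

locale cutoff_function =
  fixes K :: "'b::euclidean_space set" and \<zeta> :: "'b \<Rightarrow> real" and D\<zeta> :: "'b \<Rightarrow> 'b \<Rightarrow> real"
  assumes K_compact: "compact K"
    and \<zeta>_DERIV: "\<And>q v. ((\<lambda>h. \<zeta> (q + h *\<^sub>R v)) has_real_derivative D\<zeta> v q) (at 0)"
    and D\<zeta>_bdd: "\<And>v. bdd_on UNIV (D\<zeta> v)"
    and \<zeta>_eq_0: "\<And>q. q \<notin> K \<Longrightarrow> \<zeta> q = 0"
    and \<zeta>_cont: "continuous_on UNIV \<zeta>"
begin

lemma K_borel: "K \<in> sets borel" and K_finite: "emeasure lborel K < \<infinity>"
  using K_compact emeasure_bounded_finite[OF compact_imp_bounded[OF K_compact]]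
  by (auto simp: compact_imp_closed borel_closed)

lemma \<zeta>_bdd: "bdd_on K \<zeta>"
  by (rule bdd_on_compact[OF K_compact continuous_on_subset[OF \<zeta>_cont]]) simp

lemma D\<zeta>_measurable: "D\<zeta> v \<in> borel_measurable borel"
proof (rule borel_measurable_LIMSEQ_real)
  have [measurable]: "\<zeta> \<in> borel_measurable borel"
    using \<zeta>_cont by (rule borel_measurable_continuous_onI)
  show "(\<lambda>n. (\<zeta> (q + (1 / real (Suc n)) *\<^sub>R v) - \<zeta> q) / (1 / real (Suc n))) \<longlonglongrightarrow> D\<zeta> v q" for q
  proof -
    have "((\<lambda>h. (\<zeta> (q + h *\<^sub>R v) - \<zeta> q) / h) \<longlongrightarrow> D\<zeta> v q) (at 0)"
      using \<zeta>_DERIV[of q v] by (simp add: has_field_derivative_iff)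
    moreover have "filterlim (\<lambda>n. 1 / real (Suc n)) (at 0) sequentially"
      using LIMSEQ_inverse_real_of_nat
      by (auto simp: filterlim_at inverse_eq_divide intro!: always_eventually)
    ultimately show ?thesis by (rule filterlim_compose)
  qed
  show "(\<lambda>q. (\<zeta> (q + (1 / real (Suc n)) *\<^sub>R v) - \<zeta> q) / (1 / real (Suc n))) \<in> borel_measurable borel" for n
    by measurable
qed

text \<open>The product \<open>\<Phi> * \<zeta>\<close> has line derivatives everywhere although
  \<open>\<Phi>\<close> has them only on \<open>K\<close>: off the closed set \<open>K\<close> the
  product vanishes on a neighbourhood. No boundary term arises.\<close>

lemma integral_product_cutoff:
  assumes \<Phi>: "continuous_on K \<Phi>"
    "\<And>q. q \<in> K \<Longrightarrow> ((\<lambda>h. \<Phi> (q + h *\<^sub>R v)) has_real_derivative \<Phi>' q) (at 0)" "bdd_on K \<Phi>'"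
  shows "set_integrable lborel K (\<lambda>q. \<Phi>' q * \<zeta> q + \<Phi> q * D\<zeta> v q)"
    "(LINT q:K|lborel. \<Phi>' q * \<zeta> q + \<Phi> q * D\<zeta> v q) = 0"
proof -
  let ?f = "\<lambda>q. \<Phi> q * \<zeta> q" and ?f' = "\<lambda>q. indicator K q *\<^sub>R (\<Phi>' q * \<zeta> q + \<Phi> q * D\<zeta> v q)"
  have "integrable lborel (\<lambda>q. indicator K q *\<^sub>R ?f q)"
    using \<Phi>(1) continuous_on_subset[OF \<zeta>_cont]
    by (intro borel_integrable_compact K_compact continuous_intros) auto
  moreover have "(\<lambda>q. indicator K q *\<^sub>R ?f q) = ?f"
    using \<zeta>_eq_0 by (auto simp: fun_eq_iff indicator_def)
  ultimately have i: "integrable lborel ?f" by simp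
  have d: "((\<lambda>h. ?f (q + h *\<^sub>R v)) has_real_derivative ?f' q) (at 0)" for q
  proof (cases "q \<in> K")
    case True
    then show ?thesis
      using DERIV_mult[OF \<Phi>(2)[OF True] \<zeta>_DERIV[of q v]] by (simp add: algebra_simps)
  next
    case False
    have "((\<lambda>h. 0) has_real_derivative 0) (at 0)" by simp
    then have "((\<lambda>h. ?f (q + h *\<^sub>R v)) has_real_derivative 0) (at 0)"
    proof (rule has_field_derivative_transform_within_open)
      show "open ((\<lambda>h::real. q + h *\<^sub>R v) -` (- K))"
        by (intro open_vimage continuous_intros) (simp add: open_Compl compact_imp_closed K_compact)
    qed (use False \<zeta>_eq_0 in auto)
    then show ?thesis using False by simp
  qed
  have "bdd_on K (D\<zeta> v)" using D\<zeta>_bdd[of v] by (auto simp: bdd_on_def)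
  then have "bdd_on K (\<lambda>q. \<Phi>' q * \<zeta> q + \<Phi> q * D\<zeta> v q)"
    by (intro bdd_on_add bdd_on_mult \<Phi> \<zeta>_bdd bdd_on_compact[OF K_compact \<Phi>(1)])
  then obtain M where M: "\<And>q. q \<in> K \<Longrightarrow> \<bar>\<Phi>' q * \<zeta> q + \<Phi> q * D\<zeta> v q\<bar> \<le> M"
    by (auto simp: bdd_on_def)
  have b: "\<bar>?f' q\<bar> \<le> max M 0" for q
    using M[of q] by (auto simp: indicator_def)
  have "?f q = 0" if "q \<notin> K" for q using that \<zeta>_eq_0 by simp
  note I = integral_DERIV_along_zero[OF i d b compact_imp_bounded[OF K_compact] this]
  show "set_integrable lborel K (\<lambda>q. \<Phi>' q * \<zeta> q + \<Phi> q * D\<zeta> v q)"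
    using I(1) by (simp add: set_integrable_def)
  show "(LINT q:K|lborel. \<Phi>' q * \<zeta> q + \<Phi> q * D\<zeta> v q) = 0"
    using I(2) by (simp add: set_lebesgue_integral_def)
qed

end

lemma coord_cont_bdd: "coord_cont I X E \<Longrightarrow> (\<And>q. q \<in> K \<Longrightarrow> (\<lambda>j. Z j q) \<in> X) \<Longrightarrow> bdd_on K (\<lambda>q. E (\<lambda>j. Z j q))"
  unfolding coord_cont_def bdd_on_def by blast

lemma path_deriv_line:
  fixes Z :: "nat \<Rightarrow> 'b::euclidean_space \<Rightarrow> real"
  assumes "path_deriv I X E E'" "\<And>j. j \<in> I \<Longrightarrow> ((\<lambda>h. Z j (q + h *\<^sub>R v)) has_real_derivative Z' j) (at 0)"
    "(\<lambda>j. Z j q) \<in> X"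
  shows "((\<lambda>h. E (\<lambda>j. Z j (q + h *\<^sub>R v))) has_real_derivative (\<Sum>j\<in>I. E' j (\<lambda>j. Z j q) * Z' j)) (at 0)"
  using assms(1)[unfolded path_deriv_def, rule_format, of "\<lambda>j h. Z j (q + h *\<^sub>R v)" Z' 0] assms(2,3)
  by simp

context weak_flow
begin

text \<open>With \<open>\<partial>\<^sub>t z\<^sub>j = div F\<^sub>j - B\<^sub>j\<close> this is the
  weak form, tested with \<open>\<zeta>\<close>, of the equation satisfied by \<open>E(z)\<close>.
  The double sum is \<open>\<Sum>\<^sub>j \<nabla>(E\<^sub>j(z)) \<bullet> F\<^sub>j\<close>, which
  appears when the divergence is moved off the flux.\<close>

definition energy_integrand where
  "energy_integrand \<zeta> D\<zeta> E E1 E2 q = E (\<lambda>j. z j q) * D\<zeta> (1, 0) q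
     - \<zeta> q * ((\<Sum>j\<in>I. E1 j (\<lambda>j. z j q) * B j q)
        + (\<Sum>j\<in>I. \<Sum>k\<in>I. E2 j k (\<lambda>j. z j q) * (G k q \<bullet> F j q)))
     - (\<Sum>j\<in>I. E1 j (\<lambda>j. z j q) * (\<Sum>b\<in>Basis. (F j q \<bullet> b) * D\<zeta> (0, b) q))"

text \<open>For mollified roots the chain rule applies, and the time derivative of
  \<open>E(Z) \<zeta>\<close> as well as the divergence of the fields
  \<open>E\<^sub>j(Z) F\<^sub>j \<zeta>\<close> integrate to zero. In the difference the equation
  eliminates the quantities without known limits, and what remains converges factor by
  factor.\<close>

lemma energy_identity:
  assumes E: "twice_path_deriv I (coord_box I a b) E E1 E2" and "cutoff_function K \<zeta> D\<zeta>" and KQ: "K \<subseteq> Q"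
  shows "(LINT q:K|lborel. energy_integrand \<zeta> D\<zeta> E E1 E2 q) = 0"
proof -
  interpret cutoff_function K \<zeta> D\<zeta> by fact
  let ?X = "coord_box I a b"
  show ?thesis
  proof (rule mollified_system[OF K_compact KQ])
    fix Z DZ Fn DF Bn
    assume Zc: "\<And>n j. j \<in> I \<Longrightarrow> continuous_on UNIV (Z n j)"
      and Zd: "\<And>n j p v. j \<in> I \<Longrightarrow> ((\<lambda>h. Z n j (p + h *\<^sub>R v)) has_real_derivative DZ n j v p) (at 0)"
      and Zb: "\<And>n j v. j \<in> I \<Longrightarrow> \<exists>L. \<forall>p. \<bar>DZ n j v p\<bar> \<le> L"
      and Fc: "\<And>n j b. j \<in> I \<Longrightarrow> continuous_on UNIV (Fn n j b)"
      and Fd: "\<And>n j b p v. j \<in> I \<Longrightarrow> ((\<lambda>h. Fn n j b (p + h *\<^sub>R v)) has_real_derivative DF n j b v p) (at 0)"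
      and Fb: "\<And>n j b v. j \<in> I \<Longrightarrow> \<exists>L. \<forall>p. \<bar>DF n j b v p\<bar> \<le> L"
      and box: "\<And>n p. p \<in> K \<Longrightarrow> (\<lambda>j. Z n j p) \<in> ?X"
      and eqn: "\<And>n j p. j \<in> I \<Longrightarrow> p \<in> K \<Longrightarrow> DZ n j (1, 0) p = (\<Sum>b\<in>Basis. DF n j b (0, b) p) - Bn n j p"
      and Zl: "\<And>j p. j \<in> I \<Longrightarrow> p \<in> K \<Longrightarrow> (\<lambda>n. Z n j p) \<longlonglongrightarrow> z j p"
      and Gl: "\<And>j b. j \<in> I \<Longrightarrow> bounded_conv K (\<lambda>n. DZ n j (0, b)) (\<lambda>q. G j q \<bullet> b)"
      and Fl: "\<And>j b. j \<in> I \<Longrightarrow> bounded_conv K (\<lambda>n. Fn n j b) (\<lambda>q. F j q \<bullet> b)"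
      and Bl: "\<And>j. j \<in> I \<Longrightarrow> bounded_conv K (\<lambda>n. Bn n j) (B j)"
  have Eder: "path_deriv I ?X E E1" "\<And>j. j \<in> I \<Longrightarrow> path_deriv I ?X (E1 j) (E2 j)"
    and Ecc: "coord_cont I ?X E" "\<And>j. j \<in> I \<Longrightarrow> coord_cont I ?X (E1 j)"
      "\<And>j k. j \<in> I \<Longrightarrow> k \<in> I \<Longrightarrow> coord_cont I ?X (E2 j k)"
    using E by (auto simp: twice_path_deriv_def)
  have ZK: "continuous_on K (Z n j)" if "j \<in> I" for n j
    using Zc[OF that] continuous_on_subset by blast
  \<comment> \<open>Written only with mollified quantities whose limits are known.\<close>
  define S where "S n q = E (\<lambda>j. Z n j q) * D\<zeta> (1, 0) q
     - \<zeta> q * ((\<Sum>j\<in>I. E1 j (\<lambda>j. Z n j q) * Bn n j q)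
        + (\<Sum>j\<in>I. \<Sum>b\<in>Basis. (\<Sum>k\<in>I. E2 j k (\<lambda>j. Z n j q) * DZ n k (0, b) q) * Fn n j b q))
     - (\<Sum>j\<in>I. E1 j (\<lambda>j. Z n j q) * (\<Sum>b\<in>Basis. Fn n j b q * D\<zeta> (0, b) q))" for n q
  have S0: "(LINT q:K|lborel. S n q) = 0" for n
  proof -
    let ?A = "\<lambda>q. (\<Sum>j\<in>I. E1 j (\<lambda>j. Z n j q) * DZ n j (1, 0) q) * \<zeta> q + E (\<lambda>j. Z n j q) * D\<zeta> (1, 0) q"
    let ?A' = "\<lambda>j b q. ((\<Sum>k\<in>I. E2 j k (\<lambda>j. Z n j q) * DZ n k (0, b) q) * Fn n j b q
         + E1 j (\<lambda>j. Z n j q) * DF n j b (0, b) q) * \<zeta> q + (E1 j (\<lambda>j. Z n j q) * Fn n j b q) * D\<zeta> (0, b) q"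
    have bZ: "bdd_on K (DZ n j v)" "bdd_on K (DF n j b v)" if "j \<in> I" for j v b
      using Zb[OF that] Fb[OF that] unfolding bdd_on_def by metis+
    have bF: "bdd_on K (Fn n j b)" if "j \<in> I" for j b
      using Fc[OF that] continuous_on_subset by (intro bdd_on_compact K_compact) blast
    have A: "set_integrable lborel K ?A" "(LINT q:K|lborel. ?A q) = 0"
      by (intro integral_product_cutoff coord_cont_compose[OF Ecc(1)] ZK box path_deriv_line[OF Eder(1)] Zd
          bdd_on_sum bdd_on_mult bZ coord_cont_bdd[OF Ecc(2)]; assumption)+
    have der: "((\<lambda>h. E1 j (\<lambda>j. Z n j (q + h *\<^sub>R (0, b))) * Fn n j b (q + h *\<^sub>R (0, b))) has_real_derivative
        (\<Sum>k\<in>I. E2 j k (\<lambda>j. Z n j q) * DZ n k (0, b) q) * Fn n j b q + E1 j (\<lambda>j. Z n j q) * DF n j b (0, b) q) (at 0)"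
      if "j \<in> I" "q \<in> K" for j b q
      using DERIV_mult[OF path_deriv_line[where Z = "Z n" and v = "(0, b)", OF Eder(2)[OF that(1)] Zd box[OF that(2)]] Fd[OF that(1), of n b q "(0, b)"]]
      by (simp add: algebra_simps zero_prod_def[symmetric])
    have A': "set_integrable lborel K (?A' j b)" "(LINT q:K|lborel. ?A' j b q) = 0" if "j \<in> I" for j b
    proof -
      have 1: "continuous_on K (\<lambda>q. E1 j (\<lambda>j. Z n j q) * Fn n j b q)"
        using Fc[OF that] continuous_on_subset[OF _ subset_UNIV]
        by (intro continuous_on_mult coord_cont_compose[OF Ecc(2)[OF that]] ZK box) auto
      have 2: "bdd_on K (\<lambda>q. (\<Sum>k\<in>I. E2 j k (\<lambda>j. Z n j q) * DZ n k (0, b) q) * Fn n j b q + E1 j (\<lambda>j. Z n j q) * DF n j b (0, b) q)"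
        by (intro bdd_on_add bdd_on_mult bdd_on_sum bZ bF that coord_cont_bdd[OF Ecc(2)] coord_cont_bdd[OF Ecc(3)] box; assumption)
      show "set_integrable lborel K (?A' j b)" "(LINT q:K|lborel. ?A' j b q) = 0"
        by (rule integral_product_cutoff[OF 1 der[OF that] 2]; assumption)+
    qed
    \<comment> \<open>The mollified equation is used at this point: the time derivative in
      \<open>?A\<close> cancels the divergences in \<open>?A'\<close>, and the reaction is left
      over.\<close>
    have "S n q = ?A q - (\<Sum>j\<in>I. \<Sum>b\<in>Basis. ?A' j b q)" if "q \<in> K" for q
    proof -
      have "(\<Sum>j\<in>I. E1 j (\<lambda>j. Z n j q) * DZ n j (1, 0) q)
          = (\<Sum>j\<in>I. E1 j (\<lambda>j. Z n j q) * (\<Sum>b\<in>Basis. DF n j b (0, b) q)) - (\<Sum>j\<in>I. E1 j (\<lambda>j. Z n j q) * Bn n j q)"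
        unfolding sum_subtractf[symmetric] by (intro sum.cong refl) (simp add: eqn that right_diff_distrib)
      from arg_cong[OF this, of "\<lambda>x. \<zeta> q * x"] show ?thesis
        unfolding S_def
        by (simp add: sum.distrib sum_distrib_left sum_distrib_right algebra_simps)
    qed
    then have "(LINT q:K|lborel. S n q) = (LINT q:K|lborel. ?A q - (\<Sum>j\<in>I. \<Sum>b\<in>Basis. ?A' j b q))"
      by (intro set_lebesgue_integral_cong) (auto simp: K_borel)
    also have "\<dots> = (LINT q:K|lborel. ?A q) - (LINT q:K|lborel. (\<Sum>j\<in>I. \<Sum>b\<in>Basis. ?A' j b q))"
    proof (rule set_integral_diff(2)[OF A(1)])
      show "set_integrable lborel K (\<lambda>q. \<Sum>j\<in>I. \<Sum>b\<in>Basis. ?A' j b q)"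
        using A'(1) unfolding set_integrable_def scaleR_sum_right
        by (intro Bochner_Integration.integrable_sum) blast
    qed
    also have "(LINT q:K|lborel. (\<Sum>j\<in>I. \<Sum>b\<in>Basis. ?A' j b q)) = (\<Sum>j\<in>I. \<Sum>b\<in>Basis. LINT q:K|lborel. ?A' j b q)"
      using A'(1) unfolding set_integrable_def set_lebesgue_integral_def scaleR_sum_right
      by (subst Bochner_Integration.integral_sum; (intro sum.cong refl Bochner_Integration.integral_sum Bochner_Integration.integrable_sum)?) blast+
    finally show ?thesis using A(2) A'(2) by simp
  qed
  have z_boxK: "\<And>q. q \<in> K \<Longrightarrow> (\<lambda>j. z j q) \<in> ?X" using z_box KQ by blast
  have cD: "bounded_conv K (\<lambda>n. D\<zeta> v) (D\<zeta> v)" for v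
  proof -
    obtain M where "\<forall>q\<in>UNIV. \<bar>D\<zeta> v q\<bar> \<le> M" using D\<zeta>_bdd[of v] unfolding bdd_on_def ..
    then show ?thesis
      by (intro bounded_conv_const[where C = M] measurable_restrict_space1[OF D\<zeta>_measurable]) auto
  qed
  have c\<zeta>: "bounded_conv K (\<lambda>n. \<zeta>) \<zeta>"
  proof -
    obtain M where "\<forall>q\<in>K. \<bar>\<zeta> q\<bar> \<le> M" using \<zeta>_bdd unfolding bdd_on_def ..
    then show ?thesis
      using continuous_on_subset[OF \<zeta>_cont subset_UNIV]
      by (intro bounded_conv_const[where C = M] borel_measurable_continuous_on_restrict) auto
  qed
  note cE = bounded_conv_coord_cont[where Z = Z and z = z and I = I, OF _ ZK box Zl z_boxK]
  have "bounded_conv K S (\<lambda>q. E (\<lambda>j. z j q) * D\<zeta> (1, 0) q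
     - \<zeta> q * ((\<Sum>j\<in>I. E1 j (\<lambda>j. z j q) * B j q)
        + (\<Sum>j\<in>I. \<Sum>b\<in>Basis. (\<Sum>k\<in>I. E2 j k (\<lambda>j. z j q) * (G k q \<bullet> b)) * (F j q \<bullet> b)))
     - (\<Sum>j\<in>I. E1 j (\<lambda>j. z j q) * (\<Sum>b\<in>Basis. (F j q \<bullet> b) * D\<zeta> (0, b) q)))" (is "bounded_conv K S ?L")
    unfolding S_def by (intro bounded_conv_intros cD c\<zeta> cE Ecc Gl Fl Bl; assumption)
  from bounded_conv_integral(3)[OF this K_borel K_finite] have "(LINT q:K|lborel. ?L q) = 0"
    by (simp add: S0 LIMSEQ_const_iff)
  also have "?L = energy_integrand \<zeta> D\<zeta> E E1 E2"
  proof
    fix q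
    have "(\<Sum>b\<in>Basis. (\<Sum>k\<in>I. E2 j k (\<lambda>j. z j q) * (G k q \<bullet> b)) * (F j q \<bullet> b))
        = (\<Sum>k\<in>I. E2 j k (\<lambda>j. z j q) * (G k q \<bullet> F j q))" for j
    proof -
      have "(\<Sum>b\<in>Basis. (\<Sum>k\<in>I. E2 j k (\<lambda>j. z j q) * (G k q \<bullet> b)) * (F j q \<bullet> b))
          = (\<Sum>b\<in>Basis. \<Sum>k\<in>I. E2 j k (\<lambda>j. z j q) * ((G k q \<bullet> b) * (F j q \<bullet> b)))"
        by (simp add: sum_distrib_right mult.assoc)
      also have "\<dots> = (\<Sum>k\<in>I. \<Sum>b\<in>Basis. E2 j k (\<lambda>j. z j q) * ((G k q \<bullet> b) * (F j q \<bullet> b)))"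
        by (rule sum.swap)
      also have "\<dots> = (\<Sum>k\<in>I. E2 j k (\<lambda>j. z j q) * (G k q \<bullet> F j q))"
        by (simp add: sum_distrib_left[symmetric] euclidean_inner[symmetric])
      finally show ?thesis .
    qed
    then show "?L q = energy_integrand \<zeta> D\<zeta> E E1 E2 q" by (simp add: energy_integrand_def)
  qed
  finally show "(LINT q:K|lborel. energy_integrand \<zeta> D\<zeta> E E1 E2 q) = 0" .
  qed
qed

end

section \<open>Moments and the Euler--Poisson--Darboux system\<close>

lemma path_deriv_const: "path_deriv I X (\<lambda>w. c) (\<lambda>j w. 0)"
  by (auto simp: path_deriv_def)

lemma path_deriv_add:
  "path_deriv I X E E' \<Longrightarrow> path_deriv I X F F' \<Longrightarrow> path_deriv I X (\<lambda>w. E w + F w) (\<lambda>j w. E' j w + F' j w)"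
  unfolding path_deriv_def by (auto simp: distrib_right sum.distrib intro!: derivative_intros)

lemma path_deriv_mult:
  assumes "path_deriv I X E E'" "path_deriv I X F F'"
  shows "path_deriv I X (\<lambda>w. E w * F w) (\<lambda>j w. E' j w * F w + E w * F' j w)"
  unfolding path_deriv_def
proof (intro allI impI)
  fix w w' \<tau> assume w: "(\<forall>j\<in>I. (w j has_real_derivative w' j) (at \<tau>)) \<and> (\<lambda>j. w j \<tau>) \<in> X"
  let ?w = "\<lambda>j. w j \<tau>"
  have "((\<lambda>\<tau>. E (\<lambda>j. w j \<tau>) * F (\<lambda>j. w j \<tau>)) has_real_derivative
      (\<Sum>j\<in>I. E' j ?w * w' j) * F ?w + (\<Sum>j\<in>I. F' j ?w * w' j) * E ?w) (at \<tau>)"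
    using assms w unfolding path_deriv_def by (intro DERIV_mult) auto
  then show "((\<lambda>\<tau>. E (\<lambda>j. w j \<tau>) * F (\<lambda>j. w j \<tau>)) has_real_derivative
      (\<Sum>j\<in>I. (E' j ?w * F ?w + E ?w * F' j ?w) * w' j)) (at \<tau>)"
    by (rule DERIV_cong) (simp add: sum_distrib_right sum_distrib_left sum.distrib algebra_simps)
qed

lemma coord_cont_const: "coord_cont I X (\<lambda>w. c)"
  by (auto simp: coord_cont_def)

lemma coord_cont_add:
  assumes "coord_cont I X E" "coord_cont I X F" shows "coord_cont I X (\<lambda>w. E w + F w)"
proof -
  have "bdd_on X (\<lambda>w. E w + F w)"
    using assms by (intro bdd_on_add) (auto simp: coord_cont_def bdd_on_def)
  then show ?thesis using assms unfolding coord_cont_def bdd_on_def by (auto intro: tendsto_add)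
qed

lemma coord_cont_mult:
  assumes "coord_cont I X E" "coord_cont I X F" shows "coord_cont I X (\<lambda>w. E w * F w)"
proof -
  have "bdd_on X (\<lambda>w. E w * F w)"
    using assms by (intro bdd_on_mult) (auto simp: coord_cont_def bdd_on_def)
  then show ?thesis using assms unfolding coord_cont_def bdd_on_def by (auto intro: tendsto_mult)
qed

lemma coord_cont_uminus: "coord_cont I X E \<Longrightarrow> coord_cont I X (\<lambda>w. - E w)"
  using coord_cont_mult[OF coord_cont_const[of I X "-1"], of E] by simp

lemma coord_cont_diff: "coord_cont I X E \<Longrightarrow> coord_cont I X F \<Longrightarrow> coord_cont I X (\<lambda>w. E w - F w)"
  using coord_cont_add[OF _ coord_cont_uminus, of I X E F] by simp

lemma coord_cont_prod:
  "(\<And>k. k \<in> K \<Longrightarrow> coord_cont I X (E k)) \<Longrightarrow> coord_cont I X (\<lambda>w. \<Prod>k\<in>K. E k w)"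
  by (induction K rule: infinite_finite_induct) (auto intro: coord_cont_mult coord_cont_const)

lemma coord_cont_coord: "k \<in> I \<Longrightarrow> coord_cont I (coord_box I a b) (\<lambda>w. w k)"
  unfolding coord_cont_def coord_box_def
  by (auto intro!: exI[of _ "max \<bar>a k\<bar> \<bar>b k\<bar>"] simp: abs_le_iff)

lemma coord_cont_continuous:
  assumes "k \<in> I" and f: "continuous_on {a k..b k} f"
  shows "coord_cont I (coord_box I a b) (\<lambda>w. f (w k))"
proof -
  have "bdd_on {a k..b k} f" using f by (intro bdd_on_compact) auto
  then obtain M where "\<forall>s\<in>{a k..b k}. \<bar>f s\<bar> \<le> M" unfolding bdd_on_def ..
  then have "\<forall>w\<in>coord_box I a b. \<bar>f (w k)\<bar> \<le> M"
    using assms(1) by (simp add: coord_box_def)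
  moreover have "(\<lambda>n. f (g n k)) \<longlonglongrightarrow> f (l k)"
    if "\<forall>j\<in>I. (\<lambda>n. g n j) \<longlonglongrightarrow> l j" "\<forall>n. g n \<in> coord_box I a b" "l \<in> coord_box I a b" for g l
    using that assms(1) by (intro continuous_on_tendsto_compose[OF f]) (auto simp: coord_box_def)
  ultimately show ?thesis by (auto simp: coord_cont_def)
qed

lemma twice_path_deriv_const: "twice_path_deriv I X (\<lambda>w. c) (\<lambda>j w. 0) (\<lambda>j k w. 0)"
  by (auto simp: twice_path_deriv_def intro: path_deriv_const coord_cont_const)

lemma twice_path_deriv_add:
  "twice_path_deriv I X E E1 E2 \<Longrightarrow> twice_path_deriv I X F F1 F2 \<Longrightarrow>
   twice_path_deriv I X (\<lambda>w. E w + F w) (\<lambda>j w. E1 j w + F1 j w) (\<lambda>j k w. E2 j k w + F2 j k w)"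
  by (auto simp: twice_path_deriv_def intro: path_deriv_add coord_cont_add)

lemma twice_path_deriv_mult:
  assumes "twice_path_deriv I X E E1 E2" "twice_path_deriv I X F F1 F2"
  shows "twice_path_deriv I X (\<lambda>w. E w * F w) (\<lambda>j w. E1 j w * F w + E w * F1 j w)
     (\<lambda>j k w. E2 j k w * F w + E1 j w * F1 k w + (E1 k w * F1 j w + E w * F2 j k w))"
  using assms by (auto simp: twice_path_deriv_def intro!: path_deriv_add path_deriv_mult coord_cont_add coord_cont_mult)

lemma twice_path_deriv_cmult:
  "twice_path_deriv I X E E1 E2 \<Longrightarrow> twice_path_deriv I X (\<lambda>w. c * E w) (\<lambda>j w. c * E1 j w) (\<lambda>j k w. c * E2 j k w)"
  using twice_path_deriv_mult[OF twice_path_deriv_const[of I X c], of E E1 E2] by simp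

lemma twice_path_deriv_sum:
  "(\<And>k. k \<in> K \<Longrightarrow> twice_path_deriv I X (E k) (E1 k) (E2 k)) \<Longrightarrow>
   twice_path_deriv I X (\<lambda>w. \<Sum>k\<in>K. E k w) (\<lambda>j w. \<Sum>k\<in>K. E1 k j w) (\<lambda>j l w. \<Sum>k\<in>K. E2 k j l w)"
  by (induction K rule: infinite_finite_induct) (auto intro: twice_path_deriv_const twice_path_deriv_add)

text \<open>The weight is a parameter because it carries the truncation, while the lower limit is a
  fixed point below the box. The additional factor \<open>u - s\<close> makes \<open>moment2\<close>
  an antiderivative of \<open>moment1\<close> in the upper limit.\<close>

definition moment1 :: "real \<Rightarrow> (real \<Rightarrow> real) \<Rightarrow> nat set \<Rightarrow> (nat \<Rightarrow> real) \<Rightarrow> real \<Rightarrow> real" where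
  "moment1 A \<mu> K w u = integral {A..u} (\<lambda>s. \<mu> s * (\<Prod>k\<in>K. s - w k))"

definition moment2 :: "real \<Rightarrow> (real \<Rightarrow> real) \<Rightarrow> nat set \<Rightarrow> (nat \<Rightarrow> real) \<Rightarrow> real \<Rightarrow> real" where
  "moment2 A \<mu> K w u = integral {A..u} (\<lambda>s. \<mu> s * ((u - s) * (\<Prod>k\<in>K. s - w k)))"

lemma bounded_mult_continuous_integrable_on:
  fixes \<mu> f :: "real \<Rightarrow> real"
  assumes "\<mu> \<in> borel_measurable borel" "\<And>s. \<bar>\<mu> s\<bar> \<le> 1" "continuous_on UNIV f"
  shows "(\<lambda>s. \<mu> s * f s) integrable_on {A..u}"
proof (rule measurable_bounded_by_integrable_imp_integrable_real[where g = "\<lambda>s. \<bar>f s\<bar>"])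
  have f: "f \<in> borel_measurable borel" using assms(3) by (rule borel_measurable_continuous_onI)
  then show "(\<lambda>s. \<mu> s * f s) \<in> borel_measurable (lebesgue_on {A..u})"
    using assms(1) by (intro measurable_restrict_space1 measurable_completion) auto
  show "(\<lambda>s. \<bar>f s\<bar>) integrable_on {A..u}"
    by (intro integrable_continuous_interval continuous_intros continuous_on_subset[OF assms(3)]) auto
  show "\<bar>\<mu> s * f s\<bar> \<le> \<bar>f s\<bar>" for s
    using mult_right_mono[OF assms(2)[of s], of "\<bar>f s\<bar>"] by (simp add: abs_mult)
qed auto

text \<open>Splitting off a linear factor trades it for the weight \<open>s * \<mu> s\<close>.
  Repetition exhibits the moment as a polynomial in the \<open>w k\<close> with coefficients
  depending on the upper limit only, so the fundamental theorem of calculus replaces differentiation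
  under the integral.\<close>

lemma moment1_insert_cont:
  assumes "continuous_on UNIV \<mu>" "finite K" "k \<notin> K"
  shows "moment1 A \<mu> (insert k K) w u = moment1 A (\<lambda>s. s * \<mu> s) K w u - w k * moment1 A \<mu> K w u"
proof -
  have c: "continuous_on {A..u} \<mu>" using assms(1) continuous_on_subset by blast
  have "moment1 A \<mu> (insert k K) w u
      = integral {A..u} (\<lambda>s. s * \<mu> s * (\<Prod>k\<in>K. s - w k) - w k * (\<mu> s * (\<Prod>k\<in>K. s - w k)))"
    using assms(2,3) by (simp add: moment1_def algebra_simps)
  also have "\<dots> = moment1 A (\<lambda>s. s * \<mu> s) K w u - w k * moment1 A \<mu> K w u"
    unfolding moment1_def
    by (subst integral_diff; (intro integrable_continuous_interval continuous_intros c)?) simp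
  finally show ?thesis .
qed

lemma moment2_eq_cont:
  assumes "continuous_on UNIV \<mu>"
  shows "moment2 A \<mu> K w u = u * moment1 A \<mu> K w u - moment1 A (\<lambda>s. s * \<mu> s) K w u"
proof -
  have c: "continuous_on {A..u} \<mu>" using assms(1) continuous_on_subset by blast
  have "moment2 A \<mu> K w u
      = integral {A..u} (\<lambda>s. u * (\<mu> s * (\<Prod>k\<in>K. s - w k)) - s * \<mu> s * (\<Prod>k\<in>K. s - w k))"
    by (simp add: moment2_def algebra_simps)
  also have "\<dots> = u * moment1 A \<mu> K w u - moment1 A (\<lambda>s. s * \<mu> s) K w u"
    unfolding moment1_def
    by (subst integral_diff; (intro integrable_continuous_interval continuous_intros c)?) simp
  finally show ?thesis .
qed

lemma integral_upper_DERIV: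
  fixes \<mu> :: "real \<Rightarrow> real"
  assumes "continuous_on UNIV \<mu>" "A < u"
  shows "((\<lambda>x. integral {A..x} \<mu>) has_real_derivative \<mu> u) (at u)"
proof -
  have "continuous_on {A..u + 1} \<mu>" using assms(1) by (rule continuous_on_subset) simp
  moreover have "u \<in> {A..u + 1}" using assms(2) by simp
  ultimately have "((\<lambda>x. integral {A..x} \<mu>) has_real_derivative \<mu> u) (at u within {A..u + 1})"
    by (rule integral_has_real_derivative)
  moreover have "at u within {A..u + 1} = at u" using assms(2) by (intro at_within_Icc_at) auto
  ultimately show ?thesis by simp
qed

text \<open>Induction on the number of factors, with the weight arbitrary because each step replaces
  \<open>\<mu>\<close> by \<open>s * \<mu> s\<close>.\<close>

lemma moment1_DERIV:
  assumes "finite K" "continuous_on UNIV \<mu>" "A < u \<tau>" "(u has_real_derivative u') (at \<tau>)"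
    "\<And>k. k \<in> K \<Longrightarrow> (w k has_real_derivative w' k) (at \<tau>)"
  shows "((\<lambda>\<tau>. moment1 A \<mu> K (\<lambda>k. w k \<tau>) (u \<tau>)) has_real_derivative
     \<mu> (u \<tau>) * (\<Prod>k\<in>K. u \<tau> - w k \<tau>) * u' - (\<Sum>k\<in>K. moment1 A \<mu> (K - {k}) (\<lambda>k. w k \<tau>) (u \<tau>) * w' k)) (at \<tau>)"
  using assms
proof (induction K arbitrary: \<mu> rule: finite_induct)
  case empty
  have "((\<lambda>\<tau>. integral {A..u \<tau>} \<mu>) has_real_derivative \<mu> (u \<tau>) * u') (at \<tau>)"
    by (rule DERIV_chain2[OF integral_upper_DERIV]) (use empty in auto)
  then show ?case by (simp add: moment1_def)
next
  case (insert k K)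
  let ?w = "\<lambda>k. w k \<tau>"
  have sm: "continuous_on UNIV (\<lambda>s. s * \<mu> s)" using insert.prems by (intro continuous_intros)
  have K: "l \<in> K \<Longrightarrow> insert k K - {l} = insert k (K - {l})" for l using insert.hyps by auto
  have kK: "insert k K - {k} = K" using insert.hyps by auto
  note eq = moment1_insert_cont[OF insert.prems(1)]
  have d1: "((\<lambda>\<tau>. moment1 A (\<lambda>s. s * \<mu> s) K (\<lambda>k. w k \<tau>) (u \<tau>)) has_real_derivative
     u \<tau> * \<mu> (u \<tau>) * (\<Prod>k\<in>K. u \<tau> - w k \<tau>) * u' - (\<Sum>l\<in>K. moment1 A (\<lambda>s. s * \<mu> s) (K - {l}) ?w (u \<tau>) * w' l)) (at \<tau>)"
    by (rule insert.IH) (use insert.prems sm in auto)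
  have d2: "((\<lambda>\<tau>. moment1 A \<mu> K (\<lambda>k. w k \<tau>) (u \<tau>)) has_real_derivative
     \<mu> (u \<tau>) * (\<Prod>k\<in>K. u \<tau> - w k \<tau>) * u' - (\<Sum>l\<in>K. moment1 A \<mu> (K - {l}) ?w (u \<tau>) * w' l)) (at \<tau>)"
    by (rule insert.IH) (use insert.prems in auto)
  have d3: "(w k has_real_derivative w' k) (at \<tau>)" using insert.prems by auto
  have "((\<lambda>\<tau>. moment1 A (\<lambda>s. s * \<mu> s) K (\<lambda>k. w k \<tau>) (u \<tau>) - w k \<tau> * moment1 A \<mu> K (\<lambda>k. w k \<tau>) (u \<tau>)) has_real_derivative
     (u \<tau> * \<mu> (u \<tau>) * (\<Prod>k\<in>K. u \<tau> - w k \<tau>) * u' - (\<Sum>l\<in>K. moment1 A (\<lambda>s. s * \<mu> s) (K - {l}) ?w (u \<tau>) * w' l))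
     - (w' k * moment1 A \<mu> K ?w (u \<tau>) + (\<mu> (u \<tau>) * (\<Prod>k\<in>K. u \<tau> - w k \<tau>) * u' - (\<Sum>l\<in>K. moment1 A \<mu> (K - {l}) ?w (u \<tau>) * w' l)) * w k \<tau>)) (at \<tau>)"
    by (intro DERIV_diff d1 DERIV_mult d2 d3)
  moreover have sumeq: "(\<Sum>l\<in>K. moment1 A \<mu> (insert k K - {l}) ?w (u \<tau>) * w' l)
     = (\<Sum>l\<in>K. moment1 A (\<lambda>s. s * \<mu> s) (K - {l}) ?w (u \<tau>) * w' l) - (\<Sum>l\<in>K. moment1 A \<mu> (K - {l}) ?w (u \<tau>) * w' l) * w k \<tau>"
    unfolding sum_distrib_right sum_subtractf[symmetric]
    by (intro sum.cong refl) (use insert.hyps in \<open>simp add: K eq algebra_simps\<close>)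
  ultimately show ?case
    unfolding eq[OF insert.hyps] prod.insert[OF insert.hyps] sum.insert[OF insert.hyps] kK sumeq
    by (auto elim!: DERIV_cong simp: algebra_simps)
qed

text \<open>The boundary terms of the two first moments cancel because \<open>u - s\<close> vanishes
  at the upper limit. A first derivative therefore never evaluates the weight at a point.\<close>

lemma moment2_DERIV:
  assumes "finite K" "continuous_on UNIV \<mu>" "A < u \<tau>" "(u has_real_derivative u') (at \<tau>)"
    "\<And>k. k \<in> K \<Longrightarrow> (w k has_real_derivative w' k) (at \<tau>)"
  shows "((\<lambda>\<tau>. moment2 A \<mu> K (\<lambda>k. w k \<tau>) (u \<tau>)) has_real_derivative
     moment1 A \<mu> K (\<lambda>k. w k \<tau>) (u \<tau>) * u' - (\<Sum>k\<in>K. moment2 A \<mu> (K - {k}) (\<lambda>k. w k \<tau>) (u \<tau>) * w' k)) (at \<tau>)"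
proof -
  let ?w = "\<lambda>k. w k \<tau>"
  have sm: "continuous_on UNIV (\<lambda>s. s * \<mu> s)" using assms by (intro continuous_intros)
  note eq = moment2_eq_cont[OF assms(2)]
  have "((\<lambda>\<tau>. u \<tau> * moment1 A \<mu> K (\<lambda>k. w k \<tau>) (u \<tau>) - moment1 A (\<lambda>s. s * \<mu> s) K (\<lambda>k. w k \<tau>) (u \<tau>)) has_real_derivative
     u' * moment1 A \<mu> K ?w (u \<tau>) + (\<mu> (u \<tau>) * (\<Prod>k\<in>K. u \<tau> - w k \<tau>) * u' - (\<Sum>l\<in>K. moment1 A \<mu> (K - {l}) ?w (u \<tau>) * w' l)) * u \<tau>
     - (u \<tau> * \<mu> (u \<tau>) * (\<Prod>k\<in>K. u \<tau> - w k \<tau>) * u' - (\<Sum>l\<in>K. moment1 A (\<lambda>s. s * \<mu> s) (K - {l}) ?w (u \<tau>) * w' l))) (at \<tau>)"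
    by (intro DERIV_diff DERIV_mult moment1_DERIV assms sm)
  then show ?thesis
    unfolding eq
    by (auto elim!: DERIV_cong simp: algebra_simps sum_subtractf sum_distrib_left sum_distrib_right)
qed

text \<open>Partial derivatives for \<open>i\<close> outside \<open>K\<close>: the variable
  \<open>w i\<close> enters as the upper limit only, the variables in \<open>K\<close> as roots of
  the product only.\<close>

definition dmoment1 where
  "dmoment1 i A \<mu> K k w = (if k = i then \<mu> (w i) * (\<Prod>l\<in>K. w i - w l)
     else if k \<in> K then - moment1 A \<mu> (K - {k}) w (w i) else 0)" for i k :: nat

definition dmoment2 where
  "dmoment2 i A \<mu> K k w = (if k = i then moment1 A \<mu> K w (w i)
     else if k \<in> K then - moment2 A \<mu> (K - {k}) w (w i) else 0)" for i k :: nat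

text \<open>The weight is evaluated in the entry \<open>j = k = i\<close> and nowhere
  differentiated. The formulas thus keep their meaning for a discontinuous weight, which is how the
  Heaviside weight is reached.\<close>

definition ddmoment2 where
  "ddmoment2 i A \<mu> K j k w = (if j = i then dmoment1 i A \<mu> K k w
     else if j \<in> K then - dmoment2 i A \<mu> (K - {j}) k w else 0)" for i j k :: nat

lemma sum_cases_one_set:
  fixes f :: "nat \<Rightarrow> real"
  assumes "finite I" "i \<in> I" "K \<subseteq> I - {i}"
  shows "(\<Sum>j\<in>I. (if j = i then x else if j \<in> K then f j else 0) * w j) = x * w i + (\<Sum>j\<in>K. f j * w j)"
proof -
  have "(\<Sum>j\<in>I. (if j = i then x else if j \<in> K then f j else 0) * w j)
      = x * w i + (\<Sum>j\<in>I - {i}. (if j = i then x else if j \<in> K then f j else 0) * w j)"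
    using sum.remove[OF assms(1,2), of "\<lambda>j. (if j = i then x else if j \<in> K then f j else 0) * w j"] by simp
  also have "(\<Sum>j\<in>I - {i}. (if j = i then x else if j \<in> K then f j else 0) * w j) = (\<Sum>j\<in>K. f j * w j)"
    by (rule sum.mono_neutral_cong_right) (use assms in auto)
  finally show ?thesis .
qed

lemma moment1_path_deriv:
  assumes "finite I" "i \<in> I" "K \<subseteq> I - {i}" "continuous_on UNIV \<mu>" "A < a i"
  shows "path_deriv I (coord_box I a b) (\<lambda>w. moment1 A \<mu> K w (w i)) (dmoment1 i A \<mu> K)"
  unfolding path_deriv_def dmoment1_def sum_cases_one_set[OF assms(1-3)]
proof (intro allI impI)
  fix w w' and \<tau> :: real
  assume w: "(\<forall>j\<in>I. (w j has_real_derivative w' j) (at \<tau>)) \<and> (\<lambda>j. w j \<tau>) \<in> coord_box I a b"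
  have K: "finite K" "K \<subseteq> I" using assms finite_subset by blast+
  have "A < w i \<tau>" using w assms by (force simp: coord_box_def)
  from moment1_DERIV[where u = "w i" and w = w and u' = "w' i" and w' = w', OF K(1) assms(4) this] w K assms
  show "((\<lambda>\<tau>. moment1 A \<mu> K (\<lambda>j. w j \<tau>) (w i \<tau>)) has_real_derivative
     \<mu> (w i \<tau>) * (\<Prod>l\<in>K. w i \<tau> - w l \<tau>) * w' i + (\<Sum>j\<in>K. - moment1 A \<mu> (K - {j}) (\<lambda>j. w j \<tau>) (w i \<tau>) * w' j)) (at \<tau>)"
    by (auto simp: sum_negf)
qed

lemma moment2_path_deriv:
  assumes "finite I" "i \<in> I" "K \<subseteq> I - {i}" "continuous_on UNIV \<mu>" "A < a i"
  shows "path_deriv I (coord_box I a b) (\<lambda>w. moment2 A \<mu> K w (w i)) (dmoment2 i A \<mu> K)"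
  unfolding path_deriv_def dmoment2_def sum_cases_one_set[OF assms(1-3)]
proof (intro allI impI)
  fix w w' and \<tau> :: real
  assume w: "(\<forall>j\<in>I. (w j has_real_derivative w' j) (at \<tau>)) \<and> (\<lambda>j. w j \<tau>) \<in> coord_box I a b"
  have K: "finite K" "K \<subseteq> I" using assms finite_subset by blast+
  have "A < w i \<tau>" using w assms by (force simp: coord_box_def)
  from moment2_DERIV[where u = "w i" and w = w and u' = "w' i" and w' = w', OF K(1) assms(4) this] w K assms
  show "((\<lambda>\<tau>. moment2 A \<mu> K (\<lambda>j. w j \<tau>) (w i \<tau>)) has_real_derivative
     moment1 A \<mu> K (\<lambda>j. w j \<tau>) (w i \<tau>) * w' i + (\<Sum>j\<in>K. - moment2 A \<mu> (K - {j}) (\<lambda>j. w j \<tau>) (w i \<tau>) * w' j)) (at \<tau>)"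
    by (auto simp: sum_negf)
qed

lemma moment1_coord_cont:
  assumes "finite K" "i \<in> I" "K \<subseteq> I" "continuous_on UNIV \<mu>" "A < a i"
  shows "coord_cont I (coord_box I a b) (\<lambda>w. moment1 A \<mu> K w (w i))"
  using assms
proof (induction K arbitrary: \<mu> rule: finite_induct)
  case empty
  have "continuous_on {a i..b i} (\<lambda>u. integral {A..u} \<mu>)"
  proof (intro continuous_at_imp_continuous_on ballI)
    fix u assume "u \<in> {a i..b i}"
    then show "isCont (\<lambda>u. integral {A..u} \<mu>) u"
      using empty by (intro DERIV_isCont[OF integral_upper_DERIV]) auto
  qed
  from coord_cont_continuous[where a = a and b = b and k = i, OF empty(1) this] show ?case by (simp add: moment1_def)
next
  case (insert k K)
  have "continuous_on UNIV (\<lambda>s. s * \<mu> s)" using insert.prems by (intro continuous_intros)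
  then show ?case
    unfolding moment1_insert_cont[OF insert.prems(3) insert.hyps]
    using insert by (intro coord_cont_diff coord_cont_mult coord_cont_coord) auto
qed

lemma moment2_coord_cont:
  assumes "finite K" "i \<in> I" "K \<subseteq> I" "continuous_on UNIV \<mu>" "A < a i"
  shows "coord_cont I (coord_box I a b) (\<lambda>w. moment2 A \<mu> K w (w i))"
proof -
  have "continuous_on UNIV (\<lambda>s. s * \<mu> s)" using assms by (intro continuous_intros)
  then show ?thesis
    unfolding moment2_eq_cont[OF assms(4)]
    using assms by (intro coord_cont_diff coord_cont_mult coord_cont_coord moment1_coord_cont) auto
qed

lemma dmoment2_coord_cont:
  assumes "finite I" "i \<in> I" "K \<subseteq> I - {i}" "continuous_on UNIV \<mu>" "A < a i" "k \<in> I"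
  shows "coord_cont I (coord_box I a b) (dmoment2 i A \<mu> K k)"
proof -
  have "finite (K - S)" "K - S \<subseteq> I" for S using assms finite_subset by blast+
  note * = moment1_coord_cont[where K = "K - {}" and i = i and a = a, OF this(1) assms(2) this(2) assms(4,5)]
    moment2_coord_cont[where K = "K - {k}" and i = i and a = a, OF this(1) assms(2) this(2) assms(4,5)]
  show ?thesis
    unfolding dmoment2_def using *
    by (cases "k = i"; cases "k \<in> K") (simp_all add: coord_cont_uminus coord_cont_const)
qed

lemma dmoment1_coord_cont:
  assumes "finite I" "i \<in> I" "K \<subseteq> I - {i}" "continuous_on UNIV \<mu>" "A < a i" "k \<in> I"
  shows "coord_cont I (coord_box I a b) (dmoment1 i A \<mu> K k)"
proof -
  have "finite (K - {k})" "K - {k} \<subseteq> I" using assms finite_subset by blast+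
  note * = moment1_coord_cont[where K = "K - {k}" and i = i and a = a, OF this(1) assms(2) this(2) assms(4,5)]
  have "coord_cont I (coord_box I a b) (\<lambda>w. \<mu> (w i) * (\<Prod>l\<in>K. w i - w l))"
    using assms continuous_on_subset[OF assms(4) subset_UNIV]
    by (intro coord_cont_mult coord_cont_prod coord_cont_diff coord_cont_coord coord_cont_continuous) auto
  with * show ?thesis
    unfolding dmoment1_def
    by (cases "k = i"; cases "k \<in> K") (simp_all add: coord_cont_uminus coord_cont_const)
qed

lemma moment2_twice_path_deriv:
  assumes "finite I" "i \<in> I" "K \<subseteq> I - {i}" "continuous_on UNIV \<mu>" "A < a i"
  shows "twice_path_deriv I (coord_box I a b) (\<lambda>w. moment2 A \<mu> K w (w i)) (dmoment2 i A \<mu> K) (ddmoment2 i A \<mu> K)"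
  unfolding twice_path_deriv_def
proof (intro conjI ballI)
  let ?X = "coord_box I a b"
  have K: "finite K" "K \<subseteq> I" "\<And>j. K - {j} \<subseteq> I - {i}" using assms finite_subset by blast+
  show "path_deriv I ?X (\<lambda>w. moment2 A \<mu> K w (w i)) (dmoment2 i A \<mu> K)"
    by (rule moment2_path_deriv) fact+
  show "coord_cont I ?X (\<lambda>w. moment2 A \<mu> K w (w i))"
    by (rule moment2_coord_cont) fact+
  fix j assume j: "j \<in> I"
  show "coord_cont I ?X (dmoment2 i A \<mu> K j)"
    by (rule dmoment2_coord_cont) fact+
  have n1: "path_deriv I ?X (\<lambda>w. - 1 * moment2 A \<mu> (K - {j}) w (w i))
      (\<lambda>k w. 0 * moment2 A \<mu> (K - {j}) w (w i) + - 1 * dmoment2 i A \<mu> (K - {j}) k w)"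
    by (intro path_deriv_mult path_deriv_const moment2_path_deriv assms K)
  consider "j = i" | "j \<noteq> i" "j \<in> K" | "j \<noteq> i" "j \<notin> K" by blast
  then show "path_deriv I ?X (dmoment2 i A \<mu> K j) (ddmoment2 i A \<mu> K j)"
  proof cases
    case 1
    then show ?thesis using moment1_path_deriv[where i = i and a = a, OF assms] by (simp add: dmoment2_def[abs_def] ddmoment2_def[abs_def])
  next
    case 2
    then show ?thesis using n1
      by (simp add: dmoment2_def[of i A \<mu> K j, abs_def] ddmoment2_def[abs_def])
  next
    case 3
    then show ?thesis using path_deriv_const[of I ?X 0] by (simp add: dmoment2_def[abs_def] ddmoment2_def[abs_def])
  qed
  fix k assume k: "k \<in> I"
  show "coord_cont I ?X (ddmoment2 i A \<mu> K j k)"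
    using dmoment1_coord_cont[where i = i and a = a, OF assms k] coord_cont_uminus[OF dmoment2_coord_cont[where i = i and a = a and K = "K - {j}", OF assms(1,2) K(3) assms(4,5) k]]
    unfolding ddmoment2_def[abs_def]
    by (cases "j = i"; cases "j \<in> K") (simp_all add: coord_cont_const)
qed

lemma ddmoment2_sym: "ddmoment2 i A \<mu> K j k w = ddmoment2 i A \<mu> K k j w"
proof -
  have "K - {j} - {k} = K - {k} - {j}" by auto
  then show ?thesis by (auto simp: ddmoment2_def dmoment1_def dmoment2_def)
qed

lemma moment_integrable:
  fixes \<mu> :: "real \<Rightarrow> real"
  assumes "\<mu> \<in> borel_measurable borel" "\<And>s. \<bar>\<mu> s\<bar> \<le> 1"
  shows "(\<lambda>s. \<mu> s * (\<Prod>k\<in>K. s - w k)) integrable_on {A..u}"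
    "(\<lambda>s. \<mu> s * ((u - s) * (\<Prod>k\<in>K. s - w k))) integrable_on {A..u}"
  by (rule bounded_mult_continuous_integrable_on; (rule assms | intro continuous_intros))+

text \<open>The moments solve the Euler--Poisson--Darboux system \<open>E\<^sub>j\<^sub>k + (E\<^sub>j - E\<^sub>k) / (w\<^sub>j - w\<^sub>k) = 0\<close>
  because \<open>\<Prod>\<^sub>k (s - w\<^sub>k)\<close> does so for every \<open>s\<close>.\<close>

lemma Euler_Poisson_Darboux:
  fixes \<mu> :: "real \<Rightarrow> real"
  assumes \<mu>: "\<mu> \<in> borel_measurable borel" "\<And>s. \<bar>\<mu> s\<bar> \<le> 1" and fin: "finite I" and i: "i \<in> I"
    and jk: "j \<in> I" "k \<in> I" "j \<noteq> k" "w j \<noteq> w k"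
  defines "K \<equiv> I - {i}"
  shows "ddmoment2 i A \<mu> K j k w + (dmoment2 i A \<mu> K j w - dmoment2 i A \<mu> K k w) / (w j - w k) = 0"
proof -
  note int = moment_integrable[OF \<mu>]
  \<comment> \<open>Under the integral this is \<open>(s - w k) + (u - s) = u - w k\<close>, times
    the remaining factors. It settles the pairs that contain the index \<open>i\<close>.\<close>
  have m1: "moment1 A \<mu> K w u + moment2 A \<mu> (K - {k}) w u = (u - w k) * moment1 A \<mu> (K - {k}) w u"
    if "k \<in> K" for k u
  proof -
    have "finite (K - {k})" using fin by (simp add: K_def)
    then have p: "(\<Prod>l\<in>K. s - w l) = (s - w k) * (\<Prod>l\<in>K - {k}. s - w l)" for s
      using that by (metis insert_Diff prod.insert_remove Diff_idemp)
    have "moment1 A \<mu> K w u + moment2 A \<mu> (K - {k}) w u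
        = integral {A..u} (\<lambda>s. \<mu> s * (\<Prod>l\<in>K. s - w l) + \<mu> s * ((u - s) * (\<Prod>l\<in>K - {k}. s - w l)))"
      unfolding moment1_def moment2_def by (rule integral_add[symmetric]; rule int)
    also have "\<dots> = (u - w k) * moment1 A \<mu> (K - {k}) w u"
      unfolding moment1_def integral_mult_right[symmetric] p by (simp add: algebra_simps)
    finally show ?thesis .
  qed
  \<comment> \<open>Under the integral this is \<open>(s - w k) - (s - w j) = w j - w k\<close>,
    times the remaining factors, for two indices different from \<open>i\<close>.\<close>
  have m2: "moment2 A \<mu> (K - {j}) w u - moment2 A \<mu> (K - {k}) w u = (w j - w k) * moment2 A \<mu> (K - {j} - {k}) w u"
    if "j \<in> K" "k \<in> K" "j \<noteq> k" for j k u
  proof -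
    have f: "finite (K - {j} - {k})" using fin by (simp add: K_def)
    have "K - {j} = insert k (K - {j} - {k})" "K - {k} = insert j (K - {j} - {k})"
      using that by auto
    then have p: "(\<Prod>l\<in>K - {j}. s - w l) = (s - w k) * (\<Prod>l\<in>K - {j} - {k}. s - w l)"
      "(\<Prod>l\<in>K - {k}. s - w l) = (s - w j) * (\<Prod>l\<in>K - {j} - {k}. s - w l)" for s
      using f by (metis prod.insert Diff_iff singletonI)+
    have "moment2 A \<mu> (K - {j}) w u - moment2 A \<mu> (K - {k}) w u
        = integral {A..u} (\<lambda>s. \<mu> s * ((u - s) * (\<Prod>l\<in>K - {j}. s - w l)) - \<mu> s * ((u - s) * (\<Prod>l\<in>K - {k}. s - w l)))"
      unfolding moment2_def by (rule integral_diff[symmetric]; rule int)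
    also have "\<dots> = (w j - w k) * moment2 A \<mu> (K - {j} - {k}) w u"
      unfolding moment2_def integral_mult_right[symmetric] p by (simp add: algebra_simps)
    finally show ?thesis .
  qed
  have w: "w j - w k \<noteq> 0" using jk by simp
  have c: "K - {k} - {j} = K - {j} - {k}" by auto
  consider "j = i" | "k = i" | "j \<in> K" "k \<in> K" "j \<noteq> i" "k \<noteq> i" using jk by (auto simp: K_def)
  then show ?thesis
  proof cases
    case 1
    then have "k \<in> K" "k \<noteq> i" using jk by (auto simp: K_def)
    then show ?thesis using 1 w m1[of k "w i"]
      by (simp add: ddmoment2_def dmoment1_def dmoment2_def divide_simps)
  next
    case 2
    then have "j \<in> K" "j \<noteq> i" using jk by (auto simp: K_def)
    then show ?thesis using 2 w m1[of j "w i"]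
      by (simp add: ddmoment2_def dmoment1_def dmoment2_def divide_simps) (simp add: algebra_simps)
  next
    case 3
    then show ?thesis using w jk m2[of j k "w i"]
      by (simp add: ddmoment2_def dmoment1_def dmoment2_def divide_simps) (simp add: algebra_simps)
  qed
qed

section \<open>Heaviside weights and their ramp approximations\<close>

definition heaviside :: "real \<Rightarrow> real \<Rightarrow> real" where
  "heaviside \<kappa> s = (if s > \<kappa> then 1 else 0)"

text \<open>The ramps vanish up to and including \<open>\<kappa>\<close>, so they converge to
  \<open>heaviside\<close> at every point, the jump included. This matters because second
  derivatives evaluate the weight at \<open>w i\<close>, and a root may equal
  \<open>\<kappa>\<close> on a set of positive measure.\<close>

definition ramp :: "real \<Rightarrow> nat \<Rightarrow> real \<Rightarrow> real" where
  "ramp \<kappa> n s = min 1 (max 0 (real n * (s - \<kappa>)))"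

lemma heaviside_measurable: "heaviside \<kappa> \<in> borel_measurable borel"
  unfolding heaviside_def by measurable

lemma heaviside_bound: "\<bar>heaviside \<kappa> s\<bar> \<le> 1" "0 \<le> heaviside \<kappa> s"
  by (auto simp: heaviside_def)

lemma ramp_cont: "continuous_on S (ramp \<kappa> n)"
  unfolding ramp_def by (intro continuous_intros)

lemma ramp_measurable: "ramp \<kappa> n \<in> borel_measurable borel"
  by (rule borel_measurable_continuous_onI[OF ramp_cont])

lemma ramp_bound: "\<bar>ramp \<kappa> n s\<bar> \<le> 1"
  by (auto simp: ramp_def)

lemma ramp_tendsto: "(\<lambda>n. ramp \<kappa> n s) \<longlonglongrightarrow> heaviside \<kappa> s"
proof (cases "s > \<kappa>")
  case True
  obtain N where N: "real N * (s - \<kappa>) > 1"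
    using reals_Archimedean3[of "s - \<kappa>"] True by auto
  have "ramp \<kappa> n s = 1" if "n \<ge> N" for n
  proof -
    have "real N * (s - \<kappa>) \<le> real n * (s - \<kappa>)" using that True by (intro mult_right_mono) auto
    then show ?thesis using N by (simp add: ramp_def)
  qed
  then show ?thesis
    using True by (intro tendsto_eventually) (auto simp: eventually_sequentially heaviside_def)
next
  case False
  then have "real n * (s - \<kappa>) \<le> 0" for n by (simp add: mult_nonneg_nonpos)
  then have "ramp \<kappa> n s = 0" for n by (simp add: ramp_def)
  then show ?thesis using False by (simp add: heaviside_def)
qed

text \<open>These values identify the moments with empty product as \<open>r\<close> and half of
  \<open>r\<^sup>2\<close>.\<close>

lemma integral_heaviside:
  assumes "A \<le> \<kappa>" "A \<le> u"
  shows "integral {A..u} (heaviside \<kappa>) = max 0 (u - \<kappa>)"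
    "integral {A..u} (\<lambda>s. heaviside \<kappa> s * (u - s)) = (max 0 (u - \<kappa>))\<^sup>2 / 2"
proof -
  have *: "(f has_integral v) {A..u}" if "u \<le> \<kappa>" "\<And>s. s \<in> {A..u} \<Longrightarrow> f s = 0" "v = 0" for f :: "real \<Rightarrow> real" and v
    using has_integral_is_0[of "{A..u}" f] that by simp
  have **: "((\<lambda>s. heaviside \<kappa> s * f s) has_integral v) {A..u}"
    if "\<kappa> < u" "(f has_integral v) {\<kappa>..u}" for f :: "real \<Rightarrow> real" and v
  proof -
    have "((\<lambda>s. heaviside \<kappa> s * f s) has_integral 0) {A..\<kappa>}"
      using has_integral_is_0[of "{A..\<kappa>}" "\<lambda>s. heaviside \<kappa> s * f s"] by (simp add: heaviside_def)
    moreover have "((\<lambda>s. heaviside \<kappa> s * f s) has_integral v) {\<kappa>..u}"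
      by (rule has_integral_spike_interior[where f = f and a = \<kappa> and b = u, unfolded cbox_interval box_real])
         (use that in \<open>auto simp: heaviside_def\<close>)
    ultimately show ?thesis
      using has_integral_combine[of A \<kappa> u _ 0 v] assms that by simp
  qed
  show "integral {A..u} (heaviside \<kappa>) = max 0 (u - \<kappa>)"
  proof (cases "\<kappa> < u")
    case True
    have "((\<lambda>s. 1) has_integral (u - \<kappa>)) {\<kappa>..u}"
      using has_integral_const_real[of "1::real" \<kappa> u] True by simp
    from **[OF True this] show ?thesis using True by (simp add: integral_unique)
  next
    case False
    then show ?thesis using *[of "heaviside \<kappa>" 0] by (simp add: integral_unique heaviside_def)
  qed
  show "integral {A..u} (\<lambda>s. heaviside \<kappa> s * (u - s)) = (max 0 (u - \<kappa>))\<^sup>2 / 2"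
  proof (cases "\<kappa> < u")
    case True
    have "((\<lambda>s. u - s) has_integral (- ((u - u)\<^sup>2 / 2) - - ((u - \<kappa>)\<^sup>2 / 2))) {\<kappa>..u}"
      using True
      by (intro fundamental_theorem_of_calculus)
         (auto simp: has_real_derivative_iff_has_vector_derivative[symmetric] intro!: derivative_eq_intros simp: field_simps)
    then have "((\<lambda>s. u - s) has_integral (u - \<kappa>)\<^sup>2 / 2) {\<kappa>..u}" by simp
    from **[OF True this] show ?thesis using True by (simp add: integral_unique)
  next
    case False
    then show ?thesis using *[of "\<lambda>s. heaviside \<kappa> s * (u - s)" 0] by (simp add: integral_unique heaviside_def)
  qed
qed

lemma moment_bounds:
  fixes \<mu> :: "real \<Rightarrow> real"
  assumes \<mu>: "\<mu> \<in> borel_measurable borel" "\<And>s. \<bar>\<mu> s\<bar> \<le> 1" "\<And>s. 0 \<le> \<mu> s"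
    and W: "\<And>s. s \<in> {A..u} \<Longrightarrow> \<bar>\<Prod>k\<in>K. s - w k\<bar> \<le> W"
  shows "\<bar>moment1 A \<mu> K w u\<bar> \<le> W * integral {A..u} \<mu>"
    "\<bar>moment2 A \<mu> K w u\<bar> \<le> W * integral {A..u} (\<lambda>s. \<mu> s * (u - s))"
    "(\<And>s. s \<in> {A..u} \<Longrightarrow> w0 \<le> c * (\<Prod>k\<in>K. s - w k)) \<Longrightarrow>
      w0 * integral {A..u} (\<lambda>s. \<mu> s * (u - s)) \<le> c * moment2 A \<mu> K w u"
proof -
  have i1: "\<mu> integrable_on {A..u}"
    using bounded_mult_continuous_integrable_on[of \<mu> "\<lambda>_. 1"] \<mu> by simp
  have i2: "(\<lambda>s. \<mu> s * (u - s)) integrable_on {A..u}"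
    by (rule bounded_mult_continuous_integrable_on) (use \<mu> in \<open>auto intro!: continuous_intros\<close>)
  note int = moment_integrable[of \<mu>, OF \<mu>(1,2)]
  have "norm (moment1 A \<mu> K w u) \<le> integral {A..u} (\<lambda>s. W * \<mu> s)"
    unfolding moment1_def
  proof (rule integral_norm_bound_integral[OF int(1)])
    show "norm (\<mu> s * (\<Prod>k\<in>K. s - w k)) \<le> W * \<mu> s" if "s \<in> {A..u}" for s
      using mult_left_mono[OF W[OF that] \<mu>(3)[of s]] \<mu>(3)[of s] by (simp add: abs_mult mult.commute)
  qed (use i1 in \<open>simp add: integrable_on_mult_right\<close>)
  then show "\<bar>moment1 A \<mu> K w u\<bar> \<le> W * integral {A..u} \<mu>" by simp
  have "norm (moment2 A \<mu> K w u) \<le> integral {A..u} (\<lambda>s. W * (\<mu> s * (u - s)))"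
    unfolding moment2_def
  proof (rule integral_norm_bound_integral[OF int(2)])
    show "norm (\<mu> s * ((u - s) * (\<Prod>k\<in>K. s - w k))) \<le> W * (\<mu> s * (u - s))" if "s \<in> {A..u}" for s
    proof -
      have "0 \<le> \<mu> s * (u - s)" using \<mu>(3)[of s] that by simp
      from mult_left_mono[OF W[OF that] this] this that \<mu>(3)[of s] show ?thesis
        by (simp add: abs_mult mult_ac)
    qed
  qed (use i2 in \<open>simp add: integrable_on_mult_right\<close>)
  then show "\<bar>moment2 A \<mu> K w u\<bar> \<le> W * integral {A..u} (\<lambda>s. \<mu> s * (u - s))" by simp
  assume w0: "\<And>s. s \<in> {A..u} \<Longrightarrow> w0 \<le> c * (\<Prod>k\<in>K. s - w k)"
  have "integral {A..u} (\<lambda>s. w0 * (\<mu> s * (u - s))) \<le> integral {A..u} (\<lambda>s. c * (\<mu> s * ((u - s) * (\<Prod>k\<in>K. s - w k))))"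
  proof (rule integral_le)
    show "w0 * (\<mu> s * (u - s)) \<le> c * (\<mu> s * ((u - s) * (\<Prod>k\<in>K. s - w k)))" if "s \<in> {A..u}" for s
    proof -
      have "0 \<le> \<mu> s * (u - s)" using \<mu>(3)[of s] that by simp
      from mult_right_mono[OF w0[OF that] this] show ?thesis by (simp add: mult_ac)
    qed
  qed (use integrable_on_mult_right[OF i2] integrable_on_mult_right[OF int(2)] in blast)+
  then show "w0 * integral {A..u} (\<lambda>s. \<mu> s * (u - s)) \<le> c * moment2 A \<mu> K w u"
    by (simp add: moment2_def)
qed

section \<open>The quadratic form of the system\<close>

lemma sum_offdiag_swap:
  fixes Y :: "nat \<Rightarrow> nat \<Rightarrow> real"
  assumes "finite I"
  shows "(\<Sum>j\<in>I. \<Sum>k\<in>I - {j}. Y j k) = (\<Sum>j\<in>I. \<Sum>k\<in>I - {j}. Y k j)"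
proof -
  have *: "(\<Sum>k\<in>I - {j}. Z k) = (\<Sum>k\<in>I. if k = j then 0 else Z k)" for j and Z :: "nat \<Rightarrow> real"
    by (rule sum.mono_neutral_cong_left) (use assms in auto)
  show ?thesis unfolding * by (subst sum.swap) (simp add: eq_commute)
qed

lemma sum_offdiag_cross:
  fixes N :: "nat \<Rightarrow> nat \<Rightarrow> real"
  assumes "finite I" "i \<in> I" "\<And>j k. j \<in> I \<Longrightarrow> k \<in> I \<Longrightarrow> j \<noteq> k \<Longrightarrow> j \<noteq> i \<Longrightarrow> k \<noteq> i \<Longrightarrow> N j k = 0"
  shows "(\<Sum>j\<in>I. \<Sum>k\<in>I - {j}. N j k) = (\<Sum>k\<in>I - {i}. N i k + N k i)"
proof -
  have "(\<Sum>k\<in>I - {j}. N j k) = N j i" if "j \<in> I - {i}" for j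
  proof -
    have "(\<Sum>k\<in>I - {j}. N j k) = N j i + (\<Sum>k\<in>I - {j} - {i}. N j k)"
      using assms that by (intro sum.remove) auto
    then show ?thesis using assms(3) that by (simp add: sum.neutral)
  qed
  then have "(\<Sum>j\<in>I. \<Sum>k\<in>I - {j}. N j k) = (\<Sum>k\<in>I - {i}. N i k) + (\<Sum>j\<in>I - {i}. N j i)"
    using sum.remove[OF assms(1,2), of "\<lambda>j. \<Sum>k\<in>I - {j}. N j k"] by simp
  then show ?thesis by (simp add: sum.distrib)
qed

text \<open>The reaction coefficient is antisymmetric in \<open>j\<close> and \<open>k\<close>, so
  adding the two orders of a pair produces the difference \<open>e1 j - e1 k\<close>; symmetry of
  \<open>e2\<close> turns the single mobilities into \<open>\<alpha> j + \<alpha> k\<close>. The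
  common factor is then the Euler--Poisson--Darboux expression.\<close>

lemma quadratic_form_symmetrize:
  fixes G :: "nat \<Rightarrow> 'a::euclidean_space" and \<alpha> e1 w :: "nat \<Rightarrow> real"
  assumes fin: "finite I" and sym: "\<And>j k. e2 j k = e2 k j"
  shows "(\<Sum>j\<in>I. e1 j * (\<Sum>k\<in>I - {j}. (\<alpha> j + \<alpha> k) / (w j - w k) * (G j \<bullet> G k)))
      + (\<Sum>j\<in>I. \<Sum>k\<in>I. e2 j k * (G k \<bullet> (\<alpha> j *\<^sub>R G j)))
    = (\<Sum>j\<in>I. \<alpha> j * e2 j j * (norm (G j))\<^sup>2)
      + (1 / 2) * (\<Sum>j\<in>I. \<Sum>k\<in>I - {j}. (\<alpha> j + \<alpha> k) * (e2 j k + (e1 j - e1 k) / (w j - w k)) * (G j \<bullet> G k))"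
proof -
  define Y where "Y j k = e1 j * ((\<alpha> j + \<alpha> k) / (w j - w k) * (G j \<bullet> G k)) + e2 j k * (G k \<bullet> (\<alpha> j *\<^sub>R G j))" for j k
  have YY: "Y j k + Y k j = (\<alpha> j + \<alpha> k) * (e2 j k + (e1 j - e1 k) / (w j - w k)) * (G j \<bullet> G k)" for j k
  \<comment> \<open>If the two values coincide, the quotients are zero by convention on both sides
    and the identity persists.\<close>
  proof (cases "w j = w k")
    case True
    then show ?thesis by (simp add: Y_def sym[of k j] inner_commute algebra_simps)
  next
    case False
    then have "w j - w k \<noteq> 0" "w k - w j \<noteq> 0" by auto
    then show ?thesis unfolding Y_def sym[of k j] inner_commute[of "G k"]
      by (simp add: divide_simps) (simp add: algebra_simps inner_commute)
  qed
  have "(\<Sum>j\<in>I. e1 j * (\<Sum>k\<in>I - {j}. (\<alpha> j + \<alpha> k) / (w j - w k) * (G j \<bullet> G k)))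
      + (\<Sum>j\<in>I. \<Sum>k\<in>I. e2 j k * (G k \<bullet> (\<alpha> j *\<^sub>R G j)))
    = (\<Sum>j\<in>I. \<alpha> j * e2 j j * (norm (G j))\<^sup>2) + (\<Sum>j\<in>I. \<Sum>k\<in>I - {j}. Y j k)"
    unfolding sum.distrib[symmetric]
  proof (rule sum.cong[OF refl])
    fix j assume "j \<in> I"
    then have "(\<Sum>k\<in>I. e2 j k * (G k \<bullet> (\<alpha> j *\<^sub>R G j)))
        = e2 j j * (G j \<bullet> (\<alpha> j *\<^sub>R G j)) + (\<Sum>k\<in>I - {j}. e2 j k * (G k \<bullet> (\<alpha> j *\<^sub>R G j)))"
      using fin by (intro sum.remove)
    then show "e1 j * (\<Sum>k\<in>I - {j}. (\<alpha> j + \<alpha> k) / (w j - w k) * (G j \<bullet> G k)) + (\<Sum>k\<in>I. e2 j k * (G k \<bullet> (\<alpha> j *\<^sub>R G j)))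
        = \<alpha> j * e2 j j * (norm (G j))\<^sup>2 + (\<Sum>k\<in>I - {j}. Y j k)"
      by (simp add: Y_def sum.distrib sum_distrib_left power2_norm_eq_inner algebra_simps)
  qed
  moreover have "(\<Sum>j\<in>I. \<Sum>k\<in>I - {j}. Y j k) = (1 / 2) * (\<Sum>j\<in>I. \<Sum>k\<in>I - {j}. Y j k + Y k j)"
    using sum_offdiag_swap[OF fin, of Y] by (simp add: sum.distrib)
  ultimately show ?thesis by (simp only: YY)
qed

section \<open>Coercive energies\<close>

text \<open>Intervals are at least \<open>2 * \<delta>\<close> apart. Descending by
  \<open>\<delta>\<close> from an interval to \<open>base\<close> still leaves distance
  \<open>\<delta>\<close> to all the others, so the integrals can start strictly below the box while
  the product keeps its sign.\<close>

locale separated_box =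
  fixes I :: "nat set" and a b :: "nat \<Rightarrow> real" and \<delta> :: real
  assumes fin: "finite I" and ab: "\<And>j. j \<in> I \<Longrightarrow> a j \<le> b j" and \<delta>: "\<delta> > 0"
    and sep: "\<And>j k. j \<in> I \<Longrightarrow> k \<in> I \<Longrightarrow> j \<noteq> k \<Longrightarrow> b j + 2 * \<delta> \<le> a k \<or> b k + 2 * \<delta> \<le> a j"
begin

abbreviation "X \<equiv> coord_box I a b"

definition "base k = a k - \<delta>"

text \<open>On the box, \<open>sg k\<close> is the sign of \<open>\<Prod>\<^bsub>l \<noteq> k\<^esub> (w\<^sub>k - w\<^sub>l)\<close>; it makes the weight of the \<open>k\<close>-th moment positive.\<close>

definition "sg k = (\<Prod>l\<in>I - {k}. if b l < a k then 1 else - 1 :: real)"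

definition "w0 = \<delta> ^ (card I - 1)"

definition "R = 1 + \<delta> + 2 * (\<Sum>l\<in>I. \<bar>a l\<bar> + \<bar>b l\<bar>)"

definition "W = R ^ card I"

lemma w0_pos: "w0 > 0" using \<delta> by (simp add: w0_def)

lemma R_ge_1: "R \<ge> 1" using \<delta> by (simp add: R_def sum_nonneg)

lemma W_ge_1: "W \<ge> 1" using R_ge_1 by (simp add: W_def)

lemma base_less: "base k < a k" using \<delta> by (simp add: base_def)

lemma X_D: "w \<in> X \<Longrightarrow> j \<in> I \<Longrightarrow> a j \<le> w j" "w \<in> X \<Longrightarrow> j \<in> I \<Longrightarrow> w j \<le> b j"
  by (auto simp: coord_box_def)

lemma X_sep:
  assumes "w \<in> X" "j \<in> I" "k \<in> I" "j \<noteq> k" shows "\<bar>w j - w k\<bar> \<ge> 2 * \<delta>"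
  using sep[OF assms(2-4)] X_D[OF assms(1,2)] X_D[OF assms(1,3)] by arith

lemma bound_l: assumes "l \<in> I" shows "2 * (\<bar>a l\<bar> + \<bar>b l\<bar>) \<le> R - 1 - \<delta>"
  using member_le_sum[OF assms _ fin, of "\<lambda>l. \<bar>a l\<bar> + \<bar>b l\<bar>"] by (simp add: R_def)

text \<open>As \<open>s\<close> lies above \<open>a k - \<delta>\<close> and the gaps have length at
  least \<open>2 * \<delta>\<close>, each factor \<open>s - w l\<close> has a fixed sign and modulus
  at least \<open>\<delta>\<close>; \<open>sg\<close> collects the signs.\<close>

lemma prod_lower:
  assumes "k \<in> I" "w \<in> X" "base k \<le> s" "s \<le> b k"
  shows "w0 \<le> sg k * (\<Prod>l\<in>I - {k}. s - w l)"
proof -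
  have "w0 = (\<Prod>l\<in>I - {k}. \<delta>)" using fin assms by (simp add: w0_def)
  also have "\<dots> \<le> (\<Prod>l\<in>I - {k}. (if b l < a k then 1 else - 1) * (s - w l))"
  proof (rule prod_mono)
    fix l assume l: "l \<in> I - {k}"
    then show "0 \<le> \<delta> \<and> \<delta> \<le> (if b l < a k then 1 else - 1) * (s - w l)"
      using sep[of l k] X_D[OF assms(2), of l] ab[of k] ab[of l] assms \<delta> by (auto simp: base_def)
  qed
  also have "\<dots> = sg k * (\<Prod>l\<in>I - {k}. s - w l)" by (simp add: sg_def prod.distrib)
  finally show ?thesis .
qed

lemma abs_sg: "\<bar>sg k\<bar> = 1"
proof -
  have "\<bar>sg k\<bar> = (\<Prod>l\<in>I - {k}. 1)" unfolding sg_def abs_prod by (rule prod.cong) auto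
  then show ?thesis by simp
qed

lemma prod_upper:
  assumes "i \<in> I" "w \<in> X" "base i \<le> s" "s \<le> b i" "S \<subseteq> I"
  shows "\<bar>\<Prod>l\<in>S. s - w l\<bar> \<le> W"
proof -
  have "\<bar>s - w l\<bar> \<le> R" if "l \<in> S" for l
  proof -
    have l: "l \<in> I" using that assms by auto
    have "\<bar>s\<bar> \<le> \<bar>a i\<bar> + \<bar>b i\<bar> + \<delta>" using assms(3,4) \<delta> unfolding base_def by arith
    moreover have "\<bar>w l\<bar> \<le> \<bar>a l\<bar> + \<bar>b l\<bar>" using X_D[OF assms(2) l] by arith
    ultimately show ?thesis
      using bound_l[OF l] bound_l[OF assms(1)] abs_triangle_ineq4[of s "w l"] by argo
  qed
  then have "\<bar>\<Prod>l\<in>S. s - w l\<bar> \<le> (\<Prod>l\<in>S. R)"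
    unfolding abs_prod by (intro prod_mono) auto
  also have "\<dots> = R ^ card S" by simp
  also have "\<dots> \<le> W" unfolding W_def using R_ge_1 card_mono[OF fin assms(5)] by (intro power_increasing)
  finally show ?thesis .
qed

text \<open>With weight one the \<open>k\<close>-th moment has second derivative at least
  \<open>w0\<close> in \<open>w k\<close> on the whole box and is affine in each other variable. The
  sum solves the Euler--Poisson--Darboux system, is affine in \<open>w i\<close>, and is uniformly
  convex in each other variable separately.\<close>

definition "T i w = (\<Sum>k\<in>I - {i}. sg k * moment2 (base k) (\<lambda>_. 1) (I - {k}) w (w k))"
definition "T1 i j w = (\<Sum>k\<in>I - {i}. sg k * dmoment2 k (base k) (\<lambda>_. 1) (I - {k}) j w)"
definition "T2 i j l w = (\<Sum>k\<in>I - {i}. sg k * ddmoment2 k (base k) (\<lambda>_. 1) (I - {k}) j l w)"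

lemma T_twice: "i \<in> I \<Longrightarrow> twice_path_deriv I X (T i) (T1 i) (T2 i)"
  unfolding T_def[abs_def] T1_def[abs_def] T2_def[abs_def]
  by (intro twice_path_deriv_sum twice_path_deriv_cmult moment2_twice_path_deriv fin base_less) auto

text \<open>For \<open>\<mu>\<close> the Heaviside function at \<open>\<kappa>\<close>, the factor \<open>2 * moment2 (base i) \<mu> {} w (w i)\<close> is \<open>r\<^sup>2\<close>.\<close>

definition "en i \<epsilon> \<mu> w = sg i * moment2 (base i) \<mu> (I - {i}) w (w i)
  + \<epsilon> * (2 * moment2 (base i) \<mu> {} w (w i) * T i w)"

definition "en1 i \<epsilon> \<mu> j w = sg i * dmoment2 i (base i) \<mu> (I - {i}) j w
  + \<epsilon> * (2 * dmoment2 i (base i) \<mu> {} j w * T i w + 2 * moment2 (base i) \<mu> {} w (w i) * T1 i j w)"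

definition "en2 i \<epsilon> \<mu> j k w = sg i * ddmoment2 i (base i) \<mu> (I - {i}) j k w
  + \<epsilon> * (2 * ddmoment2 i (base i) \<mu> {} j k w * T i w + 2 * dmoment2 i (base i) \<mu> {} j w * T1 i k w
     + (2 * dmoment2 i (base i) \<mu> {} k w * T1 i j w + 2 * moment2 (base i) \<mu> {} w (w i) * T2 i j k w))"

lemma en_twice:
  assumes "i \<in> I" "continuous_on UNIV \<mu>"
  shows "twice_path_deriv I X (en i \<epsilon> \<mu>) (en1 i \<epsilon> \<mu>) (en2 i \<epsilon> \<mu>)"
  unfolding en_def[abs_def] en1_def[abs_def] en2_def[abs_def]
  by (intro twice_path_deriv_add twice_path_deriv_cmult twice_path_deriv_mult T_twice moment2_twice_path_deriv
      fin base_less assms) auto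

lemma T_EPD:
  assumes "i \<in> I" "w \<in> X" "j \<in> I" "k \<in> I" "j \<noteq> k"
  shows "T2 i j k w + (T1 i j w - T1 i k w) / (w j - w k) = 0"
proof -
  have "w j \<noteq> w k" using X_sep[OF assms(2-5)] \<delta> by auto
  then have "(\<Sum>l\<in>I - {i}. sg l * (ddmoment2 l (base l) (\<lambda>_. 1) (I - {l}) j k w
      + (dmoment2 l (base l) (\<lambda>_. 1) (I - {l}) j w - dmoment2 l (base l) (\<lambda>_. 1) (I - {l}) k w) / (w j - w k))) = 0"
    using assms fin by (intro sum.neutral ballI) (simp add: Euler_Poisson_Darboux)
  then show ?thesis
    by (simp add: T1_def T2_def distrib_left sum.distrib right_diff_distrib sum_subtractf sum_divide_distrib[symmetric]
        times_divide_eq_right[symmetric] del: times_divide_eq_right)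
       (simp add: sum_subtractf sum_divide_distrib diff_divide_distrib right_diff_distrib)
qed

lemma en2_sym: "en2 i \<epsilon> \<mu> j k w = en2 i \<epsilon> \<mu> k j w"
proof -
  have "T2 i j k w = T2 i k j w" by (simp add: T2_def ddmoment2_sym)
  then show ?thesis unfolding en2_def
    by (simp add: ddmoment2_sym[of i "base i" \<mu> _ j k] algebra_simps)
qed

text \<open>The Euler--Poisson--Darboux operator has second order and does not respect products.
  Both factors of the form "solution" drop out; what is left comes from the derivative of
  \<open>r\<^sup>2\<close>, which multiplies \<open>T1\<close> through the product rule and
  \<open>T\<close> through the difference quotient.\<close>

lemma en_EPD:
  fixes \<mu> :: "real \<Rightarrow> real"
  assumes \<mu>: "\<mu> \<in> borel_measurable borel" "\<And>s. \<bar>\<mu> s\<bar> \<le> 1"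
    and "i \<in> I" "w \<in> X" "j \<in> I" "k \<in> I" "j \<noteq> k"
  shows "en2 i \<epsilon> \<mu> j k w + (en1 i \<epsilon> \<mu> j w - en1 i \<epsilon> \<mu> k w) / (w j - w k)
    = 2 * \<epsilon> * (dmoment2 i (base i) \<mu> {} j w * (T1 i k w + T i w / (w j - w k))
       + dmoment2 i (base i) \<mu> {} k w * (T1 i j w - T i w / (w j - w k)))"
proof -
  have w: "w j \<noteq> w k" using X_sep[OF assms(4-7)] \<delta> by auto
  then have w': "w j - w k \<noteq> 0" by simp
  have f2: "ddmoment2 i (base i) \<mu> {} j k w = 0"
    using assms(7) by (auto simp: ddmoment2_def dmoment1_def)
  let ?f1 = "\<lambda>j. dmoment2 i (base i) \<mu> {} j w" and ?f = "moment2 (base i) \<mu> {} w (w i)"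
  have "en2 i \<epsilon> \<mu> j k w + (en1 i \<epsilon> \<mu> j w - en1 i \<epsilon> \<mu> k w) / (w j - w k)
    = sg i * (ddmoment2 i (base i) \<mu> (I - {i}) j k w
        + (dmoment2 i (base i) \<mu> (I - {i}) j w - dmoment2 i (base i) \<mu> (I - {i}) k w) / (w j - w k))
      + 2 * \<epsilon> * ?f * (T2 i j k w + (T1 i j w - T1 i k w) / (w j - w k))
      + 2 * \<epsilon> * (?f1 j * (T1 i k w + T i w / (w j - w k)) + ?f1 k * (T1 i j w - T i w / (w j - w k)))"
    unfolding en2_def en1_def f2 using w' by (simp add: divide_simps) (simp add: algebra_simps)
  then show ?thesis
    using T_EPD[OF assms(3-7)] Euler_Poisson_Darboux[OF \<mu> fin assms(3,5,6,7) w] by simp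
qed

lemma T_nonneg:
  assumes "w \<in> X" shows "0 \<le> T i w"
  unfolding T_def
proof (rule sum_nonneg)
  fix k assume k: "k \<in> I - {i}"
  have "0 * integral {base k..w k} (\<lambda>s. 1 * (w k - s)) \<le> sg k * moment2 (base k) (\<lambda>_. 1) (I - {k}) w (w k)"
  proof (rule moment_bounds(3)[where W = W])
    fix s assume s: "s \<in> {base k..w k}"
    have s': "base k \<le> s" "s \<le> b k" using s X_D[OF assms, of k] k by auto
    show "\<bar>\<Prod>k\<in>I - {k}. s - w k\<bar> \<le> W"
      by (rule prod_upper[OF _ assms s']) (use k in auto)
    show "0 \<le> sg k * (\<Prod>k\<in>I - {k}. s - w k)"
      using prod_lower[OF _ assms s'] k w0_pos by auto
  qed auto
  then show "0 \<le> sg k * moment2 (base k) (\<lambda>_. 1) (I - {k}) w (w k)" by simp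
qed

lemma T_bounds:
  obtains C where "C \<ge> 1" "\<And>i w. i \<in> I \<Longrightarrow> w \<in> X \<Longrightarrow> \<bar>T i w\<bar> \<le> C"
    "\<And>i j w. i \<in> I \<Longrightarrow> j \<in> I \<Longrightarrow> w \<in> X \<Longrightarrow> \<bar>T1 i j w\<bar> \<le> C"
proof -
  have "\<forall>i\<in>I. \<exists>C. \<forall>w\<in>X. \<bar>T i w\<bar> \<le> C" "\<forall>i\<in>I. \<forall>j\<in>I. \<exists>C. \<forall>w\<in>X. \<bar>T1 i j w\<bar> \<le> C"
    using T_twice by (auto simp: twice_path_deriv_def coord_cont_def)
  then obtain C0 C1 where C: "\<And>i w. i \<in> I \<Longrightarrow> w \<in> X \<Longrightarrow> \<bar>T i w\<bar> \<le> C0 i"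
      "\<And>i j w. i \<in> I \<Longrightarrow> j \<in> I \<Longrightarrow> w \<in> X \<Longrightarrow> \<bar>T1 i j w\<bar> \<le> C1 i j"
    by metis
  let ?C = "1 + (\<Sum>i\<in>I. \<bar>C0 i\<bar>) + (\<Sum>i\<in>I. \<Sum>j\<in>I. \<bar>C1 i j\<bar>)"
  have n: "0 \<le> (\<Sum>i\<in>I. \<bar>C0 i\<bar>)" "0 \<le> (\<Sum>i\<in>I. \<Sum>j\<in>I. \<bar>C1 i j\<bar>)" by (auto intro: sum_nonneg)
  show ?thesis
  proof (rule that[of ?C])
    show "?C \<ge> 1" using n by simp
    fix i w assume i: "i \<in> I" "w \<in> X"
    show "\<bar>T i w\<bar> \<le> ?C"
      using C(1)[OF i] member_le_sum[OF i(1) _ fin, of "\<lambda>i. \<bar>C0 i\<bar>"] n(2) by simp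
    fix j assume j: "j \<in> I"
    show "\<bar>T1 i j w\<bar> \<le> ?C"
    proof -
      have "\<bar>C1 i j\<bar> \<le> (\<Sum>j\<in>I. \<bar>C1 i j\<bar>)"
        by (rule member_le_sum[OF j _ fin]) simp
      also have "\<dots> \<le> (\<Sum>i\<in>I. \<Sum>j\<in>I. \<bar>C1 i j\<bar>)"
        by (rule member_le_sum[OF i(1) _ fin]) (simp add: sum_nonneg)
      finally show ?thesis using C(2)[OF i(1) j i(2)] n(1) by linarith
    qed
  qed
qed

lemma T2_diag:
  assumes "i \<in> I" "w \<in> X"
  shows "T2 i i i w = 0" "k \<in> I - {i} \<Longrightarrow> w0 \<le> T2 i k k w"
proof -
  have z: "ddmoment2 k (base k) (\<lambda>_. 1) (I - {k}) l l w = 0" if "l \<noteq> k" for k l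
    using that by (simp add: ddmoment2_def dmoment2_def)
  show "T2 i i i w = 0" unfolding T2_def by (rule sum.neutral) (use z in auto)
  assume k: "k \<in> I - {i}"
  have "T2 i k k w = sg k * ddmoment2 k (base k) (\<lambda>_. 1) (I - {k}) k k w"
    unfolding T2_def using fin k z by (subst sum.remove[of _ k]) (auto intro!: sum.neutral)
  also have "\<dots> = sg k * (\<Prod>l\<in>I - {k}. w k - w l)" by (simp add: ddmoment2_def dmoment1_def)
  also have "\<dots> \<ge> w0"
    using k X_D[OF assms(2), of k] base_less[of k] by (intro prod_lower assms) auto
  finally show "w0 \<le> T2 i k k w" .
qed

context
  fixes i :: nat and \<kappa> :: real and w :: "nat \<Rightarrow> real"
  assumes i: "i \<in> I" and \<kappa>: "\<kappa> \<in> {a i..b i}" and w: "w \<in> X"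
begin

abbreviation (input) "H \<equiv> heaviside \<kappa>"
abbreviation (input) "r \<equiv> max 0 (w i - \<kappa>)"

lemma base_le: "base i \<le> \<kappa>" "base i \<le> w i"
  using \<kappa> base_less[of i] X_D[OF w i] by auto

lemma r_le: "r \<le> R"
  using \<kappa> X_D[OF w i] bound_l[OF i] \<delta> by auto

lemma moment_empty: "moment1 (base i) H {} w (w i) = r" "2 * moment2 (base i) H {} w (w i) = r\<^sup>2"
  using integral_heaviside[OF base_le] by (simp_all add: moment1_def moment2_def)

lemma moment_upper:
  assumes "S \<subseteq> I"
  shows "\<bar>moment1 (base i) H S w (w i)\<bar> \<le> W * r" "\<bar>moment2 (base i) H S w (w i)\<bar> \<le> W * r\<^sup>2"
proof -
  have p: "\<bar>\<Prod>k\<in>S. s - w k\<bar> \<le> W" if "s \<in> {base i..w i}" for s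
    using that X_D[OF w i] by (intro prod_upper[OF i w] assms) auto
  show "\<bar>moment1 (base i) H S w (w i)\<bar> \<le> W * r"
    using moment_bounds(1)[where A = "base i" and u = "w i" and K = S and w = w and \<mu> = H, OF heaviside_measurable heaviside_bound p] integral_heaviside[OF base_le] by simp
  have "\<bar>moment2 (base i) H S w (w i)\<bar> \<le> W * (r\<^sup>2 / 2)"
    using moment_bounds(2)[where A = "base i" and u = "w i" and K = S and w = w and \<mu> = H, OF heaviside_measurable heaviside_bound p] integral_heaviside[OF base_le] by simp
  also have "\<dots> \<le> W * r\<^sup>2" using W_ge_1 by (intro mult_left_mono) auto
  finally show "\<bar>moment2 (base i) H S w (w i)\<bar> \<le> W * r\<^sup>2" .
qed

lemma moment_lower: "w0 * (r\<^sup>2 / 2) \<le> sg i * moment2 (base i) H (I - {i}) w (w i)"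
proof -
  have "w0 * integral {base i..w i} (\<lambda>s. H s * (w i - s)) \<le> sg i * moment2 (base i) H (I - {i}) w (w i)"
    using X_D[OF w i]
    by (intro moment_bounds(3)[OF heaviside_measurable heaviside_bound prod_upper[OF i w]] prod_lower[OF i w]) auto
  then show ?thesis using integral_heaviside[OF base_le] by simp
qed

lemma en_lower:
  assumes "\<epsilon> \<ge> 0" shows "w0 / 2 * r\<^sup>2 \<le> en i \<epsilon> H w"
proof -
  have "0 \<le> \<epsilon> * (r\<^sup>2 * T i w)" using assms T_nonneg[OF w, of i] by simp
  then show ?thesis unfolding en_def moment_empty using moment_lower by simp
qed

text \<open>The orders in \<open>r\<close> matter: linear in direction \<open>i\<close>, quadratic
  in the others. They match the dissipation, which controls \<open>\<nabla>z\<^sub>i\<close> without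
  weight where \<open>r > 0\<close> but the other gradients only together with a factor
  \<open>r\<close>.\<close>

lemma en_upper:
  assumes C: "\<And>w. w \<in> X \<Longrightarrow> \<bar>T i w\<bar> \<le> C" "\<And>j w. j \<in> I \<Longrightarrow> w \<in> X \<Longrightarrow> \<bar>T1 i j w\<bar> \<le> C" and \<epsilon>: "0 \<le> \<epsilon>" "\<epsilon> \<le> 1"
  shows "en i \<epsilon> H w \<le> (W + C) * r\<^sup>2" "\<bar>en1 i \<epsilon> H i w\<bar> \<le> (W + 2 * C + R * C) * r"
    "j \<in> I \<Longrightarrow> j \<noteq> i \<Longrightarrow> \<bar>en1 i \<epsilon> H j w\<bar> \<le> (W + C) * r\<^sup>2"
proof -
  have le1: "\<bar>\<epsilon> * x\<bar> \<le> \<bar>x\<bar>" for x :: real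
    using mult_right_mono[OF \<epsilon>(2), of "\<bar>x\<bar>"] \<epsilon> by (simp add: abs_mult)
  have sg1: "\<bar>sg i * x\<bar> = \<bar>x\<bar>" for x using abs_sg[of i] by (simp add: abs_mult)
  have C0: "C \<ge> 0" using C(1)[OF w] by simp
  have tr: "\<bar>sg i * x + \<epsilon> * y\<bar> \<le> \<bar>x\<bar> + \<bar>y\<bar>" for x y
    using abs_triangle_ineq[of "sg i * x" "\<epsilon> * y"] le1[of y] sg1[of x] by linarith
  have rT: "\<bar>r\<^sup>2 * x\<bar> \<le> C * r\<^sup>2" if "\<bar>x\<bar> \<le> C" for x
    using mult_left_mono[OF that, of "r\<^sup>2"] by (simp add: abs_mult mult.commute)
  have "\<bar>en i \<epsilon> H w\<bar> \<le> \<bar>moment2 (base i) H (I - {i}) w (w i)\<bar> + \<bar>r\<^sup>2 * T i w\<bar>"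
    unfolding en_def moment_empty by (rule tr)
  also have "\<dots> \<le> W * r\<^sup>2 + C * r\<^sup>2"
    by (intro add_mono moment_upper(2) rT C(1) w) auto
  finally show "en i \<epsilon> H w \<le> (W + C) * r\<^sup>2" by (simp add: distrib_right)
  have "\<bar>en1 i \<epsilon> H i w\<bar> \<le> \<bar>moment1 (base i) H (I - {i}) w (w i)\<bar> + \<bar>2 * r * T i w + r\<^sup>2 * T1 i i w\<bar>"
    unfolding en1_def moment_empty using tr by (simp add: dmoment2_def moment_empty)
  also have "\<dots> \<le> W * r + (2 * r * C + R * r * C)"
  proof (intro add_mono moment_upper(1) order_trans[OF abs_triangle_ineq])
    show "\<bar>2 * r * T i w\<bar> \<le> 2 * r * C" using mult_left_mono[OF C(1)[OF w], of "2 * r"] by (simp add: abs_mult)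
    have "\<bar>r\<^sup>2 * T1 i i w\<bar> \<le> C * (r * r)" using rT[OF C(2)[OF i w]] by (simp add: power2_eq_square)
    also have "\<dots> \<le> C * (R * r)" using r_le C0 by (intro mult_left_mono mult_right_mono) auto
    finally show "\<bar>r\<^sup>2 * T1 i i w\<bar> \<le> R * r * C" by (simp add: mult_ac)
  qed auto
  finally show "\<bar>en1 i \<epsilon> H i w\<bar> \<le> (W + 2 * C + R * C) * r" by (simp add: algebra_simps)
  assume j: "j \<in> I" "j \<noteq> i"
  have "\<bar>en1 i \<epsilon> H j w\<bar> \<le> \<bar>moment2 (base i) H (I - {i} - {j}) w (w i)\<bar> + \<bar>r\<^sup>2 * T1 i j w\<bar>"
    unfolding en1_def moment_empty
    using tr[of "- moment2 (base i) H (I - {i} - {j}) w (w i)"] j by (simp add: dmoment2_def)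
  also have "\<dots> \<le> W * r\<^sup>2 + C * r\<^sup>2"
    by (intro add_mono moment_upper(2) rT C(2) w j) auto
  finally show "\<bar>en1 i \<epsilon> H j w\<bar> \<le> (W + C) * r\<^sup>2" by (simp add: distrib_right)
qed

text \<open>The main moment is affine in \<open>w k\<close> and \<open>r\<^sup>2\<close> does not
  contain \<open>w k\<close>, so only the second derivative of \<open>T\<close> survives.\<close>

lemma en2_diag_other:
  assumes "k \<in> I - {i}" "\<epsilon> \<ge> 0" shows "\<epsilon> * r\<^sup>2 * w0 \<le> en2 i \<epsilon> H k k w"
proof -
  have "en2 i \<epsilon> H k k w = \<epsilon> * (r\<^sup>2 * T2 i k k w)"
    unfolding en2_def using assms
    by (simp add: ddmoment2_def dmoment2_def moment_empty)
  moreover have "r\<^sup>2 * w0 \<le> r\<^sup>2 * T2 i k k w"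
    by (intro mult_left_mono T2_diag(2)[OF i w assms(1)]) simp
  ultimately show ?thesis using assms(2) by (simp add: mult_left_mono mult.assoc)
qed

text \<open>Above the level the main moment contributes at least \<open>w0\<close> and
  \<open>2 \<epsilon> T\<close> is nonnegative; the smallness of \<open>\<epsilon>\<close> pays for
  the mixed term \<open>4 \<epsilon> r T1\<close>. At and below the level everything vanishes, in
  agreement with the value zero of the Heaviside weight at its jump.\<close>

lemma en2_diag_self:
  assumes C: "\<bar>T1 i i w\<bar> \<le> C" and \<epsilon>: "\<epsilon> \<ge> 0" "4 * \<epsilon> * R * C \<le> w0 / 2"
  shows "w0 / 2 * H (w i) \<le> en2 i \<epsilon> H i i w"
proof (cases "w i > \<kappa>")
  case True
  have C0: "C \<ge> 0" using C by linarith
  have "en2 i \<epsilon> H i i w = sg i * (\<Prod>l\<in>I - {i}. w i - w l) + \<epsilon> * (2 * T i w + 4 * (r * T1 i i w))"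
    unfolding en2_def using True T2_diag(1)[OF i w]
    by (simp add: ddmoment2_def dmoment1_def dmoment2_def moment_empty heaviside_def algebra_simps)
  moreover have "w0 \<le> sg i * (\<Prod>l\<in>I - {i}. w i - w l)"
    using X_D[OF w i] base_less[of i] by (intro prod_lower i w) auto
  moreover have "- (4 * \<epsilon> * R * C) \<le> \<epsilon> * (2 * T i w + 4 * (r * T1 i i w))"
  proof -
    have "\<bar>r * T1 i i w\<bar> \<le> R * C"
      using r_le C unfolding abs_mult by (intro mult_mono) auto
    then have "- (4 * (R * C)) \<le> 2 * T i w + 4 * (r * T1 i i w)"
      using T_nonneg[OF w, of i] by linarith
    from mult_left_mono[OF this \<epsilon>(1)] show ?thesis by (simp add: mult_ac)
  qed
  ultimately show ?thesis using \<epsilon>(2) True by (simp add: heaviside_def)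
next
  case False
  then have "en2 i \<epsilon> H i i w = 0"
    unfolding en2_def
    by (simp add: ddmoment2_def dmoment1_def dmoment2_def moment_empty heaviside_def T2_diag(1)[OF i w])
  then show ?thesis using False by (simp add: heaviside_def)
qed

text \<open>The derivative of \<open>r\<^sup>2\<close> is \<open>2 * r\<close> in direction
  \<open>i\<close> and zero in the others. The gap \<open>2 * \<delta>\<close> controls the quotient
  \<open>T / (w j - w k)\<close>.\<close>

lemma en_cross:
  assumes C: "\<bar>T i w\<bar> \<le> C" "\<And>k. k \<in> I \<Longrightarrow> \<bar>T1 i k w\<bar> \<le> C" and \<epsilon>: "\<epsilon> \<ge> 0"
    and jk: "j \<in> I" "k \<in> I" "j \<noteq> k"
  defines "M \<equiv> en2 i \<epsilon> H j k w + (en1 i \<epsilon> H j w - en1 i \<epsilon> H k w) / (w j - w k)"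
  shows "j \<noteq> i \<Longrightarrow> k \<noteq> i \<Longrightarrow> M = 0" "j = i \<or> k = i \<Longrightarrow> \<bar>M\<bar> \<le> 2 * \<epsilon> * r * (C * (1 + 1 / (2 * \<delta>)))"
proof -
  note M = en_EPD[OF heaviside_measurable heaviside_bound(1) i w jk, of \<epsilon> \<kappa>]
  show "j \<noteq> i \<Longrightarrow> k \<noteq> i \<Longrightarrow> M = 0"
    unfolding M_def M by (simp add: dmoment2_def)
  have q: "\<bar>T i w / (w j - w k)\<bar> \<le> C * (1 / (2 * \<delta>))"
  proof -
    have "\<bar>T i w / (w j - w k)\<bar> \<le> C / (2 * \<delta>)"
      unfolding abs_divide using C(1) X_sep[OF w jk] \<delta> by (intro frac_le) auto
    then show ?thesis by simp
  qed
  have b: "\<bar>2 * \<epsilon> * (r * x)\<bar> \<le> 2 * \<epsilon> * r * (C * (1 + 1 / (2 * \<delta>)))" if "\<bar>x\<bar> \<le> C * (1 + 1 / (2 * \<delta>))" for x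
    using mult_left_mono[OF that, of "2 * \<epsilon> * r"] \<epsilon> by (simp add: abs_mult mult_ac)
  have x: "\<bar>T1 i k w + T i w / (w j - w k)\<bar> \<le> C * (1 + 1 / (2 * \<delta>))" "\<bar>T1 i j w - T i w / (w j - w k)\<bar> \<le> C * (1 + 1 / (2 * \<delta>))"
    using C(2)[OF jk(1)] C(2)[OF jk(2)] q unfolding distrib_left by linarith+
  assume "j = i \<or> k = i"
  then consider "j = i" "k \<noteq> i" | "k = i" "j \<noteq> i" using jk by auto
  then show "\<bar>M\<bar> \<le> 2 * \<epsilon> * r * (C * (1 + 1 / (2 * \<delta>)))"
    unfolding M_def M by cases (use b[OF x(1)] b[OF x(2)] in \<open>simp_all add: dmoment2_def moment_empty\<close>)
qed

end

end

lemma Young: "(t::real) > 0 \<Longrightarrow> 2 * (x * y) \<le> t * x\<^sup>2 + y\<^sup>2 / t"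
proof -
  assume t: "t > 0"
  have "0 \<le> (t * x - y)\<^sup>2 / t" using t by simp
  also have "\<dots> = t * x\<^sup>2 + y\<^sup>2 / t - 2 * (x * y)"
    using t by (simp add: power2_eq_square field_simps)
  finally show ?thesis by simp
qed

context separated_box
begin

text \<open>The cross terms have size \<open>\<epsilon> r\<close>, while the diagonal offers sizes
  \<open>1\<close> and \<open>\<epsilon> r\<^sup>2\<close>, whose geometric mean is \<open>r\<close>
  times the square root of \<open>\<epsilon>\<close>. For small \<open>\<epsilon>\<close> this mean
  dominates. All constants depend only on the box and the bounds \<open>\<alpha>0\<close>,
  \<open>\<alpha>1\<close>.\<close>

lemma energy_coercive:
  assumes \<alpha>0: "0 < \<alpha>0" and \<alpha>1: "0 \<le> \<alpha>1"
  obtains c C \<epsilon> where "c > 0" "C > 0" "\<epsilon> > 0"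
    "\<And>i \<kappa> w. i \<in> I \<Longrightarrow> \<kappa> \<in> {a i..b i} \<Longrightarrow> w \<in> X \<Longrightarrow> c * (max 0 (w i - \<kappa>))\<^sup>2 \<le> en i \<epsilon> (heaviside \<kappa>) w"
    "\<And>i \<kappa> w. i \<in> I \<Longrightarrow> \<kappa> \<in> {a i..b i} \<Longrightarrow> w \<in> X \<Longrightarrow> en i \<epsilon> (heaviside \<kappa>) w \<le> C * (max 0 (w i - \<kappa>))\<^sup>2"
    "\<And>i \<kappa> w \<alpha> G. i \<in> I \<Longrightarrow> \<kappa> \<in> {a i..b i} \<Longrightarrow> w \<in> X \<Longrightarrow> (\<And>j. j \<in> I \<Longrightarrow> \<alpha>0 \<le> \<alpha> j \<and> \<alpha> j \<le> \<alpha>1) \<Longrightarrow>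
      c * (heaviside \<kappa> (w i) * (norm (G i :: 'a::euclidean_space))\<^sup>2 + \<epsilon> * (max 0 (w i - \<kappa>))\<^sup>2 * (\<Sum>k\<in>I - {i}. (norm (G k))\<^sup>2))
      \<le> (\<Sum>j\<in>I. en1 i \<epsilon> (heaviside \<kappa>) j w * (\<Sum>k\<in>I - {j}. (\<alpha> j + \<alpha> k) / (w j - w k) * (G j \<bullet> G k)))
        + (\<Sum>j\<in>I. \<Sum>k\<in>I. en2 i \<epsilon> (heaviside \<kappa>) j k w * (G k \<bullet> (\<alpha> j *\<^sub>R G j)))"
    "\<And>i \<kappa> w \<alpha> G \<eta> v. i \<in> I \<Longrightarrow> \<kappa> \<in> {a i..b i} \<Longrightarrow> w \<in> X \<Longrightarrow> (\<And>j. j \<in> I \<Longrightarrow> \<alpha>0 \<le> \<alpha> j \<and> \<alpha> j \<le> \<alpha>1) \<Longrightarrow>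
      2 * \<eta> * \<bar>\<Sum>j\<in>I. en1 i \<epsilon> (heaviside \<kappa>) j w * ((\<alpha> j *\<^sub>R G j) \<bullet> (v :: 'a))\<bar>
      \<le> c / 2 * (\<eta>\<^sup>2 * (heaviside \<kappa> (w i) * (norm (G i))\<^sup>2 + \<epsilon> * (max 0 (w i - \<kappa>))\<^sup>2 * (\<Sum>k\<in>I - {i}. (norm (G k))\<^sup>2)))
        + C * ((max 0 (w i - \<kappa>))\<^sup>2 * (norm v)\<^sup>2)"
    "\<And>i \<kappa> w j. i \<in> I \<Longrightarrow> \<kappa> \<in> {a i..b i} \<Longrightarrow> w \<in> X \<Longrightarrow> j \<in> I \<Longrightarrow> \<bar>en1 i \<epsilon> (heaviside \<kappa>) j w\<bar> \<le> C"
proof -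
  obtain CT where CT: "CT \<ge> 1" "\<And>i w. i \<in> I \<Longrightarrow> w \<in> X \<Longrightarrow> \<bar>T i w\<bar> \<le> CT"
    "\<And>i j w. i \<in> I \<Longrightarrow> j \<in> I \<Longrightarrow> w \<in> X \<Longrightarrow> \<bar>T1 i j w\<bar> \<le> CT"
    by (rule T_bounds) blast
  define D where "D = CT * (1 + 1 / (2 * \<delta>))"
  have D: "D \<ge> 0" using CT(1) \<delta> by (simp add: D_def)
  \<comment> \<open>A sum of two mobilities is at most \<open>2 * \<alpha>1\<close> and a mixed
    coefficient at most \<open>2 * \<epsilon> * r * D\<close>; \<open>P\<close> is the product of
    these bounds without \<open>\<epsilon> * r\<close>.\<close>
  define P where "P = 4 * \<alpha>1 * D"
  have P: "P \<ge> 0" using \<alpha>1 D by (simp add: P_def)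
  \<comment> \<open>Has to lie below both the lower bound \<open>w0 / 2\<close> of the energy and
    the part \<open>\<alpha>0 * w0 / 4\<close> of the diagonal that survives the cross
    terms.\<close>
  define c where "c = min \<alpha>0 1 * w0 / 4"
  \<comment> \<open>One bound each for the upper estimates of the energy, for the second derivative
    in direction \<open>i\<close>, and for the absorption of the cross terms. The added one keeps
    the last denominator positive.\<close>
  define \<epsilon> where "\<epsilon> = Min {1, w0 / (8 * R * CT), (\<alpha>0 * w0)\<^sup>2 / (2 * (P\<^sup>2 * card I + 1))}"
  have dpos: "0 < 2 * (P\<^sup>2 * real (card I) + 1)" by (simp add: add_nonneg_pos)
  have \<epsilon>: "\<epsilon> > 0" "\<epsilon> \<le> 1" "\<epsilon> \<le> w0 / (8 * R * CT)" "\<epsilon> \<le> (\<alpha>0 * w0)\<^sup>2 / (2 * (P\<^sup>2 * card I + 1))"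
    using w0_pos R_ge_1 CT(1) \<alpha>0 dpos by (simp_all add: \<epsilon>_def)
  have \<epsilon>2: "4 * \<epsilon> * R * CT \<le> w0 / 2"
    using \<epsilon>(3) R_ge_1 CT(1) by (simp add: field_simps)
  have \<epsilon>3: "2 * \<epsilon> * (P\<^sup>2 * card I) \<le> (\<alpha>0 * w0)\<^sup>2"
  proof -
    have "2 * \<epsilon> * (P\<^sup>2 * card I) \<le> \<epsilon> * (2 * (P\<^sup>2 * card I + 1))" using \<epsilon>(1) by (simp add: algebra_simps)
    also have "\<dots> \<le> (\<alpha>0 * w0)\<^sup>2" using \<epsilon>(4) dpos by (simp add: pos_le_divide_eq)
    finally show ?thesis .
  qed
  have c: "c > 0" using \<alpha>0 w0_pos by (simp add: c_def)
  define Ce where "Ce = W + 2 * CT + R * CT"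
  have RC: "0 \<le> R * CT" using R_ge_1 CT(1) by simp
  then have Ce: "Ce \<ge> 1" unfolding Ce_def using W_ge_1 CT(1) by linarith
  \<comment> \<open>The summands serve in turn the bound on \<open>en1\<close>, the upper bound on
    the energy, and the remainders of Young's inequality in the cutoff term.\<close>
  define C where "C = Ce * R\<^sup>2 + Ce + (2 / c + card I * (2 / (c * \<epsilon>))) * (\<alpha>1 * Ce)\<^sup>2"
  have Cnn: "0 \<le> (2 / c + card I * (2 / (c * \<epsilon>))) * (\<alpha>1 * Ce)\<^sup>2" using c \<epsilon>(1) by simp
  have R2: "1 \<le> R\<^sup>2" using R_ge_1 by simp
  have CeR: "Ce \<le> Ce * R\<^sup>2" using mult_left_mono[OF R2, of Ce] Ce by simp
  have C_ge: "Ce * R\<^sup>2 \<le> C" "Ce \<le> C" "(2 / c + card I * (2 / (c * \<epsilon>))) * (\<alpha>1 * Ce)\<^sup>2 \<le> C"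
    using Cnn Ce CeR by (simp_all add: C_def)
  have c_le: "c \<le> \<alpha>0 * w0 / 4" "c \<le> w0 / 2"
    using w0_pos mult_right_mono[of "min \<alpha>0 1" \<alpha>0 w0] mult_right_mono[of "min \<alpha>0 1" 1 w0] by (auto simp: c_def)
  show ?thesis
  proof (rule that[of c C \<epsilon>])
    show "c > 0" "\<epsilon> > 0" by fact+
    show "C > 0" using C_ge Ce by linarith
    fix i \<kappa> w assume i: "i \<in> I" and \<kappa>: "\<kappa> \<in> {a i..b i}" and w: "w \<in> X"
    let ?H = "heaviside \<kappa>" and ?r = "max 0 (w i - \<kappa>)"
    have up: "en i \<epsilon> ?H w \<le> (W + CT) * ?r\<^sup>2" "\<bar>en1 i \<epsilon> ?H i w\<bar> \<le> (W + 2 * CT + R * CT) * ?r"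
      "\<And>j. j \<in> I \<Longrightarrow> j \<noteq> i \<Longrightarrow> \<bar>en1 i \<epsilon> ?H j w\<bar> \<le> (W + CT) * ?r\<^sup>2"
      by (intro en_upper[OF i \<kappa> w] CT(2,3) less_imp_le[OF \<epsilon>(1)] \<epsilon>(2) i; assumption)+
    have r: "0 \<le> ?r" "?r \<le> R" using r_le[OF i \<kappa> w] by auto
    have r2: "?r\<^sup>2 \<le> R\<^sup>2" using r by (rule power_mono[rotated])
    have H2: "(?H (w i))\<^sup>2 = ?H (w i)" by (simp add: heaviside_def)
    have en1_i: "\<bar>en1 i \<epsilon> ?H i w\<bar> \<le> Ce * ?r" using up(2) by (simp add: Ce_def)
    have en1_j: "\<bar>en1 i \<epsilon> ?H j w\<bar> \<le> Ce * ?r\<^sup>2" if "j \<in> I" "j \<noteq> i" for j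
    proof -
      have "W + CT \<le> Ce" using CT(1) RC unfolding Ce_def by linarith
      then have "(W + CT) * ?r\<^sup>2 \<le> Ce * ?r\<^sup>2" by (intro mult_right_mono) auto
      then show ?thesis using up(3)[OF that] by linarith
    qed
    have "c * ?r\<^sup>2 \<le> w0 / 2 * ?r\<^sup>2" using c_le(2) by (intro mult_right_mono) auto
    then show "c * ?r\<^sup>2 \<le> en i \<epsilon> ?H w"
      using en_lower[OF i \<kappa> w less_imp_le[OF \<epsilon>(1)]] by linarith
    have "W + CT \<le> C" using C_ge(2) CT(1) RC unfolding Ce_def by linarith
    then have "(W + CT) * ?r\<^sup>2 \<le> C * ?r\<^sup>2" by (intro mult_right_mono) auto
    then show "en i \<epsilon> ?H w \<le> C * ?r\<^sup>2" using up(1) by linarith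
    {
      fix j assume j: "j \<in> I"
      show "\<bar>en1 i \<epsilon> ?H j w\<bar> \<le> C"
      proof (cases "j = i")
        case True
        have "Ce * ?r \<le> Ce * R\<^sup>2"
          using r R_ge_1 Ce by (intro mult_left_mono) (auto simp: power2_eq_square intro: order_trans[of _ R])
        then show ?thesis using en1_i C_ge(1) unfolding True by linarith
      next
        case False
        have "Ce * ?r\<^sup>2 \<le> Ce * R\<^sup>2" using r2 Ce by (intro mult_left_mono) auto
        then show ?thesis using en1_j[OF j False] C_ge(1) by linarith
      qed
    }
    fix \<alpha> :: "nat \<Rightarrow> real" and G :: "nat \<Rightarrow> 'a" assume \<alpha>: "\<And>j. j \<in> I \<Longrightarrow> \<alpha>0 \<le> \<alpha> j \<and> \<alpha> j \<le> \<alpha>1"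
    define S where "S = (\<Sum>k\<in>I - {i}. (norm (G k))\<^sup>2)"
    have S0: "S \<ge> 0" by (simp add: S_def sum_nonneg)
    let ?e1 = "\<lambda>j. en1 i \<epsilon> ?H j w" and ?e2 = "\<lambda>j k. en2 i \<epsilon> ?H j k w"
    let ?M = "\<lambda>j k. ?e2 j k + (?e1 j - ?e1 k) / (w j - w k)"
    let ?N = "\<lambda>j k. (\<alpha> j + \<alpha> k) * ?M j k * (G j \<bullet> G k)"
    have card: "real (card (I - {i})) \<le> real (card I)" using fin by (simp add: card_mono)
    show "c * (?H (w i) * (norm (G i))\<^sup>2 + \<epsilon> * ?r\<^sup>2 * (\<Sum>k\<in>I - {i}. (norm (G k))\<^sup>2))
      \<le> (\<Sum>j\<in>I. ?e1 j * (\<Sum>k\<in>I - {j}. (\<alpha> j + \<alpha> k) / (w j - w k) * (G j \<bullet> G k)))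
        + (\<Sum>j\<in>I. \<Sum>k\<in>I. ?e2 j k * (G k \<bullet> (\<alpha> j *\<^sub>R G j)))"
    proof -
      have cross: "j \<noteq> i \<Longrightarrow> k \<noteq> i \<Longrightarrow> ?M j k = 0"
        "j = i \<or> k = i \<Longrightarrow> \<bar>?M j k\<bar> \<le> 2 * \<epsilon> * ?r * D"
        if "j \<in> I" "k \<in> I" "j \<noteq> k" for j k
        using en_cross[where C = CT and j = j and k = k, OF i \<kappa> w CT(2)[OF i w] CT(3)[OF i _ w] less_imp_le[OF \<epsilon>(1)] that]
        unfolding D_def by blast+
      have diag_i: "\<alpha>0 * (w0 / 2 * ?H (w i)) * (norm (G i))\<^sup>2 \<le> \<alpha> i * ?e2 i i * (norm (G i))\<^sup>2"
        using en2_diag_self[OF i \<kappa> w CT(3)[OF i i w] less_imp_le[OF \<epsilon>(1)] \<epsilon>2] \<alpha>[OF i] w0_pos \<alpha>0 heaviside_bound(2)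
        by (intro mult_right_mono mult_mono) auto
      have diag_k: "\<alpha>0 * (\<epsilon> * ?r\<^sup>2 * w0) * (norm (G k))\<^sup>2 \<le> \<alpha> k * ?e2 k k * (norm (G k))\<^sup>2" if "k \<in> I - {i}" for k
        using en2_diag_other[OF i \<kappa> w that less_imp_le[OF \<epsilon>(1)]] \<alpha>[of k] that w0_pos \<alpha>0 \<epsilon>(1)
        by (intro mult_right_mono mult_mono) auto
      have N: "\<bar>?N j k\<bar> \<le> \<epsilon> / 2 * (\<alpha>0 * w0 * (?r\<^sup>2 * (norm (G l))\<^sup>2) + P\<^sup>2 * (?H (w i) * (norm (G i))\<^sup>2) / (\<alpha>0 * w0))"
        if jk: "j \<in> I" "k \<in> I" "j \<noteq> k" and l: "j = i \<and> l = k \<or> k = i \<and> l = j" for j k l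
      proof -
        have "\<bar>?M j k\<bar> \<le> 2 * \<epsilon> * ?r * D" using cross(2)[OF jk] l by auto
        moreover have "\<bar>\<alpha> j + \<alpha> k\<bar> \<le> 2 * \<alpha>1" using \<alpha>[OF jk(1)] \<alpha>[OF jk(2)] \<alpha>0 by auto
        moreover have "\<bar>G j \<bullet> G k\<bar> \<le> norm (G i) * norm (G l)"
          using Cauchy_Schwarz_ineq2[of "G j" "G k"] l by (auto simp: mult.commute)
        ultimately have "\<bar>?N j k\<bar> \<le> (2 * \<alpha>1) * (2 * \<epsilon> * ?r * D) * (norm (G i) * norm (G l))"
          unfolding abs_mult by (intro mult_mono mult_nonneg_nonneg) (use \<alpha>1 \<epsilon>(1) D in auto)
        \<comment> \<open>The factor \<open>r\<close> vanishes wherever the Heaviside factor does,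
          so the latter can be inserted for free; the cross term becomes a product of two controlled
          gradients.\<close>
        also have "\<dots> = \<epsilon> / 2 * (2 * ((?r * norm (G l)) * (P * (?H (w i) * norm (G i)))))"
        proof -
          have "\<epsilon> / 2 * (2 * ((?r * norm (G l)) * (P * (?H (w i) * norm (G i)))))
              = (2 * \<alpha>1) * (2 * \<epsilon> * (?r * ?H (w i)) * D) * (norm (G i) * norm (G l))"
            by (simp add: P_def)
          also have "?r * ?H (w i) = ?r" by (simp add: heaviside_def)
          finally show ?thesis by (rule sym)
        qed
        also have "\<dots> \<le> \<epsilon> / 2 * (\<alpha>0 * w0 * (?r * norm (G l))\<^sup>2 + (P * (?H (w i) * norm (G i)))\<^sup>2 / (\<alpha>0 * w0))"
          using \<epsilon>(1) \<alpha>0 w0_pos by (intro mult_left_mono Young) auto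
        finally show ?thesis by (simp add: power_mult_distrib H2)
      qed
      have "(\<Sum>j\<in>I. \<Sum>k\<in>I - {j}. ?N j k) = (\<Sum>k\<in>I - {i}. ?N i k + ?N k i)"
        by (rule sum_offdiag_cross[OF fin i]) (use cross(1) in auto)
      also have "\<dots> \<ge> (\<Sum>k\<in>I - {i}. - 2 * (\<epsilon> / 2 * (\<alpha>0 * w0 * (?r\<^sup>2 * (norm (G k))\<^sup>2) + P\<^sup>2 * (?H (w i) * (norm (G i))\<^sup>2) / (\<alpha>0 * w0))))"
      proof (rule sum_mono)
        fix k assume "k \<in> I - {i}"
        then have "k \<in> I" "k \<noteq> i" by auto
        from N[OF i this(1), of k] N[OF this(1) i, of k] this(2)
        show "- 2 * (\<epsilon> / 2 * (\<alpha>0 * w0 * (?r\<^sup>2 * (norm (G k))\<^sup>2) + P\<^sup>2 * (?H (w i) * (norm (G i))\<^sup>2) / (\<alpha>0 * w0))) \<le> ?N i k + ?N k i"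
          by fastforce
      qed
      also have "(\<Sum>k\<in>I - {i}. - 2 * (\<epsilon> / 2 * (\<alpha>0 * w0 * (?r\<^sup>2 * (norm (G k))\<^sup>2) + P\<^sup>2 * (?H (w i) * (norm (G i))\<^sup>2) / (\<alpha>0 * w0))))
         = - (\<epsilon> * \<alpha>0 * w0 * ?r\<^sup>2 * S) - card (I - {i}) * (\<epsilon> * P\<^sup>2 * (?H (w i) * (norm (G i))\<^sup>2) / (\<alpha>0 * w0))"
        by (simp add: S_def sum_distrib_left sum_subtractf sum_negf sum.distrib algebra_simps)
      finally have cr: "- (\<epsilon> * \<alpha>0 * w0 * ?r\<^sup>2 * S) - card (I - {i}) * (\<epsilon> * P\<^sup>2 * (?H (w i) * (norm (G i))\<^sup>2) / (\<alpha>0 * w0))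
         \<le> (\<Sum>j\<in>I. \<Sum>k\<in>I - {j}. ?N j k)" .
      have Hg: "0 \<le> ?H (w i) * (norm (G i))\<^sup>2" using heaviside_bound(2) by simp
      have "card (I - {i}) * (\<epsilon> * P\<^sup>2 * (?H (w i) * (norm (G i))\<^sup>2) / (\<alpha>0 * w0))
          \<le> card I * (\<epsilon> * P\<^sup>2 * (?H (w i) * (norm (G i))\<^sup>2) / (\<alpha>0 * w0))"
        using Hg \<epsilon>(1) \<alpha>0 w0_pos card by (intro mult_right_mono) auto
      also have "\<dots> = (\<epsilon> * (P\<^sup>2 * card I)) * (?H (w i) * (norm (G i))\<^sup>2) / (\<alpha>0 * w0)" by simp
      also have "\<dots> \<le> ((\<alpha>0 * w0)\<^sup>2 / 2) * (?H (w i) * (norm (G i))\<^sup>2) / (\<alpha>0 * w0)"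
        using \<epsilon>3 Hg \<alpha>0 w0_pos by (intro divide_right_mono mult_right_mono) auto
      also have "\<dots> = \<alpha>0 * w0 / 2 * (?H (w i) * (norm (G i))\<^sup>2)"
        using \<alpha>0 w0_pos by (simp add: power2_eq_square)
      finally have cr2: "card (I - {i}) * (\<epsilon> * P\<^sup>2 * (?H (w i) * (norm (G i))\<^sup>2) / (\<alpha>0 * w0)) \<le> \<alpha>0 * w0 / 2 * (?H (w i) * (norm (G i))\<^sup>2)" .
      have "(\<Sum>j\<in>I. \<alpha> j * ?e2 j j * (norm (G j))\<^sup>2)
          = \<alpha> i * ?e2 i i * (norm (G i))\<^sup>2 + (\<Sum>j\<in>I - {i}. \<alpha> j * ?e2 j j * (norm (G j))\<^sup>2)"
        by (rule sum.remove[OF fin i])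
      moreover have "(\<Sum>k\<in>I - {i}. \<alpha>0 * (\<epsilon> * ?r\<^sup>2 * w0) * (norm (G k))\<^sup>2) \<le> (\<Sum>j\<in>I - {i}. \<alpha> j * ?e2 j j * (norm (G j))\<^sup>2)"
        by (intro sum_mono diag_k)
      moreover have "(\<Sum>k\<in>I - {i}. \<alpha>0 * (\<epsilon> * ?r\<^sup>2 * w0) * (norm (G k))\<^sup>2) = \<epsilon> * \<alpha>0 * w0 * ?r\<^sup>2 * S"
        by (simp add: S_def sum_distrib_left mult_ac)
      moreover have "\<alpha>0 * (w0 / 2 * ?H (w i)) * (norm (G i))\<^sup>2 = \<alpha>0 * w0 / 2 * (?H (w i) * (norm (G i))\<^sup>2)" by simp
      \<comment> \<open>The mixed sum carries the factor one half and therefore consumes half of the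
        diagonal in direction \<open>i\<close> and half of the part weighted by
        \<open>r\<^sup>2\<close>.\<close>
      ultimately have tot: "\<alpha>0 * w0 / 4 * (?H (w i) * (norm (G i))\<^sup>2) + 1 / 2 * (\<epsilon> * \<alpha>0 * w0 * ?r\<^sup>2 * S)
         \<le> (\<Sum>j\<in>I. \<alpha> j * ?e2 j j * (norm (G j))\<^sup>2) + 1 / 2 * (\<Sum>j\<in>I. \<Sum>k\<in>I - {j}. ?N j k)"
        using cr cr2 diag_i by linarith
      have "c * (?H (w i) * (norm (G i))\<^sup>2 + \<epsilon> * ?r\<^sup>2 * S)
          \<le> \<alpha>0 * w0 / 4 * (?H (w i) * (norm (G i))\<^sup>2 + \<epsilon> * ?r\<^sup>2 * S)"
        using c_le(1) Hg S0 \<epsilon>(1) by (intro mult_right_mono) auto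
      also have "\<dots> \<le> \<alpha>0 * w0 / 4 * (?H (w i) * (norm (G i))\<^sup>2) + 1 / 2 * (\<epsilon> * \<alpha>0 * w0 * ?r\<^sup>2 * S)"
      proof -
        have "0 \<le> \<epsilon> * \<alpha>0 * w0 * ?r\<^sup>2 * S" using \<epsilon>(1) \<alpha>0 w0_pos S0 by simp
        then show ?thesis by (simp add: algebra_simps)
      qed
      also note tot
      also have "(\<Sum>j\<in>I. \<alpha> j * ?e2 j j * (norm (G j))\<^sup>2) + 1 / 2 * (\<Sum>j\<in>I. \<Sum>k\<in>I - {j}. ?N j k)
        = (\<Sum>j\<in>I. ?e1 j * (\<Sum>k\<in>I - {j}. (\<alpha> j + \<alpha> k) / (w j - w k) * (G j \<bullet> G k)))
          + (\<Sum>j\<in>I. \<Sum>k\<in>I. ?e2 j k * (G k \<bullet> (\<alpha> j *\<^sub>R G j)))"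
        by (rule quadratic_form_symmetrize[OF fin en2_sym, symmetric])
      finally show ?thesis by (simp add: S_def)
    qed
    fix \<eta> :: real and v :: 'a
    let ?y = "\<alpha>1 * Ce * (?r * norm v)"
    have aG: "\<bar>(\<alpha> j *\<^sub>R G j) \<bullet> v\<bar> \<le> \<alpha>1 * (norm (G j) * norm v)" if "j \<in> I" for j
    proof -
      have "\<bar>(\<alpha> j *\<^sub>R G j) \<bullet> v\<bar> = \<bar>\<alpha> j\<bar> * \<bar>G j \<bullet> v\<bar>" by (simp add: abs_mult)
      also have "\<dots> \<le> \<alpha>1 * (norm (G j) * norm v)"
        using \<alpha>[OF that] \<alpha>0 by (intro mult_mono Cauchy_Schwarz_ineq2) auto
      finally show ?thesis .
    qed
    have t_i: "2 * \<bar>\<eta>\<bar> * \<bar>?e1 i * ((\<alpha> i *\<^sub>R G i) \<bullet> v)\<bar> \<le> c / 2 * (\<eta>\<^sup>2 * (?H (w i) * (norm (G i))\<^sup>2)) + 2 / c * ?y\<^sup>2"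
    proof -
      have "2 * \<bar>\<eta>\<bar> * \<bar>?e1 i * ((\<alpha> i *\<^sub>R G i) \<bullet> v)\<bar> \<le> 2 * \<bar>\<eta>\<bar> * ((Ce * ?r) * (\<alpha>1 * (norm (G i) * norm v)))"
        unfolding abs_mult[of "?e1 i"] by (intro mult_left_mono mult_mono en1_i aG i) (use Ce r in auto)
      also have "\<dots> = 2 * ((\<bar>\<eta>\<bar> * (?H (w i) * norm (G i))) * ?y)"
        by (cases "w i > \<kappa>") (simp_all add: heaviside_def mult_ac)
      also have "\<dots> \<le> c / 2 * (\<bar>\<eta>\<bar> * (?H (w i) * norm (G i)))\<^sup>2 + ?y\<^sup>2 / (c / 2)"
        using c by (intro Young) auto
      finally show ?thesis by (simp add: power_mult_distrib H2)
    qed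
    have t_k: "2 * \<bar>\<eta>\<bar> * \<bar>?e1 k * ((\<alpha> k *\<^sub>R G k) \<bullet> v)\<bar> \<le> c * \<epsilon> / 2 * (\<eta>\<^sup>2 * (?r\<^sup>2 * (norm (G k))\<^sup>2)) + 2 / (c * \<epsilon>) * ?y\<^sup>2"
      if k: "k \<in> I - {i}" for k
    proof -
      have "2 * \<bar>\<eta>\<bar> * \<bar>?e1 k * ((\<alpha> k *\<^sub>R G k) \<bullet> v)\<bar> \<le> 2 * \<bar>\<eta>\<bar> * ((Ce * ?r\<^sup>2) * (\<alpha>1 * (norm (G k) * norm v)))"
        unfolding abs_mult[of "?e1 k"] by (intro mult_left_mono mult_mono en1_j aG) (use k Ce in auto)
      \<comment> \<open>One factor \<open>r\<close> stays with the gradient and the other goes to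
        \<open>?y\<close>, thanks to the quadratic order of \<open>en1\<close> off the index
        \<open>i\<close>.\<close>
      also have "\<dots> = 2 * ((\<bar>\<eta>\<bar> * (?r * norm (G k))) * ?y)"
        by (simp add: power2_eq_square)
      also have "\<dots> \<le> c * \<epsilon> / 2 * (\<bar>\<eta>\<bar> * (?r * norm (G k)))\<^sup>2 + ?y\<^sup>2 / (c * \<epsilon> / 2)"
        using c \<epsilon>(1) by (intro Young) auto
      finally show ?thesis by (simp add: power_mult_distrib)
    qed
    have "2 * \<eta> * \<bar>\<Sum>j\<in>I. ?e1 j * ((\<alpha> j *\<^sub>R G j) \<bullet> v)\<bar> \<le> 2 * \<bar>\<eta>\<bar> * (\<Sum>j\<in>I. \<bar>?e1 j * ((\<alpha> j *\<^sub>R G j) \<bullet> v)\<bar>)"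
      by (rule mult_mono) auto
    also have "\<dots> = 2 * \<bar>\<eta>\<bar> * \<bar>?e1 i * ((\<alpha> i *\<^sub>R G i) \<bullet> v)\<bar> + (\<Sum>k\<in>I - {i}. 2 * \<bar>\<eta>\<bar> * \<bar>?e1 k * ((\<alpha> k *\<^sub>R G k) \<bullet> v)\<bar>)"
      using sum.remove[OF fin i, of "\<lambda>j. \<bar>?e1 j * ((\<alpha> j *\<^sub>R G j) \<bullet> v)\<bar>"] by (simp add: sum_distrib_left distrib_left)
    also have "\<dots> \<le> (c / 2 * (\<eta>\<^sup>2 * (?H (w i) * (norm (G i))\<^sup>2)) + 2 / c * ?y\<^sup>2)
        + (\<Sum>k\<in>I - {i}. c * \<epsilon> / 2 * (\<eta>\<^sup>2 * (?r\<^sup>2 * (norm (G k))\<^sup>2)) + 2 / (c * \<epsilon>) * ?y\<^sup>2)"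
      by (intro add_mono t_i sum_mono t_k)
    also have "\<dots> = c / 2 * (\<eta>\<^sup>2 * (?H (w i) * (norm (G i))\<^sup>2 + \<epsilon> * ?r\<^sup>2 * S))
        + (2 / c + card (I - {i}) * (2 / (c * \<epsilon>))) * ?y\<^sup>2"
      by (simp add: S_def sum.distrib sum_distrib_left algebra_simps)
    also have "(2 / c + card (I - {i}) * (2 / (c * \<epsilon>))) * ?y\<^sup>2 \<le> (2 / c + card I * (2 / (c * \<epsilon>))) * ?y\<^sup>2"
      using card c \<epsilon>(1) by (intro mult_right_mono add_left_mono) auto
    also have "\<dots> = (2 / c + card I * (2 / (c * \<epsilon>))) * (\<alpha>1 * Ce)\<^sup>2 * (?r\<^sup>2 * (norm v)\<^sup>2)"
      by (simp add: power_mult_distrib)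
    also have "\<dots> \<le> C * (?r\<^sup>2 * (norm v)\<^sup>2)"
      by (intro mult_right_mono C_ge(3)) simp
    finally show "2 * \<eta> * \<bar>\<Sum>j\<in>I. ?e1 j * ((\<alpha> j *\<^sub>R G j) \<bullet> v)\<bar>
      \<le> c / 2 * (\<eta>\<^sup>2 * (?H (w i) * (norm (G i))\<^sup>2 + \<epsilon> * ?r\<^sup>2 * (\<Sum>k\<in>I - {i}. (norm (G k))\<^sup>2)))
        + C * (?r\<^sup>2 * (norm v)\<^sup>2)"
      by (simp add: S_def)
  qed
qed

end

locale root_flow = weak_flow + separated_box
begin

lemma coord_cont_flow:
  assumes "coord_cont I X E" "K \<subseteq> Q"
  shows "bounded_conv K (\<lambda>n q. E (\<lambda>j. z j q)) (\<lambda>q. E (\<lambda>j. z j q))"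
  by (rule bounded_conv_coord_cont[where Z = "\<lambda>n. z" and I = I and X = X, OF assms(1)])
     (use z_cont z_box assms(2) continuous_on_subset in \<open>blast | simp\<close>)+

text \<open>At a fixed point the integrals converge by dominated convergence in \<open>s\<close>.
  The bounds on the length of the interval and on the product do not depend on the point, which
  makes the convergence bounded.\<close>

lemma moment_ramp_conv:
  assumes i: "i \<in> I" and S: "S \<subseteq> I" and K: "K \<subseteq> Q"
  shows "bounded_conv K (\<lambda>n q. moment1 (base i) (ramp \<kappa> n) S (\<lambda>j. z j q) (z i q)) (\<lambda>q. moment1 (base i) (heaviside \<kappa>) S (\<lambda>j. z j q) (z i q))"
    "bounded_conv K (\<lambda>n q. moment2 (base i) (ramp \<kappa> n) S (\<lambda>j. z j q) (z i q)) (\<lambda>q. moment2 (base i) (heaviside \<kappa>) S (\<lambda>j. z j q) (z i q))"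
proof -
  have box: "(\<lambda>j. z j q) \<in> X" if "q \<in> K" for q using z_box K that by blast
  have zK: "continuous_on K (z j)" if "j \<in> I" for j using z_cont[OF that] K continuous_on_subset by blast
  have fS: "finite S" using S fin finite_subset by blast
  define L where "L = b i - base i"
  have lim: "(\<lambda>n. integral {base i..u} (\<lambda>s. ramp \<kappa> n s * f s)) \<longlonglongrightarrow> integral {base i..u} (\<lambda>s. heaviside \<kappa> s * f s)"
    if f: "continuous_on UNIV f" for f u
  proof (rule dominated_convergence(2))
    show "(\<lambda>s. ramp \<kappa> n s * f s) integrable_on {base i..u}" for n
      by (rule bounded_mult_continuous_integrable_on[OF ramp_measurable ramp_bound f])
    show "(\<lambda>s. \<bar>f s\<bar>) integrable_on {base i..u}"
      by (intro integrable_continuous_interval continuous_intros continuous_on_subset[OF f]) auto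
    show "norm (ramp \<kappa> n s * f s) \<le> \<bar>f s\<bar>" for n s
      using mult_right_mono[OF ramp_bound[of \<kappa> n s], of "\<bar>f s\<bar>"] by (simp add: abs_mult)
    show "(\<lambda>n. ramp \<kappa> n s * f s) \<longlonglongrightarrow> heaviside \<kappa> s * f s" for s
      by (intro tendsto_intros ramp_tendsto)
  qed
  have r0: "0 \<le> ramp \<kappa> n s" for n s by (simp add: ramp_def)
  have bd: "\<bar>moment1 (base i) (ramp \<kappa> n) S (\<lambda>j. z j q) (z i q)\<bar> \<le> W * L"
    "\<bar>moment2 (base i) (ramp \<kappa> n) S (\<lambda>j. z j q) (z i q)\<bar> \<le> W * (L * L)" if q: "q \<in> K" for n q
  proof -
    have u: "base i \<le> z i q" "z i q \<le> b i" using X_D[OF box[OF q] i] base_less[of i] by auto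
    have p: "\<bar>\<Prod>k\<in>S. s - z k q\<bar> \<le> W" if "s \<in> {base i..z i q}" for s
      using that u by (intro prod_upper[OF i box[OF q]] S) auto
    note mb = moment_bounds[where A = "base i" and u = "z i q" and K = S and w = "\<lambda>j. z j q" and \<mu> = "ramp \<kappa> n",
        OF ramp_measurable ramp_bound r0 p]
    have "integral {base i..z i q} (ramp \<kappa> n) \<le> integral {base i..z i q} (\<lambda>s. 1)"
      using ramp_bound by (intro integral_le integrable_continuous_interval ramp_cont) (auto simp: abs_le_iff)
    also have "\<dots> \<le> L" using u by (simp add: L_def)
    finally have 1: "integral {base i..z i q} (ramp \<kappa> n) \<le> L" .
    have "integral {base i..z i q} (\<lambda>s. ramp \<kappa> n s * (z i q - s)) \<le> integral {base i..z i q} (\<lambda>s. L)"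
    proof (intro integral_le integrable_continuous_interval continuous_intros ramp_cont)
      fix s assume s: "s \<in> {base i..z i q}"
      have "ramp \<kappa> n s * (z i q - s) \<le> 1 * (z i q - s)"
        using ramp_bound[of \<kappa> n s] s by (intro mult_right_mono) auto
      then show "ramp \<kappa> n s * (z i q - s) \<le> L" using s u by (simp add: L_def)
    qed
    also have "\<dots> \<le> L * L" using u by (simp add: L_def mult_right_mono)
    finally have 2: "integral {base i..z i q} (\<lambda>s. ramp \<kappa> n s * (z i q - s)) \<le> L * L" .
    show "\<bar>moment1 (base i) (ramp \<kappa> n) S (\<lambda>j. z j q) (z i q)\<bar> \<le> W * L"
      by (rule order_trans[OF mb(1)]) (use mult_left_mono[OF 1, of W] W_ge_1 in auto)
    show "\<bar>moment2 (base i) (ramp \<kappa> n) S (\<lambda>j. z j q) (z i q)\<bar> \<le> W * (L * L)"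
      by (rule order_trans[OF mb(2)]) (use mult_left_mono[OF 2, of W] W_ge_1 in auto)
  qed
  show "bounded_conv K (\<lambda>n q. moment1 (base i) (ramp \<kappa> n) S (\<lambda>j. z j q) (z i q)) (\<lambda>q. moment1 (base i) (heaviside \<kappa>) S (\<lambda>j. z j q) (z i q))"
  proof (rule bounded_convI[where C = "W * L"])
    have "continuous_on K (\<lambda>q. moment1 (base i) (ramp \<kappa> n) S (\<lambda>j. z j q) (z i q))" for n
      using coord_cont_compose[OF moment1_coord_cont[where a = a and b = b and i = i and K = S and A = "base i", OF fS i S ramp_cont base_less] zK box] by simp
    then show "(\<lambda>q. moment1 (base i) (ramp \<kappa> n) S (\<lambda>j. z j q) (z i q)) \<in> borel_measurable (restrict_space borel K)" for n
      by (rule borel_measurable_continuous_on_restrict)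
    show "(\<lambda>n. moment1 (base i) (ramp \<kappa> n) S (\<lambda>j. z j q) (z i q)) \<longlonglongrightarrow> moment1 (base i) (heaviside \<kappa>) S (\<lambda>j. z j q) (z i q)" for q
      unfolding moment1_def by (intro lim continuous_intros)
  qed (use bd in auto)
  show "bounded_conv K (\<lambda>n q. moment2 (base i) (ramp \<kappa> n) S (\<lambda>j. z j q) (z i q)) (\<lambda>q. moment2 (base i) (heaviside \<kappa>) S (\<lambda>j. z j q) (z i q))"
  proof (rule bounded_convI[where C = "W * (L * L)"])
    have "continuous_on K (\<lambda>q. moment2 (base i) (ramp \<kappa> n) S (\<lambda>j. z j q) (z i q))" for n
      using coord_cont_compose[OF moment2_coord_cont[where a = a and b = b and i = i and K = S and A = "base i", OF fS i S ramp_cont base_less] zK box] by simp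
    then show "(\<lambda>q. moment2 (base i) (ramp \<kappa> n) S (\<lambda>j. z j q) (z i q)) \<in> borel_measurable (restrict_space borel K)" for n
      by (rule borel_measurable_continuous_on_restrict)
    show "(\<lambda>n. moment2 (base i) (ramp \<kappa> n) S (\<lambda>j. z j q) (z i q)) \<longlonglongrightarrow> moment2 (base i) (heaviside \<kappa>) S (\<lambda>j. z j q) (z i q)" for q
      unfolding moment2_def by (intro lim continuous_intros)
  qed (use bd in auto)
qed

lemma dmoment_ramp_conv:
  assumes i: "i \<in> I" and S: "S \<subseteq> I" and K: "K \<subseteq> Q"
  shows "bounded_conv K (\<lambda>n q. dmoment2 i (base i) (ramp \<kappa> n) S j (\<lambda>j. z j q)) (\<lambda>q. dmoment2 i (base i) (heaviside \<kappa>) S j (\<lambda>j. z j q))"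
    and "bounded_conv K (\<lambda>n q. ddmoment2 i (base i) (ramp \<kappa> n) S j k (\<lambda>j. z j q)) (\<lambda>q. ddmoment2 i (base i) (heaviside \<kappa>) S j k (\<lambda>j. z j q))"
proof -
  have S': "S - {j} \<subseteq> I" "S - {k} \<subseteq> I" for j k using S by auto
  have z0: "bounded_conv K (\<lambda>n q. 0) (\<lambda>q. 0)" by (rule bounded_conv_const[where C = 0]) auto
  have d2: "bounded_conv K (\<lambda>n q. dmoment2 i (base i) (ramp \<kappa> n) S j (\<lambda>j. z j q)) (\<lambda>q. dmoment2 i (base i) (heaviside \<kappa>) S j (\<lambda>j. z j q))"
    if "S \<subseteq> I" for S j
  proof -
    have "S - {j} \<subseteq> I" using that by auto
    then show ?thesis
      unfolding dmoment2_def using moment_ramp_conv[OF i _ K] that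
      by (cases "j = i"; cases "j \<in> S") (simp_all add: bounded_conv_uminus z0)
  qed
  show "bounded_conv K (\<lambda>n q. dmoment2 i (base i) (ramp \<kappa> n) S j (\<lambda>j. z j q)) (\<lambda>q. dmoment2 i (base i) (heaviside \<kappa>) S j (\<lambda>j. z j q))"
    by (rule d2[OF S])
  have zK: "continuous_on K (z j)" if "j \<in> I" for j using z_cont[OF that] K continuous_on_subset by blast
  have "bounded_conv K (\<lambda>n q. ramp \<kappa> n (z i q)) (\<lambda>q. heaviside \<kappa> (z i q))"
  proof (rule bounded_convI[OF _ ramp_bound ramp_tendsto])
    show "(\<lambda>q. ramp \<kappa> n (z i q)) \<in> borel_measurable (restrict_space borel K)" for n
      by (intro borel_measurable_continuous_on_restrict continuous_on_compose2[OF ramp_cont[of UNIV] zK[OF i]]) auto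
  qed
  moreover have "bounded_conv K (\<lambda>n q. \<Prod>l\<in>S. z i q - z l q) (\<lambda>q. \<Prod>l\<in>S. z i q - z l q)"
    by (rule coord_cont_flow[OF _ K, where E = "\<lambda>w. \<Prod>l\<in>S. w i - w l"])
       (use S i in \<open>auto intro!: coord_cont_prod coord_cont_diff coord_cont_coord\<close>)
  ultimately have "bounded_conv K (\<lambda>n q. ramp \<kappa> n (z i q) * (\<Prod>l\<in>S. z i q - z l q)) (\<lambda>q. heaviside \<kappa> (z i q) * (\<Prod>l\<in>S. z i q - z l q))"
    by (rule bounded_conv_mult)
  then have "bounded_conv K (\<lambda>n q. dmoment1 i (base i) (ramp \<kappa> n) S k (\<lambda>j. z j q)) (\<lambda>q. dmoment1 i (base i) (heaviside \<kappa>) S k (\<lambda>j. z j q))"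
    unfolding dmoment1_def using moment_ramp_conv[OF i S'(2)[of k] K]
    by (cases "k = i"; cases "k \<in> S") (simp_all add: bounded_conv_uminus z0)
  then show "bounded_conv K (\<lambda>n q. ddmoment2 i (base i) (ramp \<kappa> n) S j k (\<lambda>j. z j q)) (\<lambda>q. ddmoment2 i (base i) (heaviside \<kappa>) S j k (\<lambda>j. z j q))"
    unfolding ddmoment2_def using d2[OF S'(1)[of j]]
    by (cases "j = i"; cases "j \<in> S") (simp_all add: bounded_conv_uminus z0)
qed

text \<open>Ramps are continuous, so the identity holds for them. Every weight-dependent factor of
  the integrand is a moment or the weight at the root itself, and these converge boundedly although
  the limit energy is not twice continuously differentiable.\<close>

lemma energy_identity_heaviside:
  assumes i: "i \<in> I" and cut: "cutoff_function K \<zeta> D\<zeta>" and K: "K \<subseteq> Q"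
  shows "set_integrable lborel K (energy_integrand \<zeta> D\<zeta> (en i \<epsilon> (heaviside \<kappa>)) (en1 i \<epsilon> (heaviside \<kappa>)) (en2 i \<epsilon> (heaviside \<kappa>)))"
    "(LINT q:K|lborel. energy_integrand \<zeta> D\<zeta> (en i \<epsilon> (heaviside \<kappa>)) (en1 i \<epsilon> (heaviside \<kappa>)) (en2 i \<epsilon> (heaviside \<kappa>)) q) = 0"
proof -
  interpret cutoff_function K \<zeta> D\<zeta> by fact
  have cc: "bounded_conv K (\<lambda>n q. c) (\<lambda>q. c)" for c :: real
    by (rule bounded_conv_const[where C = "\<bar>c\<bar>"]) auto
  have T: "coord_cont I X (T i)" "\<And>j. j \<in> I \<Longrightarrow> coord_cont I X (T1 i j)" "\<And>j k. j \<in> I \<Longrightarrow> k \<in> I \<Longrightarrow> coord_cont I X (T2 i j k)"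
    using T_twice[OF i] by (auto simp: twice_path_deriv_def)
  have IS: "I - {i} \<subseteq> I" "{} \<subseteq> I" by auto
  note mc = moment_ramp_conv[OF i IS(1) K] moment_ramp_conv[OF i IS(2) K] dmoment_ramp_conv[OF i IS(1) K] dmoment_ramp_conv[OF i IS(2) K]
  have cD: "bounded_conv K (\<lambda>n. D\<zeta> v) (D\<zeta> v)" for v
  proof -
    obtain M where "\<forall>q\<in>UNIV. \<bar>D\<zeta> v q\<bar> \<le> M" using D\<zeta>_bdd[of v] unfolding bdd_on_def ..
    then show ?thesis
      by (intro bounded_conv_const[where C = M] measurable_restrict_space1[OF D\<zeta>_measurable]) auto
  qed
  have cf: "bounded_conv K (\<lambda>n. f) f" if f: "continuous_on K f" for f
  proof -
    obtain M where "\<forall>q\<in>K. \<bar>f q\<bar> \<le> M" using bdd_on_compact[OF K_compact f] unfolding bdd_on_def ..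
    then show ?thesis using f
      by (intro bounded_conv_const[where C = M] borel_measurable_continuous_on_restrict) auto
  qed
  have c\<zeta>: "bounded_conv K (\<lambda>n. \<zeta>) \<zeta>" using \<zeta>_cont continuous_on_subset by (intro cf) blast
  have cB: "bounded_conv K (\<lambda>n. B j) (B j)" if "j \<in> I" for j
    using B_cont[OF that] K continuous_on_subset by (intro cf) blast
  have cGF: "bounded_conv K (\<lambda>n q. G k q \<bullet> F j q) (\<lambda>q. G k q \<bullet> F j q)" "bounded_conv K (\<lambda>n q. F j q \<bullet> b) (\<lambda>q. F j q \<bullet> b)" if "j \<in> I" "k \<in> I" for j k b
    using continuous_on_subset[OF F_cont[OF that(1)] K] continuous_on_subset[OF G_cont[OF that(2)] K]
    by (auto intro!: cf continuous_intros)
  have e0: "bounded_conv K (\<lambda>n q. en i \<epsilon> (ramp \<kappa> n) (\<lambda>j. z j q)) (\<lambda>q. en i \<epsilon> (heaviside \<kappa>) (\<lambda>j. z j q))"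
    unfolding en_def by (intro bounded_conv_intros cc mc coord_cont_flow[OF _ K] T)
  have e1: "bounded_conv K (\<lambda>n q. en1 i \<epsilon> (ramp \<kappa> n) j (\<lambda>j. z j q)) (\<lambda>q. en1 i \<epsilon> (heaviside \<kappa>) j (\<lambda>j. z j q))" if "j \<in> I" for j
    unfolding en1_def by (intro bounded_conv_intros cc mc coord_cont_flow[OF _ K] T that)
  have e2: "bounded_conv K (\<lambda>n q. en2 i \<epsilon> (ramp \<kappa> n) j k (\<lambda>j. z j q)) (\<lambda>q. en2 i \<epsilon> (heaviside \<kappa>) j k (\<lambda>j. z j q))" if "j \<in> I" "k \<in> I" for j k
    unfolding en2_def by (intro bounded_conv_intros cc mc coord_cont_flow[OF _ K] T that)
  have "bounded_conv K (\<lambda>n. energy_integrand \<zeta> D\<zeta> (en i \<epsilon> (ramp \<kappa> n)) (en1 i \<epsilon> (ramp \<kappa> n)) (en2 i \<epsilon> (ramp \<kappa> n)))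
     (energy_integrand \<zeta> D\<zeta> (en i \<epsilon> (heaviside \<kappa>)) (en1 i \<epsilon> (heaviside \<kappa>)) (en2 i \<epsilon> (heaviside \<kappa>)))"
    unfolding energy_integrand_def[abs_def]
    by (intro bounded_conv_intros e0 e1 e2 cD c\<zeta> cB cGF; assumption)
  note lim = bounded_conv_integral[OF this K_borel K_finite]
  show "set_integrable lborel K (energy_integrand \<zeta> D\<zeta> (en i \<epsilon> (heaviside \<kappa>)) (en1 i \<epsilon> (heaviside \<kappa>)) (en2 i \<epsilon> (heaviside \<kappa>)))"
    by (rule lim(2))
  show "(LINT q:K|lborel. energy_integrand \<zeta> D\<zeta> (en i \<epsilon> (heaviside \<kappa>)) (en1 i \<epsilon> (heaviside \<kappa>)) (en2 i \<epsilon> (heaviside \<kappa>)) q) = 0"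
    using lim(3) energy_identity[OF en_twice[OF i ramp_cont] cut K] by (simp add: LIMSEQ_const_iff)
qed

end

section \<open>The energy estimate on a cylinder\<close>

text \<open>The cubic Hermite step from zero to one. It is continuously differentiable, as the
  cutoffs require, and its derivative is an explicit parabola.\<close>

definition sstep :: "real \<Rightarrow> real" where
  "sstep u = (if u \<le> 0 then 0 else if u \<ge> 1 then 1 else 3 * u\<^sup>2 - 2 * u ^ 3)"

definition dstep :: "real \<Rightarrow> real" where
  "dstep u = max 0 (6 * u * (1 - u))"

lemma dstep_cont: "continuous_on S dstep"
  unfolding dstep_def by (intro continuous_intros)

lemma dstep_nonneg: "0 \<le> dstep u" by (simp add: dstep_def)

lemma dstep_le: "dstep u \<le> 2"
proof -
  have "0 \<le> 6 * (u - 1 / 2)\<^sup>2" by simp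
  then show ?thesis by (simp add: dstep_def power2_eq_square algebra_simps)
qed

lemma dstep_eq_0: "u \<le> 0 \<or> 1 \<le> u \<Longrightarrow> dstep u = 0"
proof -
  assume "u \<le> 0 \<or> 1 \<le> u"
  then have "u * (1 - u) \<le> 0" by (auto simp: mult_nonpos_nonneg mult_nonneg_nonpos)
  then show ?thesis by (simp add: dstep_def)
qed

text \<open>Symmetry about one half transfers the derivative at zero to the derivative at
  one.\<close>

lemma sstep_reflect: "sstep u = 1 - sstep (1 - u)"
  by (auto simp: sstep_def power2_eq_square power3_eq_cube algebra_simps)

lemma sstep_DERIV: "(sstep has_real_derivative dstep u) (at u)"
proof -
  have left: "(sstep has_real_derivative dstep u) (at u)" if "u < 1" for u
  proof -
    consider "u < 0" | "0 < u" | "u = 0" by linarith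
    then show ?thesis
    proof cases
      case 1
      have "((\<lambda>x. 0) has_real_derivative 0) (at u)" by simp
      then have "(sstep has_real_derivative 0) (at u)"
        by (rule has_field_derivative_transform_within_open[where S = "{..<0}"]) (use 1 in \<open>auto simp: sstep_def\<close>)
      then show ?thesis using 1 dstep_eq_0[of u] by simp
    next
      case 2
      have "((\<lambda>x. 3 * x\<^sup>2 - 2 * x ^ 3) has_real_derivative 6 * u * (1 - u)) (at u)"
        by (auto intro!: derivative_eq_intros simp: power2_eq_square algebra_simps)
      then have "(sstep has_real_derivative 6 * u * (1 - u)) (at u)"
        by (rule has_field_derivative_transform_within_open[where S = "{0<..<1}"]) (use 2 that in \<open>auto simp: sstep_def\<close>)
      then show ?thesis using 2 that by (simp add: dstep_def)
    next
      case 3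
      have "((\<lambda>h::real. 3 * h - 2 * h\<^sup>2) \<longlongrightarrow> 3 * 0 - 2 * 0\<^sup>2) (at_right 0)"
        by (intro tendsto_intros)
      then have lim0: "((\<lambda>h::real. 3 * h - 2 * h\<^sup>2) \<longlongrightarrow> 0) (at_right 0)" by simp
      have r: "((\<lambda>h. (sstep h - sstep 0) / (h - 0)) \<longlongrightarrow> 0) (at_right 0)"
      proof (rule Lim_transform_eventually[OF lim0])
        show "eventually (\<lambda>h::real. 3 * h - 2 * h\<^sup>2 = (sstep h - sstep 0) / (h - 0)) (at_right 0)"
          unfolding eventually_at_right_field
          by (intro exI[of _ 1]) (auto simp: sstep_def power2_eq_square power3_eq_cube field_simps)
      qed
      have l: "((\<lambda>h. (sstep h - sstep 0) / (h - 0)) \<longlongrightarrow> 0) (at_left 0)"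
        by (rule Lim_transform_eventually[OF tendsto_const]) (auto simp: eventually_at_filter sstep_def)
      show ?thesis
        using filterlim_split_at[OF l r] 3 dstep_eq_0[of u] by (simp add: has_field_derivative_iff)
    qed
  qed
  show ?thesis
  proof (cases "u < 1")
    case False
    then have "1 - u < 1" by simp
    note d = left[OF this]
    have "((\<lambda>u. 1 - sstep (1 - u)) has_real_derivative - (dstep (1 - u) * - 1)) (at u)"
      by (intro DERIV_diff[of _ 0, simplified] DERIV_chain2[where f = sstep and g = "\<lambda>u. 1 - u", OF d]) (auto intro!: derivative_eq_intros)
    then show ?thesis
      using sstep_reflect[symmetric] by (simp add: dstep_def algebra_simps)
  qed (rule left)
qed

lemma sstep_mono: "u \<le> v \<Longrightarrow> sstep u \<le> sstep v"
  using DERIV_nonneg_imp_nondecreasing[of u v sstep] sstep_DERIV dstep_nonneg by blast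

lemma sstep_eq: "u \<le> 0 \<Longrightarrow> sstep u = 0" "1 \<le> u \<Longrightarrow> sstep u = 1"
  by (auto simp: sstep_def)

lemma sstep_bounds: "0 \<le> sstep u" "sstep u \<le> 1"
  using sstep_mono[of "min u 0" u] sstep_mono[of u "max u 1"] sstep_eq(1)[of "min u 0"] sstep_eq(2)[of "max u 1"]
  by auto

lemma sstep_cont: "continuous_on S sstep"
  using DERIV_isCont[OF sstep_DERIV] continuous_at_imp_continuous_on by blast

text \<open>Mass one on the unit interval: scaled copies of \<open>dstep\<close> approximate a point
  mass in time from one side.\<close>

lemma integral_dstep: "integrable lborel dstep" "integral\<^sup>L lborel dstep = 1"
proof -
  have "has_bochner_integral lborel (\<lambda>u. dstep u * indicator {0..1} u) (sstep 1 - sstep 0)"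
    by (rule has_bochner_integral_FTC_Icc_real) (use sstep_DERIV dstep_cont[of UNIV] in \<open>auto simp: continuous_on_eq_continuous_at\<close>)
  moreover have "dstep u * indicator {0..1} u = dstep u" for u
    using dstep_eq_0[of u] by (cases "u \<in> {0..1}") auto
  ultimately show "integrable lborel dstep" "integral\<^sup>L lborel dstep = 1"
    by (auto simp: has_bochner_integral_iff sstep_eq)
qed

section \<open>Cutoffs that vanish near the physical boundary\<close>

lemma frechet_derivative_grad:
  assumes "f differentiable (at x)"
  shows "(f has_derivative (\<lambda>v. grad f x \<bullet> v)) (at x)" "frechet_derivative f (at x) v = grad f x \<bullet> v"
proof -
  have d: "(f has_derivative frechet_derivative f (at x)) (at x)"
    using assms frechet_derivative_works by blast
  then have lin: "linear (frechet_derivative f (at x))" by (rule has_derivative_linear)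
  have eq: "frechet_derivative f (at x) v = grad f x \<bullet> v" for v
  proof -
    have "frechet_derivative f (at x) v = frechet_derivative f (at x) (\<Sum>b\<in>Basis. (v \<bullet> b) *\<^sub>R b)"
      by (simp add: euclidean_representation)
    also have "\<dots> = (\<Sum>b\<in>Basis. (v \<bullet> b) * frechet_derivative f (at x) b)"
      by (simp add: linear_sum[OF lin] linear_cmul[OF lin])
    also have "\<dots> = grad f x \<bullet> v"
      by (simp add: grad_def inner_sum_left) (simp add: inner_commute mult.commute)
    finally show ?thesis .
  qed
  then show "frechet_derivative f (at x) v = grad f x \<bullet> v" .
  have "frechet_derivative f (at x) = (\<lambda>v. grad f x \<bullet> v)" using eq by auto
  with d show "(f has_derivative (\<lambda>v. grad f x \<bullet> v)) (at x)" by simp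
qed

lemma has_derivative_grad_eq: "(f has_derivative (\<lambda>v. g \<bullet> v)) (at x) \<Longrightarrow> grad f x = g"
  by (simp add: grad_def frechet_derivative_eqI euclidean_representation)

lemma has_derivative_line:
  fixes f :: "'b::euclidean_space \<Rightarrow> real"
  assumes "(f has_derivative D) (at q)"
  shows "((\<lambda>h. f (q + h *\<^sub>R v)) has_real_derivative D v) (at 0)"
proof -
  have 1: "((\<lambda>h. q + h *\<^sub>R v) has_derivative (\<lambda>h. h *\<^sub>R v)) (at 0)"
    by (auto intro!: derivative_eq_intros)
  have 2: "(f has_derivative D) (at (q + 0 *\<^sub>R v))" using assms by simp
  have "((\<lambda>h. f (q + h *\<^sub>R v)) has_derivative (\<lambda>h. D (h *\<^sub>R v))) (at 0)"
    by (rule has_derivative_compose[OF 1 2])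
  then show ?thesis
    using linear_cmul[OF has_derivative_linear[OF assms]] by (simp add: has_field_derivative_def mult_commute_abs)
qed

text \<open>\<open>s\<close> plays the role of a height above the boundary: on the closed ball the
  domain is where it is positive. Differentiability of \<open>\<eta>\<close> is available inside the
  cylinder only, so its vanishing near the bottom and the sides is recorded by the open set
  \<open>V\<close>.\<close>

locale cylinder_cutoff =
  fixes \<Omega> :: "'a::euclidean_space set" and x0 :: 'a and \<rho> T0 t0 :: real
    and \<eta> :: "real \<times> 'a \<Rightarrow> real" and s :: "'a \<Rightarrow> real" and Ds :: "'a \<Rightarrow> 'a" and V :: "(real \<times> 'a) set"
  assumes \<Omega>_open: "open \<Omega>" and T0: "T0 < t0"
    and s_deriv: "\<And>x. (s has_derivative (\<lambda>v. Ds x \<bullet> v)) (at x)" and Ds_cont: "continuous_on UNIV Ds"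
    and s_iff: "\<And>x. x \<in> cball x0 \<rho> \<Longrightarrow> x \<in> \<Omega> \<longleftrightarrow> s x > 0"
    and \<eta>_diff: "\<And>q. q \<in> {T0<..<t0} \<times> (ball x0 \<rho> \<inter> \<Omega>) \<Longrightarrow> \<eta> differentiable (at q)"
    and \<eta>_grad_cont: "continuous_on ({T0<..<t0} \<times> (ball x0 \<rho> \<inter> \<Omega>)) (grad \<eta>)"
    and \<eta>_grad_bdd: "\<exists>M. \<forall>q\<in>{T0<..<t0} \<times> (ball x0 \<rho> \<inter> \<Omega>). norm (grad \<eta> q) \<le> M"
    and \<eta>01: "\<And>q. q \<in> {T0<..<t0} \<times> (ball x0 \<rho> \<inter> \<Omega>) \<Longrightarrow> 0 \<le> \<eta> q \<and> \<eta> q \<le> 1"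
    and V_open: "open V" and V_bottom: "{T0} \<times> (ball x0 \<rho> \<inter> \<Omega>) \<subseteq> V"
    and V_lateral: "{T0<..<t0} \<times> (sphere x0 \<rho> \<inter> \<Omega>) \<subseteq> V"
    and \<eta>_V: "\<And>q. q \<in> V \<Longrightarrow> q \<in> {T0<..<t0} \<times> (ball x0 \<rho> \<inter> \<Omega>) \<Longrightarrow> \<eta> q = 0"
begin

definition "Qc = {T0<..<t0} \<times> (ball x0 \<rho> \<inter> \<Omega>)"

lemma Qc_open: "open Qc"
  unfolding Qc_def using \<Omega>_open by (intro open_Times open_Int) auto

text \<open>The last factor is zero for \<open>s \<le> d\<close> and one for
  \<open>s \<ge> 2 * d\<close>. Subtracting one from \<open>s / d\<close> pushes the support off the
  boundary and confines the gradient of this factor to the layer between these heights.\<close>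

definition "\<zeta> \<theta> d q = (if q \<in> Qc then \<theta> (fst q) * (\<eta> q)\<^sup>2 * sstep (s (snd q) / d - 1) else 0)"

definition "D\<zeta> \<theta> \<theta>' d v q = (if q \<in> Qc then
    fst v * \<theta>' (fst q) * (\<eta> q)\<^sup>2 * sstep (s (snd q) / d - 1)
    + \<theta> (fst q) * (2 * \<eta> q * (grad \<eta> q \<bullet> v)) * sstep (s (snd q) / d - 1)
    + \<theta> (fst q) * (\<eta> q)\<^sup>2 * (dstep (s (snd q) / d - 1) / d * (Ds (snd q) \<bullet> snd v)) else 0)"

lemma \<eta>_bdd: "bdd_on Qc (\<lambda>q. grad \<eta> q \<bullet> v)" "bdd_on Qc \<eta>"
proof -
  obtain M where M: "\<And>q. q \<in> Qc \<Longrightarrow> norm (grad \<eta> q) \<le> M" using \<eta>_grad_bdd unfolding Qc_def by blast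
  have "\<bar>grad \<eta> q \<bullet> v\<bar> \<le> M * norm v" if "q \<in> Qc" for q
    using Cauchy_Schwarz_ineq2[of "grad \<eta> q" v] mult_right_mono[OF M[OF that], of "norm v"] by simp
  then show "bdd_on Qc (\<lambda>q. grad \<eta> q \<bullet> v)" by (rule bdd_onI)
  show "bdd_on Qc \<eta>" using \<eta>01 by (intro bdd_onI[where M = 1]) (auto simp: Qc_def)
qed

lemma s_cont: "continuous_on S s"
  by (intro continuous_at_imp_continuous_on ballI has_derivative_continuous[OF s_deriv])

text \<open>As \<open>\<eta>\<close> is uncontrolled outside the cylinder, differentiability of the
  product there rests on a neighbourhood of each outside point on which the product
  vanishes.\<close>

lemma \<zeta>_cutoff_function:
  assumes \<theta>: "\<And>t. (\<theta> has_real_derivative \<theta>' t) (at t)" "continuous_on UNIV \<theta>'" "\<And>t. t \<notin> {\<tau>1..\<tau>2} \<Longrightarrow> \<theta> t = 0"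
    and \<tau>: "T0 < \<tau>1" "\<tau>2 < t0" and d: "d > 0"
  shows "cutoff_function ({\<tau>1..\<tau>2} \<times> {x \<in> cball x0 \<rho>. d \<le> s x}) (\<zeta> \<theta> d) (D\<zeta> \<theta> \<theta>' d)"
proof
  have c: "closed {x. d \<le> s x}" by (intro closed_Collect_le continuous_intros s_cont)
  have "{x \<in> cball x0 \<rho>. d \<le> s x} = cball x0 \<rho> \<inter> {x. d \<le> s x}" by auto
  then show "compact ({\<tau>1..\<tau>2} \<times> {x \<in> cball x0 \<rho>. d \<le> s x})"
    using compact_Int_closed[OF compact_cball c, of x0 \<rho>] by (simp add: compact_Times)
  have deriv: "(\<zeta> \<theta> d has_derivative (\<lambda>v. D\<zeta> \<theta> \<theta>' d v q)) (at q)" for q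
  proof (cases "q \<in> Qc")
    case True
    obtain t x where q: "q = (t, x)" by (cases q)
    have th: "((\<lambda>q. \<theta> (fst q)) has_derivative (\<lambda>v. \<theta>' t * fst v)) (at q)"
    proof -
      have "(\<theta> has_derivative (*) (\<theta>' t)) (at (fst q))" using \<theta>(1)[of t] by (simp add: has_field_derivative_def q)
      from has_derivative_compose[OF has_derivative_fst[OF has_derivative_ident] this] show ?thesis by simp
    qed
    have et: "(\<eta> has_derivative (\<lambda>v. grad \<eta> q \<bullet> v)) (at q)"
      using \<eta>_diff True by (intro frechet_derivative_grad) (auto simp: Qc_def)
    have sx: "((\<lambda>q. s (snd q)) has_derivative (\<lambda>v. Ds x \<bullet> snd v)) (at q)"
    proof -
      have "(s has_derivative (\<lambda>v. Ds x \<bullet> v)) (at (snd q))" using s_deriv[of x] by (simp add: q)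
      from has_derivative_compose[OF has_derivative_snd[OF has_derivative_ident] this] show ?thesis by simp
    qed
    have "((\<lambda>q. s (snd q) / d - 1) has_derivative (\<lambda>v. (Ds x \<bullet> snd v) / d)) (at q)"
      using d by (auto intro!: derivative_eq_intros sx)
    moreover have "(sstep has_derivative (*) (dstep (s x / d - 1))) (at (s (snd q) / d - 1))"
      using sstep_DERIV[of "s x / d - 1"] by (simp add: has_field_derivative_def q)
    ultimately have ss: "((\<lambda>q. sstep (s (snd q) / d - 1)) has_derivative (\<lambda>v. dstep (s x / d - 1) * ((Ds x \<bullet> snd v) / d))) (at q)"
      using has_derivative_compose by fastforce
    have "((\<lambda>q. \<theta> (fst q) * (\<eta> q * \<eta> q) * sstep (s (snd q) / d - 1)) has_derivative (\<lambda>v. D\<zeta> \<theta> \<theta>' d v q)) (at q)"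
      by (rule has_derivative_eq_rhs[OF has_derivative_mult[OF has_derivative_mult[OF th has_derivative_mult[OF et et]] ss]])
         (use True in \<open>simp add: D\<zeta>_def q fun_eq_iff power2_eq_square algebra_simps\<close>)
    then show ?thesis
      by (rule has_derivative_transform_within_open[OF _ Qc_open True]) (simp add: \<zeta>_def power2_eq_square)
  next
    case False
    obtain t x where q: "q = (t, x)" by (cases q)
    have "\<exists>N. open N \<and> q \<in> N \<and> (\<forall>q'\<in>N. \<zeta> \<theta> d q' = 0)"
    proof -
      \<comment> \<open>What makes the product vanish: \<open>\<theta>\<close> in the first two
        cases, the cylinder condition in the third, the boundary factor in the fourth, and in the
        last, on the sphere, \<open>\<eta>\<close> by means of \<open>V\<close>.\<close>
      consider "t < \<tau>1" | "t > \<tau>2" | "t \<in> {T0<..<t0}" "x \<notin> cball x0 \<rho>" | "x \<in> cball x0 \<rho>" "x \<notin> \<Omega>"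
        | "t \<in> {T0<..<t0}" "x \<in> cball x0 \<rho>" "x \<in> \<Omega>" using \<tau> by force
      then show ?thesis
      proof cases
        case 1
        then show ?thesis using \<theta>(3) q
          by (intro exI[of _ "{..<\<tau>1} \<times> UNIV"]) (auto simp: \<zeta>_def open_Times)
      next
        case 2
        then show ?thesis using \<theta>(3) q
          by (intro exI[of _ "{\<tau>2<..} \<times> UNIV"]) (auto simp: \<zeta>_def open_Times)
      next
        case 3
        then show ?thesis using q
          by (intro exI[of _ "UNIV \<times> (- cball x0 \<rho>)"]) (auto simp: \<zeta>_def Qc_def intro!: open_Times open_Compl)
      next
        case 4
        then have "s x < d" using s_iff[of x] d by auto
        moreover have "open {x. s x < d}" by (intro open_Collect_less continuous_intros s_cont)
        ultimately show ?thesis using q d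
          by (intro exI[of _ "UNIV \<times> {x. s x < d}"]) (auto simp: \<zeta>_def sstep_eq open_Times)
      next
        case 5
        then have "q \<in> V" using False q V_lateral by (auto simp: Qc_def)
        then show ?thesis using V_open \<eta>_V
          by (intro exI[of _ V]) (auto simp: \<zeta>_def Qc_def)
      qed
    qed
    then obtain N where N: "open N" "q \<in> N" "\<And>q'. q' \<in> N \<Longrightarrow> \<zeta> \<theta> d q' = 0" by blast
    have "((\<lambda>_. 0) has_derivative (\<lambda>_. 0)) (at q)" by simp
    then have "(\<zeta> \<theta> d has_derivative (\<lambda>_. 0)) (at q)"
      by (rule has_derivative_transform_within_open[OF _ N(1,2)]) (simp add: N(3))
    then show ?thesis using False by (simp add: D\<zeta>_def)
  qed
  show "((\<lambda>h. \<zeta> \<theta> d (q + h *\<^sub>R v)) has_real_derivative D\<zeta> \<theta> \<theta>' d v q) (at 0)" for q v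
    by (rule has_derivative_line[OF deriv])
  show "continuous_on UNIV (\<zeta> \<theta> d)"
    by (intro continuous_at_imp_continuous_on ballI has_derivative_continuous[OF deriv])
  show "\<zeta> \<theta> d q = 0" if "q \<notin> {\<tau>1..\<tau>2} \<times> {x \<in> cball x0 \<rho>. d \<le> s x}" for q
  proof -
    have "fst q \<notin> {\<tau>1..\<tau>2} \<or> snd q \<notin> cball x0 \<rho> \<or> s (snd q) / d - 1 \<le> 0"
      using that d by (cases q) (auto simp: pos_divide_le_eq)
    then show ?thesis using \<theta>(3) sstep_eq(1) by (auto simp: \<zeta>_def Qc_def)
  qed
  have th_c: "continuous_on UNIV \<theta>"
    using DERIV_isCont[OF \<theta>(1)] continuous_at_imp_continuous_on by blast
  have tb: "bdd_on {T0..t0} \<theta>" "bdd_on {T0..t0} \<theta>'"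
    by (auto intro!: bdd_on_compact continuous_on_subset[OF th_c] continuous_on_subset[OF \<theta>(2)])
  have tb': "bdd_on Qc (\<lambda>q. \<theta> (fst q))" "bdd_on Qc (\<lambda>q. \<theta>' (fst q))"
    using tb unfolding bdd_on_def Qc_def by fastforce+
  have cst: "bdd_on Qc (\<lambda>q. c)" for c :: real by (rule bdd_onI[where M = "\<bar>c\<bar>"]) simp
  have "\<bar>sstep u\<bar> \<le> 1" "\<bar>dstep u\<bar> \<le> 2" for u
    using sstep_bounds[of u] dstep_nonneg[of u] dstep_le[of u] by auto
  then have sb: "bdd_on Qc (\<lambda>q. sstep (s (snd q) / d - 1))" "bdd_on Qc (\<lambda>q. dstep (s (snd q) / d - 1))"
    by (blast intro: bdd_onI)+
  have "bdd_on (cball x0 \<rho>) (\<lambda>x. Ds x \<bullet> v)" for v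
    by (intro bdd_on_compact compact_cball continuous_intros continuous_on_subset[OF Ds_cont]) auto
  then have db: "bdd_on Qc (\<lambda>q. Ds (snd q) \<bullet> v)" for v
    unfolding bdd_on_def Qc_def by fastforce
  show "bdd_on UNIV (D\<zeta> \<theta> \<theta>' d v)" for v
  proof -
    have "bdd_on Qc (\<lambda>q. fst v * \<theta>' (fst q) * (\<eta> q * \<eta> q) * sstep (s (snd q) / d - 1)
      + \<theta> (fst q) * (2 * \<eta> q * (grad \<eta> q \<bullet> v)) * sstep (s (snd q) / d - 1)
      + \<theta> (fst q) * (\<eta> q * \<eta> q) * (dstep (s (snd q) / d - 1) * (1 / d) * (Ds (snd q) \<bullet> snd v)))"
      by (intro bdd_on_add bdd_on_mult tb' cst sb db \<eta>_bdd)
    then obtain M where "\<And>q. q \<in> Qc \<Longrightarrow> \<bar>D\<zeta> \<theta> \<theta>' d v q\<bar> \<le> M"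
      unfolding bdd_on_def D\<zeta>_def by (auto simp: power2_eq_square)
    then have "\<bar>D\<zeta> \<theta> \<theta>' d v q\<bar> \<le> max M 0" for q
      by (cases "q \<in> Qc") (auto simp: D\<zeta>_def le_max_iff_disj)
    then show ?thesis by (intro bdd_onI)
  qed
qed

end

section \<open>Averages concentrating at a time\<close>

lemma integrable_bounded_support:
  fixes f :: "'b::euclidean_space \<Rightarrow> real"
  assumes "f \<in> borel_measurable borel" "\<And>q. \<bar>f q\<bar> \<le> M" "\<And>q. q \<notin> S \<Longrightarrow> f q = 0" "bounded S"
  shows "integrable lborel f"
proof -
  obtain R where "\<forall>x\<in>S. norm x \<le> R" using assms(4) unfolding bounded_iff ..
  then have R: "S \<subseteq> cball 0 R" by auto
  show ?thesis
  proof (rule Bochner_Integration.integrable_bound)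
    show "integrable lborel (\<lambda>q. M * indicator (cball (0::'b) R) q :: real)"
      using emeasure_bounded_finite[OF bounded_cball[of "0::'b" R]]
      by (intro integrable_mult_right integrable_real_indicator) auto
    show "AE q in lborel. norm (f q) \<le> norm (M * indicator (cball 0 R) q :: real)"
    proof (rule AE_I2)
      fix q
      show "norm (f q) \<le> norm (M * indicator (cball 0 R) q :: real)"
        using assms(2)[of q] assms(3)[of q] subsetD[OF R, of q] by (cases "q \<in> cball 0 R") (auto simp del: mem_cball)
    qed
  qed (use assms(1) in auto)
qed

text \<open>The substitution \<open>t = \<tau> + (u + c) / N\<close> freezes the weight as
  \<open>dstep u\<close> and moves the concentration into \<open>f\<close>. Convergence is asked for
  \<open>0 < u < 1\<close> only, where \<open>dstep\<close> lives; the shift \<open>c\<close>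
  decides how long after \<open>\<tau>\<close> the averaging begins.\<close>

lemma concentrating_average:
  fixes f :: "real \<times> 'a::euclidean_space \<Rightarrow> real"
  assumes f: "f \<in> borel_measurable borel" "\<And>q. \<bar>f q\<bar> \<le> M" "\<And>t x. x \<notin> S \<Longrightarrow> f (t, x) = 0" and S: "bounded S"
    and g: "\<And>u x. 0 < u \<Longrightarrow> u < 1 \<Longrightarrow> (\<lambda>n. f (\<tau> + (u + c) / real (Suc n), x)) \<longlonglongrightarrow> g x"
  shows "(\<lambda>n. LINT q|lborel. real (Suc n) * dstep (real (Suc n) * (fst q - \<tau>) - c) * f q) \<longlonglongrightarrow> integral\<^sup>L lborel g"
proof -
  define h where "h n q = dstep (fst q) * f (\<tau> + (fst q + c) / real (Suc n), snd q)" for n and q :: "real \<times> 'a"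
  have [measurable]: "f \<in> borel_measurable borel" "dstep \<in> borel_measurable borel"
    using f borel_measurable_continuous_onI[OF dstep_cont] by auto
  have M: "0 \<le> M" using f(2)[of undefined] by linarith
  have d2: "\<bar>dstep u\<bar> \<le> 2" for u using dstep_nonneg[of u] dstep_le[of u] by auto
  have dz: "dstep u = 0" if "u \<notin> {0<..<1}" for u using that dstep_eq_0[of u] by auto
  have hm[measurable]: "h n \<in> borel_measurable borel" for n
    unfolding h_def borel_prod[symmetric] by measurable
  have hb: "\<bar>h n q\<bar> \<le> 2 * M" for n q
    unfolding h_def abs_mult by (intro mult_mono d2 f(2)) auto
  have hs: "h n q = 0" if "q \<notin> {0..1} \<times> S" for n q
    using that f(3) dz by (cases q) (auto simp: h_def)
  have b01: "bounded ({0..1::real} \<times> S)" using S by (simp add: bounded_Times)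
  have gm: "g \<in> borel_measurable borel"
  proof (rule borel_measurable_LIMSEQ_real)
    show "(\<lambda>n. f (\<tau> + (1/2 + c) / real (Suc n), x)) \<longlonglongrightarrow> g x" for x by (rule g) auto
    show "(\<lambda>x. f (\<tau> + (1/2 + c) / real (Suc n), x)) \<in> borel_measurable borel" for n
      by measurable
  qed
  have hlim: "(\<lambda>n. h n q) \<longlonglongrightarrow> dstep (fst q) * g (snd q)" for q
  proof (cases "fst q \<in> {0<..<1}")
    case True
    then show ?thesis unfolding h_def by (intro tendsto_intros g) auto
  next
    case False
    then show ?thesis using dz by (simp add: h_def)
  qed
  obtain R where "\<forall>x\<in>{0..1::real} \<times> S. norm x \<le> R" using b01 unfolding bounded_iff ..
  then have R: "{0..1::real} \<times> S \<subseteq> cball 0 R" by (intro subsetI) (simp only: mem_cball_0)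
  have w: "integrable lborel (\<lambda>q::real \<times> 'a. 2 * M * indicator (cball 0 R) q)"
    using emeasure_bounded_finite[OF bounded_cball[of "0::real \<times> 'a" R]]
    by (intro integrable_mult_right integrable_real_indicator) auto
  have hw: "norm (h n q) \<le> 2 * M * indicator (cball 0 R) q" for n q
    using hb[of n q] hs[of q n] subsetD[OF R, of q] M by (cases "q \<in> cball 0 R") (auto simp del: mem_cball)
  have gm': "(\<lambda>q. dstep (fst q) * g (snd q)) \<in> borel_measurable borel"
    by (rule borel_measurable_LIMSEQ_real[OF hlim hm])
  have gi: "integrable lborel (\<lambda>q. dstep (fst q) * g (snd q))"
    by (rule integrable_dominated_convergence[where s = h and w = "\<lambda>q. 2 * M * indicator (cball 0 R) q"])
       (use hlim hw w gm' in auto)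
  have lim: "(\<lambda>n. integral\<^sup>L lborel (h n)) \<longlonglongrightarrow> (LINT q|lborel. dstep (fst q) * g (snd q))"
    by (rule integral_dominated_convergence[where w = "\<lambda>q. 2 * M * indicator (cball 0 R) q"])
       (use hlim hw w gm' in auto)
  have prod: "(LINT q|lborel. F q) = (LINT x|lborel. LINT t|lborel. F (t, x))"
    if "integrable lborel F" for F :: "real \<times> 'a \<Rightarrow> real"
    using lborel_pair.integral_snd[of "\<lambda>t x. F (t, x)"] that by (simp add: lborel_prod)
  have "(LINT q|lborel. dstep (fst q) * g (snd q)) = integral\<^sup>L lborel g"
    using prod[OF gi] integral_dstep by simp
  moreover have "(LINT q|lborel. real (Suc n) * dstep (real (Suc n) * (fst q - \<tau>) - c) * f q) = integral\<^sup>L lborel (h n)" for n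
  proof -
    define N where "N = real (Suc n)"
    have N: "N > 0" by (simp add: N_def)
    let ?F = "\<lambda>q. N * dstep (N * (fst q - \<tau>) - c) * f q"
    have "integrable lborel ?F"
    proof (rule integrable_bounded_support)
      have [measurable]: "f \<in> borel_measurable (borel \<Otimes>\<^sub>M borel)" using f(1) by (simp add: borel_prod)
      show "?F \<in> borel_measurable borel" unfolding borel_prod[symmetric] by measurable
      show "\<bar>?F q\<bar> \<le> N * 2 * M" for q
        unfolding abs_mult using N by (intro mult_mono d2 f(2)) auto
      show "?F q = 0" if "q \<notin> {\<tau> + c / N .. \<tau> + (1 + c) / N} \<times> S" for q
      proof -
        obtain t x where q: "q = (t, x)" by (cases q)
        have "dstep (N * (t - \<tau>) - c) = 0" if t: "t \<notin> {\<tau> + c / N .. \<tau> + (1 + c) / N}"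
          using t N by (intro dz) (auto simp: field_simps)
        then show ?thesis using that q f(3) by auto
      qed
      show "bounded ({\<tau> + c / N .. \<tau> + (1 + c) / N} \<times> S)" using S by (simp add: bounded_Times)
    qed
    then have "(LINT q|lborel. ?F q) = (LINT x|lborel. LINT t|lborel. ?F (t, x))" by (rule prod)
    also have "\<dots> = (LINT x|lborel. LINT u|lborel. h n (u, x))"
    proof (rule arg_cong[where f = "integral\<^sup>L lborel"], rule ext)
      fix x
      have key: "?F ((\<tau> + c / N) + (1 / N) * u, x) = N * h n (u, x)" for u
      proof -
        have e1: "N * ((\<tau> + c / N) + (1 / N) * u - \<tau>) - c = u" using N by (simp add: field_simps)
        have e2: "(\<tau> + c / N) + (1 / N) * u = \<tau> + (u + c) / N" using N by (simp add: field_simps)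
        show ?thesis by (simp only: fst_conv snd_conv h_def e1 N_def[symmetric] mult.assoc) (simp only: e2)
      qed
      have "(LINT t|lborel. ?F (t, x)) = \<bar>1 / N\<bar> *\<^sub>R (LINT u|lborel. ?F ((\<tau> + c / N) + (1 / N) * u, x))"
        by (rule lborel_integral_real_affine) (use N in simp)
      also have "\<dots> = \<bar>1 / N\<bar> *\<^sub>R (LINT u|lborel. N * h n (u, x))" by (simp only: key)
      finally show "(LINT t|lborel. ?F (t, x)) = (LINT u|lborel. h n (u, x))" using N by simp
    qed
    also have "\<dots> = integral\<^sup>L lborel (h n)"
      by (rule prod[symmetric], rule integrable_bounded_support[OF hm hb hs b01])
    finally show ?thesis by (simp add: N_def)
  qed
  ultimately show ?thesis using lim by simp
qed

text \<open>The two boundary assumptions balance each other: \<open>layer\<close> bounds the measure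
  of a strip of height \<open>d\<close> by a multiple of \<open>d\<close>, which compensates the
  factor \<open>1 / d\<close> in the gradient of the boundary cutoff, and \<open>flux\<close> makes
  the product small.\<close>

locale cylinder_flow =
  root_flow Q I a b z G F B \<delta> + cylinder_cutoff \<Omega> x0 \<rho> T0 t0 \<eta> s Ds V
  for Q :: "(real \<times> 'a::euclidean_space) set" and I a b z G F B \<delta> and \<Omega> :: "'a set" and x0 \<rho> T0 t0 \<eta> s Ds V +
  fixes i :: nat and \<kappa> c C \<epsilon> \<alpha>1 CL :: real and \<alpha> :: "nat \<Rightarrow> real \<times> 'a \<Rightarrow> real"
  assumes i: "i \<in> I"
    and F_eq: "\<And>j q. j \<in> I \<Longrightarrow> q \<in> Q \<Longrightarrow> F j q = \<alpha> j q *\<^sub>R G j q"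
    and B_eq: "\<And>j q. j \<in> I \<Longrightarrow> q \<in> Q \<Longrightarrow> B j q = (\<Sum>k\<in>I - {j}. (\<alpha> j q + \<alpha> k q) / (z j q - z k q) * (G j q \<bullet> G k q))"
    and \<alpha>_bd: "\<And>j q. j \<in> I \<Longrightarrow> q \<in> Q \<Longrightarrow> 0 \<le> \<alpha> j q \<and> \<alpha> j q \<le> \<alpha>1"
    and cst: "c > 0" "C > 0" "\<epsilon> > 0" and \<alpha>1: "0 \<le> \<alpha>1" and CL: "0 \<le> CL"
    and en_ge: "\<And>w. w \<in> X \<Longrightarrow> c * (max 0 (w i - \<kappa>))\<^sup>2 \<le> en i \<epsilon> (heaviside \<kappa>) w"
    and en_le: "\<And>w. w \<in> X \<Longrightarrow> en i \<epsilon> (heaviside \<kappa>) w \<le> C * (max 0 (w i - \<kappa>))\<^sup>2"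
    and en_form: "\<And>q. q \<in> Q \<Longrightarrow>
      c * (heaviside \<kappa> (z i q) * (norm (G i q))\<^sup>2 + \<epsilon> * (max 0 (z i q - \<kappa>))\<^sup>2 * (\<Sum>k\<in>I - {i}. (norm (G k q))\<^sup>2))
      \<le> (\<Sum>j\<in>I. en1 i \<epsilon> (heaviside \<kappa>) j (\<lambda>j. z j q) * (\<Sum>k\<in>I - {j}. (\<alpha> j q + \<alpha> k q) / (z j q - z k q) * (G j q \<bullet> G k q)))
        + (\<Sum>j\<in>I. \<Sum>k\<in>I. en2 i \<epsilon> (heaviside \<kappa>) j k (\<lambda>j. z j q) * (G k q \<bullet> (\<alpha> j q *\<^sub>R G j q)))"
    and en_cut: "\<And>q \<eta> v. q \<in> Q \<Longrightarrow>
      2 * \<eta> * \<bar>\<Sum>j\<in>I. en1 i \<epsilon> (heaviside \<kappa>) j (\<lambda>j. z j q) * ((\<alpha> j q *\<^sub>R G j q) \<bullet> v)\<bar>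
      \<le> c / 2 * (\<eta>\<^sup>2 * (heaviside \<kappa> (z i q) * (norm (G i q))\<^sup>2 + \<epsilon> * (max 0 (z i q - \<kappa>))\<^sup>2 * (\<Sum>k\<in>I - {i}. (norm (G k q))\<^sup>2)))
        + C * ((max 0 (z i q - \<kappa>))\<^sup>2 * (norm v)\<^sup>2)"
    and en1_le: "\<And>w j. w \<in> X \<Longrightarrow> j \<in> I \<Longrightarrow> \<bar>en1 i \<epsilon> (heaviside \<kappa>) j w\<bar> \<le> C"
    and cyl_sub: "{T0<..<t0} \<times> (cball x0 \<rho> \<inter> \<Omega>) \<subseteq> Q"
    and G_bdd: "\<And>j. j \<in> I \<Longrightarrow> bdd_on ({T0<..<t0} \<times> (ball x0 \<rho> \<inter> \<Omega>)) (\<lambda>q. norm (G j q))"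
    and flux: "\<And>e. e > 0 \<Longrightarrow> \<exists>d>0. \<forall>j\<in>I. \<forall>t\<in>{T0<..<t0}. \<forall>x\<in>ball x0 \<rho> \<inter> \<Omega>. s x < d \<longrightarrow> \<bar>G j (t, x) \<bullet> Ds x\<bar> < e"
    and layer: "\<And>d. d > 0 \<Longrightarrow> emeasure lborel {x \<in> ball x0 \<rho> \<inter> \<Omega>. s x < d} \<le> ennreal (CL * d)"
begin

definition "rr q = max 0 (z i q - \<kappa>)"
definition "DD q = heaviside \<kappa> (z i q) * (norm (G i q))\<^sup>2 + \<epsilon> * (rr q)\<^sup>2 * (\<Sum>k\<in>I - {i}. (norm (G k q))\<^sup>2)"
definition "cc q = (rr q)\<^sup>2 * ((norm (snd (grad \<eta> q)))\<^sup>2 + \<eta> q * \<bar>fst (grad \<eta> q)\<bar>)"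

text \<open>Bounded convergence of a constant sequence means measurable and bounded on the cylinder;
  this encoding inherits the closure under sums and products.\<close>

definition "bm f \<longleftrightarrow> bounded_conv Qc (\<lambda>n. f) f" for f

lemma bmI: "f \<in> borel_measurable (restrict_space borel Qc) \<Longrightarrow> bdd_on Qc f \<Longrightarrow> bm f"
  unfolding bm_def bdd_on_def by (auto intro: bounded_conv_const)

lemma bm_cont: "continuous_on Qc f \<Longrightarrow> bdd_on Qc f \<Longrightarrow> bm f"
  by (intro bmI borel_measurable_continuous_on_restrict)

lemma bm_bdd: "bm f \<Longrightarrow> bdd_on Qc f"
  by (auto simp: bm_def bounded_conv_def bdd_on_def)

lemma bm_add: "bm f \<Longrightarrow> bm g \<Longrightarrow> bm (\<lambda>q. f q + g q)"
  and bm_diff: "bm f \<Longrightarrow> bm g \<Longrightarrow> bm (\<lambda>q. f q - g q)"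
  and bm_mult: "bm f \<Longrightarrow> bm g \<Longrightarrow> bm (\<lambda>q. f q * g q)"
  unfolding bm_def by (intro bounded_conv_intros; assumption)+

lemma bm_sum: "(\<And>k. k \<in> A \<Longrightarrow> bm (f k)) \<Longrightarrow> bm (\<lambda>q. \<Sum>k\<in>A. f k q)"
  unfolding bm_def by (rule bounded_conv_sum)

lemma bm_const: "bm (\<lambda>q. k)"
  by (rule bmI) (auto intro: bdd_onI[where M = "\<bar>k\<bar>"])

lemma Qc_sub: "Qc \<subseteq> Q" using cyl_sub unfolding Qc_def by auto

lemma Qc_bounded: "bounded Qc"
  unfolding Qc_def by (intro bounded_Times bounded_Int) auto

lemma Qc_borel: "Qc \<in> sets borel" and Qc_finite: "emeasure lborel Qc < \<infinity>"
  using Qc_open emeasure_bounded_finite[OF Qc_bounded] by auto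

lemma bm_integrable: "bm f \<Longrightarrow> set_integrable lborel Qc f"
  using bounded_conv_integral(1)[OF _ Qc_borel Qc_finite] by (simp add: bm_def)

lemma \<eta>_cont: "continuous_on Qc \<eta>"
  by (intro continuous_at_imp_continuous_on ballI differentiable_imp_continuous_within \<eta>_diff)
     (simp add: Qc_def)

lemma bm_\<eta>: "bm \<eta>" "bm (\<lambda>q. (\<eta> q)\<^sup>2)"
  using bm_cont[OF \<eta>_cont \<eta>_bdd(2)] bm_mult[of \<eta> \<eta>] by (auto simp: power2_eq_square)

lemma z_cont_Qc: "j \<in> I \<Longrightarrow> continuous_on Qc (z j)"
  using z_cont Qc_sub continuous_on_subset by blast

lemma z_X: "q \<in> Qc \<Longrightarrow> (\<lambda>j. z j q) \<in> X"
  using z_box Qc_sub by blast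

lemma z_bdd: "j \<in> I \<Longrightarrow> bdd_on Qc (z j)"
proof -
  assume j: "j \<in> I"
  have "\<bar>z j q\<bar> \<le> \<bar>a j\<bar> + \<bar>b j\<bar>" if "q \<in> Qc" for q
    using X_D[OF z_X[OF that] j] by linarith
  then show ?thesis by (rule bdd_onI)
qed

lemma rr_cont: "continuous_on Qc rr"
  unfolding rr_def by (intro continuous_intros z_cont_Qc i)

lemma bm_rr: "bm rr" "bm (\<lambda>q. (rr q)\<^sup>2)"
proof -
  obtain M where M: "\<And>q. q \<in> Qc \<Longrightarrow> \<bar>z i q\<bar> \<le> M" using z_bdd[OF i] by (auto simp: bdd_on_def)
  have "\<bar>rr q\<bar> \<le> M + \<bar>\<kappa>\<bar>" if "q \<in> Qc" for q
    using M[OF that] by (auto simp: rr_def)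
  then show "bm rr" by (intro bm_cont rr_cont bdd_onI)
  from bm_mult[OF this this] show "bm (\<lambda>q. (rr q)\<^sup>2)" by (simp add: power2_eq_square)
qed

lemma bm_G: "j \<in> I \<Longrightarrow> bm (\<lambda>q. (norm (G j q))\<^sup>2)"
proof -
  assume j: "j \<in> I"
  have "bm (\<lambda>q. norm (G j q))"
    using G_bdd[OF j] continuous_on_subset[OF G_cont[OF j] Qc_sub]
    by (intro bm_cont continuous_on_norm) (auto simp: Qc_def)
  from bm_mult[OF this this] show ?thesis by (simp add: power2_eq_square)
qed

lemma bm_DD: "bm DD"
proof -
  have "heaviside \<kappa> \<circ> z i \<in> borel_measurable (restrict_space borel Qc)"
    using borel_measurable_continuous_on_restrict[OF z_cont_Qc[OF i]] heaviside_measurable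
    by (rule measurable_comp)
  then have "bm (\<lambda>q. heaviside \<kappa> (z i q))"
    using heaviside_bound(1) by (intro bmI bdd_onI[where M = 1]) (auto simp: o_def)
  then show ?thesis
    unfolding DD_def by (intro bm_add bm_mult bm_sum bm_const bm_rr bm_G i) auto
qed

lemma bm_cc: "bm cc"
proof -
  obtain M where M: "\<And>q. q \<in> Qc \<Longrightarrow> norm (grad \<eta> q) \<le> M"
    using \<eta>_grad_bdd unfolding Qc_def by blast
  have le: "norm (snd p) \<le> norm p" "\<bar>fst p\<bar> \<le> norm p" for p :: "real \<times> 'a"
    using norm_snd_le[of "snd p" "fst p"] norm_fst_le[of "fst p" "snd p"] by simp_all
  have b: "bdd_on Qc (\<lambda>q. norm (snd (grad \<eta> q)))" "bdd_on Qc (\<lambda>q. \<bar>fst (grad \<eta> q)\<bar>)"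
    using order_trans[OF le(1) M] order_trans[OF le(2) M] by (auto intro!: bdd_onI[where M = M])
  have gc: "continuous_on Qc (grad \<eta>)" using \<eta>_grad_cont by (simp add: Qc_def)
  have 1: "bm (\<lambda>q. norm (snd (grad \<eta> q)))" "bm (\<lambda>q. \<bar>fst (grad \<eta> q)\<bar>)"
    by (intro bm_cont b continuous_intros gc)+
  have "bm (\<lambda>q. (rr q)\<^sup>2 * (norm (snd (grad \<eta> q)) * norm (snd (grad \<eta> q)) + \<eta> q * \<bar>fst (grad \<eta> q)\<bar>))"
    by (intro bm_mult bm_add bm_rr bm_\<eta> 1)
  then show ?thesis by (simp add: cc_def[abs_def] power2_eq_square[of "norm _"])
qed

lemma DD_nonneg: "0 \<le> DD q"
  unfolding DD_def using heaviside_bound(2) cst by (intro add_nonneg_nonneg mult_nonneg_nonneg sum_nonneg) auto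

lemma cc_nonneg: "q \<in> Qc \<Longrightarrow> 0 \<le> cc q"
  unfolding cc_def using \<eta>01[of q] by (intro mult_nonneg_nonneg add_nonneg_nonneg) (auto simp: Qc_def)

lemma bm_time: "continuous_on UNIV f \<Longrightarrow> bm (\<lambda>q. f (fst q))"
proof -
  assume f: "continuous_on UNIV f"
  have "bdd_on {T0..t0} f" by (intro bdd_on_compact continuous_on_subset[OF f]) auto
  then have "bdd_on Qc (\<lambda>q. f (fst q))" unfolding bdd_on_def Qc_def by fastforce
  moreover have "continuous_on Qc (\<lambda>q. f (fst q))"
    by (rule continuous_on_compose2[OF f]) (auto intro: continuous_intros)
  ultimately show ?thesis by (intro bm_cont)
qed

text \<open>The energy is only comparable to \<open>r\<^sup>2\<close>, so the time derivative of the
  weight is split: where it rises, by \<open>p\<close>, the upper bound is used, and where it falls,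
  by \<open>m\<close>, the lower one. Half of the dissipation pays for the gradient of
  \<open>\<eta>\<close>; the last summand is the flux through the boundary layer.\<close>

lemma integrand_le:
  assumes \<theta>: "\<theta> (fst q) \<ge> 0" "\<theta>' (fst q) = p - m" "p \<ge> 0" "m \<ge> 0" and d: "d > 0" and q: "q \<in> Qc"
  shows "energy_integrand (\<zeta> \<theta> d) (D\<zeta> \<theta> \<theta>' d) (en i \<epsilon> (heaviside \<kappa>)) (en1 i \<epsilon> (heaviside \<kappa>)) (en2 i \<epsilon> (heaviside \<kappa>)) q
    \<le> sstep (s (snd q) / d - 1) * (C * p * ((\<eta> q)\<^sup>2 * (rr q)\<^sup>2) - c * m * ((\<eta> q)\<^sup>2 * (rr q)\<^sup>2)
          + 2 * C * (\<theta> (fst q) * cc q) - c / 2 * (\<theta> (fst q) * ((\<eta> q)\<^sup>2 * DD q)))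
      + \<theta> (fst q) * (dstep (s (snd q) / d - 1) / d) * (C * \<alpha>1 * (\<Sum>j\<in>I. \<bar>G j q \<bullet> Ds (snd q)\<bar>))"
proof -
  have qQ: "q \<in> Q" using q Qc_sub by auto
  let ?w = "\<lambda>j. z j q" and ?H = "heaviside \<kappa>" and ?\<chi> = "sstep (s (snd q) / d - 1)" and ?th = "\<theta> (fst q)"
    and ?ds = "dstep (s (snd q) / d - 1) / d"
  let ?E = "en i \<epsilon> ?H ?w" and ?e1 = "\<lambda>j. en1 i \<epsilon> ?H j ?w" and ?e2 = "\<lambda>j k. en2 i \<epsilon> ?H j k ?w"
  define \<eta>t where "\<eta>t = fst (grad \<eta> q)"
  define \<eta>x where "\<eta>x = snd (grad \<eta> q)"
  have et: "0 \<le> \<eta> q" "\<eta> q \<le> 1" using \<eta>01[of q] q by (auto simp: Qc_def)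
  define Qf where "Qf = (\<Sum>j\<in>I. ?e1 j * B j q) + (\<Sum>j\<in>I. \<Sum>k\<in>I. ?e2 j k * (G k q \<bullet> F j q))"
  define L where "L = (\<Sum>j\<in>I. ?e1 j * (F j q \<bullet> \<eta>x))"
  define L' where "L' = (\<Sum>j\<in>I. ?e1 j * (F j q \<bullet> Ds (snd q)))"
  have g0: "grad \<eta> q \<bullet> (1, 0) = \<eta>t" "grad \<eta> q \<bullet> (0, bb) = \<eta>x \<bullet> bb" for bb
    by (cases "grad \<eta> q"; simp add: \<eta>t_def \<eta>x_def)+
  have sumF: "(\<Sum>b\<in>Basis. (F j q \<bullet> b) * D\<zeta> \<theta> \<theta>' d (0, b) q)
      = ?th * (2 * \<eta> q) * ?\<chi> * (F j q \<bullet> \<eta>x) + ?th * (\<eta> q)\<^sup>2 * ?ds * (F j q \<bullet> Ds (snd q))" for j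
  proof -
    have "(\<Sum>b\<in>Basis. (F j q \<bullet> b) * D\<zeta> \<theta> \<theta>' d (0, b) q)
        = ?th * (2 * \<eta> q) * ?\<chi> * (\<Sum>b\<in>Basis. (F j q \<bullet> b) * (\<eta>x \<bullet> b))
          + ?th * (\<eta> q)\<^sup>2 * ?ds * (\<Sum>b\<in>Basis. (F j q \<bullet> b) * (Ds (snd q) \<bullet> b))"
      unfolding sum_distrib_left sum.distrib[symmetric] using q
      by (intro sum.cong refl) (simp add: D\<zeta>_def g0 algebra_simps)
    then show ?thesis by (simp only: euclidean_inner[symmetric])
  qed
  have "energy_integrand (\<zeta> \<theta> d) (D\<zeta> \<theta> \<theta>' d) (en i \<epsilon> ?H) (en1 i \<epsilon> ?H) (en2 i \<epsilon> ?H) q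
      = ?E * ((p - m) * (\<eta> q)\<^sup>2 * ?\<chi> + ?th * (2 * \<eta> q * \<eta>t) * ?\<chi>)
        - ?th * (\<eta> q)\<^sup>2 * ?\<chi> * Qf - (?th * (2 * \<eta> q) * ?\<chi> * L + ?th * (\<eta> q)\<^sup>2 * ?ds * L')"
    unfolding energy_integrand_def sumF using q
    by (simp add: Qf_def L_def L'_def D\<zeta>_def \<zeta>_def g0 \<theta>(2) sum_distrib_left sum.distrib distrib_left mult_ac)
  also have "\<dots> \<le> ?\<chi> * (C * p * ((\<eta> q)\<^sup>2 * (rr q)\<^sup>2) - c * m * ((\<eta> q)\<^sup>2 * (rr q)\<^sup>2)
          + 2 * C * (?th * cc q) - c / 2 * (?th * ((\<eta> q)\<^sup>2 * DD q)))
      + ?th * ?ds * (C * \<alpha>1 * (\<Sum>j\<in>I. \<bar>G j q \<bullet> Ds (snd q)\<bar>))"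
  proof -
    have E: "c * (rr q)\<^sup>2 \<le> ?E" "?E \<le> C * (rr q)\<^sup>2"
      using en_ge[OF z_X[OF q]] en_le[OF z_X[OF q]] by (auto simp: rr_def)
    then have E0: "0 \<le> ?E" using cst by (meson less_imp_le mult_nonneg_nonneg order_trans zero_le_power2)
    have "?E * (p * (\<eta> q)\<^sup>2) \<le> C * (rr q)\<^sup>2 * (p * (\<eta> q)\<^sup>2)" "c * (rr q)\<^sup>2 * (m * (\<eta> q)\<^sup>2) \<le> ?E * (m * (\<eta> q)\<^sup>2)"
      using E \<theta> by (intro mult_right_mono; simp)+
    then have 1: "?E * ((p - m) * (\<eta> q)\<^sup>2) \<le> C * p * ((\<eta> q)\<^sup>2 * (rr q)\<^sup>2) - c * m * ((\<eta> q)\<^sup>2 * (rr q)\<^sup>2)"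
      by (simp add: algebra_simps)
    have "?E * (2 * \<eta> q * \<eta>t) \<le> ?E * (2 * \<eta> q * \<bar>\<eta>t\<bar>)" using E0 et by (intro mult_left_mono) auto
    also have "\<dots> \<le> C * (rr q)\<^sup>2 * (2 * \<eta> q * \<bar>\<eta>t\<bar>)" using E et by (intro mult_right_mono) auto
    finally have 2: "?E * (2 * \<eta> q * \<eta>t) \<le> 2 * C * ((rr q)\<^sup>2 * (\<eta> q * \<bar>\<eta>t\<bar>))" by (simp add: mult_ac)
    have 3: "c * DD q \<le> Qf"
      using en_form[OF qQ] F_eq[OF _ qQ] B_eq[OF _ qQ] by (simp add: Qf_def DD_def rr_def)
    have LF: "L = (\<Sum>j\<in>I. ?e1 j * ((\<alpha> j q *\<^sub>R G j q) \<bullet> \<eta>x))"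
      unfolding L_def by (rule sum.cong) (auto simp: F_eq[OF _ qQ])
    have "- (2 * \<eta> q * L) \<le> 2 * \<eta> q * \<bar>L\<bar>"
      using mult_left_mono[of "- L" "\<bar>L\<bar>" "2 * \<eta> q"] et by simp
    also have "\<dots> \<le> c / 2 * ((\<eta> q)\<^sup>2 * DD q) + C * ((rr q)\<^sup>2 * (norm \<eta>x)\<^sup>2)"
      unfolding LF using en_cut[OF qQ, of "\<eta> q" \<eta>x] by (simp add: DD_def rr_def)
    finally have 4: "- (2 * \<eta> q * L) \<le> c / 2 * ((\<eta> q)\<^sup>2 * DD q) + C * ((rr q)\<^sup>2 * (norm \<eta>x)\<^sup>2)" .
    have rx: "C * ((rr q)\<^sup>2 * (norm \<eta>x)\<^sup>2) \<le> 2 * C * ((rr q)\<^sup>2 * (norm \<eta>x)\<^sup>2)" using cst by simp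
    have "\<bar>L'\<bar> \<le> (\<Sum>j\<in>I. C * (\<alpha>1 * \<bar>G j q \<bullet> Ds (snd q)\<bar>))"
      unfolding L'_def
    proof (rule order_trans[OF sum_abs], rule sum_mono)
      fix j assume j: "j \<in> I"
      have "\<bar>?e1 j * (F j q \<bullet> Ds (snd q))\<bar> = \<bar>?e1 j\<bar> * (\<bar>\<alpha> j q\<bar> * \<bar>G j q \<bullet> Ds (snd q)\<bar>)"
        by (simp add: F_eq[OF j qQ] abs_mult)
      also have "\<dots> \<le> C * (\<alpha>1 * \<bar>G j q \<bullet> Ds (snd q)\<bar>)"
        using \<alpha>_bd[OF j qQ] cst by (intro mult_mono en1_le z_X q j) auto
      finally show "\<bar>?e1 j * (F j q \<bullet> Ds (snd q))\<bar> \<le> C * (\<alpha>1 * \<bar>G j q \<bullet> Ds (snd q)\<bar>)" .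
    qed
    then have L': "\<bar>L'\<bar> \<le> C * \<alpha>1 * (\<Sum>j\<in>I. \<bar>G j q \<bullet> Ds (snd q)\<bar>)"
      by (simp add: sum_distrib_left mult.assoc)
    have ds0: "0 \<le> ?ds" using dstep_nonneg d by simp
    have "(\<eta> q)\<^sup>2 \<le> 1" using et by (simp add: power_le_one)
    then have "(\<eta> q)\<^sup>2 * \<bar>L'\<bar> \<le> 1 * \<bar>L'\<bar>" by (rule mult_right_mono) simp
    then have "(\<eta> q)\<^sup>2 * - L' \<le> 1 * \<bar>L'\<bar>"
      using mult_left_mono[OF abs_ge_minus_self, of "(\<eta> q)\<^sup>2" L'] by simp
    then have "?th * ?ds * ((\<eta> q)\<^sup>2 * - L') \<le> ?th * ?ds * (C * \<alpha>1 * (\<Sum>j\<in>I. \<bar>G j q \<bullet> Ds (snd q)\<bar>))"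
      using L' \<theta>(1) ds0 by (intro mult_left_mono mult_nonneg_nonneg) auto
    then have 5: "- (?th * (\<eta> q)\<^sup>2 * ?ds * L') \<le> ?th * ?ds * (C * \<alpha>1 * (\<Sum>j\<in>I. \<bar>G j q \<bullet> Ds (snd q)\<bar>))"
      by (simp add: mult_ac)
    have "(\<eta> q)\<^sup>2 * (c * DD q) \<le> (\<eta> q)\<^sup>2 * Qf" by (intro mult_left_mono 3) simp
    then have "?E * (2 * \<eta> q * \<eta>t) - (\<eta> q)\<^sup>2 * Qf - 2 * \<eta> q * L \<le> 2 * C * cc q - c / 2 * ((\<eta> q)\<^sup>2 * DD q)"
      using 2 4 rx unfolding cc_def \<eta>t_def[symmetric] \<eta>x_def[symmetric] by (simp add: algebra_simps)
    from mult_left_mono[OF this \<theta>(1)]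
    have 6: "?th * (?E * (2 * \<eta> q * \<eta>t) - (\<eta> q)\<^sup>2 * Qf - 2 * \<eta> q * L) \<le> ?th * (2 * C * cc q - c / 2 * ((\<eta> q)\<^sup>2 * DD q))" .
    have 7: "?\<chi> * (?E * ((p - m) * (\<eta> q)\<^sup>2) + ?th * (?E * (2 * \<eta> q * \<eta>t) - (\<eta> q)\<^sup>2 * Qf - 2 * \<eta> q * L))
       \<le> ?\<chi> * (C * p * ((\<eta> q)\<^sup>2 * (rr q)\<^sup>2) - c * m * ((\<eta> q)\<^sup>2 * (rr q)\<^sup>2) + ?th * (2 * C * cc q - c / 2 * ((\<eta> q)\<^sup>2 * DD q)))"
      by (intro mult_left_mono add_mono 1 6 sstep_bounds)
    have alg1: "E * ((p - m) * e * ch + th * (2 * h * t) * ch) - th * e * ch * Qf - (th * (2 * h) * ch * L + th * e * ds * L')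
        = ch * (E * ((p - m) * e) + th * (E * (2 * h * t) - e * Qf - 2 * h * L)) + - (th * e * ds * L')"
      for E p m e ch th h t ds :: real by (simp add: algebra_simps)
    have alg2: "u - v + 2 * C * (th * x) - c / 2 * (th * (e * y)) = u - v + th * (2 * C * x - c / 2 * (e * y))"
      for u v th x e y :: real by (simp add: algebra_simps)
    show ?thesis unfolding alg1 alg2 by (rule add_mono) fact+
  qed
  finally show ?thesis .
qed

end

context cylinder_flow
begin

text \<open>A factor of size \<open>1 / d\<close> on a layer of measure of order \<open>d\<close>
  leaves a fixed multiple of the flux, which is below \<open>e\<close> near the boundary.\<close>

lemma layer_integral_small:
  assumes e: "e > 0" and \<theta>: "\<And>t. \<bar>\<theta> t\<bar> \<le> Th"
  shows "\<exists>d0>0. \<forall>d. 0 < d \<and> d < d0 \<longrightarrow>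
     \<bar>LINT q:Qc|lborel. \<theta> (fst q) * (dstep (s (snd q) / d - 1) / d) * (C * \<alpha>1 * (\<Sum>j\<in>I. \<bar>G j q \<bullet> Ds (snd q)\<bar>))\<bar>
       \<le> Th * 2 * C * \<alpha>1 * real (card I) * e * (2 * CL) * (t0 - T0)"
proof -
  obtain d0 where d0: "d0 > 0" "\<And>j t x. j \<in> I \<Longrightarrow> t \<in> {T0<..<t0} \<Longrightarrow> x \<in> ball x0 \<rho> \<inter> \<Omega> \<Longrightarrow> s x < d0 \<Longrightarrow> \<bar>G j (t, x) \<bullet> Ds x\<bar> < e"
    using flux[OF e] by blast
  have Th: "Th \<ge> 0" using \<theta>[of 0] by linarith
  let ?g = "\<lambda>d q. \<theta> (fst q) * (dstep (s (snd q) / d - 1) / d) * (C * \<alpha>1 * (\<Sum>j\<in>I. \<bar>G j q \<bullet> Ds (snd q)\<bar>))"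
  have "\<bar>LINT q:Qc|lborel. ?g d q\<bar> \<le> Th * 2 * C * \<alpha>1 * real (card I) * e * (2 * CL) * (t0 - T0)"
    if d: "0 < d" "d < d0 / 2" for d
  proof -
    \<comment> \<open>The gradient of the boundary factor lives below height \<open>2 * d\<close>,
      whence the restriction \<open>d < d0 / 2\<close>.\<close>
    define L where "L = {x \<in> ball x0 \<rho> \<inter> \<Omega>. s x < 2 * d}"
    define P where "P = Th * (2 / d) * (C * \<alpha>1 * (real (card I) * e))"
    have P: "P \<ge> 0" using Th d cst \<alpha>1 e by (simp add: P_def)
    have Lb: "L \<in> sets borel"
    proof -
      have "L = (ball x0 \<rho> \<inter> \<Omega>) \<inter> {x. s x < 2 * d}" by (auto simp: L_def)
      moreover have "open {x. s x < 2 * d}" by (intro open_Collect_less continuous_intros s_cont)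
      ultimately show ?thesis using \<Omega>_open by auto
    qed
    have Le: "emeasure lborel L \<le> ennreal (CL * (2 * d))" unfolding L_def by (rule layer) (use d in simp)
    have Pb: "({T0<..<t0} \<times> L) \<in> sets lborel"
      using Lb by (simp add: borel_Times)
    have Pe: "emeasure lborel ({T0<..<t0} \<times> L) \<le> ennreal ((t0 - T0) * (CL * (2 * d)))"
    proof -
      have "emeasure lborel ({T0<..<t0} \<times> L) = emeasure lborel {T0<..<t0} * emeasure lborel L"
        using lborel.emeasure_pair_measure_Times[of "{T0<..<t0}" lborel L] Lb by (simp add: lborel_prod)
      also have "\<dots> \<le> ennreal (t0 - T0) * ennreal (CL * (2 * d))"
        using Le T0 by (intro mult_mono) auto
      finally show ?thesis using T0 CL d by (simp add: ennreal_mult)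
    qed
    then have Pf: "emeasure lborel ({T0<..<t0} \<times> L) < \<infinity>"
      using order_le_less_trans by fastforce
    have Pm: "measure lborel ({T0<..<t0} \<times> L) \<le> (t0 - T0) * (CL * (2 * d))"
      unfolding measure_def using T0 CL d by (intro enn2real_leI Pe) auto
    have pw: "\<bar>indicator Qc q *\<^sub>R ?g d q\<bar> \<le> P * indicator ({T0<..<t0} \<times> L) q" for q
    proof (cases "q \<in> Qc")
      case True
      obtain t x where q: "q = (t, x)" by (cases q)
      have tx: "t \<in> {T0<..<t0}" "x \<in> ball x0 \<rho> \<inter> \<Omega>" using True q by (auto simp: Qc_def)
      show ?thesis
      proof (cases "s x < 2 * d")
        case s: True
        have "(\<Sum>j\<in>I. \<bar>G j q \<bullet> Ds x\<bar>) \<le> (\<Sum>j\<in>I. e)"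
          using d0(2)[OF _ tx] s d q by (intro sum_mono less_imp_le) auto
        then have 1: "C * \<alpha>1 * (\<Sum>j\<in>I. \<bar>G j q \<bullet> Ds x\<bar>) \<le> C * \<alpha>1 * (real (card I) * e)"
          using cst \<alpha>1 by (intro mult_left_mono) auto
        have 0: "0 \<le> C * \<alpha>1 * (\<Sum>j\<in>I. \<bar>G j q \<bullet> Ds x\<bar>)" using cst \<alpha>1 by (simp add: sum_nonneg)
        have 2: "\<bar>dstep (s x / d - 1) / d\<bar> \<le> 2 / d"
          using dstep_le dstep_nonneg d by (simp add: divide_right_mono)
        have "\<bar>?g d q\<bar> \<le> Th * (2 / d) * (C * \<alpha>1 * (real (card I) * e))"
          unfolding abs_mult[of "_ * _" "C * \<alpha>1 * _"] abs_mult[of "\<theta> _"] q fst_conv snd_conv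
          using 0 1 2 \<theta>[of t] Th d q by (intro mult_mono) auto
        then show ?thesis using True tx s by (simp add: q P_def L_def)
      next
        case False
        then have "1 \<le> s x / d - 1" using d by (simp add: field_simps)
        then have "dstep (s x / d - 1) = 0" by (intro dstep_eq_0) auto
        then show ?thesis using P q by simp
      qed
    qed (use P in simp)
    have "\<bar>LINT q:Qc|lborel. ?g d q\<bar> \<le> (LINT q|lborel. \<bar>indicator Qc q *\<^sub>R ?g d q\<bar>)"
      unfolding set_lebesgue_integral_def by (rule integral_abs_bound)
    also have "\<dots> \<le> (LINT q|lborel. P * indicator ({T0<..<t0} \<times> L) q)"
      by (rule integral_mono') (use Pb Pf P pw in auto)
    also have "\<dots> = P * measure lborel ({T0<..<t0} \<times> L)" using Pb by simp
    also have "\<dots> \<le> P * ((t0 - T0) * (CL * (2 * d)))" by (intro mult_left_mono Pm P)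
    also have "\<dots> = Th * 2 * C * \<alpha>1 * real (card I) * e * (2 * CL) * (t0 - T0)"
      using d by (simp add: P_def field_simps)
    finally show ?thesis .
  qed
  then show ?thesis using d0(1) by (intro exI[of _ "d0 / 2"]) auto
qed


lemma bm_layer:
  assumes "d > 0" "continuous_on UNIV \<theta>"
  shows "bm (\<lambda>q. sstep (s (snd q) / d - 1))"
    "bm (\<lambda>q. \<theta> (fst q) * (dstep (s (snd q) / d - 1) / d) * (C * \<alpha>1 * (\<Sum>j\<in>I. \<bar>G j q \<bullet> Ds (snd q)\<bar>)))"
proof -
  have sc: "continuous_on Qc (\<lambda>q. s (snd q) / d - 1)"
    by (intro continuous_intros continuous_on_compose2[OF s_cont[of UNIV]]) (use assms in auto)
  have "\<bar>sstep u\<bar> \<le> 1" "\<bar>dstep u\<bar> \<le> 2" for u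
    using sstep_bounds[of u] dstep_nonneg[of u] dstep_le[of u] by auto
  then have sb: "bdd_on Qc (\<lambda>q. sstep (s (snd q) / d - 1))" "bdd_on Qc (\<lambda>q. dstep (s (snd q) / d - 1))"
    by (blast intro: bdd_onI)+
  show 1: "bm (\<lambda>q. sstep (s (snd q) / d - 1))"
    by (intro bm_cont sb continuous_on_compose2[OF sstep_cont[of UNIV] sc]) auto
  have 2: "bm (\<lambda>q. dstep (s (snd q) / d - 1))"
    by (intro bm_cont sb continuous_on_compose2[OF dstep_cont[of UNIV] sc]) auto
  have 3: "bm (\<lambda>q. \<bar>G j q \<bullet> Ds (snd q)\<bar>)" if j: "j \<in> I" for j
  proof (rule bm_cont)
    show "continuous_on Qc (\<lambda>q. \<bar>G j q \<bullet> Ds (snd q)\<bar>)"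
      by (intro continuous_intros continuous_on_subset[OF G_cont[OF j] Qc_sub] continuous_on_compose2[OF Ds_cont]) auto
    have "bdd_on (cball x0 \<rho>) (\<lambda>x. norm (Ds x))"
      by (intro bdd_on_compact compact_cball continuous_intros continuous_on_subset[OF Ds_cont]) auto
    then have "bdd_on Qc (\<lambda>q. norm (Ds (snd q)))" unfolding bdd_on_def Qc_def by fastforce
    moreover have "bdd_on Qc (\<lambda>q. norm (G j q))" using G_bdd[OF j] by (simp add: Qc_def)
    ultimately have "bdd_on Qc (\<lambda>q. norm (G j q) * norm (Ds (snd q)))" by (intro bdd_on_mult)
    then obtain M where M: "\<And>q. q \<in> Qc \<Longrightarrow> \<bar>norm (G j q) * norm (Ds (snd q))\<bar> \<le> M" by (auto simp: bdd_on_def)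
    have "\<bar>\<bar>G j q \<bullet> Ds (snd q)\<bar>\<bar> \<le> M" if "q \<in> Qc" for q
      using Cauchy_Schwarz_ineq2[of "G j q" "Ds (snd q)"] M[OF that] by simp
    then show "bdd_on Qc (\<lambda>q. \<bar>G j q \<bullet> Ds (snd q)\<bar>)" by (rule bdd_onI)
  qed
  have "bm (\<lambda>q. \<theta> (fst q) * (dstep (s (snd q) / d - 1) * (1 / d)) * (C * \<alpha>1 * (\<Sum>j\<in>I. \<bar>G j q \<bullet> Ds (snd q)\<bar>)))"
    by (intro bm_mult bm_sum bm_const bm_time assms 2 3)
  then show "bm (\<lambda>q. \<theta> (fst q) * (dstep (s (snd q) / d - 1) / d) * (C * \<alpha>1 * (\<Sum>j\<in>I. \<bar>G j q \<bullet> Ds (snd q)\<bar>)))"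
    by simp
qed

text \<open>The width of the boundary layer tends to zero: inside the cylinder the boundary factor
  becomes one, and the error caused by its gradient vanishes. The weight in time is kept general for
  the limit towards a time slice.\<close>

lemma weighted_inequality:
  assumes \<theta>: "\<And>t. (\<theta> has_real_derivative p t - m t) (at t)" "\<And>t. 0 \<le> \<theta> t" "\<And>t. t \<notin> {\<tau>1..\<tau>2} \<Longrightarrow> \<theta> t = 0"
    and pm: "continuous_on UNIV p" "continuous_on UNIV m" "\<And>t. 0 \<le> p t" "\<And>t. 0 \<le> m t"
      "\<And>t. t \<notin> {\<tau>1..\<tau>2} \<Longrightarrow> p t = 0" "\<And>t. t \<notin> {\<tau>1..\<tau>2} \<Longrightarrow> m t = 0"
    and \<tau>: "T0 < \<tau>1" "\<tau>2 < t0"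
  shows "c * (LINT q:Qc|lborel. m (fst q) * ((\<eta> q)\<^sup>2 * (rr q)\<^sup>2)) + c / 2 * (LINT q:Qc|lborel. \<theta> (fst q) * ((\<eta> q)\<^sup>2 * DD q))
    \<le> C * (LINT q:Qc|lborel. p (fst q) * ((\<eta> q)\<^sup>2 * (rr q)\<^sup>2)) + 2 * C * (LINT q:Qc|lborel. \<theta> (fst q) * cc q)"
proof -
  have th_c: "continuous_on UNIV \<theta>"
    using DERIV_isCont[OF \<theta>(1)] by (intro continuous_at_imp_continuous_on) auto
  obtain Th where Th: "\<And>t. \<bar>\<theta> t\<bar> \<le> Th"
  proof -
    have "bdd_on {\<tau>1..\<tau>2} \<theta>" by (intro bdd_on_compact continuous_on_subset[OF th_c]) auto
    then obtain M where "\<forall>t\<in>{\<tau>1..\<tau>2}. \<bar>\<theta> t\<bar> \<le> M" unfolding bdd_on_def ..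
    then have "\<bar>\<theta> t\<bar> \<le> max M 0" for t using \<theta>(3)[of t] by (cases "t \<in> {\<tau>1..\<tau>2}") (auto simp: le_max_iff_disj)
    then show ?thesis by (rule that)
  qed
  define A where "A q = C * p (fst q) * ((\<eta> q)\<^sup>2 * (rr q)\<^sup>2) - c * m (fst q) * ((\<eta> q)\<^sup>2 * (rr q)\<^sup>2)
          + 2 * C * (\<theta> (fst q) * cc q) - c / 2 * (\<theta> (fst q) * ((\<eta> q)\<^sup>2 * DD q))" for q
  define Rd where "Rd d q = \<theta> (fst q) * (dstep (s (snd q) / d - 1) / d) * (C * \<alpha>1 * (\<Sum>j\<in>I. \<bar>G j q \<bullet> Ds (snd q)\<bar>))" for d q
  have bmA: "bm A"
    unfolding A_def[abs_def] by (intro bm_add bm_diff bm_mult bm_const bm_time pm th_c bm_\<eta> bm_rr bm_cc bm_DD)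
  have ineq: "0 \<le> (LINT q:Qc|lborel. sstep (s (snd q) / d - 1) * A q) + (LINT q:Qc|lborel. Rd d q)" if d: "d > 0" for d
  proof -
    let ?K = "{\<tau>1..\<tau>2} \<times> {x \<in> cball x0 \<rho>. d \<le> s x}"
    let ?ei = "energy_integrand (\<zeta> \<theta> d) (D\<zeta> \<theta> (\<lambda>t. p t - m t) d) (en i \<epsilon> (heaviside \<kappa>)) (en1 i \<epsilon> (heaviside \<kappa>)) (en2 i \<epsilon> (heaviside \<kappa>))"
    have cut: "cutoff_function ?K (\<zeta> \<theta> d) (D\<zeta> \<theta> (\<lambda>t. p t - m t) d)"
      by (intro \<zeta>_cutoff_function \<theta> \<tau> d continuous_intros pm)
    have KQ: "?K \<subseteq> Q"
      using \<tau> d s_iff by (intro subset_trans[OF _ cyl_sub]) auto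
    note id = energy_identity_heaviside[OF i cut KQ, of \<epsilon> \<kappa>]
    note b = bm_layer[OF d th_c, folded Rd_def]
    have int: "set_integrable lborel Qc (\<lambda>q. sstep (s (snd q) / d - 1) * A q)" "set_integrable lborel Qc (Rd d)"
      by (intro bm_integrable bm_mult b bmA)+
    have pw: "indicator ?K q *\<^sub>R ?ei q \<le> indicator Qc q *\<^sub>R (sstep (s (snd q) / d - 1) * A q + Rd d q)" for q
    proof (cases "q \<in> Qc")
      case q: True
      show ?thesis
      proof (cases "q \<in> ?K")
        case True
        then show ?thesis
          using integrand_le[of \<theta> q "\<lambda>t. p t - m t" "p (fst q)" "m (fst q)" d] q d \<theta>(2) pm
          by (simp add: A_def Rd_def)
      next
        case False
        have "fst q \<notin> {\<tau>1..\<tau>2} \<or> s (snd q) / d - 1 \<le> 0"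
          using False q d by (cases q) (auto simp: Qc_def pos_divide_le_eq)
        then have "sstep (s (snd q) / d - 1) * A q + Rd d q = 0"
          using \<theta>(3) pm(5,6) sstep_eq(1) dstep_eq_0 by (auto simp: A_def Rd_def)
        then show ?thesis using False by simp
      qed
    next
      case False
      then have "?ei q = 0" by (simp add: energy_integrand_def \<zeta>_def D\<zeta>_def)
      then show ?thesis using False by simp
    qed
    have "0 = (LINT q:?K|lborel. ?ei q)" using id(2) by simp
    also have "\<dots> \<le> (LINT q:Qc|lborel. sstep (s (snd q) / d - 1) * A q + Rd d q)"
      unfolding set_lebesgue_integral_def
      using id(1) set_integral_add(1)[OF int] pw unfolding set_integrable_def by (intro integral_mono) auto
    also have "\<dots> = (LINT q:Qc|lborel. sstep (s (snd q) / d - 1) * A q) + (LINT q:Qc|lborel. Rd d q)"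
      by (rule set_integral_add(2)[OF int])
    finally show ?thesis .
  qed
  define dn where "dn n = 1 / real (Suc n)" for n
  have dn: "dn n > 0" "dn \<longlonglongrightarrow> 0" for n
    using LIMSEQ_inverse_real_of_nat by (auto simp: dn_def[abs_def] inverse_eq_divide)
  have "bounded_conv Qc (\<lambda>n q. sstep (s (snd q) / dn n - 1)) (\<lambda>q. 1)"
  proof (rule bounded_convI[where C = 1])
    show "(\<lambda>q. sstep (s (snd q) / dn n - 1)) \<in> borel_measurable (restrict_space borel Qc)" for n
      using bm_layer(1)[OF dn(1)[of n] th_c] by (auto simp: bm_def bounded_conv_def)
    show "\<bar>sstep (s (snd q) / dn n - 1)\<bar> \<le> 1" for q n using sstep_bounds[of "s (snd q) / dn n - 1"] by simp
    show "(\<lambda>n. sstep (s (snd q) / dn n - 1)) \<longlonglongrightarrow> 1" if "q \<in> Qc" for q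
    proof (rule tendsto_eventually)
      have "s (snd q) > 0" using that s_iff[of "snd q"] by (auto simp: Qc_def)
      then have "eventually (\<lambda>n. dn n < s (snd q) / 2) sequentially"
        by (intro order_tendstoD(2)[OF dn(2)]) simp
      then show "eventually (\<lambda>n. sstep (s (snd q) / dn n - 1) = 1) sequentially"
      proof eventually_elim
        case (elim n)
        then have "1 \<le> s (snd q) / dn n - 1" using dn(1)[of n] by (simp add: field_simps)
        then show ?case by (rule sstep_eq(2))
      qed
    qed
  qed
  from bounded_conv_integral(3)[OF bounded_conv_mult[OF this bmA[unfolded bm_def]] Qc_borel Qc_finite]
  have lim: "(\<lambda>n. LINT q:Qc|lborel. sstep (s (snd q) / dn n - 1) * A q) \<longlonglongrightarrow> (LINT q:Qc|lborel. A q)" by simp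
  have A0: "0 \<le> (LINT q:Qc|lborel. A q)"
  proof (rule ccontr)
    assume neg: "\<not> ?thesis"
    define Kc where "Kc = Th * 2 * C * \<alpha>1 * real (card I) * (2 * CL) * (t0 - T0)"
    have Kc: "Kc \<ge> 0"
    proof -
      have "Th \<ge> 0" using Th[of 0] by linarith
      then show ?thesis using cst \<alpha>1 CL T0 by (simp add: Kc_def)
    qed
    \<comment> \<open>Chosen so that the error is at most half of the supposed deficit; adding one
      covers \<open>Kc = 0\<close>.\<close>
    define e where "e = - (LINT q:Qc|lborel. A q) / (2 * (Kc + 1))"
    have e: "e > 0" using neg Kc unfolding e_def by (intro divide_pos_pos) auto
    obtain d0 where d0: "d0 > 0" "\<And>d. 0 < d \<Longrightarrow> d < d0 \<Longrightarrow> \<bar>LINT q:Qc|lborel. Rd d q\<bar> \<le> Kc * e"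
    proof -
      have eq: "Th * 2 * C * \<alpha>1 * real (card I) * e * (2 * CL) * (t0 - T0) = Kc * e" by (simp add: Kc_def)
      show ?thesis using layer_integral_small[OF e, of \<theta> Th, OF Th] that unfolding eq Rd_def[symmetric] by blast
    qed
    have "eventually (\<lambda>n. dn n < d0) sequentially" by (rule order_tendstoD(2)[OF dn(2) d0(1)])
    then have "eventually (\<lambda>n. - (Kc * e) \<le> (LINT q:Qc|lborel. sstep (s (snd q) / dn n - 1) * A q)) sequentially"
    proof eventually_elim
      case (elim n)
      show ?case using ineq[OF dn(1)[of n]] d0(2)[OF dn(1) elim] by linarith
    qed
    with lim have "- (Kc * e) \<le> (LINT q:Qc|lborel. A q)"
      by (rule tendsto_lowerbound) simp
    moreover have "Kc * e < - (LINT q:Qc|lborel. A q)"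
    proof -
      have "Kc * e \<le> (Kc + 1) * e" using e by simp
      also have "\<dots> = - (LINT q:Qc|lborel. A q) / 2" using Kc by (simp add: e_def field_simps)
      also have "\<dots> < - (LINT q:Qc|lborel. A q)" using neg by simp
      finally show ?thesis .
    qed
    ultimately show False by linarith
  qed
  have i1: "set_integrable lborel Qc (\<lambda>q. p (fst q) * ((\<eta> q)\<^sup>2 * (rr q)\<^sup>2))" "set_integrable lborel Qc (\<lambda>q. m (fst q) * ((\<eta> q)\<^sup>2 * (rr q)\<^sup>2))"
    "set_integrable lborel Qc (\<lambda>q. \<theta> (fst q) * cc q)" "set_integrable lborel Qc (\<lambda>q. \<theta> (fst q) * ((\<eta> q)\<^sup>2 * DD q))"
    by (intro bm_integrable bm_mult bm_time pm th_c bm_\<eta> bm_rr bm_cc bm_DD)+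
  have "(LINT q:Qc|lborel. A q) = C * (LINT q:Qc|lborel. p (fst q) * ((\<eta> q)\<^sup>2 * (rr q)\<^sup>2))
      - c * (LINT q:Qc|lborel. m (fst q) * ((\<eta> q)\<^sup>2 * (rr q)\<^sup>2)) + 2 * C * (LINT q:Qc|lborel. \<theta> (fst q) * cc q)
      - c / 2 * (LINT q:Qc|lborel. \<theta> (fst q) * ((\<eta> q)\<^sup>2 * DD q))"
  proof -
    have A': "A = (\<lambda>q. C * (p (fst q) * ((\<eta> q)\<^sup>2 * (rr q)\<^sup>2)) - c * (m (fst q) * ((\<eta> q)\<^sup>2 * (rr q)\<^sup>2))
          + 2 * C * (\<theta> (fst q) * cc q) - c / 2 * (\<theta> (fst q) * ((\<eta> q)\<^sup>2 * DD q)))"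
      by (simp add: A_def fun_eq_iff mult.assoc)
    note j = set_integrable_mult_right[OF i1(1), of C] set_integrable_mult_right[OF i1(2), of c]
      set_integrable_mult_right[OF i1(3), of "2 * C"] set_integrable_mult_right[OF i1(4), of "c / 2"]
    show ?thesis
      unfolding A' using j
      by (subst set_integral_diff(2) set_integral_add(2); (intro set_integral_diff(1) set_integral_add(1) j)?)+ simp
  qed
  with A0 show ?thesis by linarith
qed


lemma bm_borel:
  assumes "bm f"
  shows "(\<lambda>q. indicator Qc q * f q) \<in> borel_measurable borel" "\<exists>M. \<forall>q. \<bar>indicator Qc q * f q\<bar> \<le> M"
proof -
  have "f \<in> borel_measurable (restrict_space borel Qc)" using assms by (auto simp: bm_def bounded_conv_def)
  then show "(\<lambda>q. indicator Qc q * f q) \<in> borel_measurable borel"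
    using Qc_borel by (subst (asm) borel_measurable_restrict_space_iff) auto
  obtain M where "\<forall>q\<in>Qc. \<bar>f q\<bar> \<le> M" using bm_bdd[OF assms] unfolding bdd_on_def ..
  then have "\<bar>indicator Qc q * f q\<bar> \<le> max M 0" for q
    by (cases "q \<in> Qc") (auto simp: le_max_iff_disj)
  then show "\<exists>M. \<forall>q. \<bar>indicator Qc q * f q\<bar> \<le> M" by blast
qed

text \<open>The rising part of the weight concentrates at the initial time, where
  \<open>\<eta>\<close> vanishes, and the falling part just after \<open>\<tau>\<close>, where it
  reproduces the integral over the slice. The weight itself tends to the indicator of the times up
  to \<open>\<tau>\<close>.\<close>

lemma estimate_at_time:
  assumes \<tau>: "T0 < \<tau>" "\<tau> < t0"
  shows "c * (LINT x:ball x0 \<rho> \<inter> \<Omega>|lborel. (\<eta> (\<tau>, x))\<^sup>2 * (rr (\<tau>, x))\<^sup>2)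
      + c / 2 * (LINT q:Qc|lborel. indicator {..\<tau>} (fst q) * ((\<eta> q)\<^sup>2 * DD q))
    \<le> 2 * C * (LINT q:Qc|lborel. cc q)"
proof -
  let ?g = "\<lambda>q. (\<eta> q)\<^sup>2 * (rr q)\<^sup>2" and ?D = "ball x0 \<rho> \<inter> \<Omega>"
  define f where "f q = indicator Qc q * ?g q" for q
  have bmg: "bm ?g" by (intro bm_mult bm_\<eta> bm_rr)
  obtain M where f: "f \<in> borel_measurable borel" "\<And>q. \<bar>f q\<bar> \<le> M"
    using bm_borel[OF bmg] unfolding f_def[abs_def] by blast
  have f0: "f (t, x) = 0" if "x \<notin> ball x0 \<rho>" for t x using that by (simp add: f_def Qc_def)
  have gc: "continuous_on Qc ?g" by (intro continuous_intros \<eta>_cont rr_cont)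
  define N where "N n = real (Suc n)" for n
  have N: "N n > 0" for n by (simp add: N_def)
  have Nlim: "filterlim N at_top sequentially"
    unfolding N_def by (rule filterlim_compose[OF filterlim_real_sequentially filterlim_Suc])
  have shift: "(\<lambda>n. t + k / N n) \<longlonglongrightarrow> t" for t k :: real
    using tendsto_add[OF tendsto_const tendsto_divide_0[OF tendsto_const filterlim_at_top_imp_at_infinity[OF Nlim]], of t k] by simp
  \<comment> \<open>The rise takes place between \<open>T0 + 1 / N\<close> and
    \<open>T0 + 2 / N\<close>, strictly after the initial time, since the weight must have compact
    support in the open time interval. The fall starts at \<open>\<tau>\<close>; its summand
    \<open>- 0\<close> matches the shape of the averaging lemma.\<close>
  define p where "p n t = N n * dstep (N n * (t - T0) - 1)" for n t
  define m where "m n t = N n * dstep (N n * (t - \<tau>) - 0)" for n t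
  define \<theta> where "\<theta> n t = sstep (N n * (t - T0) - 1) - sstep (N n * (t - \<tau>))" for n t
  have mlim: "(\<lambda>n. LINT q:Qc|lborel. m n (fst q) * ?g q) \<longlonglongrightarrow> (LINT x:?D|lborel. ?g (\<tau>, x))"
  proof -
    have "(\<lambda>n. LINT q|lborel. N n * dstep (N n * (fst q - \<tau>) - 0) * f q) \<longlonglongrightarrow> (LINT x|lborel. indicator ?D x *\<^sub>R ?g (\<tau>, x))"
      unfolding N_def
    proof (rule concentrating_average[where S = "ball x0 \<rho>", OF f f0 bounded_ball])
      fix u :: real and x
      show "(\<lambda>n. f (\<tau> + (u + 0) / real (Suc n), x)) \<longlonglongrightarrow> indicator ?D x *\<^sub>R ?g (\<tau>, x)"
      proof (cases "x \<in> ?D")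
        case True
        then have q: "(\<tau>, x) \<in> Qc" using \<tau> by (simp add: Qc_def)
        have "(\<lambda>n. (\<tau> + (u + 0) / N n, x)) \<longlonglongrightarrow> (\<tau>, x)" by (intro tendsto_Pair shift tendsto_const)
        then have l: "(\<lambda>n. (\<tau> + (u + 0) / N n, x)) \<longlonglongrightarrow> (\<tau>, x)" .
        have ev: "eventually (\<lambda>n. (\<tau> + (u + 0) / N n, x) \<in> Qc) sequentially"
          by (rule topological_tendstoD[OF l Qc_open q])
        have "isCont ?g (\<tau>, x)" using gc Qc_open q by (simp add: continuous_on_eq_continuous_at)
        from isCont_tendsto_compose[OF this l]
        have "(\<lambda>n. ?g (\<tau> + (u + 0) / N n, x)) \<longlonglongrightarrow> ?g (\<tau>, x)" .
        then have "(\<lambda>n. f (\<tau> + (u + 0) / N n, x)) \<longlonglongrightarrow> ?g (\<tau>, x)"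
          by (rule Lim_transform_eventually) (use ev in \<open>eventually_elim, simp add: f_def\<close>)
        then show ?thesis using True by (simp add: N_def)
      next
        case False
        then show ?thesis by (auto simp: f_def Qc_def)
      qed
    qed
    then show ?thesis
      by (simp add: set_lebesgue_integral_def f_def m_def mult_ac)
  qed
  \<comment> \<open>At each fixed point of the bottom slice \<open>\<eta>\<close> vanishes for times
    close to \<open>T0\<close>. The length of that time interval may degenerate towards the edge of
    the slice, which pointwise convergence tolerates.\<close>
  have plim: "(\<lambda>n. LINT q:Qc|lborel. p n (fst q) * ?g q) \<longlonglongrightarrow> 0"
  proof -
    have "(\<lambda>n. LINT q|lborel. N n * dstep (N n * (fst q - T0) - 1) * f q) \<longlonglongrightarrow> (LINT x|(lborel::'a measure). 0)"
      unfolding N_def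
    proof (rule concentrating_average[where S = "ball x0 \<rho>", OF f f0 bounded_ball])
      fix u :: real and x
      show "(\<lambda>n. f (T0 + (u + 1) / real (Suc n), x)) \<longlonglongrightarrow> 0"
      proof (cases "x \<in> ?D")
        case True
        then have q: "(T0, x) \<in> V" using V_bottom by auto
        have l: "(\<lambda>n. (T0 + (u + 1) / N n, x)) \<longlonglongrightarrow> (T0, x)" by (intro tendsto_Pair shift tendsto_const)
        have "eventually (\<lambda>n. (T0 + (u + 1) / N n, x) \<in> V) sequentially"
          by (rule topological_tendstoD[OF l V_open q])
        then have "eventually (\<lambda>n. f (T0 + (u + 1) / N n, x) = 0) sequentially"
          by eventually_elim (use \<eta>_V in \<open>auto simp: f_def Qc_def indicator_def\<close>)
        then show ?thesis unfolding N_def by (rule tendsto_eventually)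
      next
        case False
        then show ?thesis by (auto simp: f_def Qc_def)
      qed
    qed
    then show ?thesis
      by (simp add: set_lebesgue_integral_def f_def p_def mult_ac)
  qed
  have th_der: "(\<theta> n has_real_derivative p n t - m n t) (at t)" for n t
    unfolding \<theta>_def[abs_def] p_def m_def
    by (auto intro!: derivative_eq_intros DERIV_chain2[where f = sstep, OF sstep_DERIV] simp: algebra_simps)
  have th_c: "continuous_on UNIV (\<theta> n)" for n
    using DERIV_isCont[OF th_der] by (intro continuous_at_imp_continuous_on) auto
  have pmc: "continuous_on UNIV (p n)" "continuous_on UNIV (m n)" for n
    unfolding p_def[abs_def] m_def[abs_def]
    by (intro continuous_intros continuous_on_compose2[OF dstep_cont[of UNIV]]; simp)+
  have thb: "\<bar>\<theta> n t\<bar> \<le> 1" for n t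
    using sstep_bounds[of "N n * (t - T0) - 1"] sstep_bounds[of "N n * (t - \<tau>)"] by (auto simp: \<theta>_def)
  have Nlarge: "eventually (\<lambda>n. N n * k > 1) sequentially" if "k > 0" for k
    using filterlim_tendsto_pos_mult_at_top[OF tendsto_const that Nlim]
    by (simp add: filterlim_at_top_dense mult.commute)
  have thlim: "bounded_conv Qc (\<lambda>n q. \<theta> n (fst q)) (\<lambda>q. indicator {..\<tau>} (fst q))"
  proof (rule bounded_convI[OF _ thb])
    show "(\<lambda>q. \<theta> n (fst q)) \<in> borel_measurable (restrict_space borel Qc)" for n
      using bm_time[OF th_c] by (auto simp: bm_def bounded_conv_def)
    fix q assume "q \<in> Qc"
    then have t: "fst q > T0" by (auto simp: Qc_def)
    have "eventually (\<lambda>n. N n * ((fst q - T0) / 2) > 1) sequentially" using t by (intro Nlarge) simp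
    then have e1: "eventually (\<lambda>n. sstep (N n * (fst q - T0) - 1) = 1) sequentially"
      by eventually_elim (simp add: sstep_eq(2))
    show "(\<lambda>n. \<theta> n (fst q)) \<longlonglongrightarrow> indicator {..\<tau>} (fst q)"
    proof (cases "fst q \<le> \<tau>")
      case True
      then have z0: "sstep (N n * (fst q - \<tau>)) = 0" for n
        using N[of n] by (intro sstep_eq(1)) (simp add: mult_nonneg_nonpos)
      from e1 have "eventually (\<lambda>n. \<theta> n (fst q) = 1) sequentially"
        by eventually_elim (simp add: \<theta>_def z0)
      then show ?thesis using True by (simp add: tendsto_eventually)
    next
      case False
      then have "eventually (\<lambda>n. N n * (fst q - \<tau>) > 1) sequentially" by (intro Nlarge) simp
      then have "eventually (\<lambda>n. \<theta> n (fst q) = 0) sequentially"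
        using e1 by eventually_elim (simp add: \<theta>_def sstep_eq(2))
      then show ?thesis using False by (simp add: tendsto_eventually)
    qed
  qed
  have "bm (\<lambda>q. (\<eta> q)\<^sup>2 * DD q)" by (intro bm_mult bm_\<eta> bm_DD)
  from bounded_conv_integral(3)[OF bounded_conv_mult[OF thlim this[unfolded bm_def]] Qc_borel Qc_finite]
  have Dlim: "(\<lambda>n. LINT q:Qc|lborel. \<theta> n (fst q) * ((\<eta> q)\<^sup>2 * DD q)) \<longlonglongrightarrow> (LINT q:Qc|lborel. indicator {..\<tau>} (fst q) * ((\<eta> q)\<^sup>2 * DD q))" .
  \<comment> \<open>The first condition lets the rise begin no later than the fall, which makes the
    weight nonnegative; the second keeps the fall inside the cylinder.\<close>
  have "eventually (\<lambda>n. N n * ((\<tau> - T0) / 1) > 1 \<and> N n * (t0 - \<tau>) > 1) sequentially"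
    using \<tau> by (intro eventually_conj Nlarge) auto
  then have ev: "eventually (\<lambda>n. c * (LINT q:Qc|lborel. m n (fst q) * ?g q) + c / 2 * (LINT q:Qc|lborel. \<theta> n (fst q) * ((\<eta> q)\<^sup>2 * DD q))
    \<le> C * (LINT q:Qc|lborel. p n (fst q) * ?g q) + 2 * C * (LINT q:Qc|lborel. cc q)) sequentially"
  proof eventually_elim
    case (elim n)
    then have n1: "N n * (\<tau> - T0) \<ge> 1" and n2: "\<tau> + 1 / N n < t0" using N[of n] by (auto simp: field_simps)
    have th0: "0 \<le> \<theta> n t" for t
    proof -
      have "N n * (t - T0) - 1 = N n * (t - \<tau>) + (N n * (\<tau> - T0) - 1)" by (simp add: algebra_simps)
      then show ?thesis using sstep_mono[of "N n * (t - \<tau>)" "N n * (t - T0) - 1"] n1 by (simp add: \<theta>_def)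
    qed
    have out: "\<theta> n t = 0 \<and> p n t = 0 \<and> m n t = 0" if t: "t \<notin> {T0 + 1 / N n .. \<tau> + 1 / N n}" for t
    proof -
      consider "t < T0 + 1 / N n" | "t > \<tau> + 1 / N n" using t by fastforce
      then show ?thesis
      proof cases
        case 1
        then have a: "N n * (t - T0) - 1 \<le> 0" using N[of n] by (simp add: field_simps)
        have "N n * (t - T0) - 1 = N n * (t - \<tau>) + (N n * (\<tau> - T0) - 1)" by (simp add: algebra_simps)
        with a n1 have b: "N n * (t - \<tau>) \<le> 0" by linarith
        show ?thesis using a b sstep_eq(1) dstep_eq_0 by (simp add: \<theta>_def p_def m_def)
      next
        case 2
        then have a: "1 \<le> N n * (t - \<tau>)" using N[of n] by (simp add: field_simps)
        have "N n * (t - T0) - 1 = N n * (t - \<tau>) + (N n * (\<tau> - T0) - 1)" by (simp add: algebra_simps)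
        with a n1 have b: "1 \<le> N n * (t - T0) - 1" by linarith
        show ?thesis using a b sstep_eq(2) dstep_eq_0 by (simp add: \<theta>_def p_def m_def)
      qed
    qed
    have "c * (LINT q:Qc|lborel. m n (fst q) * ?g q) + c / 2 * (LINT q:Qc|lborel. \<theta> n (fst q) * ((\<eta> q)\<^sup>2 * DD q))
      \<le> C * (LINT q:Qc|lborel. p n (fst q) * ?g q) + 2 * C * (LINT q:Qc|lborel. \<theta> n (fst q) * cc q)"
    proof (rule weighted_inequality[OF th_der th0 _ pmc])
      show "T0 < T0 + 1 / N n" "\<tau> + 1 / N n < t0" using n2 N[of n] by auto
      show "0 \<le> p n t" "0 \<le> m n t" for t
        using N[of n] dstep_nonneg by (simp_all add: p_def m_def)
    qed (use out in blast)+
    moreover have "(LINT q:Qc|lborel. \<theta> n (fst q) * cc q) \<le> (LINT q:Qc|lborel. cc q)"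
    proof (rule set_integral_mono)
      show "set_integrable lborel Qc (\<lambda>q. \<theta> n (fst q) * cc q)" "set_integrable lborel Qc cc"
        by (intro bm_integrable bm_mult bm_time th_c bm_cc)+
      show "\<theta> n (fst q) * cc q \<le> cc q" if "q \<in> Qc" for q
        using mult_right_mono[of "\<theta> n (fst q)" 1 "cc q"] thb[of n "fst q"] cc_nonneg[OF that] by (simp add: abs_le_iff)
    qed
    ultimately show ?case using cst mult_left_mono[of _ _ "2 * C"] by (smt (verit))
  qed
  have "(\<lambda>n. c * (LINT q:Qc|lborel. m n (fst q) * ?g q) + c / 2 * (LINT q:Qc|lborel. \<theta> n (fst q) * ((\<eta> q)\<^sup>2 * DD q)))
    \<longlonglongrightarrow> c * (LINT x:?D|lborel. ?g (\<tau>, x)) + c / 2 * (LINT q:Qc|lborel. indicator {..\<tau>} (fst q) * ((\<eta> q)\<^sup>2 * DD q))"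
    by (intro tendsto_intros mlim Dlim)
  moreover have "(\<lambda>n. C * (LINT q:Qc|lborel. p n (fst q) * ?g q) + 2 * C * (LINT q:Qc|lborel. cc q))
    \<longlonglongrightarrow> C * 0 + 2 * C * (LINT q:Qc|lborel. cc q)"
    by (intro tendsto_intros plim)
  ultimately show ?thesis using ev by (auto dest: tendsto_le[OF sequentially_bot, rotated 2])
qed

lemma estimate_sup:
  assumes "T0 < \<tau>" "\<tau> < t0"
  shows "(LINT x:ball x0 \<rho> \<inter> \<Omega>|lborel. (\<eta> (\<tau>, x))\<^sup>2 * (rr (\<tau>, x))\<^sup>2) \<le> 2 * C / c * (LINT q:Qc|lborel. cc q)"
proof -
  have "0 \<le> (LINT q:Qc|lborel. indicator {..\<tau>} (fst q) * ((\<eta> q)\<^sup>2 * DD q))"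
    unfolding set_lebesgue_integral_def by (intro Bochner_Integration.integral_nonneg) (use DD_nonneg in auto)
  then have "0 \<le> c / 2 * (LINT q:Qc|lborel. indicator {..\<tau>} (fst q) * ((\<eta> q)\<^sup>2 * DD q))" using cst by simp
  then have "c * (LINT x:ball x0 \<rho> \<inter> \<Omega>|lborel. (\<eta> (\<tau>, x))\<^sup>2 * (rr (\<tau>, x))\<^sup>2) \<le> 2 * C * (LINT q:Qc|lborel. cc q)"
    using estimate_at_time[OF assms] by linarith
  then show ?thesis using cst by (simp add: field_simps)
qed

text \<open>The slice term is dropped and the time \<open>\<tau>\<close> increases to
  \<open>t0\<close>, which exhausts the cylinder.\<close>

lemma estimate_gradient: "(LINT q:Qc|lborel. (\<eta> q)\<^sup>2 * DD q) \<le> 4 * C / c * (LINT q:Qc|lborel. cc q)"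
proof -
  define \<tau> where "\<tau> n = t0 - (t0 - T0) / real (n + 2)" for n
  have \<tau>: "T0 < \<tau> n" "\<tau> n < t0" for n
  proof -
    have "(t0 - T0) / real (n + 2) < (t0 - T0) / 1" using T0 by (intro divide_strict_left_mono) auto
    then show "T0 < \<tau> n" by (simp add: \<tau>_def)
    show "\<tau> n < t0" using T0 by (simp add: \<tau>_def)
  qed
  have "(\<lambda>n. (t0 - T0) / real (n + 2)) \<longlonglongrightarrow> 0"
    using LIMSEQ_ignore_initial_segment[OF lim_const_over_n[of "t0 - T0"], of 2] by simp
  then have \<tau>lim: "\<tau> \<longlonglongrightarrow> t0"
    unfolding \<tau>_def[abs_def] using tendsto_diff[OF tendsto_const, of _ 0 sequentially t0] by simp
  have bi: "bounded_conv Qc (\<lambda>n q. indicator {..\<tau> n} (fst q)) (\<lambda>q. 1)"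
  proof (rule bounded_convI[where C = 1])
    have "(\<lambda>q. indicator {..\<tau> n} (fst q)) \<in> borel_measurable (borel :: (real \<times> 'a) measure)" for n
      unfolding borel_prod[symmetric] by measurable
    then show "(\<lambda>q. indicator {..\<tau> n} (fst q)) \<in> borel_measurable (restrict_space borel Qc)" for n
      by (rule measurable_restrict_space1)
    show "(\<lambda>n. indicator {..\<tau> n} (fst q)) \<longlonglongrightarrow> 1" if "q \<in> Qc" for q
    proof (rule tendsto_eventually)
      have "fst q < t0" using that by (auto simp: Qc_def)
      from order_tendstoD(1)[OF \<tau>lim this]
      show "eventually (\<lambda>n. indicator {..\<tau> n} (fst q) = 1) sequentially" by eventually_elim auto
    qed
  qed (auto simp: indicator_def)
  have "bm (\<lambda>q. (\<eta> q)\<^sup>2 * DD q)" by (intro bm_mult bm_\<eta> bm_DD)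
  from bounded_conv_integral(3)[OF bounded_conv_mult[OF bi this[unfolded bm_def]] Qc_borel Qc_finite]
  have lim: "(\<lambda>n. LINT q:Qc|lborel. indicator {..\<tau> n} (fst q) * ((\<eta> q)\<^sup>2 * DD q)) \<longlonglongrightarrow> (LINT q:Qc|lborel. (\<eta> q)\<^sup>2 * DD q)"
    by simp
  have "(LINT q:Qc|lborel. indicator {..\<tau> n} (fst q) * ((\<eta> q)\<^sup>2 * DD q)) \<le> 4 * C / c * (LINT q:Qc|lborel. cc q)" for n
  proof -
    have "0 \<le> (LINT x:ball x0 \<rho> \<inter> \<Omega>|lborel. (\<eta> (\<tau> n, x))\<^sup>2 * (rr (\<tau> n, x))\<^sup>2)"
      unfolding set_lebesgue_integral_def by (intro Bochner_Integration.integral_nonneg) auto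
    then have "0 \<le> c * (LINT x:ball x0 \<rho> \<inter> \<Omega>|lborel. (\<eta> (\<tau> n, x))\<^sup>2 * (rr (\<tau> n, x))\<^sup>2)" using cst by simp
    then have "c / 2 * (LINT q:Qc|lborel. indicator {..\<tau> n} (fst q) * ((\<eta> q)\<^sup>2 * DD q)) \<le> 2 * C * (LINT q:Qc|lborel. cc q)"
      using estimate_at_time[OF \<tau>(1)[of n] \<tau>(2)[of n]] by linarith
    then show ?thesis using cst by (simp add: field_simps)
  qed
  with lim show ?thesis by (intro LIMSEQ_le_const2[of _ "LINT q:Qc|lborel. (\<eta> q)\<^sup>2 * DD q"]) auto
qed

end

section \<open>Level sets, charts and boundary layers\<close>

text \<open>Packing replaces Fubini and the area formula: \<open>n\<close> disjoint translates of
  \<open>A\<close> inside \<open>S\<close> bound the measure of \<open>A\<close>. It yields both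
  null level sets and the linear size of boundary layers.\<close>

lemma measure_disjoint_translates:
  fixes A S :: "'b::euclidean_space set"
  assumes A: "A \<in> sets borel" "bounded A" and S: "S \<in> sets borel" "bounded S"
    and sub: "\<And>k x. k < n \<Longrightarrow> x \<in> A \<Longrightarrow> x + (real k * \<tau>) *\<^sub>R v \<in> S"
    and disj: "\<And>k l x y. k < l \<Longrightarrow> l < n \<Longrightarrow> x \<in> A \<Longrightarrow> y \<in> A \<Longrightarrow> x + (real k * \<tau>) *\<^sub>R v \<noteq> y + (real l * \<tau>) *\<^sub>R v"
  shows "real n * measure lborel A \<le> measure lborel S"
proof -
  let ?i = "\<lambda>k x. indicator A (x + (- (real k * \<tau>)) *\<^sub>R v) :: real"
  have fA: "integrable lborel (indicator A :: _ \<Rightarrow> real)" and fS: "integrable lborel (indicator S :: _ \<Rightarrow> real)"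
    using A S emeasure_bounded_finite by (auto intro!: integrable_real_indicator)
  have i: "integrable lborel (?i k)" "integral\<^sup>L lborel (?i k) = measure lborel A" for k
    using integral_lborel_translate[of "indicator A" "(- (real k * \<tau>)) *\<^sub>R v"] fA A
    by (simp_all del: scaleR_minus_left)
  have "real n * measure lborel A = (\<Sum>k<n. integral\<^sup>L lborel (?i k))" using i by simp
  also have "\<dots> = (LINT x|lborel. (\<Sum>k<n. ?i k x))" using i by (subst Bochner_Integration.integral_sum) auto
  also have "\<dots> \<le> (LINT x|lborel. indicator S x)"
  proof (rule integral_mono)
    show "integrable lborel (\<lambda>x. \<Sum>k<n. ?i k x)" using i by auto
    show "(\<Sum>k<n. ?i k x) \<le> indicator S x" for x
    proof (cases "\<exists>k<n. x + (- (real k * \<tau>)) *\<^sub>R v \<in> A")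
      case True
      then obtain k where k: "k < n" "x + (- (real k * \<tau>)) *\<^sub>R v \<in> A" by auto
      have "?i l x = 0" if l: "l < n" "l \<noteq> k" for l
      proof (rule ccontr)
        assume "?i l x \<noteq> 0"
        then have "x + (- (real l * \<tau>)) *\<^sub>R v \<in> A" by (auto simp: indicator_def split: if_splits)
        with disj[of l k "x + (- (real l * \<tau>)) *\<^sub>R v" "x + (- (real k * \<tau>)) *\<^sub>R v"]
          disj[of k l "x + (- (real k * \<tau>)) *\<^sub>R v" "x + (- (real l * \<tau>)) *\<^sub>R v"] k l
        show False by (cases "l < k") auto
      qed
      then have "(\<Sum>l<n. ?i l x) = ?i k x" using k(1) by (subst sum.remove[of _ k]) (auto intro!: sum.neutral)
      moreover have "x \<in> S" using sub[OF k] by simp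
      ultimately show ?thesis by (simp add: indicator_def)
    next
      case False
      then have "(\<Sum>k<n. ?i k x) = 0" by (intro sum.neutral) (auto simp: indicator_def)
      then show ?thesis by simp
    qed
  qed (use fS in auto)
  also have "\<dots> = measure lborel S" using S by simp
  finally show ?thesis .
qed

text \<open>Near a point with \<open>g > 0\<close> the function increases strictly along
  \<open>v\<close>, so translates of a piece of the level set along \<open>v\<close> are disjoint.
  Arbitrarily many of them fit into one ball, so the piece is null. Negating \<open>f\<close> covers
  the other sign.\<close>

lemma null_level_set:
  fixes f :: "'b::euclidean_space \<Rightarrow> real"
  assumes Q: "open Q" and f: "continuous_on Q f" and g: "continuous_on Q g"
    and der: "\<And>q. q \<in> Q \<Longrightarrow> ((\<lambda>h. f (q + h *\<^sub>R v)) has_real_derivative g q) (at 0)"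
  shows "{q \<in> Q. f q = \<kappa> \<and> g q \<noteq> 0} \<in> null_sets lborel"
proof -
  have pos: "negligible {q \<in> Q. f q = \<kappa> \<and> g q > 0}"
    if Q: "open Q" and f: "continuous_on Q f" and g: "continuous_on Q g"
      and der: "\<And>q. q \<in> Q \<Longrightarrow> ((\<lambda>h. f (q + h *\<^sub>R v)) has_real_derivative g q) (at 0)"
    for f g :: "'b \<Rightarrow> real" and \<kappa>
    unfolding locally_negligible_alt[of "{q \<in> Q. f q = \<kappa> \<and> g q > 0}"]
  proof
    fix q0 assume q0: "q0 \<in> {q \<in> Q. f q = \<kappa> \<and> g q > 0}"
    let ?Z = "{q \<in> Q. f q = \<kappa> \<and> g q > 0}"
    have "open {q \<in> Q. g q > 0}"
    proof -
      have "open (Q \<inter> g -` {0<..})" using g Q by (intro continuous_open_preimage) auto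
      then show ?thesis by (simp add: Int_def vimage_def)
    qed
    then obtain r where r: "r > 0" "ball q0 r \<subseteq> {q \<in> Q. g q > 0}" using q0 open_contains_ball by blast
    define A where "A = {q \<in> ball q0 (r / 2). f q = \<kappa>}"
    have "closedin (top_of_set (ball q0 (r / 2))) A"
    proof -
      have "continuous_on (ball q0 (r / 2)) f" by (rule continuous_on_subset[OF f]) (use r subset_ball[of "r / 2" r q0] in force)
      from continuous_closedin_preimage[OF this, of "{\<kappa>}"]
      show ?thesis by (simp add: A_def Int_def vimage_def)
    qed
    then have Ab: "A \<in> sets borel" by (metis borel_closed borel_open closedin_closed open_ball sets.Int)
    \<comment> \<open>The segment stays in the ball by convexity, and there the derivative along
      \<open>v\<close> is positive. Two points of the level set thus never differ by a positive
      multiple of \<open>v\<close>.\<close>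
    have incr: "f (q + h *\<^sub>R v) > f q" if h: "h > 0" and qq: "q \<in> ball q0 r" "q + h *\<^sub>R v \<in> ball q0 r" for q h
    proof (rule DERIV_pos_imp_increasing[of 0 h "\<lambda>h. f (q + h *\<^sub>R v)", simplified])
      show "0 < h" by fact
      fix t assume t: "0 \<le> t" "t \<le> h"
      have "q + t *\<^sub>R v = (1 - t / h) *\<^sub>R q + (t / h) *\<^sub>R (q + h *\<^sub>R v)" using h by (simp add: algebra_simps)
      moreover have "t / h \<le> 1" "0 \<le> t / h" using t h by auto
      ultimately have "q + t *\<^sub>R v \<in> ball q0 r"
        using convexD[OF convex_ball, of q q0 r "q + h *\<^sub>R v" "1 - t / h" "t / h"] qq by auto
      then have qt: "q + t *\<^sub>R v \<in> Q" "g (q + t *\<^sub>R v) > 0" using r by auto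
      have "((\<lambda>x. f (q + t *\<^sub>R v + (x - t) *\<^sub>R v)) has_real_derivative g (q + t *\<^sub>R v) * 1) (at t)"
        by (rule DERIV_chain2[where f = "\<lambda>h. f (q + t *\<^sub>R v + h *\<^sub>R v)" and g = "\<lambda>x. x - t"])
           (use der[OF qt(1)] in \<open>auto intro!: derivative_eq_intros\<close>)
      then show "\<exists>y. ((\<lambda>h. f (q + h *\<^sub>R v)) has_real_derivative y) (at t) \<and> 0 < y"
        using qt(2) by (auto simp: algebra_simps)
    qed
    have le: "real n * measure lborel A \<le> measure lborel (ball q0 r)" for n
    proof (rule measure_disjoint_translates[OF Ab])
      \<comment> \<open>Fewer than \<open>n\<close> steps displace by less than
        \<open>r / 2\<close>, which keeps the translates inside the ball of radius \<open>r\<close>;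
        the added ones avoid division by zero.\<close>
      define \<tau> where "\<tau> = r / (2 * (real n + 1) * (norm v + 1))"
      have nv: "0 < 2 * (real n + 1) * (norm v + 1)" by (simp add: add_nonneg_pos)
      have \<tau>: "\<tau> > 0" using r nv by (simp add: \<tau>_def)
      have small: "norm ((real k * \<tau>) *\<^sub>R v) < r / 2" if "k < n" for k
      proof -
        have "norm ((real k * \<tau>) *\<^sub>R v) = real k * \<tau> * norm v" using \<tau> by simp
        also have "\<dots> \<le> real k * \<tau> * (norm v + 1)" using \<tau> by (intro mult_left_mono) auto
        also have "\<dots> < (real n + 1) * \<tau> * (norm v + 1)"
          using that \<tau> by (intro mult_strict_right_mono) (auto simp: add_nonneg_pos)
        also have "\<dots> = r / 2" using nv by (simp add: \<tau>_def field_simps)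
        finally show ?thesis .
      qed
      show "bounded A" unfolding A_def by (rule bounded_subset[OF bounded_ball[of q0 "r / 2"]]) auto
      show in_ball: "x + (real k * \<tau>) *\<^sub>R v \<in> ball q0 r" if "k < n" "x \<in> A" for k x
        using small[OF that(1)] that(2) norm_triangle_ineq4[of "q0 - x" "(real k * \<tau>) *\<^sub>R v"]
        by (simp add: A_def dist_norm algebra_simps)
      show "x + (real k * \<tau>) *\<^sub>R v \<noteq> y + (real l * \<tau>) *\<^sub>R v" if kl: "k < l" "l < n" and xy: "x \<in> A" "y \<in> A" for k l x y
      proof
        assume eq: "x + (real k * \<tau>) *\<^sub>R v = y + (real l * \<tau>) *\<^sub>R v"
        have "x = x + (real k * \<tau>) *\<^sub>R v - (real k * \<tau>) *\<^sub>R v" by simp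
        also have "\<dots> = y + (real l * \<tau> - real k * \<tau>) *\<^sub>R v" unfolding eq by (simp add: algebra_simps)
        finally have x: "x = y + (real l * \<tau> - real k * \<tau>) *\<^sub>R v" .
        have "real l * \<tau> - real k * \<tau> > 0" using kl \<tau> by simp
        moreover have "y \<in> ball q0 r" "x \<in> ball q0 r" using xy r by (auto simp: A_def)
        ultimately have "f x > f y" using incr[of _ y] x by blast
        then show False using xy by (simp add: A_def)
      qed
    qed auto
    have "measure lborel A = 0"
    proof (rule ccontr)
      assume "measure lborel A \<noteq> 0"
      then have "measure lborel A > 0" using measure_nonneg[of lborel A] by linarith
      from reals_Archimedean3[OF this, rule_format, of "measure lborel (ball q0 r)"] le show False
        by (meson not_less)
    qed
    moreover have "bounded A" unfolding A_def by (rule bounded_subset[OF bounded_ball[of q0 "r / 2"]]) auto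
    ultimately have "emeasure lborel A = 0"
      using emeasure_bounded_finite[of A] by (auto simp: measure_def enn2real_eq_0_iff)
    then have neg: "negligible A"
      using Ab by (metis negligible_iff_null_sets null_setsI null_sets_completionI sets_lborel)
    show "\<exists>U. openin (top_of_set ?Z) U \<and> q0 \<in> U \<and> negligible U"
    proof (intro exI conjI)
      show "openin (top_of_set ?Z) (?Z \<inter> ball q0 (r / 2))" by (simp add: openin_open_Int)
      show "q0 \<in> ?Z \<inter> ball q0 (r / 2)" using q0 r by simp
      show "negligible (?Z \<inter> ball q0 (r / 2))" by (rule negligible_subset[OF neg]) (auto simp: A_def)
    qed
  qed
  have "negligible {q \<in> Q. f q = \<kappa> \<and> g q > 0}" by (rule pos[OF Q f g der])
  moreover have "negligible {q \<in> Q. - f q = - \<kappa> \<and> - g q > 0}"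
    by (rule pos[OF Q]) (use f g der in \<open>auto intro!: continuous_intros derivative_intros\<close>)
  moreover have "{q \<in> Q. f q = \<kappa> \<and> g q \<noteq> 0} = {q \<in> Q. f q = \<kappa> \<and> g q > 0} \<union> {q \<in> Q. - f q = - \<kappa> \<and> - g q > 0}"
    by auto
  ultimately have n: "negligible {q \<in> Q. f q = \<kappa> \<and> g q \<noteq> 0}" by (simp only: negligible_Un)
  have b: "{q \<in> Q. f q = \<kappa> \<and> g q \<noteq> 0} \<in> sets borel"
  proof -
    have "f \<in> borel_measurable (restrict_space borel Q)" "g \<in> borel_measurable (restrict_space borel Q)"
      using f g by (auto intro: borel_measurable_continuous_on_restrict)
    then have "{q \<in> space (restrict_space borel Q). f q = \<kappa> \<and> g q \<noteq> 0} \<in> sets (restrict_space borel Q)" by measurable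
    then show ?thesis using Q by (simp add: space_restrict_space sets_restrict_space_iff borel_open)
  qed
  show ?thesis
    using n b by (metis negligible_iff_null_sets null_sets_completion_iff sets_lborel)
qed

lemma uniform_limit_jointly_continuous:
  fixes u :: "'t::metric_space \<Rightarrow> 'b::metric_space \<Rightarrow> 'c::metric_space"
  assumes c: "\<And>t. t \<in> J \<Longrightarrow> continuous_on S (u t)"
    and l: "\<And>t. t \<in> J \<Longrightarrow> uniform_limit S u (u t) (at t within J)"
  shows "continuous_on (J \<times> S) (\<lambda>(t, x). u t x)"
  unfolding continuous_on_iff
proof (intro ballI allI impI)
  fix q and e :: real assume q: "q \<in> J \<times> S" and e: "e > 0"
  obtain t x where tx: "q = (t, x)" "t \<in> J" "x \<in> S" using q by auto
  have "eventually (\<lambda>t'. \<forall>y\<in>S. dist (u t' y) (u t y) < e / 2) (at t within J)"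
    using uniform_limitD[OF l[OF tx(2)], of "e / 2"] e by simp
  then obtain d1 where d1: "d1 > 0" "\<And>t'. t' \<in> J \<Longrightarrow> dist t' t < d1 \<Longrightarrow> \<forall>y\<in>S. dist (u t' y) (u t y) < e / 2"
    unfolding eventually_at using e by (metis dist_self half_gt_zero)
  obtain d2 where d2: "d2 > 0" "\<And>y. y \<in> S \<Longrightarrow> dist y x < d2 \<Longrightarrow> dist (u t y) (u t x) < e / 2"
    using c[OF tx(2)] tx(3) e unfolding continuous_on_iff by (metis half_gt_zero)
  show "\<exists>d>0. \<forall>q'\<in>J \<times> S. dist q' q < d \<longrightarrow> dist (case q' of (t, x) \<Rightarrow> u t x) (case q of (t, x) \<Rightarrow> u t x) < e"
  proof (intro exI[of _ "min d1 d2"] conjI ballI impI)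
    fix q' assume q': "q' \<in> J \<times> S" "dist q' q < min d1 d2"
    obtain t' x' where t': "q' = (t', x')" "t' \<in> J" "x' \<in> S" using q' by auto
    have "dist t' t < d1" "dist x' x < d2"
      using q'(2) dist_fst_le[of q' q] dist_snd_le[of q' q] by (auto simp: t' tx)
    then have "dist (u t' x') (u t x') < e / 2" "dist (u t x') (u t x) < e / 2"
      using d1 d2 t' by auto
    then have "dist (u t' x') (u t x) < e" using dist_triangle[of "u t' x'" "u t x" "u t x'"] by linarith
    then show "dist (case q' of (t, x) \<Rightarrow> u t x) (case q of (t, x) \<Rightarrow> u t x) < e" by (simp add: t' tx)
  qed (use d1 d2 in auto)
qed

lemma uniform_limit_on_closure:
  fixes u :: "'t \<Rightarrow> 'b::metric_space \<Rightarrow> 'c::real_normed_vector"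
  assumes l: "uniform_limit S u v F" and c: "eventually (\<lambda>t. continuous_on (closure S) (u t)) F" "continuous_on (closure S) v"
  shows "uniform_limit (closure S) u v F"
proof (rule uniform_limitI)
  fix e :: real assume e: "e > 0"
  have "eventually (\<lambda>t. \<forall>x\<in>S. dist (u t x) (v x) < e / 2) F" using uniform_limitD[OF l, of "e / 2"] e by simp
  with c(1) show "eventually (\<lambda>t. \<forall>x\<in>closure S. dist (u t x) (v x) < e) F"
  proof eventually_elim
    case (elim t)
    have "norm (u t x - v x) \<le> e / 2" if "x \<in> closure S" for x
      using continuous_on_closure_norm_le[of S "\<lambda>x. u t x - v x" "e / 2", OF _ _ that] elim c(2)
      by (force intro: continuous_on_diff simp: dist_norm)
    then show ?case using e by (force simp: dist_norm)
  qed
qed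

lemma Ck_on_2_grad:
  fixes \<gamma> :: "'a::euclidean_space \<Rightarrow> real" and e :: 'a
  assumes \<gamma>: "Ck_on 2 UNIV \<gamma>"
  defines "s \<equiv> \<lambda>y. y \<bullet> e - \<gamma> (y - (y \<bullet> e) *\<^sub>R e)"
  shows "(s has_derivative (\<lambda>v. grad s x \<bullet> v)) (at x)" "continuous_on UNIV (grad s)"
    "grad (\<lambda>y. \<gamma> (y - (y \<bullet> e) *\<^sub>R e) - y \<bullet> e) x = - grad s x"
proof -
  let ?P = "\<lambda>y. y - (y \<bullet> e) *\<^sub>R e"
  have \<gamma>d: "(\<gamma> has_derivative frechet_derivative \<gamma> (at x)) (at x)" for x
    using \<gamma> frechet_derivative_works by (auto simp: numeral_2_eq_2)
  have \<gamma>c: "continuous_on UNIV (\<lambda>x. frechet_derivative \<gamma> (at x) v)" for v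
    using \<gamma> by (auto simp: numeral_2_eq_2 intro!: continuous_at_imp_continuous_on differentiable_imp_continuous_within)
  have P: "(?P has_derivative ?P) (at x)" for x by (auto intro!: derivative_eq_intros)
  have d: "(s has_derivative (\<lambda>v. v \<bullet> e - frechet_derivative \<gamma> (at (?P x)) (?P v))) (at x)" for x
    unfolding s_def
    by (intro has_derivative_diff has_derivative_compose[OF P \<gamma>d]) (auto intro!: derivative_eq_intros)
  then have diff: "s differentiable (at x)" for x by (auto simp: differentiable_def)
  show sg: "(s has_derivative (\<lambda>v. grad s x \<bullet> v)) (at x)" for x by (rule frechet_derivative_grad(1)[OF diff])
  have "continuous_on UNIV (\<lambda>x. \<Sum>b\<in>Basis. (b \<bullet> e - frechet_derivative \<gamma> (at (?P x)) (?P b)) *\<^sub>R b)"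
    by (intro continuous_intros continuous_on_compose2[OF \<gamma>c]) auto
  then show "continuous_on UNIV (grad s)"
    unfolding grad_def frechet_derivative_eqI[OF d] .
  have "((\<lambda>y. - s y) has_derivative (\<lambda>v. - grad s x \<bullet> v)) (at x)"
    using has_derivative_minus[OF sg] by simp
  from has_derivative_grad_eq[OF this]
  show "grad (\<lambda>y. \<gamma> (y - (y \<bullet> e) *\<^sub>R e) - y \<bullet> e) x = - grad s x" by (simp add: s_def)
qed

text \<open>Moving by \<open>h\<close> along \<open>e\<close> leaves the projection orthogonal to
  \<open>e\<close> unchanged and raises the height by exactly \<open>h\<close>. Translates of the
  layer by multiples of \<open>d *\<^sub>R e\<close> occupy different ranges of heights, so about
  \<open>1 / d\<close> disjoint ones fit into a slightly larger ball.\<close>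

lemma graph_layer_measure:
  fixes \<gamma> :: "'a::euclidean_space \<Rightarrow> real" and e x0 :: 'a
  assumes \<gamma>: "Ck_on 2 UNIV \<gamma>" and e: "norm e = 1" and \<Omega>: "open \<Omega>"
  defines "s \<equiv> \<lambda>y. y \<bullet> e - \<gamma> (y - (y \<bullet> e) *\<^sub>R e)"
  assumes pos: "\<And>x. x \<in> ball x0 \<rho> \<inter> \<Omega> \<Longrightarrow> 0 < s x"
  shows "\<exists>CL\<ge>0. \<forall>d>0. emeasure lborel {x \<in> ball x0 \<rho> \<inter> \<Omega>. s x < d} \<le> ennreal (CL * d)"
proof (intro exI[of _ "2 * measure lborel (ball x0 (\<rho> + 1))"] conjI allI impI)
  let ?M = "measure lborel (ball x0 (\<rho> + 1))"
  fix d :: real assume d: "d > 0"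
  let ?L = "{x \<in> ball x0 \<rho> \<inter> \<Omega>. s x < d}"
  have ee: "e \<bullet> e = 1" using e by (simp add: dot_square_norm)
  have shift: "s (x + h *\<^sub>R e) = s x + h" for x h
    by (simp add: s_def inner_add_left ee algebra_simps)
  have sc: "continuous_on UNIV s"
    unfolding s_def
    by (intro continuous_at_imp_continuous_on ballI has_derivative_continuous[OF Ck_on_2_grad(1)[OF \<gamma>]])
  have Lb: "?L \<in> sets borel" "bounded ?L"
  proof -
    have "?L = ball x0 \<rho> \<inter> \<Omega> \<inter> {x. s x < d}" by auto
    moreover have "open {x. s x < d}" by (intro open_Collect_less continuous_intros sc)
    ultimately show "?L \<in> sets borel" using \<Omega> by auto
    show "bounded ?L" by (rule bounded_subset[OF bounded_ball[of x0 \<rho>]]) auto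
  qed
  have fin: "emeasure lborel ?L = ennreal (measure lborel ?L)"
    using emeasure_bounded_finite[OF Lb(2)] by (intro emeasure_eq_ennreal_measure) auto
  have M: "measure lborel ?L \<le> ?M"
    using emeasure_bounded_finite[OF bounded_ball[of x0 "\<rho> + 1"]] Lb
    by (intro measure_mono_fmeasurable) (auto simp: fmeasurable_def)
  have "measure lborel ?L \<le> 2 * ?M * d"
  proof (cases "d \<le> 1")
    case True
    \<comment> \<open>As many translates as move by at most one in total. For
      \<open>d \<le> 1\<close> this number is at least \<open>1 / (2 * d)\<close>, which is the
      origin of the factor two in the constant.\<close>
    define n where "n = nat \<lfloor>1 / d\<rfloor>"
    have n1: "real n \<le> 1 / d" using d by (simp add: n_def)
    have n2: "1 / d < real n + 1" using d unfolding n_def by linarith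
    have "1 \<le> 1 / d" using True d by simp
    then have n3: "1 / d \<le> 2 * real n" using n1 n2 by (cases n) auto
    have nd: "real n * d \<le> 1" using n1 d by (simp add: field_simps)
    have "real n * measure lborel ?L \<le> ?M"
    proof (rule measure_disjoint_translates[OF Lb, where \<tau> = d and v = e])
      fix k x assume k: "k < n" and x: "x \<in> ?L"
      have "real k * d \<le> real n * d" using k d by (intro mult_right_mono) auto
       then have "real k * d \<le> 1" using nd by linarith
      then have "norm ((real k * d) *\<^sub>R e) \<le> 1" using d e by simp
      then show "x + (real k * d) *\<^sub>R e \<in> ball x0 (\<rho> + 1)"
        using x norm_triangle_ineq4[of "x0 - x" "(real k * d) *\<^sub>R e"] by (simp add: dist_norm algebra_simps)
    next
      fix k l x y assume kl: "k < l" "l < n" and xy: "x \<in> ?L" "y \<in> ?L"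
      show "x + (real k * d) *\<^sub>R e \<noteq> y + (real l * d) *\<^sub>R e"
      proof
        assume "x + (real k * d) *\<^sub>R e = y + (real l * d) *\<^sub>R e"
        then have "s x + real k * d = s y + real l * d" by (metis shift)
        moreover have "s x < d" "s y > 0" using xy pos by auto
        moreover have "(real k + 1) * d \<le> real l * d" using kl d by (intro mult_right_mono) auto
        ultimately show False by (simp add: algebra_simps)
      qed
    qed auto
    then have "2 * real n * measure lborel ?L * d \<le> 2 * ?M * d" using d by (simp add: mult_right_mono)
    moreover have "1 \<le> 2 * real n * d" using n3 d by (simp add: field_simps)
    then have "1 * measure lborel ?L \<le> (2 * real n * d) * measure lborel ?L" by (intro mult_right_mono) auto
    ultimately show ?thesis by (simp add: mult_ac)
  next
    case False
    have "?M * 1 \<le> ?M * (2 * d)" using False by (intro mult_left_mono) auto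
    then show ?thesis using M by simp
  qed
  then show "emeasure lborel ?L \<le> ennreal (2 * ?M * d)" unfolding fin by (rule ennreal_leI)
qed simp

text \<open>A Lebesgue number of the cover of the compact closure by the domain itself and the balls
  of all its charts.\<close>

lemma uniform_chart_radius:
  fixes \<Omega> :: "'a::euclidean_space set"
  assumes "bounded_C2_domain \<Omega>"
  obtains r where "r > 0" "\<And>x0 \<rho>. x0 \<in> closure \<Omega> \<Longrightarrow> 0 < \<rho> \<Longrightarrow> \<rho> \<le> r \<Longrightarrow>
    cball x0 \<rho> \<subseteq> \<Omega> \<or> (\<exists>p \<delta> e \<gamma>. C2_graph_near \<Omega> p \<delta> e \<gamma> \<and> cball x0 \<rho> \<subseteq> ball p \<delta>)"
proof -
  have \<Omega>: "open \<Omega>" "bounded \<Omega>" "\<And>x. x \<in> frontier \<Omega> \<Longrightarrow> \<exists>\<delta> e \<gamma>. C2_graph_near \<Omega> x \<delta> e \<gamma>"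
    using assms by (auto simp: bounded_C2_domain_def)
  define GG where "GG = insert \<Omega> {ball p \<delta> | p \<delta> e \<gamma>. C2_graph_near \<Omega> p \<delta> e \<gamma>}"
  have cov: "closure \<Omega> \<subseteq> \<Union> GG"
  proof
    fix x assume x: "x \<in> closure \<Omega>"
    show "x \<in> \<Union> GG"
    proof (cases "x \<in> \<Omega>")
      case False
      then have "x \<in> frontier \<Omega>" using x \<Omega>(1) by (simp add: frontier_def interior_open)
      then obtain \<delta> e \<gamma> where g: "C2_graph_near \<Omega> x \<delta> e \<gamma>" using \<Omega>(3) by blast
      then have "ball x \<delta> \<in> GG" "x \<in> ball x \<delta>" by (auto simp: GG_def C2_graph_near_def)
      then show ?thesis by blast
    qed (auto simp: GG_def)
  qed
  have op: "open B" if "B \<in> GG" for B using that \<Omega>(1) by (auto simp: GG_def)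
  have "compact (closure \<Omega>)" using \<Omega>(2) by (simp add: compact_closure)
  from Heine_Borel_lemma[OF this cov op] obtain r where r: "r > 0" "\<And>x. x \<in> closure \<Omega> \<Longrightarrow> \<exists>B\<in>GG. ball x r \<subseteq> B"
    by metis
  show ?thesis
  \<comment> \<open>Half of the number, so that closed balls fit into the open ball of radius
    \<open>r\<close>.\<close>
  proof (rule that[of "r / 2"])
    fix x0 \<rho> assume x0: "x0 \<in> closure \<Omega>" "0 < \<rho>" "\<rho> \<le> r / 2"
    have "cball x0 \<rho> \<subseteq> ball x0 r" using x0 by auto
    then show "cball x0 \<rho> \<subseteq> \<Omega> \<or> (\<exists>p \<delta> e \<gamma>. C2_graph_near \<Omega> p \<delta> e \<gamma> \<and> cball x0 \<rho> \<subseteq> ball p \<delta>)"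
      using r(2)[OF x0(1)] unfolding GG_def by blast
  qed (use r in simp)
qed

section \<open>Nonnegative integrals, essential suprema and gradients of truncations\<close>

lemma nn_integral_eq_set_integral:
  assumes "set_integrable M A f" "\<And>x. x \<in> A \<Longrightarrow> 0 \<le> f x"
  shows "(\<integral>\<^sup>+x\<in>A. ennreal (f x)\<partial>M) = ennreal (LINT x:A|M. f x)"
proof -
  have "(\<integral>\<^sup>+x\<in>A. ennreal (f x)\<partial>M) = (\<integral>\<^sup>+x. ennreal (indicator A x *\<^sub>R f x) \<partial>M)"
    by (subst nn_integral_set_ennreal) (simp add: mult.commute)
  also have "\<dots> = ennreal (LINT x|M. indicator A x *\<^sub>R f x)"
    using assms by (intro nn_integral_eq_integral) (auto simp: set_integrable_def indicator_def)
  finally show ?thesis by (simp add: set_lebesgue_integral_def)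
qed

lemma slice_nn_integral_measurable:
  fixes f :: "real \<times> 'a::euclidean_space \<Rightarrow> real"
  assumes f: "f \<in> borel_measurable (restrict_space borel (A \<times> S))" and A: "A \<in> sets borel" and S: "S \<in> sets borel"
  shows "(\<lambda>t. \<integral>\<^sup>+x\<in>S. ennreal (f (t, x)) \<partial>lborel) \<in> borel_measurable (restrict_space lborel A)"
proof -
  have AS: "A \<times> S \<in> sets borel" using A S by (rule borel_Times)
  have "(\<lambda>q. f q * indicator (A \<times> S) q) \<in> borel_measurable borel"
    using f AS by (subst (asm) borel_measurable_restrict_space_iff) (auto simp: mult.commute)
  then have "(\<lambda>q. ennreal (f q * indicator (A \<times> S) q)) \<in> borel_measurable (lborel \<Otimes>\<^sub>M lborel)"
    by (simp add: lborel_prod)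
  from lborel.borel_measurable_nn_integral_fst[OF this]
  have "(\<lambda>t. \<integral>\<^sup>+x. ennreal (f (t, x) * indicator (A \<times> S) (t, x)) \<partial>lborel) \<in> borel_measurable (restrict_space lborel A)"
    by (rule measurable_restrict_space1)
  then show ?thesis
  proof (rule measurable_cong[THEN iffD1, rotated])
    fix t assume "t \<in> space (restrict_space lborel A)"
    then have "t \<in> A" by (simp add: space_restrict_space)
    then show "(\<integral>\<^sup>+x. ennreal (f (t, x) * indicator (A \<times> S) (t, x)) \<partial>lborel) = (\<integral>\<^sup>+x\<in>S. ennreal (f (t, x)) \<partial>lborel)"
      unfolding nn_integral_set_ennreal by (simp add: indicator_times)
  qed
qed

lemma partial_derivatives_grad:
  fixes f :: "real \<times> 'a::euclidean_space \<Rightarrow> real"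
  assumes "f differentiable (at (t, x))"
  shows "grad (\<lambda>y. f (t, y)) x = snd (grad f (t, x))" "deriv (\<lambda>s. f (s, x)) t = fst (grad f (t, x))"
proof -
  have f: "(f has_derivative (\<lambda>v. grad f (t, x) \<bullet> v)) (at (t, x))" by (rule frechet_derivative_grad(1)[OF assms])
  have "((\<lambda>y. f (t, y)) has_derivative (\<lambda>v. grad f (t, x) \<bullet> (0, v))) (at x)"
    by (rule has_derivative_compose[where f = "\<lambda>y. (t, y)", OF _ f]) (auto intro!: derivative_eq_intros)
  then show "grad (\<lambda>y. f (t, y)) x = snd (grad f (t, x))"
    by (intro has_derivative_grad_eq) (simp add: inner_Pair_0)
  have "((\<lambda>s. f (s, x)) has_derivative (\<lambda>v. grad f (t, x) \<bullet> (v, 0))) (at t)"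
    by (rule has_derivative_compose[where f = "\<lambda>s. (s, x)", OF _ f]) (auto intro!: derivative_eq_intros)
  then have "((\<lambda>s. f (s, x)) has_real_derivative fst (grad f (t, x))) (at t)"
    by (simp add: has_field_derivative_def inner_Pair_0 mult.commute[of _ "fst (grad f (t, x))"])
  then show "deriv (\<lambda>s. f (s, x)) t = fst (grad f (t, x))" by (rule DERIV_imp_deriv)
qed

text \<open>Off the level the truncation is locally zero or the function minus a constant. On the
  level its increments are bounded by those of \<open>u\<close>, which are of smaller order once the
  gradient vanishes there.\<close>

lemma grad_truncation:
  fixes u :: "'a::euclidean_space \<Rightarrow> real"
  assumes u: "(u has_derivative (\<lambda>v. g \<bullet> v)) (at x)" and S: "open S" "x \<in> S"
    and r: "\<And>y. y \<in> S \<Longrightarrow> r y = max 0 (u y - \<kappa>)" and g: "u x = \<kappa> \<Longrightarrow> g = 0"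
  shows "grad r x = heaviside \<kappa> (u x) *\<^sub>R g"
proof (rule has_derivative_grad_eq)
  have uc: "(u \<longlongrightarrow> u x) (at x)" using has_derivative_continuous[OF u] by (simp add: isCont_def)
  have eS: "eventually (\<lambda>y. y \<in> S) (at x)" using eventually_at_topological S by blast
  consider "u x > \<kappa>" | "u x < \<kappa>" | "u x = \<kappa>" by linarith
  then show "(r has_derivative (\<lambda>v. (heaviside \<kappa> (u x) *\<^sub>R g) \<bullet> v)) (at x)"
  proof cases
    case 1
    have "eventually (\<lambda>y. u y - \<kappa> = r y) (at x)"
      using order_tendstoD(1)[OF uc 1] eS by eventually_elim (simp add: r)
    moreover have "((\<lambda>y. u y - \<kappa>) has_derivative (\<lambda>v. g \<bullet> v)) (at x)" using u by (auto intro!: derivative_eq_intros)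
    ultimately show ?thesis using 1 S(2) by (auto intro: has_derivative_transform_eventually simp: r heaviside_def)
  next
    case 2
    have ev: "eventually (\<lambda>y. 0 = r y) (at x)"
      using order_tendstoD(2)[OF uc 2] eS by eventually_elim (simp add: r)
    have "((\<lambda>y. 0) has_derivative (\<lambda>v. 0)) (at x)" by simp
    from has_derivative_transform_eventually[OF this ev]
    show ?thesis using 2 S(2) by (simp add: r heaviside_def)
  next
    case 3
    have "((\<lambda>y. (u y - u x) /\<^sub>R norm (y - x)) \<longlongrightarrow> 0) (at x)"
      using u g[OF 3] by (simp add: has_derivative_at_within)
    from tendsto_norm_zero[OF this]
    have "((\<lambda>y. norm (u y - u x) / norm (y - x)) \<longlongrightarrow> 0) (at x)"
      by (simp add: abs_mult divide_inverse mult.commute)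
    then have "((\<lambda>y. norm (r y - r x) / norm (y - x)) \<longlongrightarrow> 0) (at x)"
      by (rule tendsto_0_le[where K = 1]) (use eS S 3 in \<open>auto elim!: eventually_mono simp: r divide_right_mono\<close>)
    then have "((\<lambda>y. norm ((r y - r x) /\<^sub>R norm (y - x))) \<longlongrightarrow> 0) (at x)"
      by (simp add: abs_mult divide_inverse mult.commute)
    from tendsto_norm_zero_cancel[OF this] show ?thesis using 3 by (simp add: has_derivative_at_within heaviside_def)
  qed
qed

lemma esssup_cong_space:
  assumes "\<And>x. x \<in> space M \<Longrightarrow> f x = g x"
  shows "esssup M f = esssup M g"
  using assms measurable_cong[of M f g borel] Limsup_eq[of f g "ae_filter M"] AE_I2[of M "\<lambda>x. f x = g x"]
  by (simp add: esssup_def)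

text \<open>The three terms on the left of the estimate share one bound with constant
  \<open>4 * C / c\<close>; adding them is the source of \<open>12 * C / c\<close>.\<close>

lemma ennreal_triple:
  assumes "U \<le> ennreal k * Y" "V \<le> ennreal k * Y" "W \<le> ennreal k * Y" "0 \<le> k" "3 * k \<le> K"
  shows "U + V + W \<le> ennreal K * Y"
proof -
  have "U + V + W \<le> ennreal k * Y + ennreal k * Y + ennreal k * Y"
    by (intro add_mono assms)
  also have "\<dots> = ennreal (3 * k) * Y"
  proof -
    have "ennreal (3 * k) = ennreal (k + k + k)" by simp
    also have "\<dots> = ennreal k + ennreal k + ennreal k" using assms(4) by (simp only: ennreal_plus add_nonneg_nonneg)
    finally show ?thesis by (simp only: distrib_right)
  qed
  also have "\<dots> \<le> ennreal K * Y" using assms by (intro mult_right_mono ennreal_leI) auto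
  finally show ?thesis .
qed

context cylinder_flow
begin

lemma nn_bm:
  assumes "bm f" "\<And>q. q \<in> Qc \<Longrightarrow> 0 \<le> f q"
  shows "(\<integral>\<^sup>+q\<in>Qc. ennreal (f q)\<partial>lborel) = ennreal (LINT q:Qc|lborel. f q)"
  by (rule nn_integral_eq_set_integral[OF bm_integrable[OF assms(1)] assms(2)])

text \<open>The constant of the slice estimate is doubled to agree with that of the gradient
  estimate, so that all three terms can be added uniformly.\<close>

lemma nn_estimate_sup:
  assumes \<tau>: "T0 < \<tau>" "\<tau> < t0"
  shows "(\<integral>\<^sup>+x\<in>ball x0 \<rho> \<inter> \<Omega>. ennreal ((\<eta> (\<tau>, x))\<^sup>2 * (rr (\<tau>, x))\<^sup>2) \<partial>lborel)
    \<le> ennreal (4 * C / c) * (\<integral>\<^sup>+q\<in>Qc. ennreal (cc q) \<partial>lborel)"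
proof -
  let ?D = "ball x0 \<rho> \<inter> \<Omega>" and ?f = "\<lambda>q. (\<eta> q)\<^sup>2 * (rr q)\<^sup>2"
  have "bounded_conv ?D (\<lambda>n x. ?f (\<tau>, x)) (\<lambda>x. ?f (\<tau>, x))"
  proof -
    have c: "continuous_on Qc ?f" by (intro continuous_intros \<eta>_cont rr_cont)
    obtain M where M: "\<And>q. q \<in> Qc \<Longrightarrow> \<bar>?f q\<bar> \<le> M"
      using bm_bdd[OF bm_mult[OF bm_\<eta>(2) bm_rr(2)]] by (auto simp: bdd_on_def)
    have "continuous_on ?D (\<lambda>x. ?f (\<tau>, x))"
      by (rule continuous_on_compose2[OF c]) (use \<tau> in \<open>auto intro!: continuous_intros simp: Qc_def\<close>)
    then show ?thesis
      using M \<tau> by (intro bounded_conv_const[where C = M] borel_measurable_continuous_on_restrict) (auto simp: Qc_def)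
  qed
  moreover have "?D \<in> sets borel" "emeasure lborel ?D < \<infinity>"
    using \<Omega>_open emeasure_bounded_finite[of ?D] by (auto intro: bounded_Int)
  ultimately have "set_integrable lborel ?D (\<lambda>x. ?f (\<tau>, x))" by (rule bounded_conv_integral(1))
  then have "(\<integral>\<^sup>+x\<in>?D. ennreal (?f (\<tau>, x)) \<partial>lborel) = ennreal (LINT x:?D|lborel. ?f (\<tau>, x))"
    by (rule nn_integral_eq_set_integral) simp
  also have "\<dots> \<le> ennreal (4 * C / c * (LINT q:Qc|lborel. cc q))"
  proof (rule ennreal_leI)
    have "0 \<le> (LINT q:Qc|lborel. cc q)"
      unfolding set_lebesgue_integral_def by (intro Bochner_Integration.integral_nonneg) (use cc_nonneg in \<open>auto simp: indicator_def\<close>)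
    then have "2 * C / c * (LINT q:Qc|lborel. cc q) \<le> 4 * C / c * (LINT q:Qc|lborel. cc q)"
      using cst by (intro mult_right_mono divide_right_mono) auto
    then show "(LINT x:?D|lborel. ?f (\<tau>, x)) \<le> 4 * C / c * (LINT q:Qc|lborel. cc q)"
      using estimate_sup[OF \<tau>] by linarith
  qed
  also have "\<dots> = ennreal (4 * C / c) * (\<integral>\<^sup>+q\<in>Qc. ennreal (cc q) \<partial>lborel)"
    using ennreal_mult'[of "4 * C / c"] cst nn_bm[OF bm_cc cc_nonneg] by simp
  finally show ?thesis .
qed

lemma nn_estimate_gradient:
  "(\<integral>\<^sup>+q\<in>Qc. ennreal ((\<eta> q)\<^sup>2 * DD q) \<partial>lborel) \<le> ennreal (4 * C / c) * (\<integral>\<^sup>+q\<in>Qc. ennreal (cc q) \<partial>lborel)"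
proof -
  have "(\<integral>\<^sup>+q\<in>Qc. ennreal ((\<eta> q)\<^sup>2 * DD q) \<partial>lborel) = ennreal (LINT q:Qc|lborel. (\<eta> q)\<^sup>2 * DD q)"
    by (rule nn_bm) (auto intro!: bm_mult bm_\<eta> bm_DD mult_nonneg_nonneg DD_nonneg)
  also have "\<dots> \<le> ennreal (4 * C / c * (LINT q:Qc|lborel. cc q))"
    by (intro ennreal_leI estimate_gradient)
  also have "\<dots> = ennreal (4 * C / c) * (\<integral>\<^sup>+q\<in>Qc. ennreal (cc q) \<partial>lborel)"
    using ennreal_mult'[of "4 * C / c"] cst nn_bm[OF bm_cc cc_nonneg] by simp
  finally show ?thesis .
qed

lemma null_contact_set: "{q \<in> Q. z i q = \<kappa> \<and> G i q \<noteq> 0} \<in> null_sets lborel"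
proof -
  have 1: "{q \<in> Q. z i q = \<kappa> \<and> G i q \<bullet> b \<noteq> 0} \<in> null_sets lborel" for b
    by (rule null_level_set[OF Q_open z_cont[OF i] _ z_DERIV[OF i]])
       (auto intro!: continuous_intros G_cont i)
  have "{q \<in> Q. z i q = \<kappa> \<and> G i q \<noteq> 0} = (\<Union>b\<in>Basis. {q \<in> Q. z i q = \<kappa> \<and> G i q \<bullet> b \<noteq> 0})"
    using euclidean_eqI[of _ "0 :: 'a"] by auto
  also have "\<dots> \<in> null_sets lborel" using 1 by (intro null_sets_UN' countable_finite) auto
  finally show ?thesis .
qed

text \<open>\<open>r\<close> and \<open>u\<close> belong to the original solution, whereas
  \<open>z\<close> may be its reflection. Only norms of gradients are compared, and these do not see
  the sign.\<close>

context
  fixes r :: "real \<Rightarrow> 'a \<Rightarrow> real" and u :: "nat \<Rightarrow> real \<Rightarrow> 'a \<Rightarrow> real"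
  assumes r: "\<And>t x. (t, x) \<in> Q \<Longrightarrow> r t x = rr (t, x)"
    and z_deriv: "\<And>t x. (t, x) \<in> Q \<Longrightarrow> ((\<lambda>y. z i (t, y)) has_derivative (\<lambda>v. G i (t, x) \<bullet> v)) (at x)"
    and u: "\<And>j t x. j \<in> I \<Longrightarrow> (t, x) \<in> Q \<Longrightarrow> norm (grad (u j t) x) = norm (G j (t, x))"
begin

text \<open>At a contact point where the root has nonzero gradient the truncation is not
  differentiable and \<open>grad\<close> has an arbitrary value. Such points form a null set, and
  everywhere else the chain rule for truncations holds.\<close>

lemma AE_grad_truncation: "AE q in lborel. q \<in> Qc \<longrightarrow> norm (grad (r (fst q)) (snd q)) = heaviside \<kappa> (z i q) * norm (G i q)"
proof (rule AE_I'[OF null_contact_set], rule subsetI)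
  fix q assume q: "q \<in> {q \<in> space lborel. \<not> (q \<in> Qc \<longrightarrow> norm (grad (r (fst q)) (snd q)) = heaviside \<kappa> (z i q) * norm (G i q))}"
  obtain t x where tx: "q = (t, x)" by (cases q)
  have qQ: "(t, x) \<in> Q" using q Qc_sub tx by auto
  obtain S where S: "open S" "x \<in> S" "\<And>y. y \<in> S \<Longrightarrow> (t, y) \<in> Q"
    by (rule open_prod_elim[OF Q_open qQ]) blast
  have "G i q \<noteq> 0 \<and> z i q = \<kappa>"
  proof (rule ccontr)
    assume "\<not> ?thesis"
    then have "grad (r t) x = heaviside \<kappa> (z i (t, x)) *\<^sub>R G i (t, x)"
      using S by (intro grad_truncation[OF z_deriv[OF qQ] S(1,2)]) (auto simp: r rr_def tx)
    then show False using q heaviside_bound(2)[of \<kappa> "z i q"] by (simp add: tx)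
  qed
  then show "q \<in> {q \<in> Q. z i q = \<kappa> \<and> G i q \<noteq> 0}" using qQ tx by auto
qed

lemma part_estimates:
  assumes A: "A \<subseteq> Qc"
  shows "(\<integral>\<^sup>+(t, x)\<in>A. ennreal ((\<eta> (t, x))\<^sup>2 * (norm (grad (r t) x))\<^sup>2) \<partial>lborel)
      \<le> ennreal (4 * C / c) * (\<integral>\<^sup>+q\<in>Qc. ennreal (cc q) \<partial>lborel)" (is ?g)
    and "e \<ge> 0 \<Longrightarrow> e \<le> \<epsilon> \<Longrightarrow> ennreal e * (\<integral>\<^sup>+(t, x)\<in>A. ennreal ((\<eta> (t, x))\<^sup>2 * (r t x)\<^sup>2 * (\<Sum>j\<in>I - {i}. (norm (grad (u j t) x))\<^sup>2)) \<partial>lborel)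
      \<le> ennreal (4 * C / c) * (\<integral>\<^sup>+q\<in>Qc. ennreal (cc q) \<partial>lborel)" (is "_ \<Longrightarrow> _ \<Longrightarrow> ?s")
proof -
  have "(\<integral>\<^sup>+(t, x)\<in>A. ennreal ((\<eta> (t, x))\<^sup>2 * (norm (grad (r t) x))\<^sup>2) \<partial>lborel)
      \<le> (\<integral>\<^sup>+q\<in>Qc. ennreal ((\<eta> q)\<^sup>2 * DD q) \<partial>lborel)"
  proof (rule nn_integral_mono_AE)
    show "AE q in lborel. (case q of (t, x) \<Rightarrow> ennreal ((\<eta> (t, x))\<^sup>2 * (norm (grad (r t) x))\<^sup>2)) * indicator A q
        \<le> ennreal ((\<eta> q)\<^sup>2 * DD q) * indicator Qc q"
      using AE_grad_truncation
    proof eventually_elim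
      case (elim q)
      show ?case
      proof (cases "q \<in> A")
        case True
        then have q: "q \<in> Qc" using A by auto
        have "(heaviside \<kappa> (z i q) * norm (G i q))\<^sup>2 \<le> DD q"
        proof -
          have "(heaviside \<kappa> (z i q) * norm (G i q))\<^sup>2 = heaviside \<kappa> (z i q) * (norm (G i q))\<^sup>2"
            by (simp add: heaviside_def)
          moreover have "0 \<le> \<epsilon> * (rr q)\<^sup>2 * (\<Sum>k\<in>I - {i}. (norm (G k q))\<^sup>2)"
            using cst by (intro mult_nonneg_nonneg sum_nonneg) auto
          ultimately show ?thesis by (simp add: DD_def)
        qed
        then have "(\<eta> q)\<^sup>2 * (heaviside \<kappa> (z i q) * norm (G i q))\<^sup>2 \<le> (\<eta> q)\<^sup>2 * DD q"
          by (intro mult_left_mono) auto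
        then show ?thesis using True q elim by (cases q) (auto intro!: ennreal_leI)
      qed simp
    qed
  qed
  then show ?g using nn_estimate_gradient by (rule order_trans)
  show ?s if e: "e \<ge> 0" "e \<le> \<epsilon>"
  proof -
    have Q0: "indicator A q \<le> (indicator Qc q :: ennreal)" for q using A by (auto simp: indicator_def)
    let ?f = "\<lambda>q. (\<eta> q)\<^sup>2 * (rr q)\<^sup>2 * (\<Sum>j\<in>I - {i}. (norm (G j q))\<^sup>2)"
    have eq: "(case q of (t, x) \<Rightarrow> ennreal ((\<eta> (t, x))\<^sup>2 * (r t x)\<^sup>2 * (\<Sum>j\<in>I - {i}. (norm (grad (u j t) x))\<^sup>2))) * indicator A q
        \<le> ennreal (?f q) * indicator Qc q" for q
    proof (cases "q \<in> A")
      case True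
      then have "q \<in> Q" "q \<in> Qc" using A Qc_sub by auto
      then show ?thesis using True by (cases q) (auto simp: r u)
    qed simp
    have m: "bm ?f" by (intro bm_mult bm_sum bm_G bm_\<eta> bm_rr) auto
    have f0: "0 \<le> ?f q" for q by (intro mult_nonneg_nonneg sum_nonneg) auto
    have "ennreal e * (\<integral>\<^sup>+(t, x)\<in>A. ennreal ((\<eta> (t, x))\<^sup>2 * (r t x)\<^sup>2 * (\<Sum>j\<in>I - {i}. (norm (grad (u j t) x))\<^sup>2)) \<partial>lborel)
        \<le> ennreal e * (\<integral>\<^sup>+q\<in>Qc. ennreal (?f q) \<partial>lborel)"
      by (intro mult_left_mono nn_integral_mono eq) auto
    also have "\<dots> = ennreal (e * (LINT q:Qc|lborel. ?f q))"
      using e by (subst nn_bm[OF m f0]) (simp add: ennreal_mult')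
    also have "\<dots> \<le> ennreal (LINT q:Qc|lborel. (\<eta> q)\<^sup>2 * DD q)"
    proof (rule ennreal_leI)
      have "(LINT q:Qc|lborel. e * ?f q) \<le> (LINT q:Qc|lborel. (\<eta> q)\<^sup>2 * DD q)"
      proof (rule set_integral_mono)
        show "set_integrable lborel Qc (\<lambda>q. e * ?f q)" by (intro bm_integrable bm_mult bm_const m)
        show "set_integrable lborel Qc (\<lambda>q. (\<eta> q)\<^sup>2 * DD q)" by (intro bm_integrable bm_mult bm_DD bm_\<eta>)
        fix q assume "q \<in> Qc"
        have "e * ?f q \<le> \<epsilon> * ?f q" by (rule mult_right_mono[OF e(2) f0])
        moreover have "0 \<le> (\<eta> q)\<^sup>2 * (heaviside \<kappa> (z i q) * (norm (G i q))\<^sup>2)"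
          using heaviside_bound(2) by (intro mult_nonneg_nonneg) auto
        ultimately show "e * ?f q \<le> (\<eta> q)\<^sup>2 * DD q" by (simp add: DD_def distrib_left mult_ac)
      qed
      then show "e * (LINT q:Qc|lborel. ?f q) \<le> (LINT q:Qc|lborel. (\<eta> q)\<^sup>2 * DD q)" by simp
    qed
    also have "\<dots> = (\<integral>\<^sup>+q\<in>Qc. ennreal ((\<eta> q)\<^sup>2 * DD q) \<partial>lborel)"
      by (rule nn_bm[symmetric]) (auto intro!: bm_mult bm_\<eta> bm_DD mult_nonneg_nonneg DD_nonneg)
    finally show ?thesis using nn_estimate_gradient by (rule order_trans)
  qed
qed

text \<open>The bound holds at every time. The work lies in the measurability of the slice integrals
  in time, which bounding an essential supremum requires.\<close>

lemma esssup_estimate: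
  assumes S: "S \<in> sets borel" "S \<subseteq> ball x0 \<rho> \<inter> \<Omega>" and t1: "T0 \<le> t1"
  shows "esssup (restrict_space lborel {t1<..<t0}) (\<lambda>t. \<integral>\<^sup>+x\<in>S. ennreal ((\<eta> (t, x))\<^sup>2 * (r t x)\<^sup>2) \<partial>lborel)
    \<le> ennreal (4 * C / c) * (\<integral>\<^sup>+q\<in>Qc. ennreal (cc q) \<partial>lborel)"
proof (rule esssup_I)
  let ?f = "\<lambda>q. (\<eta> q)\<^sup>2 * (rr q)\<^sup>2"
  have sub: "{t1<..<t0} \<times> S \<subseteq> Qc" using S t1 by (auto simp: Qc_def)
  have rf: "ennreal ((\<eta> (t, x))\<^sup>2 * (r t x)\<^sup>2) * indicator S x = ennreal (?f (t, x)) * indicator S x" if "t \<in> {t1<..<t0}" for t x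
    using r[of t x] subsetD[OF Qc_sub, of "(t, x)"] subsetD[OF sub, of "(t, x)"] that by (auto simp: indicator_def)
  have c: "continuous_on ({t1<..<t0} \<times> S) ?f"
    by (rule continuous_on_subset[OF _ sub]) (intro continuous_intros \<eta>_cont rr_cont)
  have "(\<lambda>t. \<integral>\<^sup>+x\<in>S. ennreal (?f (t, x)) \<partial>lborel) \<in> borel_measurable (restrict_space lborel {t1<..<t0})"
    using S by (intro slice_nn_integral_measurable borel_measurable_continuous_on_restrict c) auto
  then show "(\<lambda>t. \<integral>\<^sup>+x\<in>S. ennreal ((\<eta> (t, x))\<^sup>2 * (r t x)\<^sup>2) \<partial>lborel) \<in> borel_measurable (restrict_space lborel {t1<..<t0})"
    by (rule measurable_cong[THEN iffD1, rotated]) (simp add: space_restrict_space rf)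
  show "AE t in restrict_space lborel {t1<..<t0}. (\<integral>\<^sup>+x\<in>S. ennreal ((\<eta> (t, x))\<^sup>2 * (r t x)\<^sup>2) \<partial>lborel)
    \<le> ennreal (4 * C / c) * (\<integral>\<^sup>+q\<in>Qc. ennreal (cc q) \<partial>lborel)"
  proof (rule AE_I2)
    fix t assume "t \<in> space (restrict_space lborel {t1<..<t0})"
    then have t: "t \<in> {t1<..<t0}" by (simp add: space_restrict_space)
    have "(\<integral>\<^sup>+x\<in>S. ennreal (?f (t, x)) \<partial>lborel) \<le> (\<integral>\<^sup>+x\<in>ball x0 \<rho> \<inter> \<Omega>. ennreal (?f (t, x)) \<partial>lborel)"
      by (rule nn_set_integral_set_mono[OF S(2)])
    also have "\<dots> \<le> ennreal (4 * C / c) * (\<integral>\<^sup>+q\<in>Qc. ennreal (cc q) \<partial>lborel)"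
      using t t1 by (intro nn_estimate_sup) auto
    finally show "(\<integral>\<^sup>+x\<in>S. ennreal ((\<eta> (t, x))\<^sup>2 * (r t x)\<^sup>2) \<partial>lborel)
      \<le> ennreal (4 * C / c) * (\<integral>\<^sup>+q\<in>Qc. ennreal (cc q) \<partial>lborel)" by (simp add: rf[OF t])
  qed
qed

lemma energy_estimate:
  assumes e: "e \<ge> 0" "e \<le> \<epsilon>" and K: "12 * C / c \<le> K"
  shows "esssup (restrict_space lborel {T0<..<t0})
      (\<lambda>t. \<integral>\<^sup>+x\<in>ball x0 \<rho> \<inter> \<Omega>. ennreal ((\<eta> (t, x))\<^sup>2 * (r t x)\<^sup>2) \<partial>lborel)
    + (\<integral>\<^sup>+(t, x)\<in>Qc. ennreal ((\<eta> (t, x))\<^sup>2 * (norm (grad (r t) x))\<^sup>2) \<partial>lborel)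
    + ennreal e * (\<integral>\<^sup>+(t, x)\<in>Qc. ennreal ((\<eta> (t, x))\<^sup>2 * (r t x)\<^sup>2 * (\<Sum>j\<in>I - {i}. (norm (grad (u j t) x))\<^sup>2)) \<partial>lborel)
    \<le> ennreal K * (\<integral>\<^sup>+(t, x)\<in>Qc. ennreal ((r t x)\<^sup>2 *
          ((norm (grad (\<lambda>y. \<eta> (t, y)) x))\<^sup>2 + \<eta> (t, x) * \<bar>deriv (\<lambda>s. \<eta> (s, x)) t\<bar>)) \<partial>lborel)"
proof -
  have "(\<integral>\<^sup>+(t, x)\<in>Qc. ennreal ((r t x)\<^sup>2 * ((norm (grad (\<lambda>y. \<eta> (t, y)) x))\<^sup>2 + \<eta> (t, x) * \<bar>deriv (\<lambda>s. \<eta> (s, x)) t\<bar>)) \<partial>lborel)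
      = (\<integral>\<^sup>+q\<in>Qc. ennreal (cc q) \<partial>lborel)"
  proof (rule set_nn_integral_cong)
    fix q assume "q \<in> space lborel \<inter> Qc"
    moreover obtain t x where "q = (t, x)" by (cases q)
    ultimately show "(case q of (t, x) \<Rightarrow> ennreal ((r t x)\<^sup>2 * ((norm (grad (\<lambda>y. \<eta> (t, y)) x))\<^sup>2 + \<eta> (t, x) * \<bar>deriv (\<lambda>s. \<eta> (s, x)) t\<bar>)))
        = ennreal (cc q)"
      using \<eta>_diff[of q] Qc_sub by (auto simp: cc_def r partial_derivatives_grad Qc_def[symmetric])
  qed auto
  moreover have "ball x0 \<rho> \<inter> \<Omega> \<in> sets borel" using \<Omega>_open by auto
  ultimately show ?thesis
    using cst K by (intro ennreal_triple[where k = "4 * C / c"]) (simp_all add: esssup_estimate part_estimates e)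
qed

text \<open>Where the cutoff equals one it may be inserted into the left-hand side; on the right its
  derivatives are replaced by the bound \<open>M\<close>.\<close>

lemma localized_estimate:
  assumes S: "S \<in> sets borel" "S \<subseteq> ball x0 \<rho> \<inter> \<Omega>" and t1: "T0 \<le> t1"
    and one: "\<And>t x. t \<in> {t1<..<t0} \<Longrightarrow> x \<in> S \<Longrightarrow> \<eta> (t, x) = 1"
    and M: "\<And>q. q \<in> Qc \<Longrightarrow> (norm (snd (grad \<eta> q)))\<^sup>2 + \<eta> q * \<bar>fst (grad \<eta> q)\<bar> \<le> M" "0 \<le> M"
    and e: "e \<ge> 0" "e \<le> \<epsilon>" and K: "12 * C / c * M \<le> K"
  shows "esssup (restrict_space lborel {t1<..<t0}) (\<lambda>t. \<integral>\<^sup>+x\<in>S. ennreal ((r t x)\<^sup>2) \<partial>lborel)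
    + (\<integral>\<^sup>+(t, x)\<in>{t1<..<t0} \<times> S. ennreal ((norm (grad (r t) x))\<^sup>2) \<partial>lborel)
    + ennreal e * (\<integral>\<^sup>+(t, x)\<in>{t1<..<t0} \<times> S. ennreal ((r t x)\<^sup>2 * (\<Sum>j\<in>I - {i}. (norm (grad (u j t) x))\<^sup>2)) \<partial>lborel)
    \<le> ennreal K * (\<integral>\<^sup>+(t, x)\<in>Qc. ennreal ((r t x)\<^sup>2) \<partial>lborel)"
proof -
  let ?A = "{t1<..<t0} \<times> S" and ?Y = "\<integral>\<^sup>+(t, x)\<in>Qc. ennreal ((r t x)\<^sup>2) \<partial>lborel"
  have A: "?A \<subseteq> Qc" using S t1 by (auto simp: Qc_def)
  have rm: "(\<lambda>q. ennreal ((rr q)\<^sup>2) * indicator Qc q) \<in> borel_measurable lborel"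
  proof -
    have "(\<lambda>q. (rr q)\<^sup>2 * indicator Qc q) \<in> borel_measurable borel"
      using bm_integrable[OF bm_rr(2)] unfolding set_integrable_def integrable_iff_bounded by (simp add: mult.commute)
    then have "(\<lambda>q. ennreal ((rr q)\<^sup>2 * indicator Qc q)) \<in> borel_measurable lborel" by measurable
    then show ?thesis by (simp add: ennreal_mult' ennreal_indicator)
  qed
  have "(\<integral>\<^sup>+q\<in>Qc. ennreal (cc q) \<partial>lborel) \<le> (\<integral>\<^sup>+q. ennreal M * (ennreal ((rr q)\<^sup>2) * indicator Qc q) \<partial>lborel)"
  proof (rule nn_integral_mono)
    fix q
    have "cc q \<le> M * (rr q)\<^sup>2" if "q \<in> Qc"
      unfolding cc_def using mult_left_mono[OF M(1)[OF that], of "(rr q)\<^sup>2"] by (simp add: mult.commute)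
    then show "ennreal (cc q) * indicator Qc q \<le> ennreal M * (ennreal ((rr q)\<^sup>2) * indicator Qc q)"
      using M(2) by (auto simp: indicator_def ennreal_mult[symmetric] intro: ennreal_leI)
  qed
  also have "\<dots> = ennreal M * (\<integral>\<^sup>+q\<in>Qc. ennreal ((rr q)\<^sup>2) \<partial>lborel)" by (rule nn_integral_cmult[OF rm])
  also have "(\<integral>\<^sup>+q\<in>Qc. ennreal ((rr q)\<^sup>2) \<partial>lborel) = ?Y"
    using Qc_sub by (intro set_nn_integral_cong) (auto simp: r)
  finally have "ennreal (4 * C / c) * (\<integral>\<^sup>+q\<in>Qc. ennreal (cc q) \<partial>lborel) \<le> ennreal (4 * C / c) * (ennreal M * ?Y)"
    by (rule mult_left_mono) simp
  also have "\<dots> = ennreal (4 * C / c * M) * ?Y" using M(2) cst ennreal_mult'[of "4 * C / c" M] by (simp add: mult.assoc)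
  finally have Y: "ennreal (4 * C / c) * (\<integral>\<^sup>+q\<in>Qc. ennreal (cc q) \<partial>lborel) \<le> ennreal (4 * C / c * M) * ?Y" .
  have eqs: "esssup (restrict_space lborel {t1<..<t0}) (\<lambda>t. \<integral>\<^sup>+x\<in>S. ennreal ((r t x)\<^sup>2) \<partial>lborel)
      = esssup (restrict_space lborel {t1<..<t0}) (\<lambda>t. \<integral>\<^sup>+x\<in>S. ennreal ((\<eta> (t, x))\<^sup>2 * (r t x)\<^sup>2) \<partial>lborel)"
  proof (rule esssup_cong_space)
    fix t assume "t \<in> space (restrict_space lborel {t1<..<t0})"
    then show "(\<integral>\<^sup>+x\<in>S. ennreal ((r t x)\<^sup>2) \<partial>lborel) = (\<integral>\<^sup>+x\<in>S. ennreal ((\<eta> (t, x))\<^sup>2 * (r t x)\<^sup>2) \<partial>lborel)"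
      by (intro set_nn_integral_cong) (auto simp: space_restrict_space one)
  qed
  have eqg: "(\<integral>\<^sup>+(t, x)\<in>?A. ennreal ((norm (grad (r t) x))\<^sup>2) \<partial>lborel)
      = (\<integral>\<^sup>+(t, x)\<in>?A. ennreal ((\<eta> (t, x))\<^sup>2 * (norm (grad (r t) x))\<^sup>2) \<partial>lborel)"
    by (intro set_nn_integral_cong) (auto simp: one)
  have eqz: "(\<integral>\<^sup>+(t, x)\<in>?A. ennreal ((r t x)\<^sup>2 * (\<Sum>j\<in>I - {i}. (norm (grad (u j t) x))\<^sup>2)) \<partial>lborel)
      = (\<integral>\<^sup>+(t, x)\<in>?A. ennreal ((\<eta> (t, x))\<^sup>2 * (r t x)\<^sup>2 * (\<Sum>j\<in>I - {i}. (norm (grad (u j t) x))\<^sup>2)) \<partial>lborel)"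
    by (intro set_nn_integral_cong) (auto simp: one)
  show ?thesis
    unfolding eqs eqg eqz
    by (rule ennreal_triple[OF order_trans[OF esssup_estimate[OF S t1] Y] order_trans[OF part_estimates(1)[OF A] Y]
          order_trans[OF part_estimates(2)[OF A e] Y]])
       (use cst M(2) K in simp_all)
qed

end

end

section \<open>The root system\<close>

text \<open>At each time the gradient extends continuously to the closure, and uniform convergence
  in time makes the extension jointly continuous. The compactness arguments up to the boundary rest
  on this.\<close>

lemma C_C1_extension:
  fixes u :: "real \<Rightarrow> 'a::euclidean_space \<Rightarrow> real"
  assumes u: "C_C1 J S u"
  obtains G where "continuous_on (J \<times> closure S) (\<lambda>(t, x). u t x)" "continuous_on (J \<times> closure S) (\<lambda>(t, x). G t x)"
    "\<And>t x. t \<in> J \<Longrightarrow> x \<in> S \<Longrightarrow> G t x = grad (u t) x"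
    "\<And>t x. t \<in> J \<Longrightarrow> x \<in> S \<Longrightarrow> (u t has_derivative (\<lambda>v. grad (u t) x \<bullet> v)) (at x)"
proof -
  have J: "t \<in> closure J" if "t \<in> J" for t using that closure_subset by auto
  have le: "at t within J \<le> at t within closure J" for t by (rule at_le[OF closure_subset])
  have "\<forall>t\<in>J. \<exists>G. continuous_on (closure S) G \<and> (\<forall>x\<in>S. G x = grad (u t) x)"
    using u J unfolding C_C1_def C1_closure_def by blast
  then obtain G where G: "\<And>t. t \<in> J \<Longrightarrow> continuous_on (closure S) (G t)" "\<And>t x. t \<in> J \<Longrightarrow> x \<in> S \<Longrightarrow> G t x = grad (u t) x"
    by metis
  have "uniform_limit (closure S) u (u t) (at t within J)" "uniform_limit S (\<lambda>s. grad (u s)) (grad (u t)) (at t within J)"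
    if "t \<in> J" for t
    using u J[OF that] le filterlim_mono[OF _ order_refl le] unfolding C_C1_def by blast+
  note ul = this
  have eJ: "eventually (\<lambda>s. s \<in> J) (at t within J)" for t by (simp add: eventually_at_filter)
  have "uniform_limit (closure S) G (G t) (at t within J)" if t: "t \<in> J" for t
  proof (rule uniform_limit_on_closure)
    show "uniform_limit S G (G t) (at t within J)"
      by (rule uniform_limit_cong[THEN iffD1, OF _ _ ul(2)[OF t]])
         (use eJ[of t] G(2) t in \<open>auto elim!: eventually_mono\<close>)
    show "eventually (\<lambda>s. continuous_on (closure S) (G s)) (at t within J)"
      using eJ by eventually_elim (rule G(1))
  qed (rule G(1)[OF t])
  then have "continuous_on (J \<times> closure S) (\<lambda>(t, x). G t x)"
    by (intro uniform_limit_jointly_continuous G(1))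
  moreover have "continuous_on (J \<times> closure S) (\<lambda>(t, x). u t x)"
    using u J ul(1) unfolding C_C1_def C1_closure_def by (intro uniform_limit_jointly_continuous) blast+
  moreover have "(u t has_derivative (\<lambda>v. grad (u t) x \<bullet> v)) (at x)" if "t \<in> J" "x \<in> S" for t x
    using u J[OF that(1)] that(2) unfolding C_C1_def C1_closure_def by (intro frechet_derivative_grad(1)) blast
  ultimately show ?thesis using that G(2) by blast
qed

section \<open>Bounds and separation of the roots\<close>

definition root_box :: "nat \<Rightarrow> (nat \<Rightarrow> real) \<Rightarrow> (nat \<Rightarrow> real) \<Rightarrow> (nat \<Rightarrow> real) \<Rightarrow> bool" where
  "root_box N g a b \<longleftrightarrow> N \<ge> 2 \<and> 0 < g 1 \<and> strict_mono_on {1..N} g \<and>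
    (\<forall>j\<in>{1..N-1}. g j < a j \<and> a j \<le> b j \<and> b j < g (j + 1))"

lemma root_box_D:
  assumes "root_box N g a b"
  shows "0 < g 1" "\<And>j k. 1 \<le> j \<Longrightarrow> j \<le> k \<Longrightarrow> k \<le> N \<Longrightarrow> g j \<le> g k" "\<And>j. 1 \<le> j \<Longrightarrow> j \<le> N \<Longrightarrow> 0 < g j"
proof -
  show g1: "0 < g 1" using assms by (simp add: root_box_def)
  show mono: "g j \<le> g k" if "1 \<le> j" "j \<le> k" "k \<le> N" for j k
    using assms that strict_mono_onD[of "{1..N}" g j k] by (cases "j = k") (auto simp: root_box_def)
  show "0 < g j" if "1 \<le> j" "j \<le> N" for j using g1 mono[of 1 j] that by simp
qed

text \<open>Each root lies below the next \<open>g\<close>, so the roots other than the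
  \<open>j\<close>-th add up to at most \<open>g 2 + ... + g N\<close>, and at least
  \<open>g 1\<close> remains. Positivity of the roots gives the upper bound.\<close>

lemma root_lambda_bounds:
  assumes box: "root_box N g a b" and w: "\<And>l. l \<in> {1..N-1} \<Longrightarrow> w l \<in> {a l..b l}" and j: "j \<in> {1..N-1}"
  shows "g 1 \<le> root_lambda N g j w" "root_lambda N g j w \<le> (\<Sum>l=1..N. g l)"
proof -
  have g: "g l < w l" "w l \<le> g (l + 1)" if "l \<in> {1..N-1}" for l using box w[OF that] that by (force simp: root_box_def)+
  note g0 = root_box_D(3)[OF box]
  have N: "N \<ge> 2" using box by (simp add: root_box_def)
  have "(\<Sum>l\<in>{1..N-1} - {j}. w l) \<le> (\<Sum>l\<in>{1..N-1} - {j}. g (l + 1))" by (intro sum_mono g) auto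
  also have "\<dots> \<le> (\<Sum>l=1..N-1. g (l + 1))"
    using N by (intro sum_mono2) (auto intro!: order_less_imp_le[OF g0])
  also have "\<dots> = (\<Sum>l=2..N. g l)"
    using N sum.shift_bounds_cl_Suc_ivl[of g 1 "N - 1"] by (simp add: numeral_2_eq_2)
  finally have "(\<Sum>l\<in>{1..N-1} - {j}. w l) \<le> (\<Sum>l=2..N. g l)" .
  moreover have "(\<Sum>l=1..N. g l) = g 1 + (\<Sum>l=2..N. g l)"
    using N by (subst sum.atLeast_Suc_atMost) (auto simp: numeral_2_eq_2)
  ultimately show "g 1 \<le> root_lambda N g j w" by (simp add: root_lambda_def)
  have "0 \<le> (\<Sum>l\<in>{1..N-1} - {j}. w l)"
  proof (rule sum_nonneg)
    fix l assume "l \<in> {1..N-1} - {j}"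
    then show "0 \<le> w l" using g(1)[of l] g0[of l] by fastforce
  qed
  then show "root_lambda N g j w \<le> (\<Sum>l=1..N. g l)" by (simp add: root_lambda_def)
qed

lemma root_a_bounds:
  assumes "root_box N g a b" "\<And>l. l \<in> {1..N-1} \<Longrightarrow> w l \<in> {a l..b l}" "j \<in> {1..N-1}"
  shows "1 / (\<Sum>l=1..N. g l) \<le> root_a N g j w" "root_a N g j w \<le> 1 / g 1"
  using root_lambda_bounds[OF assms] root_box_D(1)[OF assms(1)]
  by (auto simp: root_a_def intro!: divide_left_mono)

lemma root_box_separated:
  assumes box: "root_box N g a b"
  obtains \<delta> where "separated_box {1..N-1} a b \<delta>" "separated_box {1..N-1} (\<lambda>j. - b j) (\<lambda>j. - a j) \<delta>"
proof -
  have lt: "b j < a k" if jk: "j \<in> {1..N-1}" "k \<in> {1..N-1}" "j < k" for j k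
  proof -
    have "b j < g (j + 1)" "g k < a k" using box jk by (auto simp: root_box_def)
    moreover have "g (j + 1) \<le> g k" using jk by (intro root_box_D(2)[OF box]) auto
    ultimately show ?thesis by linarith
  qed
  let ?P = "{(j, k). j \<in> {1..N-1} \<and> k \<in> {1..N-1} \<and> j < k}"
  \<comment> \<open>The inserted one keeps the minimum meaningful for \<open>N = 2\<close>, when
    there are no pairs.\<close>
  define S where "S = insert 1 ((\<lambda>(j, k). (a k - b j) / 2) ` ?P)"
  have "?P \<subseteq> {1..N-1} \<times> {1..N-1}" by auto
  then have fin: "finite S" unfolding S_def by (meson finite.insertI finite_SigmaI finite_atLeastAtMost finite_imageI finite_subset)
  have pos: "\<forall>x\<in>S. 0 < x" using lt by (auto simp: S_def)
  define \<delta> where "\<delta> = Min S"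
  have \<delta>: "\<delta> > 0" using fin pos by (auto simp: \<delta>_def S_def)
  have sep: "b j + 2 * \<delta> \<le> a k" if jk: "j \<in> {1..N-1}" "k \<in> {1..N-1}" "j < k" for j k
  proof -
    have "(a k - b j) / 2 \<in> S" using jk unfolding S_def by (intro insertI2 image_eqI[where x = "(j, k)"]) auto
    then have "\<delta> \<le> (a k - b j) / 2" using fin by (simp only: \<delta>_def Min_le)
    then show ?thesis by simp
  qed
  have "separated_box {1..N-1} a b \<delta>"
  proof
    show "b j + 2 * \<delta> \<le> a k \<or> b k + 2 * \<delta> \<le> a j" if "j \<in> {1..N-1}" "k \<in> {1..N-1}" "j \<noteq> k" for j k
      using sep[of j k] sep[of k j] that by (meson linorder_neqE_nat)
  qed (use box \<delta> in \<open>auto simp: root_box_def\<close>)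
  moreover have "separated_box {1..N-1} (\<lambda>j. - b j) (\<lambda>j. - a j) \<delta>"
  proof
    show "- a j + 2 * \<delta> \<le> - b k \<or> - a k + 2 * \<delta> \<le> - b j" if "j \<in> {1..N-1}" "k \<in> {1..N-1}" "j \<noteq> k" for j k
      using sep[of j k] sep[of k j] that by (smt (verit) linorder_neqE_nat)
  qed (use box \<delta> in \<open>auto simp: root_box_def\<close>)
  ultimately show ?thesis by (rule that)
qed

text \<open>One height function covers the interior and the boundary case. Its gradient is a
  multiple of an outward normal at height zero, which is how the Neumann condition becomes vanishing
  flux along \<open>Ds\<close>.\<close>

lemma boundary_chart:
  fixes \<Omega> :: "'a::euclidean_space set"
  assumes \<Omega>: "open \<Omega>"
    and chart: "cball x0 \<rho> \<subseteq> \<Omega> \<or> (\<exists>p \<delta> e \<gamma>. C2_graph_near \<Omega> p \<delta> e \<gamma> \<and> cball x0 \<rho> \<subseteq> ball p \<delta>)"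
  obtains s Ds CL where "\<And>x. (s has_derivative (\<lambda>v. Ds x \<bullet> v)) (at x)" "continuous_on UNIV Ds"
    "\<And>x. x \<in> cball x0 \<rho> \<Longrightarrow> x \<in> \<Omega> \<longleftrightarrow> s x > 0" "(CL::real) \<ge> 0"
    "\<And>d. d > 0 \<Longrightarrow> emeasure lborel {x \<in> ball x0 \<rho> \<inter> \<Omega>. s x < d} \<le> ennreal (CL * d)"
    "\<And>x. x \<in> cball x0 \<rho> \<inter> closure \<Omega> \<Longrightarrow> s x = 0 \<Longrightarrow> \<exists>k \<nu>. outward_unit_normal \<Omega> x \<nu> \<and> Ds x = k *\<^sub>R \<nu>"
  using chart
proof
  assume sub: "cball x0 \<rho> \<subseteq> \<Omega>"
  show ?thesis
  \<comment> \<open>A ball inside the domain gets constant height one: the layer is empty for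
    \<open>d \<le> 1\<close>, and for larger \<open>d\<close> the measure of the ball is at most
    \<open>d\<close> times itself.\<close>
  proof (rule that[of "\<lambda>_. 1" "\<lambda>_. 0" "measure lborel (ball x0 \<rho>)"])
    fix d :: real assume d: "d > 0"
    have "ball x0 \<rho> \<subseteq> cball x0 \<rho>" by (rule ball_subset_cball)
    then have eq: "ball x0 \<rho> \<inter> \<Omega> = ball x0 \<rho>" using sub by auto
    show "emeasure lborel {x \<in> ball x0 \<rho> \<inter> \<Omega>. 1 < d} \<le> ennreal (measure lborel (ball x0 \<rho>) * d)"
    proof (cases "1 < d")
      case True
      have "emeasure lborel (ball x0 \<rho>) = ennreal (measure lborel (ball x0 \<rho>))"
        using emeasure_bounded_finite[OF bounded_ball[of x0 \<rho>]] by (intro emeasure_eq_ennreal_measure) auto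
      moreover have "measure lborel (ball x0 \<rho>) * 1 \<le> measure lborel (ball x0 \<rho>) * d" using True by (intro mult_left_mono) auto
      ultimately have "emeasure lborel (ball x0 \<rho>) \<le> ennreal (measure lborel (ball x0 \<rho>) * d)"
        by (simp only: ennreal_leI mult_1_right)
      then show ?thesis using True by (simp only: eq simp_thms Collect_mem_eq)
    qed simp
  qed (use sub in auto)
next
  assume "\<exists>p \<delta> e \<gamma>. C2_graph_near \<Omega> p \<delta> e \<gamma> \<and> cball x0 \<rho> \<subseteq> ball p \<delta>"
  then obtain p \<delta> e \<gamma> where g: "C2_graph_near \<Omega> p \<delta> e \<gamma>" and sub: "cball x0 \<rho> \<subseteq> ball p \<delta>" by blast
  define s where "s = (\<lambda>y. y \<bullet> e - \<gamma> (y - (y \<bullet> e) *\<^sub>R e))"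
  have \<gamma>: "Ck_on 2 UNIV \<gamma>" and e: "norm e = 1" and eq: "\<Omega> \<inter> ball p \<delta> = {y \<in> ball p \<delta>. \<gamma> (y - (y \<bullet> e) *\<^sub>R e) < y \<bullet> e}"
    using g by (simp_all add: C2_graph_near_def)
  have iff: "x \<in> \<Omega> \<longleftrightarrow> s x > 0" if "x \<in> cball x0 \<rho>" for x
  proof -
    have "x \<in> ball p \<delta>" using sub that by blast
    then have "x \<in> \<Omega> \<longleftrightarrow> x \<in> {y \<in> ball p \<delta>. \<gamma> (y - (y \<bullet> e) *\<^sub>R e) < y \<bullet> e}" using eq by blast
    then show ?thesis using \<open>x \<in> ball p \<delta>\<close> by (simp add: s_def)
  qed
  have pos: "0 < s x" if "x \<in> ball x0 \<rho> \<inter> \<Omega>" for x using iff[of x] that by auto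
  obtain CL where CL: "CL \<ge> 0" "\<forall>d>0. emeasure lborel {x \<in> ball x0 \<rho> \<inter> \<Omega>. s x < d} \<le> ennreal (CL * d)"
    using graph_layer_measure[OF \<gamma> e \<Omega>, of x0 \<rho>] pos unfolding s_def by blast
  show ?thesis
  proof (rule that[of s "grad s" CL])
    show "(s has_derivative (\<lambda>v. grad s x \<bullet> v)) (at x)" for x unfolding s_def by (rule Ck_on_2_grad(1)[OF \<gamma>])
    show "continuous_on UNIV (grad s)" unfolding s_def by (rule Ck_on_2_grad(2)[OF \<gamma>])
    show "\<exists>k \<nu>. outward_unit_normal \<Omega> x \<nu> \<and> grad s x = k *\<^sub>R \<nu>" if x: "x \<in> cball x0 \<rho> \<inter> closure \<Omega>" "s x = 0" for x
    proof -
      \<comment> \<open>The definition of the normal asks for a chart centred at the point itself,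
        so the given chart is restricted to a small ball around \<open>x\<close>.\<close>
      obtain \<delta>' where \<delta>': "\<delta>' > 0" "ball x \<delta>' \<subseteq> ball p \<delta>" using x(1) sub open_contains_ball[of "ball p \<delta>"] by blast
      have "C2_graph_near \<Omega> x \<delta>' e \<gamma>"
        unfolding C2_graph_near_def using \<gamma> e eq \<delta>' by blast
      let ?n = "grad (\<lambda>y. \<gamma> (y - (y \<bullet> e) *\<^sub>R e) - y \<bullet> e) x"
      have "outward_unit_normal \<Omega> x (?n /\<^sub>R norm ?n)"
        unfolding outward_unit_normal_def Let_def using \<open>C2_graph_near \<Omega> x \<delta>' e \<gamma>\<close> by blast
      moreover have "grad s x = - ?n" unfolding s_def Ck_on_2_grad(3)[OF \<gamma>] by simp
      then have "grad s x = (- norm ?n) *\<^sub>R (?n /\<^sub>R norm ?n)" by (cases "?n = 0") auto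
      ultimately show ?thesis by blast
    qed
  qed (use iff CL in auto)
qed

text \<open>By joint continuity the points with flux at least \<open>e\<close> form a compact set.
  It misses the zeros of \<open>s\<close>, so \<open>s\<close> has a positive minimum on it; below
  that height the flux is smaller than \<open>e\<close>, uniformly in time.\<close>

lemma flux_small_near_boundary:
  fixes G :: "real \<Rightarrow> 'a::euclidean_space \<Rightarrow> 'a"
  assumes G: "continuous_on ({T0..t0} \<times> closure (ball x0 \<rho> \<inter> \<Omega>)) (\<lambda>(t, x). G t x)"
    and s: "continuous_on UNIV s" and Ds: "continuous_on UNIV Ds"
    and pos: "\<And>x. x \<in> ball x0 \<rho> \<inter> \<Omega> \<Longrightarrow> (0::real) < s x"
    and zero: "\<And>t x. t \<in> {T0..t0} \<Longrightarrow> x \<in> closure (ball x0 \<rho> \<inter> \<Omega>) \<Longrightarrow> s x = 0 \<Longrightarrow> G t x \<bullet> Ds x = 0"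
    and e: "e > 0"
  shows "eventually (\<lambda>d. \<forall>t\<in>{T0..t0}. \<forall>x\<in>ball x0 \<rho> \<inter> \<Omega>. s x < d \<longrightarrow> \<bar>G t x \<bullet> Ds x\<bar> < e) (at_right 0)"
proof -
  let ?D = "closure (ball x0 \<rho> \<inter> \<Omega>)"
  let ?K = "{T0..t0} \<times> ?D" and ?h = "\<lambda>q. \<bar>(case q of (t, x) \<Rightarrow> G t x) \<bullet> Ds (snd q)\<bar>"
  have K: "compact ?K" by (intro compact_Times compact_closure[THEN iffD2] bounded_Int) auto
  have hc: "continuous_on ?K ?h"
    by (intro continuous_intros G continuous_on_compose2[OF Ds]) auto
  let ?E = "?K \<inter> ?h -` {e..}"
  have "closedin (top_of_set ?K) ?E" by (rule continuous_closedin_preimage[OF hc]) simp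
  from closedin_compact[OF K this] have E: "compact ?E" .
  have s0: "0 \<le> s x" if "x \<in> ?D" for x
  proof -
    have "?D \<subseteq> {x. 0 \<le> s x}"
      using pos by (intro closure_minimal closed_Collect_le continuous_intros s) (auto intro: less_imp_le)
    then show ?thesis using that by auto
  qed
  have "\<exists>d>0. \<forall>q\<in>?E. d \<le> s (snd q)"
  proof (cases "?E = {}")
    case True
    then show ?thesis using zero_less_one by (metis equals0D)
  next
    case False
    have "continuous_on ?E (\<lambda>q. s (snd q))" by (intro continuous_on_compose2[OF s] continuous_intros) auto
    from continuous_attains_inf[OF E False this] obtain q where q: "q \<in> ?E" "\<forall>p\<in>?E. s (snd q) \<le> s (snd p)" by blast
    have "s (snd q) \<noteq> 0" using q(1) e zero[of "fst q" "snd q"] by (cases q) auto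
    moreover have "0 \<le> s (snd q)" using q(1) s0 by auto
    ultimately have "0 < s (snd q)" by simp
    then show ?thesis using q(2) by blast
  qed
  then obtain d0 where d0: "d0 > 0" "\<And>q. q \<in> ?E \<Longrightarrow> d0 \<le> s (snd q)" by blast
  have *: "\<bar>G t x \<bullet> Ds x\<bar> < e" if "t \<in> {T0..t0}" "x \<in> ball x0 \<rho> \<inter> \<Omega>" "s x < d" "d < d0" for t x d
  proof (rule ccontr)
    assume "\<not> ?thesis"
    moreover have "x \<in> ?D" by (rule subsetD[OF closure_subset that(2)])
    ultimately have "(t, x) \<in> ?E" using that(1) by auto
    from d0(2)[OF this] show False using that by simp
  qed
  show ?thesis
    using * by (intro eventually_at_rightI[OF _ d0(1)]) auto
qed

lemma compact_C1_closure_bounded: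
  assumes "C1_closure S f" "bounded S"
  obtains M where "\<And>q. q \<in> S \<Longrightarrow> norm (grad f q) \<le> M"
proof -
  obtain G where G: "continuous_on (closure S) G" "\<And>x. x \<in> S \<Longrightarrow> G x = grad f x"
    using assms(1) by (auto simp: C1_closure_def)
  have "compact (G ` closure S)" using assms(2) by (intro compact_continuous_image G) (simp add: compact_closure)
  then obtain M where "\<And>y. y \<in> G ` closure S \<Longrightarrow> norm y \<le> M" using compact_imp_bounded bounded_iff by metis
  then show ?thesis using that G(2) closure_subset by (metis image_eqI subsetD)
qed

lemma cutoff_cylinder_cutoff:
  fixes \<Omega> :: "'a::euclidean_space set"
  assumes \<eta>: "cutoff \<Omega> t0 x0 \<rho> \<eta>" and \<Omega>: "open \<Omega>" and \<rho>: "\<rho> > 0"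
    and s: "\<And>x. (s has_derivative (\<lambda>v. Ds x \<bullet> v)) (at x)" "continuous_on UNIV Ds"
      "\<And>x. x \<in> cball x0 \<rho> \<Longrightarrow> x \<in> \<Omega> \<longleftrightarrow> s x > 0"
  obtains V where "cylinder_cutoff \<Omega> x0 \<rho> (t0 - \<rho>\<^sup>2) t0 \<eta> s Ds V"
proof -
  let ?Q = "{t0 - \<rho>\<^sup>2<..<t0} \<times> (ball x0 \<rho> \<inter> \<Omega>)"
  have C1: "C1_closure ?Q \<eta>" and b: "\<And>q. q \<in> ?Q \<Longrightarrow> 0 \<le> \<eta> q \<and> \<eta> q \<le> 1"
    using \<eta> unfolding cutoff_def Qcyl_def Dcap_def by blast+
  obtain V where V: "open V" "{t0 - \<rho>\<^sup>2} \<times> (ball x0 \<rho> \<inter> \<Omega>) \<subseteq> V"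
      "{t0 - \<rho>\<^sup>2<..<t0} \<times> (sphere x0 \<rho> \<inter> \<Omega>) \<subseteq> V" "\<And>q. q \<in> V \<Longrightarrow> q \<in> ?Q \<Longrightarrow> \<eta> q = 0"
    using \<eta> \<rho> unfolding cutoff_def Qcyl_def Dcap_def frontier_ball[OF \<rho>] by blast
  have bd: "bounded ?Q" by (intro bounded_Times bounded_Int) auto
  obtain G where G: "continuous_on (closure ?Q) G" "\<And>q. q \<in> ?Q \<Longrightarrow> G q = grad \<eta> q"
    using C1 unfolding C1_closure_def by blast
  show ?thesis
  proof (rule that, unfold_locales)
    show "continuous_on ?Q (grad \<eta>)"
      using continuous_on_subset[OF G(1) closure_subset] G(2) by (simp cong: continuous_on_cong)
    show "\<exists>M. \<forall>q\<in>?Q. norm (grad \<eta> q) \<le> M"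
      by (rule compact_C1_closure_bounded[OF C1 bd]) blast
    show "\<eta> differentiable at q" if "q \<in> ?Q" for q using C1 that unfolding C1_closure_def by blast
    show "t0 - \<rho>\<^sup>2 < t0" using \<rho> by simp
    show "0 \<le> \<eta> q \<and> \<eta> q \<le> 1" if "q \<in> ?Q" for q by (rule b[OF that])
    show "\<eta> q = 0" if "q \<in> V" "q \<in> ?Q" for q by (rule V(4)[OF that])
  qed (rule \<Omega> s V; assumption)+
qed

text \<open>The spatial transition is a function of the squared distance, so no norm is
  differentiated at the centre, and the parabolic scaling lets the single width \<open>D\<close>
  serve both space and time.\<close>

lemma shrinking_cutoff:
  fixes \<Omega> :: "'a::euclidean_space set"
  assumes \<sigma>: "0 < \<sigma>" "\<sigma> < \<rho>" and \<Omega>: "open \<Omega>"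
    and s: "\<And>x. (s has_derivative (\<lambda>v. Ds x \<bullet> v)) (at x)" "continuous_on UNIV Ds"
      "\<And>x. x \<in> cball x0 \<rho> \<Longrightarrow> x \<in> \<Omega> \<longleftrightarrow> s x > 0"
  obtains \<eta> V where "cylinder_cutoff \<Omega> x0 \<rho> (t0 - \<rho>\<^sup>2) t0 \<eta> s Ds V"
    "\<And>t x. t \<in> {t0 - \<sigma>\<^sup>2<..<t0} \<Longrightarrow> x \<in> ball x0 \<sigma> \<Longrightarrow> \<eta> (t, x) = 1"
    "\<And>q. (norm (snd (grad \<eta> q)))\<^sup>2 + \<eta> q * \<bar>fst (grad \<eta> q)\<bar> \<le> 72 / (\<rho> - \<sigma>)\<^sup>2"
proof -
  \<comment> \<open>Stopping at the midpoint leaves room between the support of the cutoff and the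
    outer boundary, as the open set \<open>V\<close> demands.\<close>
  define w where "w = (\<sigma> + \<rho>) / 2"
  define D where "D = w\<^sup>2 - \<sigma>\<^sup>2"
  define t1 where "t1 = t0 - w\<^sup>2"
  have w: "\<sigma> < w" "w < \<rho>" "w - \<sigma> = (\<rho> - \<sigma>) / 2" using \<sigma> by (auto simp: w_def field_simps)
  have D_eq: "D = (w - \<sigma>) * (w + \<sigma>)" by (simp add: D_def power2_eq_square algebra_simps)
  have D: "D > 0" using w \<sigma> by (simp add: D_eq)
  define p where "p = (\<lambda>q :: real \<times> 'a. ((snd q - x0) \<bullet> (snd q - x0) - \<sigma>\<^sup>2) / D)"
  define l where "l = (\<lambda>q :: real \<times> 'a. (fst q - t1) / D)"
  define \<eta> where "\<eta> = (\<lambda>q. (1 - sstep (p q)) * sstep (l q))"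
  define g where "g = (\<lambda>q. ((1 - sstep (p q)) * (dstep (l q) / D), (- (sstep (l q) * dstep (p q) * (2 / D))) *\<^sub>R (snd q - x0)))"
  have dp: "((\<lambda>q. sstep (p q)) has_derivative (\<lambda>v. dstep (p q) * (2 * ((snd q - x0) \<bullet> snd v) / D))) (at q)" for q
  proof -
    have "(p has_derivative (\<lambda>v. 2 * ((snd q - x0) \<bullet> snd v) / D)) (at q)"
      unfolding p_def using D by (auto intro!: derivative_eq_intros simp: inner_commute)
    from has_derivative_compose[OF this sstep_DERIV[THEN has_field_derivative_imp_has_derivative]]
    show ?thesis by (simp add: mult.commute)
  qed
  have dl: "((\<lambda>q. sstep (l q)) has_derivative (\<lambda>v. dstep (l q) * (fst v / D))) (at q)" for q
  proof -
    have "(l has_derivative (\<lambda>v. fst v / D)) (at q)"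
      unfolding l_def using D by (auto intro!: derivative_eq_intros)
    from has_derivative_compose[OF this sstep_DERIV[THEN has_field_derivative_imp_has_derivative]]
    show ?thesis by (simp add: mult.commute)
  qed
  have dg: "(\<eta> has_derivative (\<lambda>v. g q \<bullet> v)) (at q)" for q
    unfolding \<eta>_def
    by (rule has_derivative_eq_rhs[OF has_derivative_mult[OF has_derivative_diff[OF has_derivative_const dp] dl]])
       (use D in \<open>auto simp: g_def inner_prod_def fun_eq_iff inner_diff_left field_simps\<close>)
  have grad: "grad \<eta> = g" using has_derivative_grad_eq[OF dg] by auto
  have \<eta>01: "0 \<le> \<eta> q" "\<eta> q \<le> 1" for q
    using sstep_bounds[of "p q"] sstep_bounds[of "l q"] by (auto simp: \<eta>_def intro: mult_le_one)
  have 1: "\<bar>fst (g q)\<bar> \<le> 8 / (\<rho> - \<sigma>)\<^sup>2" for q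
  proof -
    have "(w - \<sigma>)\<^sup>2 \<le> D" unfolding D_eq power2_eq_square using w \<sigma> by (intro mult_left_mono) auto
    then have D4: "(\<rho> - \<sigma>)\<^sup>2 / 4 \<le> D" by (simp add: w(3) power_divide)
    have "\<bar>fst (g q)\<bar> = (1 - sstep (p q)) * (dstep (l q) / D)"
      using sstep_bounds(2)[of "p q"] dstep_nonneg[of "l q"] D by (simp add: g_def abs_mult)
    also have "\<dots> \<le> 1 * (2 / D)"
      using sstep_bounds[of "p q"] dstep_nonneg[of "l q"] dstep_le[of "l q"] D
      by (intro mult_mono divide_right_mono) auto
    also have "\<dots> \<le> 2 / ((\<rho> - \<sigma>)\<^sup>2 / 4)" using D4 D \<sigma> by (simp only: mult_1) (intro divide_left_mono; simp)
    finally show ?thesis by simp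
  qed
  have 2: "norm (snd (g q)) \<le> 8 / (\<rho> - \<sigma>)" for q
  proof (cases "norm (snd q - x0) \<le> w")
    case True
    have "norm (snd (g q)) = sstep (l q) * dstep (p q) * (2 / D) * norm (snd q - x0)"
      using sstep_bounds(1)[of "l q"] dstep_nonneg[of "p q"] D by (simp add: g_def abs_mult)
    also have "\<dots> \<le> 1 * 2 * (2 / D) * w"
      using sstep_bounds[of "l q"] dstep_nonneg[of "p q"] dstep_le[of "p q"] D True
      by (intro mult_mono mult_nonneg_nonneg) auto
    also have "\<dots> \<le> 4 / (w - \<sigma>)" using w \<sigma> D by (simp add: D_eq field_simps)
    finally show ?thesis by (simp add: w(3))
  next
    case False
    then have "w\<^sup>2 \<le> (snd q - x0) \<bullet> (snd q - x0)"
      using w \<sigma> power_mono[of w "norm (snd q - x0)" 2] by (simp add: power2_norm_eq_inner)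
    then have "1 \<le> p q" using D by (simp add: p_def D_def field_simps)
    then show ?thesis using dstep_eq_0[of "p q"] \<sigma> by (simp add: g_def)
  qed
  show ?thesis
  proof (rule that[of \<eta> "{q. fst q < t1} \<union> {q. w < norm (snd q - x0)}"])
    show "cylinder_cutoff \<Omega> x0 \<rho> (t0 - \<rho>\<^sup>2) t0 \<eta> s Ds ({q. fst q < t1} \<union> {q. w < norm (snd q - x0)})"
    proof
      show "open \<Omega>" by fact
      show "t0 - \<rho>\<^sup>2 < t0" using \<sigma> by simp
      show "\<eta> differentiable at q" for q using dg differentiable_def by blast
      show "continuous_on S (grad \<eta>)" for S
        unfolding grad g_def p_def l_def
        by (intro continuous_intros continuous_on_compose2[OF sstep_cont[of UNIV]] continuous_on_compose2[OF dstep_cont[of UNIV]])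
           (use D in auto)
      show "\<exists>M. \<forall>q\<in>{t0 - \<rho>\<^sup>2<..<t0} \<times> (ball x0 \<rho> \<inter> \<Omega>). norm (grad \<eta> q) \<le> M"
      proof (intro exI ballI)
        fix q
        show "norm (grad \<eta> q) \<le> 8 / (\<rho> - \<sigma>)\<^sup>2 + 8 / (\<rho> - \<sigma>)"
          using norm_Pair_le[of "fst (g q)" "snd (g q)"] 1[of q] 2[of q] by (simp add: grad)
      qed
      show "0 \<le> \<eta> q \<and> \<eta> q \<le> 1" for q using \<eta>01 by blast
      show "open ({q. fst q < t1} \<union> {q. w < norm (snd q - x0)})"
        by (intro open_Un open_Collect_less continuous_intros)
      have "w\<^sup>2 < \<rho>\<^sup>2" using w \<sigma> by (intro power_strict_mono) auto
      then show "{t0 - \<rho>\<^sup>2} \<times> (ball x0 \<rho> \<inter> \<Omega>) \<subseteq> {q. fst q < t1} \<union> {q. w < norm (snd q - x0)}"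
        by (auto simp: t1_def)
      show "{t0 - \<rho>\<^sup>2<..<t0} \<times> (sphere x0 \<rho> \<inter> \<Omega>) \<subseteq> {q. fst q < t1} \<union> {q. w < norm (snd q - x0)}"
        using w by (auto simp: dist_norm norm_minus_commute)
      fix q assume "q \<in> {q. fst q < t1} \<union> {q. w < norm (snd q - x0)}"
      then consider "fst q < t1" | "w < norm (snd q - x0)" by auto
      then show "\<eta> q = 0"
      proof cases
        case 1
        then have "l q \<le> 0" using D by (simp add: l_def divide_nonpos_pos)
        then show ?thesis by (simp add: \<eta>_def sstep_eq)
      next
        case 2
        then have "w\<^sup>2 \<le> (snd q - x0) \<bullet> (snd q - x0)"
          using w \<sigma> power_mono[of w "norm (snd q - x0)" 2] by (simp add: power2_norm_eq_inner)
        then have "1 \<le> p q" using D by (simp add: p_def D_def field_simps)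
        then show ?thesis by (simp add: \<eta>_def sstep_eq)
      qed
    qed (use s in auto)
    show "\<eta> (t, x) = 1" if "t \<in> {t0 - \<sigma>\<^sup>2<..<t0}" "x \<in> ball x0 \<sigma>" for t x
    proof -
      have "norm (x - x0) \<le> \<sigma>" using that by (simp add: dist_norm norm_minus_commute)
      then have "(x - x0) \<bullet> (x - x0) \<le> \<sigma>\<^sup>2" using power_mono[of "norm (x - x0)" \<sigma> 2] by (simp add: power2_norm_eq_inner)
      then have "p (t, x) \<le> 0" using D by (simp add: p_def divide_nonpos_pos)
      moreover have "1 \<le> l (t, x)" using that D by (simp add: l_def t1_def D_def)
      ultimately show ?thesis by (simp add: \<eta>_def sstep_eq)
    qed
    show "(norm (snd (grad \<eta> q)))\<^sup>2 + \<eta> q * \<bar>fst (grad \<eta> q)\<bar> \<le> 72 / (\<rho> - \<sigma>)\<^sup>2" for q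
    proof -
      \<comment> \<open>The constant is \<open>8\<^sup>2 + 8 = 72\<close>.\<close>
      have "(norm (snd (g q)))\<^sup>2 \<le> (8 / (\<rho> - \<sigma>))\<^sup>2" using 2[of q] by (intro power_mono) auto
      moreover have "\<eta> q * \<bar>fst (g q)\<bar> \<le> 1 * (8 / (\<rho> - \<sigma>)\<^sup>2)" using 1[of q] \<eta>01[of q] by (intro mult_mono) auto
      ultimately show ?thesis by (simp add: grad power_divide add_divide_distrib[symmetric])
    qed
  qed
qed

section \<open>The root system and its reflection as a weak flow\<close>

definition signed_root :: "real \<Rightarrow> (nat \<Rightarrow> real \<Rightarrow> 'a \<Rightarrow> real) \<Rightarrow> nat \<Rightarrow> real \<times> 'a \<Rightarrow> real" where
  "signed_root \<sigma> z j q = \<sigma> * z j (fst q) (snd q)"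

definition signed_grad :: "real \<Rightarrow> (nat \<Rightarrow> real \<Rightarrow> 'a \<Rightarrow> real) \<Rightarrow> nat \<Rightarrow> real \<times> 'a \<Rightarrow> 'a::euclidean_space" where
  "signed_grad \<sigma> z j q = \<sigma> *\<^sub>R grad (z j (fst q)) (snd q)"

definition root_mobility :: "nat \<Rightarrow> (nat \<Rightarrow> real) \<Rightarrow> (nat \<Rightarrow> real \<Rightarrow> 'a \<Rightarrow> real) \<Rightarrow> nat \<Rightarrow> real \<times> 'a \<Rightarrow> real" where
  "root_mobility N g z j q = root_a N g j (\<lambda>l. z l (fst q) (snd q))"

text \<open>The mobilities remain functions of the original roots. Under reflection the reaction
  changes sign once, as two signs come from the gradients and one from the difference of the roots;
  the linear part changes sign too. So the reflected roots solve a system of the same form.\<close>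

lemma root_flow_solution:
  fixes \<Omega> U :: "'a::euclidean_space set"
  assumes box: "root_box N g a b" and sol: "strong_root_solution N g p \<Omega> J U z"
    and op: "open J" "open \<Omega>" "open U"
    and range: "\<And>j t x. t \<in> J \<Longrightarrow> x \<in> \<Omega> \<inter> U \<Longrightarrow> j \<in> {1..N-1} \<Longrightarrow> z j t x \<in> {a j..b j}"
    and \<sigma>: "\<sigma> = 1 \<or> \<sigma> = - 1" and sb: "separated_box {1..N-1} a' b' \<delta>"
    and box': "\<And>j y. j \<in> {1..N-1} \<Longrightarrow> y \<in> {a j..b j} \<Longrightarrow> \<sigma> * y \<in> {a' j..b' j}"
  shows "root_flow (J \<times> (\<Omega> \<inter> U)) {1..N-1} a' b' (signed_root \<sigma> z) (signed_grad \<sigma> z)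
    (\<lambda>j q. root_mobility N g z j q *\<^sub>R signed_grad \<sigma> z j q)
    (\<lambda>j q. \<Sum>k\<in>{1..N-1} - {j}. (root_mobility N g z j q + root_mobility N g z k q)
        / (signed_root \<sigma> z j q - signed_root \<sigma> z k q) * (signed_grad \<sigma> z j q \<bullet> signed_grad \<sigma> z k q)) \<delta>"
proof -
  let ?S = "\<Omega> \<inter> U" and ?I = "{1..N-1}"
  let ?Q = "J \<times> ?S"
  interpret separated_box ?I a' b' \<delta> by (rule sb)
  have C1: "C_C1 J ?S (z j)" if "j \<in> ?I" for j using sol that by (simp add: strong_root_solution_def)
  have zc0: "continuous_on ?Q (\<lambda>q. z j (fst q) (snd q))" and gc0: "continuous_on ?Q (\<lambda>q. grad (z j (fst q)) (snd q))"
    and zd: "\<And>t x. t \<in> J \<Longrightarrow> x \<in> ?S \<Longrightarrow> (z j t has_derivative (\<lambda>v. grad (z j t) x \<bullet> v)) (at x)" if j: "j \<in> ?I" for j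
  proof -
    obtain G where G: "continuous_on (J \<times> closure ?S) (\<lambda>(t, x). z j t x)" "continuous_on (J \<times> closure ?S) (\<lambda>(t, x). G t x)"
      "\<And>t x. t \<in> J \<Longrightarrow> x \<in> ?S \<Longrightarrow> G t x = grad (z j t) x"
      "\<And>t x. t \<in> J \<Longrightarrow> x \<in> ?S \<Longrightarrow> (z j t has_derivative (\<lambda>v. grad (z j t) x \<bullet> v)) (at x)"
      using C_C1_extension[OF C1[OF j]] by blast
    have sub: "?Q \<subseteq> J \<times> closure ?S" by (intro Sigma_mono closure_subset order_refl)
    show "continuous_on ?Q (\<lambda>q. z j (fst q) (snd q))"
      using continuous_on_subset[OF G(1) sub] by (simp add: case_prod_beta')
    have "continuous_on ?Q (\<lambda>q. G (fst q) (snd q))"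
      using continuous_on_subset[OF G(2) sub] by (simp add: case_prod_beta')
    then show "continuous_on ?Q (\<lambda>q. grad (z j (fst q)) (snd q))"
      by (rule continuous_on_cong[THEN iffD1, rotated -1]) (auto simp: G(3))
    show "\<And>t x. t \<in> J \<Longrightarrow> x \<in> ?S \<Longrightarrow> (z j t has_derivative (\<lambda>v. grad (z j t) x \<bullet> v)) (at x)" by (rule G(4))
  qed
  have zc: "continuous_on ?Q (signed_root \<sigma> z j)" and gc: "continuous_on ?Q (signed_grad \<sigma> z j)" if "j \<in> ?I" for j
    unfolding signed_root_def[abs_def] signed_grad_def[abs_def] by (intro continuous_intros zc0 gc0 that)+
  have rng: "z l (fst q) (snd q) \<in> {a l..b l}" if "q \<in> ?Q" "l \<in> ?I" for q l using range that by auto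
  have lam: "root_lambda N g j (\<lambda>l. z l (fst q) (snd q)) \<noteq> 0" if q: "q \<in> ?Q" and j: "j \<in> ?I" for q j
    using root_lambda_bounds(1)[OF box _ j, of "\<lambda>l. z l (fst q) (snd q)"] rng[OF q] root_box_D(1)[OF box] by force
  have ac: "continuous_on ?Q (root_mobility N g z j)" if j: "j \<in> ?I" for j
    unfolding root_mobility_def[abs_def] root_a_def
  proof (intro continuous_on_divide continuous_on_const ballI lam j)
    show "continuous_on ?Q (\<lambda>q. root_lambda N g j (\<lambda>l. z l (fst q) (snd q)))"
      unfolding root_lambda_def by (intro continuous_intros zc0) auto
  qed
  have bx: "a' j \<le> signed_root \<sigma> z j q \<and> signed_root \<sigma> z j q \<le> b' j" if "j \<in> ?I" "q \<in> ?Q" for j q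
    using box'[OF that(1) rng[OF that(2,1)]] by (simp add: signed_root_def)
  have ne: "signed_root \<sigma> z j q - signed_root \<sigma> z k q \<noteq> 0" if "j \<in> ?I" "k \<in> ?I" "j \<noteq> k" "q \<in> ?Q" for j k q
    using sep[OF that(1-3)] bx[OF that(1,4)] bx[OF that(2,4)] \<delta> by linarith
  show ?thesis
  proof (intro root_flow.intro weak_flow.intro)
    show "separated_box ?I a' b' \<delta>" by (rule sb)
    show "open ?Q" using op by (intro open_Times open_Int)
    show "finite ?I" by simp
    show "continuous_on ?Q (signed_root \<sigma> z j)" "continuous_on ?Q (signed_grad \<sigma> z j)"
      "continuous_on ?Q (\<lambda>q. root_mobility N g z j q *\<^sub>R signed_grad \<sigma> z j q)" if "j \<in> ?I" for j
      by (intro continuous_intros zc gc ac that)+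
    show "continuous_on ?Q (\<lambda>q. \<Sum>k\<in>?I - {j}. (root_mobility N g z j q + root_mobility N g z k q)
        / (signed_root \<sigma> z j q - signed_root \<sigma> z k q) * (signed_grad \<sigma> z j q \<bullet> signed_grad \<sigma> z k q))" if "j \<in> ?I" for j
      using that by (intro continuous_intros zc gc ac ballI ne) auto
    show "((\<lambda>h. signed_root \<sigma> z j (q + h *\<^sub>R (0, w))) has_real_derivative signed_grad \<sigma> z j q \<bullet> w) (at 0)"
      if j: "j \<in> ?I" and q: "q \<in> ?Q" for j q w
    proof -
      have "((\<lambda>h. z j (fst q) (snd q + h *\<^sub>R w)) has_real_derivative grad (z j (fst q)) (snd q) \<bullet> w) (at 0)"
        by (rule has_derivative_line[OF zd[OF j]]) (use q in auto)
      from DERIV_cmult[OF this, of \<sigma>] show ?thesis by (simp add: signed_root_def signed_grad_def)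
    qed
    show "(\<lambda>j. signed_root \<sigma> z j q) \<in> coord_box ?I a' b'" if "q \<in> ?Q" for q
      using bx that by (simp add: coord_box_def)
    fix j :: nat and \<phi> :: "real \<times> 'a \<Rightarrow> real" assume j: "j \<in> ?I" and \<phi>: "test_function ?Q \<phi>"
    have "Ck_on (Suc 0) UNIV \<phi>" using \<phi> unfolding test_function_def by blast
    then have d\<phi>: "\<phi> differentiable (at q)" for q by (cases q) simp
    let ?f = "\<lambda>q. case q of (t, x) \<Rightarrow>
             - z j t x * deriv (\<lambda>s. \<phi> (s, x)) t
             + root_a N g j (\<lambda>l. z l t x) * (grad (z j t) x \<bullet> grad (\<lambda>y. \<phi> (t, y)) x)
             + (\<Sum>k\<in>?I - {j}. root_C N g j k (\<lambda>l. z l t x) * (grad (z j t) x \<bullet> grad (z k t) x)) * \<phi> (t, x)"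
    let ?g = "\<lambda>q. - signed_root \<sigma> z j q * frechet_derivative \<phi> (at q) (1, 0)
          + (\<Sum>b\<in>Basis. ((root_mobility N g z j q *\<^sub>R signed_grad \<sigma> z j q) \<bullet> b) * frechet_derivative \<phi> (at q) (0, b))
          + (\<Sum>k\<in>?I - {j}. (root_mobility N g z j q + root_mobility N g z k q)
              / (signed_root \<sigma> z j q - signed_root \<sigma> z k q) * (signed_grad \<sigma> z j q \<bullet> signed_grad \<sigma> z k q)) * \<phi> q"
    have eq: "?g q = \<sigma> * ?f q" for q
    proof (cases q)
      case (Pair t x)
      have s2: "\<sigma> * \<sigma> = 1" "c / (\<sigma> * u - \<sigma> * v) = \<sigma> * (c / (u - v))" for c u v
        using \<sigma> minus_divide_right[of c "u - v"] by auto
      have 1: "frechet_derivative \<phi> (at q) (1, 0) = deriv (\<lambda>s. \<phi> (s, x)) t"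
        using frechet_derivative_grad(2)[OF d\<phi>] partial_derivatives_grad(2)[OF d\<phi>] by (simp add: Pair inner_Pair_0)
      have 2: "frechet_derivative \<phi> (at q) (0, b) = grad (\<lambda>y. \<phi> (t, y)) x \<bullet> b" for b
        using frechet_derivative_grad(2)[OF d\<phi>] partial_derivatives_grad(1)[OF d\<phi>] by (simp add: Pair inner_Pair_0)
      have 3: "(\<Sum>b\<in>Basis. (F \<bullet> b) * (grad (\<lambda>y. \<phi> (t, y)) x \<bullet> b)) = F \<bullet> grad (\<lambda>y. \<phi> (t, y)) x" for F
        by (rule euclidean_inner[symmetric])
      have "(root_mobility N g z j q + root_mobility N g z k q)
              / (signed_root \<sigma> z j q - signed_root \<sigma> z k q) * (signed_grad \<sigma> z j q \<bullet> signed_grad \<sigma> z k q)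
            = \<sigma> * (root_C N g j k (\<lambda>l. z l t x) * (grad (z j t) x \<bullet> grad (z k t) x))" for k
        unfolding signed_root_def signed_grad_def root_mobility_def root_C_def s2 Pair using s2(1)
        by (simp add: mult.assoc[symmetric])
      then have 4: "(\<Sum>k\<in>?I - {j}. (root_mobility N g z j q + root_mobility N g z k q)
              / (signed_root \<sigma> z j q - signed_root \<sigma> z k q) * (signed_grad \<sigma> z j q \<bullet> signed_grad \<sigma> z k q))
            = \<sigma> * (\<Sum>k\<in>?I - {j}. root_C N g j k (\<lambda>l. z l t x) * (grad (z j t) x \<bullet> grad (z k t) x))"
        by (simp only: sum_distrib_left)
      show ?thesis unfolding 1 2 3 4
        by (simp add: Pair signed_root_def signed_grad_def root_mobility_def algebra_simps)
    qed
    have "(LINT q:?Q|lborel. ?f q) = 0"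
      using sol j \<phi> unfolding strong_root_solution_def root_system_distributional_def by blast
    then show "(LINT q:?Q|lborel. ?g q) = 0" unfolding eq by simp
  qed
qed

text \<open>The inequality with coefficient one in front of the gradient term; \<open>e\<close>
  takes the place of \<open>c * \<epsilon>\<close>.\<close>

definition cutoff_energy_bound ::
  "'a::euclidean_space set \<Rightarrow> nat \<Rightarrow> nat \<Rightarrow> (nat \<Rightarrow> real \<Rightarrow> 'a \<Rightarrow> real) \<Rightarrow> (real \<Rightarrow> 'a \<Rightarrow> real) \<Rightarrow> (real \<times> 'a \<Rightarrow> real)
    \<Rightarrow> real \<Rightarrow> 'a \<Rightarrow> real \<Rightarrow> real \<Rightarrow> real \<Rightarrow> bool" where
  "cutoff_energy_bound \<Omega> N i z r \<eta> t0 x0 \<rho> e K \<longleftrightarrow>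
    esssup (restrict_space lborel {t0 - \<rho>\<^sup>2 <..< t0})
      (\<lambda>s. \<integral>\<^sup>+ x\<in>Dcap \<Omega> x0 \<rho>. ennreal ((\<eta> (s, x))\<^sup>2 * (r s x)\<^sup>2) \<partial>lborel)
    + (\<integral>\<^sup>+ (t, x)\<in>Qcyl \<Omega> t0 x0 \<rho>. ennreal ((\<eta> (t, x))\<^sup>2 * (norm (grad (r t) x))\<^sup>2) \<partial>lborel)
    + ennreal e *
      (\<integral>\<^sup>+ (t, x)\<in>Qcyl \<Omega> t0 x0 \<rho>. ennreal ((\<eta> (t, x))\<^sup>2 * (r t x)\<^sup>2 *
          (\<Sum>j\<in>{1..N-1} - {i}. (norm (grad (z j t) x))\<^sup>2)) \<partial>lborel)
    \<le> ennreal K *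
      (\<integral>\<^sup>+ (t, x)\<in>Qcyl \<Omega> t0 x0 \<rho>. ennreal ((r t x)\<^sup>2 *
          ((norm (grad (\<lambda>y. \<eta> (t, y)) x))\<^sup>2 + \<eta> (t, x) * \<bar>deriv (\<lambda>s. \<eta> (s, x)) t\<bar>)) \<partial>lborel)"

definition local_energy_bound ::
  "'a::euclidean_space set \<Rightarrow> nat \<Rightarrow> nat \<Rightarrow> (nat \<Rightarrow> real \<Rightarrow> 'a \<Rightarrow> real) \<Rightarrow> (real \<Rightarrow> 'a \<Rightarrow> real)
    \<Rightarrow> real \<Rightarrow> 'a \<Rightarrow> real \<Rightarrow> real \<Rightarrow> real \<Rightarrow> real \<Rightarrow> bool" where
  "local_energy_bound \<Omega> N i z r t0 x0 \<rho> \<rho>' e K \<longleftrightarrow>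
    esssup (restrict_space lborel {t0 - \<rho>'\<^sup>2 <..< t0}) (\<lambda>t. \<integral>\<^sup>+ x\<in>Dcap \<Omega> x0 \<rho>'. ennreal ((r t x)\<^sup>2) \<partial>lborel)
    + (\<integral>\<^sup>+ (t, x)\<in>Qcyl \<Omega> t0 x0 \<rho>'. ennreal ((norm (grad (r t) x))\<^sup>2) \<partial>lborel)
    + ennreal e *
      (\<integral>\<^sup>+ (t, x)\<in>Qcyl \<Omega> t0 x0 \<rho>'. ennreal ((r t x)\<^sup>2 * (\<Sum>j\<in>{1..N-1} - {i}. (norm (grad (z j t) x))\<^sup>2)) \<partial>lborel)
    \<le> ennreal (K / (\<rho> - \<rho>')\<^sup>2) * (\<integral>\<^sup>+ (t, x)\<in>Qcyl \<Omega> t0 x0 \<rho>. ennreal ((r t x)\<^sup>2) \<partial>lborel)"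

text \<open>The continuous extension and the boundary condition give two limits of the normal
  derivative at \<open>x\<close>. They agree because \<open>x\<close> lies in the closure of the
  open set but not in the set, so that the filter of approach is nontrivial.\<close>

lemma neumann_extension_zero:
  assumes G: "continuous_on (J \<times> closure (\<Omega> \<inter> U)) (\<lambda>(t, x). G t x)"
      "\<And>t x. t \<in> J \<Longrightarrow> x \<in> \<Omega> \<inter> U \<Longrightarrow> G t x = grad (z j t) x"
    and neu: "neumann_trace_zero N J \<Omega> U z" and j: "j \<in> {1..N-1}" and t: "t \<in> J"
    and x: "x \<in> closure \<Omega>" "x \<notin> \<Omega>" "x \<in> U" and op: "open \<Omega>" "open U" and \<nu>: "outward_unit_normal \<Omega> x \<nu>"
  shows "G t x \<bullet> \<nu> = 0"
proof -
  have xc: "x \<in> closure (\<Omega> \<inter> U)" using x op open_Int_closure_subset[of U \<Omega>] by (auto simp: Int_commute)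
  have "x \<in> frontier \<Omega> \<inter> U" using x op by (simp add: frontier_def interior_open)
  then have 1: "((\<lambda>y. grad (z j t) y \<bullet> \<nu>) \<longlongrightarrow> 0) (at x within \<Omega> \<inter> U)"
    using neu j t \<nu> unfolding neumann_trace_zero_def by blast
  have "continuous_on (closure (\<Omega> \<inter> U)) (\<lambda>y. G t y \<bullet> \<nu>)"
  proof -
    have "continuous_on (closure (\<Omega> \<inter> U)) (\<lambda>y. case (t, y) of (t, x) \<Rightarrow> G t x)"
      by (rule continuous_on_compose2[OF G(1)]) (use t in \<open>auto intro!: continuous_intros\<close>)
    then show ?thesis by (intro continuous_intros) simp
  qed
  then have "((\<lambda>y. G t y \<bullet> \<nu>) \<longlongrightarrow> G t x \<bullet> \<nu>) (at x within closure (\<Omega> \<inter> U))"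
    using xc by (simp add: continuous_on_def)
  then have "((\<lambda>y. G t y \<bullet> \<nu>) \<longlongrightarrow> G t x \<bullet> \<nu>) (at x within \<Omega> \<inter> U)"
    by (rule tendsto_within_subset[OF _ closure_subset])
  then have 2: "((\<lambda>y. grad (z j t) y \<bullet> \<nu>) \<longlongrightarrow> G t x \<bullet> \<nu>) (at x within \<Omega> \<inter> U)"
    by (rule Lim_transform_within[OF _ zero_less_one]) (simp add: G(2)[OF t])
  have "at x within \<Omega> \<inter> U \<noteq> bot"
    using xc x(2) by (simp add: at_within_eq_bot_iff)
  from tendsto_unique[OF this 2 1] show ?thesis .
qed

text \<open>Quantifying over every smaller \<open>e\<close> and every larger \<open>K'\<close>
  builds in monotonicity, so that the constants for upper and lower truncations can be merged by a
  minimum and a maximum.\<close>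

definition truncation_estimates ::
  "'a::euclidean_space set \<Rightarrow> nat \<Rightarrow> (nat \<Rightarrow> real) \<Rightarrow> (nat \<Rightarrow> real) \<Rightarrow> (nat \<Rightarrow> real) \<Rightarrow> real \<Rightarrow> real \<Rightarrow> real \<Rightarrow> real \<Rightarrow> bool" where
  "truncation_estimates \<Omega> N g a b R \<sigma> K \<epsilon> \<longleftrightarrow>
    (\<forall>p x0 t0 \<rho> J U z i k r e K'. x0 \<in> closure \<Omega> \<longrightarrow> 0 < \<rho> \<longrightarrow> \<rho> \<le> R \<longrightarrow>
      solution_neighbourhood t0 x0 \<rho> J U \<longrightarrow> strong_root_solution N g p \<Omega> J U z \<longrightarrow>
      (\<forall>t\<in>J. \<forall>x\<in>\<Omega> \<inter> U. \<forall>j\<in>{1..N-1}. z j t x \<in> {a j..b j}) \<longrightarrow>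
      i \<in> {1..N-1} \<longrightarrow> k \<in> {a i..b i} \<longrightarrow> r = (\<lambda>t x. max 0 (\<sigma> * z i t x - \<sigma> * k)) \<longrightarrow>
      0 \<le> e \<longrightarrow> e \<le> \<epsilon> \<longrightarrow> K \<le> K' \<longrightarrow>
      (\<forall>\<eta>. cutoff \<Omega> t0 x0 \<rho> \<eta> \<longrightarrow> cutoff_energy_bound \<Omega> N i z r \<eta> t0 x0 \<rho> e K') \<and>
      (\<forall>\<rho>'. 0 < \<rho>' \<longrightarrow> \<rho>' < \<rho> \<longrightarrow> local_energy_bound \<Omega> N i z r t0 x0 \<rho> \<rho>' e (72 * K')))"

text \<open>The constants are fixed from the box and the bounds on the mobilities before any
  solution or cylinder is introduced; this gives the claimed uniformity. The chart influences only
  the error terms, which vanish in the limit.\<close>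

lemma root_truncation_estimates:
  fixes \<Omega> :: "'a::euclidean_space set"
  assumes box: "root_box N g a b" and \<sigma>: "\<sigma> = 1 \<or> \<sigma> = - 1" and sb: "separated_box {1..N-1} a' b' \<delta>"
    and box': "\<And>j y. j \<in> {1..N-1} \<Longrightarrow> y \<in> {a j..b j} \<Longrightarrow> \<sigma> * y \<in> {a' j..b' j}"
    and \<Omega>: "open \<Omega>"
    and chart: "\<And>x0 \<rho>. x0 \<in> closure \<Omega> \<Longrightarrow> 0 < \<rho> \<Longrightarrow> \<rho> \<le> R \<Longrightarrow>
      cball x0 \<rho> \<subseteq> \<Omega> \<or> (\<exists>p \<delta> e \<gamma>. C2_graph_near \<Omega> p \<delta> e \<gamma> \<and> cball x0 \<rho> \<subseteq> ball p \<delta>)"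
  obtains K \<epsilon> where "0 < K" "0 < \<epsilon>" "truncation_estimates \<Omega> N g a b R \<sigma> K \<epsilon>"
proof -
  let ?I = "{1..N-1}"
  interpret B: separated_box ?I a' b' \<delta> by (rule sb)
  define \<alpha>0 where "\<alpha>0 = 1 / (\<Sum>l=1..N. g l)"
  define \<alpha>1 where "\<alpha>1 = 1 / g 1"
  have "0 < (\<Sum>l=1..N. g l)"
    using box root_box_D(3)[OF box] by (intro sum_pos) (auto simp: root_box_def)
  then have \<alpha>0: "0 < \<alpha>0" and \<alpha>1: "0 \<le> \<alpha>1" using root_box_D(1)[OF box] by (simp_all add: \<alpha>0_def \<alpha>1_def)
  from B.energy_coercive[OF this, where ?'a = 'a] obtain c C \<epsilon> where
    c: "c > 0" and C: "C > 0" and \<epsilon>: "\<epsilon> > 0"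
    and en: "\<And>i \<kappa> w. i \<in> ?I \<Longrightarrow> \<kappa> \<in> {a' i..b' i} \<Longrightarrow> w \<in> B.X \<Longrightarrow> c * (max 0 (w i - \<kappa>))\<^sup>2 \<le> B.en i \<epsilon> (heaviside \<kappa>) w"
      "\<And>i \<kappa> w. i \<in> ?I \<Longrightarrow> \<kappa> \<in> {a' i..b' i} \<Longrightarrow> w \<in> B.X \<Longrightarrow> B.en i \<epsilon> (heaviside \<kappa>) w \<le> C * (max 0 (w i - \<kappa>))\<^sup>2"
      "\<And>i \<kappa> w \<alpha> G. i \<in> ?I \<Longrightarrow> \<kappa> \<in> {a' i..b' i} \<Longrightarrow> w \<in> B.X \<Longrightarrow> (\<And>j. j \<in> ?I \<Longrightarrow> \<alpha>0 \<le> \<alpha> j \<and> \<alpha> j \<le> \<alpha>1) \<Longrightarrow>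
      c * (heaviside \<kappa> (w i) * (norm (G i :: 'a))\<^sup>2 + \<epsilon> * (max 0 (w i - \<kappa>))\<^sup>2 * (\<Sum>k\<in>?I - {i}. (norm (G k))\<^sup>2))
      \<le> (\<Sum>j\<in>?I. B.en1 i \<epsilon> (heaviside \<kappa>) j w * (\<Sum>k\<in>?I - {j}. (\<alpha> j + \<alpha> k) / (w j - w k) * (G j \<bullet> G k)))
        + (\<Sum>j\<in>?I. \<Sum>k\<in>?I. B.en2 i \<epsilon> (heaviside \<kappa>) j k w * (G k \<bullet> (\<alpha> j *\<^sub>R G j)))"
      "\<And>i \<kappa> w \<alpha> G \<eta> v. i \<in> ?I \<Longrightarrow> \<kappa> \<in> {a' i..b' i} \<Longrightarrow> w \<in> B.X \<Longrightarrow> (\<And>j. j \<in> ?I \<Longrightarrow> \<alpha>0 \<le> \<alpha> j \<and> \<alpha> j \<le> \<alpha>1) \<Longrightarrow>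
      2 * \<eta> * \<bar>\<Sum>j\<in>?I. B.en1 i \<epsilon> (heaviside \<kappa>) j w * ((\<alpha> j *\<^sub>R G j) \<bullet> (v :: 'a))\<bar>
      \<le> c / 2 * (\<eta>\<^sup>2 * (heaviside \<kappa> (w i) * (norm (G i))\<^sup>2 + \<epsilon> * (max 0 (w i - \<kappa>))\<^sup>2 * (\<Sum>k\<in>?I - {i}. (norm (G k))\<^sup>2)))
        + C * ((max 0 (w i - \<kappa>))\<^sup>2 * (norm v)\<^sup>2)"
      "\<And>i \<kappa> w j. i \<in> ?I \<Longrightarrow> \<kappa> \<in> {a' i..b' i} \<Longrightarrow> w \<in> B.X \<Longrightarrow> j \<in> ?I \<Longrightarrow> \<bar>B.en1 i \<epsilon> (heaviside \<kappa>) j w\<bar> \<le> C"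
    by blast
  show ?thesis
  proof (rule that[of "12 * C / c" \<epsilon>], goal_cases)
    case 3
    show ?case unfolding truncation_estimates_def
    proof (intro allI impI)
      fix p t0 \<rho> i k e K' and x0 :: 'a and J and U :: "'a set" and z :: "nat \<Rightarrow> real \<Rightarrow> 'a \<Rightarrow> real" and r
      assume x0: "x0 \<in> closure \<Omega>" and \<rho>: "0 < \<rho>" "\<rho> \<le> R" and nb: "solution_neighbourhood t0 x0 \<rho> J U"
        and sol: "strong_root_solution N g p \<Omega> J U z"
        and rng: "\<forall>t\<in>J. \<forall>x\<in>\<Omega> \<inter> U. \<forall>j\<in>?I. z j t x \<in> {a j..b j}"
        and i: "i \<in> ?I" and k: "k \<in> {a i..b i}" and r: "r = (\<lambda>t x. max 0 (\<sigma> * z i t x - \<sigma> * k))"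
        and e: "0 \<le> e" "e \<le> \<epsilon>" and K': "12 * C / c \<le> K'"
      define \<kappa> where "\<kappa> = \<sigma> * k"
      have \<kappa>: "\<kappa> \<in> {a' i..b' i}" unfolding \<kappa>_def by (rule box'[OF i k])
      have range: "z j t x \<in> {a j..b j}" if "t \<in> J" "x \<in> \<Omega> \<inter> U" "j \<in> ?I" for j t x using rng that by blast
      let ?T0 = "t0 - \<rho>\<^sup>2" and ?S = "\<Omega> \<inter> U" and ?D = "ball x0 \<rho> \<inter> \<Omega>"
      let ?Q = "J \<times> ?S" and ?z = "signed_root \<sigma> z" and ?G = "signed_grad \<sigma> z" and ?\<alpha> = "root_mobility N g z"
      let ?B = "\<lambda>j q. \<Sum>k\<in>?I - {j}. (?\<alpha> j q + ?\<alpha> k q) / (?z j q - ?z k q) * (?G j q \<bullet> ?G k q)"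
      have op: "open J" "open U" and J: "{?T0..t0} \<subseteq> J" and U: "cball x0 \<rho> \<subseteq> U"
        using nb \<rho> by (auto simp: solution_neighbourhood_def)
      have T0: "?T0 < t0" using \<rho> by simp
      have bU: "ball x0 \<rho> \<subseteq> U" using U ball_subset_cball[of x0 \<rho>] by blast
      have rf: "root_flow ?Q ?I a' b' ?z ?G (\<lambda>j q. ?\<alpha> j q *\<^sub>R ?G j q) ?B \<delta>"
        by (rule root_flow_solution[OF box sol op(1) \<Omega> op(2) range \<sigma> sb box'])
      then interpret F: root_flow ?Q ?I a' b' ?z ?G "\<lambda>j q. ?\<alpha> j q *\<^sub>R ?G j q" ?B \<delta> .
      have \<alpha>: "\<alpha>0 \<le> ?\<alpha> j q \<and> ?\<alpha> j q \<le> \<alpha>1" if "j \<in> ?I" "q \<in> ?Q" for j q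
        using root_a_bounds[OF box _ that(1), of "\<lambda>l. z l (fst q) (snd q)"] range that(2)
        by (auto simp: root_mobility_def \<alpha>0_def \<alpha>1_def)
      have s1: "\<bar>\<sigma>\<bar> = 1" using \<sigma> by auto
      have C1: "C_C1 J ?S (z j)" if "j \<in> ?I" for j using sol that by (simp add: strong_root_solution_def)
      have neu: "neumann_trace_zero N J \<Omega> U z" using sol by (simp add: strong_root_solution_def)
      obtain s Ds CL where s: "\<And>x. (s has_derivative (\<lambda>v. Ds x \<bullet> v)) (at x)" "continuous_on UNIV Ds"
        "\<And>x. x \<in> cball x0 \<rho> \<Longrightarrow> x \<in> \<Omega> \<longleftrightarrow> s x > 0" and CL: "(CL::real) \<ge> 0"
        "\<And>d. d > 0 \<Longrightarrow> emeasure lborel {x \<in> ?D. s x < d} \<le> ennreal (CL * d)"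
        and sn: "\<And>x. x \<in> cball x0 \<rho> \<inter> closure \<Omega> \<Longrightarrow> s x = 0 \<Longrightarrow> \<exists>k \<nu>. outward_unit_normal \<Omega> x \<nu> \<and> Ds x = k *\<^sub>R \<nu>"
        by (rule boundary_chart[OF \<Omega> chart[OF x0 \<rho>]]) blast
      have sc: "continuous_on UNIV s"
        by (intro continuous_at_imp_continuous_on ballI has_derivative_continuous[OF s(1)])
      have pos: "0 < s x" if "x \<in> ?D" for x using that s(3)[of x] by auto
      have clD: "closure ?D \<subseteq> cball x0 \<rho> \<inter> closure \<Omega>"
      proof -
        have "?D \<subseteq> cball x0 \<rho>" using ball_subset_cball[of x0 \<rho>] by blast
        then have "closure ?D \<subseteq> cball x0 \<rho>" by (rule closure_minimal) simp
        moreover have "closure ?D \<subseteq> closure \<Omega>" by (rule closure_mono) simp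
        ultimately show ?thesis by blast
      qed
      have clS: "closure ?D \<subseteq> closure ?S" using bU by (intro closure_mono) auto
      have ext: "bdd_on ({?T0<..<t0} \<times> ?D) (\<lambda>q. norm (?G j q))
        \<and> (\<forall>e>0. eventually (\<lambda>d. \<forall>t\<in>{?T0<..<t0}. \<forall>x\<in>?D. s x < d \<longrightarrow> \<bar>?G j (t, x) \<bullet> Ds x\<bar> < e) (at_right 0))
        \<and> (\<forall>t x. (t, x) \<in> ?Q \<longrightarrow> ((\<lambda>y. ?z j (t, y)) has_derivative (\<lambda>v. ?G j (t, x) \<bullet> v)) (at x))" if j: "j \<in> ?I" for j
      proof -
        obtain G where G0: "continuous_on (J \<times> closure ?S) (\<lambda>(t, x). z j t x)" "continuous_on (J \<times> closure ?S) (\<lambda>(t, x). G t x)"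
          "\<And>t x. t \<in> J \<Longrightarrow> x \<in> ?S \<Longrightarrow> G t x = grad (z j t) x"
          "\<And>t x. t \<in> J \<Longrightarrow> x \<in> ?S \<Longrightarrow> (z j t has_derivative (\<lambda>v. grad (z j t) x \<bullet> v)) (at x)"
          using C_C1_extension[OF C1[OF j]] by blast
        note G = G0(2-4)
        have Gc: "continuous_on ({?T0..t0} \<times> closure ?D) (\<lambda>(t, x). G t x)"
          by (rule continuous_on_subset[OF G(1)]) (use J clS in auto)
        have Geq: "?G j (t, x) = \<sigma> *\<^sub>R G t x" if "t \<in> {?T0<..<t0}" "x \<in> ?D" for t x
        proof -
          have "t \<in> J" using that(1) J by auto
          moreover have "x \<in> ?S" using that(2) bU by blast
          ultimately show ?thesis by (simp add: signed_grad_def G(2))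
        qed
        have cD: "x \<in> closure ?D" if "x \<in> ?D" for x using that by (rule subsetD[OF closure_subset])
        have "bdd_on ({?T0..t0} \<times> closure ?D) (\<lambda>q. norm (case q of (t, x) \<Rightarrow> G t x))"
          by (intro bdd_on_compact compact_Times compact_closure[THEN iffD2] bounded_Int continuous_on_norm Gc) auto
        then obtain M where M: "\<And>t x. t \<in> {?T0..t0} \<Longrightarrow> x \<in> closure ?D \<Longrightarrow> norm (G t x) \<le> M"
          unfolding bdd_on_def by force
        have "\<bar>norm (?G j q)\<bar> \<le> M" if "q \<in> {?T0<..<t0} \<times> ?D" for q
          using that M[of "fst q" "snd q"] Geq[of "fst q" "snd q"] cD[of "snd q"] s1 by (cases q) auto
        then have 1: "bdd_on ({?T0<..<t0} \<times> ?D) (\<lambda>q. norm (?G j q))" by (rule bdd_onI)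
        have zero: "G t x \<bullet> Ds x = 0" if t: "t \<in> {?T0..t0}" and x: "x \<in> closure ?D" and sx: "s x = 0" for t x
        proof -
          have xx: "x \<in> cball x0 \<rho> \<inter> closure \<Omega>" using x clD by blast
          obtain k \<nu> where \<nu>: "outward_unit_normal \<Omega> x \<nu>" "Ds x = k *\<^sub>R \<nu>" using sn[OF xx sx] by blast
          have "G t x \<bullet> \<nu> = 0"
            by (rule neumann_extension_zero[OF G(1,2) neu j _ _ _ _ \<Omega> op(2) \<nu>(1)]) (use t J xx U s(3)[of x] sx in auto)
          then show ?thesis by (simp add: \<nu>(2))
        qed
        have 2: "eventually (\<lambda>d. \<forall>t\<in>{?T0<..<t0}. \<forall>x\<in>?D. s x < d \<longrightarrow> \<bar>?G j (t, x) \<bullet> Ds x\<bar> < e) (at_right 0)" if "e > 0" for e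
        proof -
          have "eventually (\<lambda>d. \<forall>t\<in>{?T0..t0}. \<forall>x\<in>?D. s x < d \<longrightarrow> \<bar>G t x \<bullet> Ds x\<bar> < e) (at_right 0)"
            by (rule flux_small_near_boundary[OF Gc sc s(2) pos zero that])
          then show ?thesis
          proof eventually_elim
            case (elim d)
            show ?case
            proof (intro ballI impI)
              fix t x assume tx: "t \<in> {?T0<..<t0}" "x \<in> ?D" "s x < d"
              then have "\<bar>G t x \<bullet> Ds x\<bar> < e" using elim by auto
              then show "\<bar>?G j (t, x) \<bullet> Ds x\<bar> < e" using Geq[OF tx(1,2)] s1 by (simp add: abs_mult)
            qed
          qed
        qed
        have 3: "((\<lambda>y. ?z j (t, y)) has_derivative (\<lambda>v. ?G j (t, x) \<bullet> v)) (at x)" if "(t, x) \<in> ?Q" for t x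
          unfolding signed_root_def signed_grad_def using has_derivative_mult_right[OF G(3)[of t x], of \<sigma>] that by simp
        show ?thesis using 1 2 3 by blast
      qed
      \<comment> \<open>Stated for an arbitrary cutoff because it is used twice: with the given
        \<open>\<eta>\<close> and with the shrinking one.\<close>
      have flow: "cylinder_flow ?Q ?I a' b' ?z ?G (\<lambda>j q. ?\<alpha> j q *\<^sub>R ?G j q) ?B \<delta> \<Omega> x0 \<rho> ?T0 t0 \<eta> s Ds V i \<kappa> c C \<epsilon> \<alpha>1 CL ?\<alpha>"
        if cc: "cylinder_cutoff \<Omega> x0 \<rho> ?T0 t0 \<eta> s Ds V" for \<eta> V
      proof (intro cylinder_flow.intro rf cc cylinder_flow_axioms.intro)
        fix q :: "real \<times> 'a" assume q: "q \<in> ?Q"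
        have w: "(\<lambda>j. ?z j q) \<in> B.X" by (rule F.z_box[OF q])
        show "c * (heaviside \<kappa> (?z i q) * (norm (?G i q))\<^sup>2 + \<epsilon> * (max 0 (?z i q - \<kappa>))\<^sup>2 * (\<Sum>k\<in>?I - {i}. (norm (?G k q))\<^sup>2))
          \<le> (\<Sum>j\<in>?I. B.en1 i \<epsilon> (heaviside \<kappa>) j (\<lambda>j. ?z j q) * (\<Sum>k\<in>?I - {j}. (?\<alpha> j q + ?\<alpha> k q) / (?z j q - ?z k q) * (?G j q \<bullet> ?G k q)))
            + (\<Sum>j\<in>?I. \<Sum>k\<in>?I. B.en2 i \<epsilon> (heaviside \<kappa>) j k (\<lambda>j. ?z j q) * (?G k q \<bullet> (?\<alpha> j q *\<^sub>R ?G j q)))"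
          by (rule en(3)[OF i \<kappa> w \<alpha>[OF _ q], where G = "\<lambda>j. ?G j q"])
        show "2 * \<eta>' * \<bar>\<Sum>j\<in>?I. B.en1 i \<epsilon> (heaviside \<kappa>) j (\<lambda>j. ?z j q) * ((?\<alpha> j q *\<^sub>R ?G j q) \<bullet> v)\<bar>
          \<le> c / 2 * (\<eta>'\<^sup>2 * (heaviside \<kappa> (?z i q) * (norm (?G i q))\<^sup>2 + \<epsilon> * (max 0 (?z i q - \<kappa>))\<^sup>2 * (\<Sum>k\<in>?I - {i}. (norm (?G k q))\<^sup>2)))
            + C * ((max 0 (?z i q - \<kappa>))\<^sup>2 * (norm v)\<^sup>2)" for \<eta>' v
          by (rule en(4)[OF i \<kappa> w \<alpha>[OF _ q], where G = "\<lambda>j. ?G j q"])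
        show "0 \<le> ?\<alpha> j q \<and> ?\<alpha> j q \<le> \<alpha>1" if "j \<in> ?I" for j using \<alpha>[OF that q] \<alpha>0 by auto
      next
        show "{?T0<..<t0} \<times> (cball x0 \<rho> \<inter> \<Omega>) \<subseteq> ?Q" using J U by auto
        show "bdd_on ({?T0<..<t0} \<times> ?D) (\<lambda>q. norm (?G j q))" if "j \<in> ?I" for j using ext[OF that] by blast
        show "\<exists>d>0. \<forall>j\<in>?I. \<forall>t\<in>{?T0<..<t0}. \<forall>x\<in>?D. s x < d \<longrightarrow> \<bar>?G j (t, x) \<bullet> Ds x\<bar> < e" if e: "e > 0" for e
        proof -
          have "eventually (\<lambda>d. \<forall>j\<in>?I. \<forall>t\<in>{?T0<..<t0}. \<forall>x\<in>?D. s x < d \<longrightarrow> \<bar>?G j (t, x) \<bullet> Ds x\<bar> < e) (at_right 0)"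
            using ext e by (intro eventually_ball_finite) auto
          with eventually_at_right_less[of 0]
          have "eventually (\<lambda>d. 0 < d \<and> (\<forall>j\<in>?I. \<forall>t\<in>{?T0<..<t0}. \<forall>x\<in>?D. s x < d \<longrightarrow> \<bar>?G j (t, x) \<bullet> Ds x\<bar> < e)) (at_right 0)"
            by (rule eventually_conj)
          from eventually_happens'[OF trivial_limit_at_right_real this] show ?thesis .
        qed
      qed (use i c C \<epsilon> \<alpha>1 CL en(1,2,5)[OF i \<kappa>] in auto)
      have rQ: "r t x = cylinder_flow.rr ?z i \<kappa> (t, x)" if "cylinder_cutoff \<Omega> x0 \<rho> ?T0 t0 \<eta> s Ds V" for t x \<eta> V
        unfolding cylinder_flow.rr_def[OF flow[OF that]] by (simp add: r signed_root_def \<kappa>_def)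
      have dz: "((\<lambda>y. ?z i (t, y)) has_derivative (\<lambda>v. ?G i (t, x) \<bullet> v)) (at x)" if "(t, x) \<in> ?Q" for t x
        using ext[OF i] that by blast
      have nG: "norm (grad (z j t) x) = norm (?G j (t, x))" for j t x using s1 by (simp add: signed_grad_def)
      show "(\<forall>\<eta>. cutoff \<Omega> t0 x0 \<rho> \<eta> \<longrightarrow> cutoff_energy_bound \<Omega> N i z r \<eta> t0 x0 \<rho> e K') \<and>
        (\<forall>\<rho>'. 0 < \<rho>' \<longrightarrow> \<rho>' < \<rho> \<longrightarrow> local_energy_bound \<Omega> N i z r t0 x0 \<rho> \<rho>' e (72 * K'))"
      proof (intro conjI allI impI)
        fix \<eta> assume "cutoff \<Omega> t0 x0 \<rho> \<eta>"
        then obtain V where V: "cylinder_cutoff \<Omega> x0 \<rho> ?T0 t0 \<eta> s Ds V"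
          by (rule cutoff_cylinder_cutoff[OF _ \<Omega> \<rho>(1) s])
        show "cutoff_energy_bound \<Omega> N i z r \<eta> t0 x0 \<rho> e K'"
          using cylinder_flow.energy_estimate[OF flow[OF V] rQ[OF V] dz nG e K']
          by (simp only: cutoff_energy_bound_def Qcyl_def Dcap_def cylinder_cutoff.Qc_def[OF V])
      next
        fix \<rho>' assume \<rho>': "0 < \<rho>'" "\<rho>' < \<rho>"
        obtain \<eta> V where V: "cylinder_cutoff \<Omega> x0 \<rho> ?T0 t0 \<eta> s Ds V"
          and one: "\<And>t x. t \<in> {t0 - \<rho>'\<^sup>2<..<t0} \<Longrightarrow> x \<in> ball x0 \<rho>' \<Longrightarrow> \<eta> (t, x) = 1"
          and bd: "\<And>q. (norm (snd (grad \<eta> q)))\<^sup>2 + \<eta> q * \<bar>fst (grad \<eta> q)\<bar> \<le> 72 / (\<rho> - \<rho>')\<^sup>2"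
          using shrinking_cutoff[where ?t0.0 = t0, OF \<rho>' \<Omega> s] by metis
        have 1: "ball x0 \<rho>' \<inter> \<Omega> \<in> sets borel" using \<Omega> by auto
        have 2: "ball x0 \<rho>' \<inter> \<Omega> \<subseteq> ?D" using \<rho>' by auto
        have 3: "?T0 \<le> t0 - \<rho>'\<^sup>2" using \<rho>' by (simp add: power_mono)
        have 4: "\<eta> (t, x) = 1" if "t \<in> {t0 - \<rho>'\<^sup>2<..<t0}" "x \<in> ball x0 \<rho>' \<inter> \<Omega>" for t x using one that by blast
        have 5: "0 \<le> 72 / (\<rho> - \<rho>')\<^sup>2" by simp
        have "12 * C / c * (72 / (\<rho> - \<rho>')\<^sup>2) \<le> K' * (72 / (\<rho> - \<rho>')\<^sup>2)" using K' by (rule mult_right_mono) simp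
        then have 6: "12 * C / c * (72 / (\<rho> - \<rho>')\<^sup>2) \<le> 72 * K' / (\<rho> - \<rho>')\<^sup>2" by (simp add: mult.commute)
        show "local_energy_bound \<Omega> N i z r t0 x0 \<rho> \<rho>' e (72 * K')"
          using cylinder_flow.localized_estimate[OF flow[OF V] rQ[OF V] dz nG 1 2 3 4 bd 5 e 6]
          by (simp only: local_energy_bound_def Qcyl_def Dcap_def cylinder_cutoff.Qc_def[OF V])
      qed
    qed
  qed (use c C \<epsilon> in simp_all)
qed

theorem proposition12p2:
  fixes \<Omega> :: "'a::euclidean_space set"
  assumes "DIM('a) \<ge> 2" and "bounded_C2_domain \<Omega>"
  shows "\<exists>\<rho>\<^sub>\<Omega>>0. \<forall>(N::nat) (g::nat \<Rightarrow> real) (a::nat \<Rightarrow> real) (b::nat \<Rightarrow> real).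
    N \<ge> 2 \<longrightarrow> 0 < g 1 \<longrightarrow> strict_mono_on {1..N} g \<longrightarrow>
    (\<forall>j\<in>{1..N-1}. g j < a j \<and> a j \<le> b j \<and> b j < g (j + 1)) \<longrightarrow>
    (\<exists>c>0. \<exists>C>0. \<exists>\<epsilon>>0.
      \<forall>(p::real) (x0::'a) (t0::real) (\<rho>::real) (J::real set) (U::'a set)
        (z::nat \<Rightarrow> real \<Rightarrow> 'a \<Rightarrow> real) (i::nat) (k::real) (r::real \<Rightarrow> 'a \<Rightarrow> real).
      p > real DIM('a) + 2 \<longrightarrow> x0 \<in> closure \<Omega> \<longrightarrow> 0 < \<rho> \<longrightarrow> \<rho> \<le> \<rho>\<^sub>\<Omega> \<longrightarrow>
      solution_neighbourhood t0 x0 \<rho> J U \<longrightarrow>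
      strong_root_solution N g p \<Omega> J U z \<longrightarrow>
      (\<forall>t\<in>J. \<forall>x\<in>\<Omega> \<inter> U. \<forall>j\<in>{1..N-1}. z j t x \<in> {a j..b j}) \<longrightarrow>
      i \<in> {1..N-1} \<longrightarrow> k \<in> {a i..b i} \<longrightarrow>
      r = (\<lambda>t x. max (z i t x - k) 0) \<or> r = (\<lambda>t x. max (k - z i t x) 0) \<longrightarrow>
      (\<forall>\<eta>. cutoff \<Omega> t0 x0 \<rho> \<eta> \<longrightarrow>
        esssup (restrict_space lborel {t0 - \<rho>\<^sup>2 <..< t0})
          (\<lambda>s. \<integral>\<^sup>+ x\<in>Dcap \<Omega> x0 \<rho>. ennreal ((\<eta> (s, x))\<^sup>2 * (r s x)\<^sup>2) \<partial>lborel)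
        + ennreal c *
          (\<integral>\<^sup>+ (t, x)\<in>Qcyl \<Omega> t0 x0 \<rho>. ennreal ((\<eta> (t, x))\<^sup>2 * (norm (grad (r t) x))\<^sup>2) \<partial>lborel)
        + ennreal (c * \<epsilon>) *
          (\<integral>\<^sup>+ (t, x)\<in>Qcyl \<Omega> t0 x0 \<rho>. ennreal ((\<eta> (t, x))\<^sup>2 * (r t x)\<^sup>2 *
              (\<Sum>j\<in>{1..N-1} - {i}. (norm (grad (z j t) x))\<^sup>2)) \<partial>lborel)
        \<le> ennreal C *
          (\<integral>\<^sup>+ (t, x)\<in>Qcyl \<Omega> t0 x0 \<rho>. ennreal ((r t x)\<^sup>2 *
              ((norm (grad (\<lambda>y. \<eta> (t, y)) x))\<^sup>2 + \<eta> (t, x) * \<bar>deriv (\<lambda>s. \<eta> (s, x)) t\<bar>)) \<partial>lborel))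
      \<and>
      (\<forall>\<sigma>. 0 < \<sigma> \<longrightarrow> \<sigma> < \<rho> \<longrightarrow>
        esssup (restrict_space lborel {t0 - \<sigma>\<^sup>2 <..< t0})
          (\<lambda>t. \<integral>\<^sup>+ x\<in>Dcap \<Omega> x0 \<sigma>. ennreal ((r t x)\<^sup>2) \<partial>lborel)
        + (\<integral>\<^sup>+ (t, x)\<in>Qcyl \<Omega> t0 x0 \<sigma>. ennreal ((norm (grad (r t) x))\<^sup>2) \<partial>lborel)
        + ennreal (c * \<epsilon>) *
          (\<integral>\<^sup>+ (t, x)\<in>Qcyl \<Omega> t0 x0 \<sigma>. ennreal ((r t x)\<^sup>2 *
              (\<Sum>j\<in>{1..N-1} - {i}. (norm (grad (z j t) x))\<^sup>2)) \<partial>lborel)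
        \<le> ennreal (C / (\<rho> - \<sigma>)\<^sup>2) *
          (\<integral>\<^sup>+ (t, x)\<in>Qcyl \<Omega> t0 x0 \<rho>. ennreal ((r t x)\<^sup>2) \<partial>lborel)))"
proof -
  have \<Omega>: "open \<Omega>" using assms(2) by (simp add: bounded_C2_domain_def)
  \<comment> \<open>The radius comes from the geometry alone and is therefore chosen before
    \<open>N\<close>, \<open>g\<close> and the box.\<close>
  obtain R where R: "R > 0" and chart: "\<And>x0 \<rho>. x0 \<in> closure \<Omega> \<Longrightarrow> 0 < \<rho> \<Longrightarrow> \<rho> \<le> R \<Longrightarrow>
    cball x0 \<rho> \<subseteq> \<Omega> \<or> (\<exists>p \<delta> e \<gamma>. C2_graph_near \<Omega> p \<delta> e \<gamma> \<and> cball x0 \<rho> \<subseteq> ball p \<delta>)"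
    using uniform_chart_radius[OF assms(2)] by blast
  show ?thesis
  proof (rule exI[of _ R], intro conjI R allI impI, goal_cases)
    case (1 N g a b)
    then have box: "root_box N g a b" by (simp add: root_box_def)
    obtain \<delta> where \<delta>: "separated_box {1..N-1} a b \<delta>" "separated_box {1..N-1} (\<lambda>j. - b j) (\<lambda>j. - a j) \<delta>"
      by (rule root_box_separated[OF box])
    have b1: "\<And>j y. j \<in> {1..N-1} \<Longrightarrow> y \<in> {a j..b j} \<Longrightarrow> 1 * y \<in> {a j..b j}" by simp
    have b2: "\<And>j y. j \<in> {1..N-1} \<Longrightarrow> y \<in> {a j..b j} \<Longrightarrow> - 1 * y \<in> {- b j..- a j}" by simp
    obtain K1 \<epsilon>1 where K1: "0 < K1" "0 < \<epsilon>1" and up: "truncation_estimates \<Omega> N g a b R 1 K1 \<epsilon>1"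
      by (rule root_truncation_estimates[OF box disjI1[OF refl] \<delta>(1) b1 \<Omega> chart])
    obtain K2 \<epsilon>2 where K2: "0 < K2" "0 < \<epsilon>2" and low: "truncation_estimates \<Omega> N g a b R (- 1) K2 \<epsilon>2"
      by (rule root_truncation_estimates[OF box disjI2[OF refl] \<delta>(2) b2 \<Omega> chart])
    define K where "K = max K1 K2"
    define \<epsilon> where "\<epsilon> = min \<epsilon>1 \<epsilon>2"
    have K: "0 < K" "K1 \<le> K" "K2 \<le> K" and \<epsilon>: "0 < \<epsilon>" "\<epsilon> \<le> \<epsilon>1" "\<epsilon> \<le> \<epsilon>2" using K1 K2 by (auto simp: K_def \<epsilon>_def)
    have main: "(\<forall>\<eta>. cutoff \<Omega> t0 x0 \<rho> \<eta> \<longrightarrow> cutoff_energy_bound \<Omega> N i z r \<eta> t0 x0 \<rho> \<epsilon> (72 * K)) \<and>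
      (\<forall>\<rho>'. 0 < \<rho>' \<longrightarrow> \<rho>' < \<rho> \<longrightarrow> local_energy_bound \<Omega> N i z r t0 x0 \<rho> \<rho>' \<epsilon> (72 * K))"
      if x0: "x0 \<in> closure \<Omega>" and \<rho>: "0 < \<rho>" "\<rho> \<le> R" and nb: "solution_neighbourhood t0 x0 \<rho> J U"
        and sol: "strong_root_solution N g p \<Omega> J U z" and range: "\<forall>t\<in>J. \<forall>x\<in>\<Omega> \<inter> U. \<forall>j\<in>{1..N-1}. z j t x \<in> {a j..b j}"
        and i: "i \<in> {1..N-1}" and k: "k \<in> {a i..b i}"
        and r: "r = (\<lambda>t x. max (z i t x - k) 0) \<or> r = (\<lambda>t x. max (k - z i t x) 0)" for p x0 t0 \<rho> J U z i k r
    proof -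
      have K72: "K1 \<le> 72 * K" "K2 \<le> 72 * K" using K by auto
      from r show ?thesis
      proof
        assume "r = (\<lambda>t x. max (z i t x - k) 0)"
        then have r: "r = (\<lambda>t x. max 0 (1 * z i t x - 1 * k))" by (simp add: max.commute)
        note h = up[unfolded truncation_estimates_def, rule_format (no_asm), OF x0 \<rho> nb sol range i k r less_imp_le[OF \<epsilon>(1)] \<epsilon>(2)]
        show ?thesis using h[OF K(2)] h[OF K72(1)] by blast
      next
        assume "r = (\<lambda>t x. max (k - z i t x) 0)"
        then have r: "r = (\<lambda>t x. max 0 (- 1 * z i t x - - 1 * k))" by (simp add: max.commute)
        note h = low[unfolded truncation_estimates_def, rule_format (no_asm), OF x0 \<rho> nb sol range i k r less_imp_le[OF \<epsilon>(1)] \<epsilon>(3)]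
        show ?thesis using h[OF K(3)] h[OF K72(2)] by blast
      qed
    qed
    show ?case
    \<comment> \<open>The bounds already have coefficient one in front of the gradient term, so
      \<open>c = 1\<close> serves both inequalities. The factor 72 comes from the shrinking cutoff
      and only enlarges the constant of the first inequality.\<close>
    proof (rule exI[of _ 1], intro conjI zero_less_one, rule exI[of _ "72 * K"], intro conjI, goal_cases)
      case 2
      show ?case
        unfolding mult_1 ennreal_1 cutoff_energy_bound_def[symmetric] local_energy_bound_def[symmetric]
        using \<epsilon>(1) main by blast
    qed (use K in simp)
  qed
qed

end
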